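(* (i) For all integers $t\ge 7$ and $n\ge 3t-6$, $rb(\mathcal{T}_n,M_t)\le 2n+3t-13$. (ii) For all integers $t\ge 7$ and $n\ge 9t+3$, $rb(\mathcal{T}_n,M_t)=2n+3t-14$.
   Context: All graphs are finite, simple and undirected. $M_t$ denotes a matching with $t$ edges (i.e., $t$ pairwise disjoint edges). $\mathcal{T}_n$ denotes the class of all plane triangulations (maximal planar graphs embedded in the plane) on $n$ vertices. An edge-colored subgraph is rainbow if all its edges have distinct colors. $rb(\mathcal{T}_n,H)$ is the minimum integer $k$ such that for every $T\in\mathcal{T}_n$ containing $H$ as a subgraph, every edge-coloring of $T$ using at least $k$ colors contains a rainbow copy of $H$. *)

theory Defs
  imports "HOL-Analysis.Analysis"
begin

type_synonym 'a graph = "'a set \<times> 'a set set"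

abbreviation verts :: "'a graph \<Rightarrow> 'a set" where
  "verts G \<equiv> fst G"

abbreviation edges :: "'a graph \<Rightarrow> 'a set set" where
  "edges G \<equiv> snd G"

definition simple_graph :: "'a graph \<Rightarrow> bool" where
  "simple_graph G \<longleftrightarrow> finite (verts G) \<and> (\<forall>e\<in>edges G. e \<subseteq> verts G \<and> card e = 2)"

text \<open>
  The plane is modelled by the type of complex numbers. In an embedding, the arc drawn for an
  edge joins the points of its two end vertices, passes through no other vertex, and meets the
  arc of any other edge only in the point of a common end vertex.
\<close>

definition plane_embedding ::
    "'a graph \<Rightarrow> ('a \<Rightarrow> complex) \<Rightarrow> ('a set \<Rightarrow> real \<Rightarrow> complex) \<Rightarrow> bool" where
  "plane_embedding G p \<gamma> \<longleftrightarrow>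
     inj_on p (verts G) \<and>
     (\<forall>e\<in>edges G. arc (\<gamma> e) \<and>
        {pathstart (\<gamma> e), pathfinish (\<gamma> e)} = p ` e \<and>
        path_image (\<gamma> e) \<inter> p ` verts G \<subseteq> p ` e) \<and>
     (\<forall>e\<in>edges G. \<forall>e'\<in>edges G. e \<noteq> e' \<longrightarrow>
        path_image (\<gamma> e) \<inter> path_image (\<gamma> e') \<subseteq> p ` (e \<inter> e'))"

definition planar :: "'a graph \<Rightarrow> bool" where
  "planar G \<longleftrightarrow> simple_graph G \<and> (\<exists>p \<gamma>. plane_embedding G p \<gamma>)"

definition maximal_planar :: "'a graph \<Rightarrow> bool" where
  "maximal_planar G \<longleftrightarrow> planar G \<and>
     (\<forall>u\<in>verts G. \<forall>v\<in>verts G. u \<noteq> v \<longrightarrow> {u, v} \<notin> edges G \<longrightarrow>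
        \<not> planar (verts G, insert {u, v} (edges G)))"

text \<open>
  Containment of subgraphs and edge-colourings do not refer to the chosen embedding, so a plane
  triangulation is represented by its underlying graph. Vertices are natural numbers, which
  covers every finite graph up to isomorphism.
\<close>

definition plane_triangulations :: "nat \<Rightarrow> nat graph set" where
  "plane_triangulations n = {G. maximal_planar G \<and> card (verts G) = n}"

definition copy_of :: "'b graph \<Rightarrow> 'a graph \<Rightarrow> ('b \<Rightarrow> 'a) \<Rightarrow> bool" where
  "copy_of H G f \<longleftrightarrow> inj_on f (verts H) \<and> f ` verts H \<subseteq> verts G \<and>
     (\<forall>e\<in>edges H. f ` e \<in> edges G)"

definition contains_subgraph :: "'a graph \<Rightarrow> 'b graph \<Rightarrow> bool" where
  "contains_subgraph G H \<longleftrightarrow> (\<exists>f. copy_of H G f)"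

definition contains_rainbow :: "('a set \<Rightarrow> 'c) \<Rightarrow> 'a graph \<Rightarrow> 'b graph \<Rightarrow> bool" where
  "contains_rainbow c G H \<longleftrightarrow> (\<exists>f. copy_of H G f \<and> inj_on c ((\<lambda>e. f ` e) ` edges H))"

text \<open>
  The number of colours used by a colouring is the number of values it takes on the edges; as
  there are finitely many edges, natural numbers suffice as colours. If the graphs in the class
  have boundedly many edges (as for a fixed number of vertices), all large \<open>k\<close> satisfy the
  condition vacuously, so the minimum exists.
\<close>

definition rb :: "'a graph set \<Rightarrow> 'b graph \<Rightarrow> nat" where
  "rb \<G> H = (LEAST k. \<forall>G\<in>\<G>. contains_subgraph G H \<longrightarrow>
     (\<forall>c :: 'a set \<Rightarrow> nat. k \<le> card (c ` edges G) \<longrightarrow> contains_rainbow c G H))"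

definition matching_graph :: "nat \<Rightarrow> nat graph" where
  "matching_graph t = ({..<2 * t}, (\<lambda>i. {2 * i, 2 * i + 1}) ` {..<t})"

end

theory Submission
  imports Defs
begin

text \<open>
  Choose one edge of every colour. If the resulting planar graph \<open>G\<close> has no \<open>t\<close> disjoint edges, the
  Tutte-Berge formula provides a set \<open>S\<close> whose removal leaves connected parts with
  \<open>card S + (\<Sum>C. card C div 2) < t\<close>. A planar graph on \<open>m\<close> vertices has at most \<open>3 m - 6\<close> edges, a bipartite
  one at most \<open>2 m - 4\<close>, and both bounds survive the contraction of connected sets. With as many
  colours as assumed they are almost attained, so either all parts are single vertices and
  \<open>card S = t - 1\<close>, or there is one larger part, with three vertices, and \<open>card S = t - 2\<close>.

  An edge \<open>{u, v}\<close> of the triangulation inside the set \<open>I\<close> of isolated vertices has the colour of some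
  \<open>g\<close> in \<open>G\<close>. By Hall's theorem \<open>S\<close> can be matched into \<open>I - {u, v}\<close> without using \<open>g\<close>, unless some subset of
  \<open>S\<close> has too few neighbours. Such subsets are tight for the edge bounds. If the bounds are attained,
  there are none; if one edge is missing, they have at most two elements, and for three edges \<open>{u, v}\<close>
  chosen successively outside the neighbourhoods of the earlier subsets they cannot all exist. Such
  edges exist because a maximal planar graph has minimum degree at least three.

  For the lower bound, triangulate \<open>t - 2\<close> vertices, put a vertex into every face, distribute the
  remaining vertices over one face, and give distinct colours to the edges that meet the \<open>t - 2\<close> vertices
  and one further colour to all others.
\<close>

section \<open>Arcs in the plane\<close>

text \<open>If only single vertices remain beside \<open>S\<close> and
  \<open>card S = t - 1\<close>, there are at most
  \<open>(3 (t - 1) - 6) + (2 n - 4) = 2 n + 3 t - 13\<close> representatives. With a triangle as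
  further part the bounds for \<open>S\<close> plus triangle and for \<open>S\<close> against the
  single vertices add up to the same number, but they are not attained together. So the first claim
  leaves no slack and the second leaves one edge, missing inside \<open>S\<close> or between
  \<open>S\<close> and \<open>I\<close>. With \<open>card S = t - 1\<close>, the threshold
  \<open>n \<ge> 3 t - 6\<close> says \<open>2 * card S \<le> card I + 3\<close>. Planarity means
  arcs in the plane, so all edge bounds come from Jordan's and Janiszewski's theorems. Face
  boundaries are never shown to be cycles: a face touches an edge set that is not acyclic, an edge
  touches at most two faces, and a double count does the rest. Drawings are not contracted either:
  spanning trees of the contracted sets stay in the drawing and only the other edges are
  weighted.\<close>

definition mindeg2 :: "'a set set \<Rightarrow> bool" where
  "mindeg2 Y \<longleftrightarrow> (\<forall>e\<in>Y. \<forall>v\<in>e. \<exists>e'\<in>Y. e' \<noteq> e \<and> v \<in> e')"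

text \<open>A finite graph is a forest iff no nonempty set of its edges has minimum degree two. In
  this form a leaf edge is available at once and no walk or cycle has to be named.\<close>

definition acyclic_edges :: "'a set set \<Rightarrow> bool" where
  "acyclic_edges E \<longleftrightarrow> (\<forall>Y\<subseteq>E. Y \<noteq> {} \<longrightarrow> \<not> mindeg2 Y)"

lemma acyclic_edges_mono: "acyclic_edges E \<Longrightarrow> E' \<subseteq> E \<Longrightarrow> acyclic_edges E'"
  unfolding acyclic_edges_def by blast

locale plane_graph =
  fixes V :: "'a set" and E :: "'a set set" and p :: "'a \<Rightarrow> complex"
    and \<gamma> :: "'a set \<Rightarrow> real \<Rightarrow> complex"
  assumes simple: "simple_graph (V, E)" and embedding: "plane_embedding (V, E) p \<gamma>"
begin

lemma finite_V: "finite V" and edge_sub: "e \<in> E \<Longrightarrow> e \<subseteq> V" and edge_card: "e \<in> E \<Longrightarrow> card e = 2"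
  using simple by (auto simp: simple_graph_def)

lemma finite_E: "finite E"
  using finite_V edge_sub by (meson PowI finite_Pow_iff finite_subset subsetI)

lemma inj_p: "inj_on p V"
  and arc_\<gamma>: "e \<in> E \<Longrightarrow> arc (\<gamma> e)"
  and ends_\<gamma>: "e \<in> E \<Longrightarrow> {pathstart (\<gamma> e), pathfinish (\<gamma> e)} = p ` e"
  and vert_\<gamma>: "e \<in> E \<Longrightarrow> path_image (\<gamma> e) \<inter> p ` V \<subseteq> p ` e"
  and disj_\<gamma>: "e \<in> E \<Longrightarrow> e' \<in> E \<Longrightarrow> e \<noteq> e' \<Longrightarrow>
    path_image (\<gamma> e) \<inter> path_image (\<gamma> e') \<subseteq> p ` (e \<inter> e')"
  using embedding unfolding plane_embedding_def fst_conv snd_conv by blast+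

lemma subgraph:
  assumes "V' \<subseteq> V" "E' \<subseteq> E" "\<Union>E' \<subseteq> V'"
  shows "plane_graph V' E' p \<gamma>"
proof
  have "finite V'"
    by (rule finite_subset[OF assms(1) finite_V])
  then show "simple_graph (V', E')"
    using edge_card assms(2,3) by (auto simp: simple_graph_def)
  have "inj_on p V'"
    by (rule inj_on_subset[OF inj_p assms(1)])
  moreover have "path_image (\<gamma> e) \<inter> p ` V' \<subseteq> p ` e" if "e \<in> E'" for e
    using vert_\<gamma>[of e] that assms(1,2) by blast
  moreover have "arc (\<gamma> e) \<and> {pathstart (\<gamma> e), pathfinish (\<gamma> e)} = p ` e" if "e \<in> E'" for e
    using arc_\<gamma>[of e] ends_\<gamma>[of e] that assms(2) by blast
  moreover have "path_image (\<gamma> e) \<inter> path_image (\<gamma> e') \<subseteq> p ` (e \<inter> e')"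
    if "e \<in> E'" "e' \<in> E'" "e \<noteq> e'" for e e'
    using disj_\<gamma>[of e e'] that assms(2) by blast
  ultimately show "plane_embedding (V', E') p \<gamma>"
    unfolding plane_embedding_def fst_conv snd_conv by blast
qed

definition drawing :: "'a set \<Rightarrow> 'a set set \<Rightarrow> complex set" where
  "drawing V' E' = p ` V' \<union> (\<Union>e\<in>E'. path_image (\<gamma> e))"

lemma compact_drawing: "V' \<subseteq> V \<Longrightarrow> E' \<subseteq> E \<Longrightarrow> compact (drawing V' E')"
  unfolding drawing_def
  by (intro compact_Un compact_UN finite_imp_compact[OF finite_imageI] compact_arc_image)
     (use finite_V finite_E arc_\<gamma> finite_subset in \<open>blast+\<close>)

lemma closed_drawing: "V' \<subseteq> V \<Longrightarrow> E' \<subseteq> E \<Longrightarrow> closed (drawing V' E')"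
  by (simp add: compact_drawing compact_imp_closed)

lemma drawing_insert: "drawing V' (insert e E') = drawing V' E' \<union> path_image (\<gamma> e)"
  unfolding drawing_def by auto

lemma ends_in_path: "e \<in> E \<Longrightarrow> p ` e \<subseteq> path_image (\<gamma> e)"
  using ends_\<gamma>[of e] by (metis insert_subset pathfinish_in_path_image pathstart_in_path_image empty_subsetI)

lemma drawing_Int_edge:
  assumes "V' \<subseteq> V" "E' \<subseteq> E" "e \<in> E" "e \<notin> E'"
  shows "drawing V' E' \<inter> path_image (\<gamma> e) \<subseteq> p ` e"
  using vert_\<gamma>[of e] disj_\<gamma>[of e] assms unfolding drawing_def by blast

lemma edgeE:
  assumes "e \<in> E" obtains u v where "e = {u, v}" "u \<noteq> v" "u \<in> V" "v \<in> V"
    "pathstart (\<gamma> e) = p u" "pathfinish (\<gamma> e) = p v" "p u \<noteq> p v"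
proof -
  obtain a b where ab: "e = {a, b}" "a \<noteq> b"
    using edge_card[OF assms] by (auto simp: card_2_iff)
  have V: "a \<in> V" "b \<in> V"
    using edge_sub[OF assms] ab by auto
  then have "p a \<noteq> p b"
    using inj_p ab by (auto dest: inj_onD)
  moreover have "{pathstart (\<gamma> e), pathfinish (\<gamma> e)} = {p a, p b}"
    using ends_\<gamma>[OF assms] ab by simp
  then have "pathstart (\<gamma> e) = p a \<and> pathfinish (\<gamma> e) = p b \<or> pathstart (\<gamma> e) = p b \<and> pathfinish (\<gamma> e) = p a"
    by (simp add: doubleton_eq_iff)
  ultimately show thesis
    using that[of a b] that[of b a] ab V by (metis insert_commute)
qed

text \<open>Leaf edges are peeled off one by one. A leaf edge meets the rest of the drawing in at
  most one point, and by Janiszewski's theorem two sets with connected complements and connected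
  intersection have a union with connected complement.\<close>

lemma connected_acyclic_complement:
  assumes "E' \<subseteq> E" "V' \<subseteq> V" "\<Union>E' \<subseteq> V'" "acyclic_edges E'"
  shows "connected (- drawing V' E')"
  using assms
proof (induction "card E'" arbitrary: E' V')
  case 0
  then have "E' = {}"
    using finite_subset[OF _ finite_E] by auto
  moreover have "connected (UNIV - p ` V')"
    by (rule connected_open_delete_finite) (use finite_subset[OF 0(3) finite_V] in auto)
  ultimately show ?case
    by (simp add: drawing_def Compl_eq_Diff_UNIV)
next
  case (Suc n)
  then have "E' \<noteq> {}" by auto
  then have "\<not> mindeg2 E'"
    using Suc.prems(4) by (simp add: acyclic_edges_def)
  then obtain e v where e: "e \<in> E'" "v \<in> e" and leaf: "\<And>e'. e' \<in> E' \<Longrightarrow> v \<in> e' \<Longrightarrow> e' = e"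
    unfolding mindeg2_def by blast
  have eE: "e \<in> E" using e Suc.prems by blast
  \<comment> \<open>The leaf \<open>v\<close> leaves the vertex set too; otherwise
    \<open>p v\<close> would be a second point of intersection and the intersection would be
    disconnected.\<close>
  define A where "A = drawing (V' - {v}) (E' - {e})"
  obtain u where u: "e = {u, v}" "u \<noteq> v"
    using edge_card[OF eE] e(2) by (auto simp: card_2_iff)
  have uv: "u \<in> V'" "v \<in> V'" using Suc.prems(3) e(1) u by auto
  have eq: "drawing V' E' = A \<union> path_image (\<gamma> e)"
    using ends_in_path[OF eE] u e(1) uv unfolding A_def drawing_def by auto
  have sub: "A \<inter> path_image (\<gamma> e) \<subseteq> {p u}"
  proof
    fix x assume x: "x \<in> A \<inter> path_image (\<gamma> e)"
    then consider w where "w \<in> V' - {v}" "x = p w" | e' where "e' \<in> E' - {e}" "x \<in> path_image (\<gamma> e')"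
      unfolding A_def drawing_def by auto
    then show "x \<in> {p u}"
    proof cases
      case 1
      then have "x \<in> p ` e" using vert_\<gamma>[OF eE] x Suc.prems(2) by blast
      then have "p w \<in> {p u, p v}" using 1 u by auto
      moreover have "p w \<noteq> p v"
        using 1 uv inj_p Suc.prems(2) by (auto dest!: inj_onD[of p V w v])
      ultimately show ?thesis using 1 by auto
    next
      case 2
      then have "x \<in> p ` (e \<inter> e')"
        using disj_\<gamma>[OF eE, of e'] x Suc.prems(1) by blast
      moreover have "v \<notin> e'" using 2 leaf by auto
      ultimately show ?thesis using u by auto
    qed
  qed
  have "connected (- A)" unfolding A_def
  proof (rule Suc.hyps(1))
    show "n = card (E' - {e})" using Suc.hyps(2) e(1) by simp
    show "acyclic_edges (E' - {e})" using Suc.prems(4) acyclic_edges_mono by blast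
    show "\<Union>(E' - {e}) \<subseteq> V' - {v}" using Suc.prems(3) leaf by blast
  qed (use Suc.prems in auto)
  moreover have "connected (- path_image (\<gamma> e))"
    by (simp add: arc_\<gamma> connected_arc_complement eE)
  moreover have "compact A"
    unfolding A_def using Suc.prems by (intro compact_drawing) auto
  moreover have "closed (path_image (\<gamma> e))"
    by (simp add: arc_\<gamma> closed_arc_image eE)
  moreover have "connected (A \<inter> path_image (\<gamma> e))"
    using sub by (metis connected_empty connected_sing subset_singletonD)
  ultimately show ?case
    unfolding eq by (rule_tac Janiszewski_connected)
qed

end

section \<open>Counting faces from below\<close>

lemma components_intermediate:
  assumes "C \<in> components X" "C \<subseteq> Y" "Y \<subseteq> X"
  shows "C \<in> components Y"
proof -
  have C: "C \<noteq> {}" "connected C" "\<And>D. D \<noteq> {} \<Longrightarrow> C \<subseteq> D \<Longrightarrow> D \<subseteq> X \<Longrightarrow> connected D \<Longrightarrow> D = C"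
    using assms(1) unfolding in_components_maximal by simp_all
  show ?thesis
    unfolding in_components_maximal
  proof (intro conjI allI impI)
    fix D assume "D \<noteq> {} \<and> C \<subseteq> D \<and> D \<subseteq> Y \<and> connected D"
    then show "D = C"
      using C(3)[of D] assms(3) by auto
  qed (use C assms in auto)
qed

text \<open>A disc stays connected when its centre is removed. The inverse parametrisation would map
  the punctured disc to a connected subset of the unit interval that has points on both sides of
  \<open>s\<close> but omits \<open>s\<close>.\<close>

lemma ball_not_subset_arc:
  fixes g :: "real \<Rightarrow> complex"
  assumes "arc g" "0 < s" "s < 1" "0 < \<epsilon>"
  shows "\<not> ball (g s) \<epsilon> \<subseteq> path_image g"
proof
  assume sub: "ball (g s) \<epsilon> \<subseteq> path_image g"
  obtain h where h: "homeomorphism {0..1} (path_image g) g h"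
    by (rule homeomorphism_arc[OF assms(1)])
  have cont: "continuous_on (path_image g) h" and hg: "\<And>x. x \<in> {0..1} \<Longrightarrow> h (g x) = x"
    and gh: "\<And>y. y \<in> path_image g \<Longrightarrow> g (h y) = y"
    using h unfolding homeomorphism_def by simp_all
  have bcon: "connected (ball (g s) \<epsilon> - {g s})"
    by (rule connected_open_delete) auto
  have "ball (g s) \<epsilon> - {g s} \<subseteq> path_image g"
    using sub by blast
  then have con: "connected (h ` (ball (g s) \<epsilon> - {g s}))"
    using bcon connected_continuous_image continuous_on_subset[OF cont] by blast
  have s01: "s \<in> {0..1}" using assms(2,3) by simp
  have "continuous_on {0..1} g"
    using assms(1) arc_imp_path path_def by blast
  then have "\<exists>d>0. \<forall>x\<in>{0..1}. dist x s < d \<longrightarrow> dist (g x) (g s) < \<epsilon>"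
    unfolding continuous_on_iff using s01 assms(4) by blast
  then obtain d where d: "d > 0" "\<And>x. x \<in> {0..1} \<Longrightarrow> dist x s < d \<Longrightarrow> dist (g x) (g s) < \<epsilon>"
    by blast
  define a b where "a = max (s - d/2) 0" and "b = min (s + d/2) 1"
  have ab: "a \<in> {0..1}" "b \<in> {0..1}" "a < s" "s < b" "dist a s < d" "dist b s < d"
    using assms(2,3) d(1) by (auto simp: a_def b_def dist_real_def)
  have "x \<in> h ` (ball (g s) \<epsilon> - {g s})" if "x \<in> {0..1}" "x \<noteq> s" "dist x s < d" for x
  proof
    show "x = h (g x)" using hg that by simp
    have "g x \<noteq> g s" using hg[OF that(1)] hg[OF s01] that(2) by metis
    then show "g x \<in> ball (g s) \<epsilon> - {g s}"
      using d(2)[of x] that by (simp add: dist_commute)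
  qed
  then have "a \<in> h ` (ball (g s) \<epsilon> - {g s})" "b \<in> h ` (ball (g s) \<epsilon> - {g s})"
    using ab by auto
  then have "{a..b} \<subseteq> h ` (ball (g s) \<epsilon> - {g s})"
    by (rule connected_contains_Icc[OF con])
  moreover have "s \<in> {a..b}"
    using ab(3,4) by simp
  ultimately have "s \<in> h ` (ball (g s) \<epsilon> - {g s})"
    by blast
  then obtain y where "y \<in> ball (g s) \<epsilon> - {g s}" "s = h y" by (rule imageE)
  moreover from this have "g (h y) = y"
    using gh[of y] sub by blast
  ultimately show False by simp
qed

context plane_graph
begin

lemma path_edge_cases:
  assumes "e \<in> E" "z \<in> path_image (\<gamma> e)"
  obtains "z \<in> p ` e" | s where "0 < s" "s < 1" "z = \<gamma> e s"
proof -
  obtain s where s: "s \<in> {0..1}" "z = \<gamma> e s"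
    using assms(2) by (auto simp: path_image_def)
  have "\<gamma> e 0 \<in> p ` e" "\<gamma> e 1 \<in> p ` e"
    using ends_\<gamma>[OF assms(1)] by (auto simp: pathstart_def pathfinish_def)
  then show thesis
    using s that(1) that(2)[of s] by (cases "s = 0 \<or> s = 1") auto
qed

lemma edge_interior_notin:
  assumes "e \<in> E" "0 < s" "s < 1"
  shows "\<gamma> e s \<notin> p ` e"
proof -
  have inj: "inj_on (\<gamma> e) {0..1}"
    using arc_\<gamma>[OF assms(1)] by (simp add: arc_def)
  have "p ` e = {\<gamma> e 0, \<gamma> e 1}"
    using ends_\<gamma>[OF assms(1)] by (simp add: pathstart_def pathfinish_def)
  moreover have "\<gamma> e s \<noteq> \<gamma> e 0" "\<gamma> e s \<noteq> \<gamma> e 1"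
    using inj assms by (auto dest!: inj_onD)
  ultimately show ?thesis by auto
qed

lemma edge_interior_notin_drawing:
  assumes "e \<in> E" "0 < s" "s < 1" "V' \<subseteq> V" "E' \<subseteq> E" "e \<notin> E'"
  shows "\<gamma> e s \<notin> drawing V' E'"
proof
  assume "\<gamma> e s \<in> drawing V' E'"
  moreover have "\<gamma> e s \<in> path_image (\<gamma> e)" using assms by (auto simp: path_image_def)
  ultimately have "\<gamma> e s \<in> p ` e"
    using drawing_Int_edge[OF assms(4,5,1,6)] by blast
  then show False using edge_interior_notin assms by blast
qed

definition open_arc :: "'a set \<Rightarrow> complex set" where
  "open_arc e = \<gamma> e ` {0<..<1}"

lemma connected_open_arc:
  assumes "e \<in> E"
  shows "connected (open_arc e)"
proof -
  have "continuous_on {0..1} (\<gamma> e)"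
    using arc_\<gamma>[OF assms] by (simp add: arc_def path_def)
  then have "continuous_on {0<..<1} (\<gamma> e)"
    by (rule continuous_on_subset) auto
  then show ?thesis
    unfolding open_arc_def by (rule connected_continuous_image) simp
qed

lemma path_image_open_arc:
  assumes "e \<in> E"
  shows "path_image (\<gamma> e) = open_arc e \<union> p ` e"
proof
  show "path_image (\<gamma> e) \<subseteq> open_arc e \<union> p ` e"
  proof
    fix z assume "z \<in> path_image (\<gamma> e)"
    with assms show "z \<in> open_arc e \<union> p ` e"
      by (rule path_edge_cases) (auto simp: open_arc_def)
  qed
  show "open_arc e \<union> p ` e \<subseteq> path_image (\<gamma> e)"
    using ends_in_path[OF assms] by (auto simp: open_arc_def path_image_def)
qed

lemma open_arc_drawing:
  assumes "e \<in> E" "V' \<subseteq> V" "E' \<subseteq> E" "e \<notin> E'"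
  shows "open_arc e \<inter> drawing V' E' = {}"
  using edge_interior_notin_drawing assms by (auto simp: open_arc_def)

text \<open>If the ends of \<open>e\<close> are already linked in the rest of the drawing, the arc
  of \<open>e\<close> closes up to a Jordan curve. The return path is chosen as an arc so that the
  curve meets the rest of the drawing in a connected set, as Janiszewski's theorem requires.\<close>

lemma closing_curve:
  assumes "e = {u, v}" "e \<in> E" "E' \<subseteq> E" "e \<notin> E'"
    and "path_component (drawing V E') (p u) (p v)"
  obtains q c where "path_image q \<subseteq> drawing V E'" "arc q" "simple_path c" "pathfinish c = pathstart c"
    "path_image c = path_image (\<gamma> e) \<union> path_image q"
    "drawing V E' \<inter> path_image c = path_image q"
proof -
  obtain a b where ab: "e = {a, b}" "a \<noteq> b" "a \<in> V" "b \<in> V"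
    "pathstart (\<gamma> e) = p a" "pathfinish (\<gamma> e) = p b" "p a \<noteq> p b"
    using edgeE[OF assms(2)] by blast
  have "path_component (drawing V E') (p b) (p a)"
    using assms(1,5) path_component_sym[OF assms(5)] ab(1) by (auto simp: doubleton_eq_iff)
  then obtain g where g: "path g" "path_image g \<subseteq> drawing V E'" "pathstart g = p b" "pathfinish g = p a"
    by (auto simp: path_component_def)
  then obtain q where q: "arc q" "path_image q \<subseteq> path_image g" "pathstart q = p b" "pathfinish q = p a"
    using path_contains_arc ab(7) by metis
  have int: "path_image (\<gamma> e) \<inter> drawing V E' \<subseteq> {p a, p b}"
    using drawing_Int_edge[OF order_refl assms(3,2,4)] ab(1) by auto
  have im: "path_image (\<gamma> e +++ q) = path_image (\<gamma> e) \<union> path_image q"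
    by (rule path_image_join) (simp add: ab(6) q(3))
  have sub: "path_image q \<subseteq> drawing V E'"
    using q(2) g(2) by (rule subset_trans)
  have ends: "p a \<in> path_image q" "p b \<in> path_image q"
    using q(3,4) by (metis pathfinish_in_path_image, metis pathstart_in_path_image)
  show thesis
  proof (rule that[of q "\<gamma> e +++ q"])
    show "simple_path (\<gamma> e +++ q)"
    proof (rule simple_path_join_loop)
      show "path_image (\<gamma> e) \<inter> path_image q \<subseteq> {pathstart (\<gamma> e), pathstart q}"
        unfolding ab(5) q(3) using int sub by blast
    qed (simp_all add: ab(5,6) q(1,3,4) arc_\<gamma> assms(2))
    show "drawing V E' \<inter> path_image (\<gamma> e +++ q) = path_image q"
      unfolding im using int sub ends by blast
  qed (simp_all add: ab(5,6) q(1,3,4) im sub)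
qed

lemma p_in_drawing: "v \<in> V' \<Longrightarrow> p v \<in> drawing V' E'"
  by (simp add: drawing_def)

text \<open>One step of Euler's formula. The open arc lies in a single face \<open>F0\<close>; every
  other face survives. Near the midpoint \<open>m\<close> there are points off the arc, giving at
  least one new face inside \<open>F0\<close>. If \<open>e\<close> closes a Jordan curve,
  \<open>m\<close> is a limit of points from the inside and from the outside, and these lie in two
  different new faces.\<close>

lemma faces_insert_edge:
  assumes E': "E' \<subseteq> E" "e \<in> E" "e \<notin> E'" "e = {u, v}"
    and FF: "finite FF" "FF \<subseteq> components (- drawing V E')"
  obtains FF' where "finite FF'" "FF' \<subseteq> components (- drawing V (insert e E'))"
    "card FF + (if path_component (drawing V E') (p u) (p v) then 1 else 0) \<le> card FF'"
proof -
  define A where "A = drawing V E'"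
  define m where "m = \<gamma> e (1/2)"
  define F0 where "F0 = connected_component_set (- A) m"
  define D where "D = A \<union> path_image (\<gamma> e)"
  have D: "drawing V (insert e E') = D"
    by (simp add: D_def A_def drawing_insert)
  have clA: "closed A" unfolding A_def using closed_drawing E' by simp
  have arcA: "open_arc e \<inter> A = {}"
    unfolding A_def by (rule open_arc_drawing) (use E' in auto)
  have mo: "m \<in> open_arc e" unfolding m_def open_arc_def by auto
  then have mA: "m \<in> - A" using arcA by auto
  have F0: "F0 \<in> components (- A)" unfolding F0_def using mA by (auto simp: components_def)
  have sub0: "open_arc e \<subseteq> F0"
    unfolding F0_def by (rule connected_component_maximal) (use mo arcA connected_open_arc E' in auto)
  have pe: "p ` e \<subseteq> A"
    using edge_sub[OF E'(2)] p_in_drawing by (auto simp: A_def)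
  have keep: "F \<in> components (- D)" "F \<inter> F0 = {}" if "F \<in> components (- A)" "F \<noteq> F0" for F
  proof -
    show disj: "F \<inter> F0 = {}"
      using components_eq[OF that(1) F0] that(2) by blast
    have "F \<subseteq> - D"
      using disj sub0 pe in_components_subset[OF that(1)] path_image_open_arc[OF E'(2)]
      by (auto simp: D_def)
    then show "F \<in> components (- D)"
      by (rule components_intermediate[OF that(1)]) (auto simp: D_def)
  qed
  obtain \<epsilon> where \<epsilon>: "\<epsilon> > 0" "ball m \<epsilon> \<subseteq> - A"
    using clA mA by (meson open_Compl open_contains_ball)
  have ballF0: "ball m \<epsilon> \<subseteq> F0"
    unfolding F0_def by (rule connected_component_maximal) (use \<epsilon> in auto)
  define C where "C = connected_component_set (- D)"
  have Cx: "C x \<in> components (- D)" "C x \<notin> FF - {F0}" if "x \<in> ball m \<epsilon>" "x \<notin> path_image (\<gamma> e)" for x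
  proof -
    have xD: "x \<in> - D" using that \<epsilon> by (auto simp: D_def)
    then show "C x \<in> components (- D)" by (auto simp: C_def components_def)
    have "x \<in> C x" using xD by (simp add: C_def)
    then show "C x \<notin> FF - {F0}" using keep(2)[of "C x"] ballF0 that(1) FF(2) unfolding A_def by blast
  qed
  have fin: "finite (FF - {F0})" "FF - {F0} \<subseteq> components (- D)" "card FF \<le> card (FF - {F0}) + 1"
    using FF keep(1) by (auto simp: A_def card_Diff_singleton_if)
  show thesis
  proof (cases "path_component A (p u) (p v)")
    case True
    obtain q c where qc: "path_image q \<subseteq> A" "arc q" "simple_path c" "pathfinish c = pathstart c"
      "path_image c = path_image (\<gamma> e) \<union> path_image q" "A \<inter> path_image c = path_image q"
      using closing_curve[OF E'(4,2,1,3)] True unfolding A_def by metis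
    have J: "frontier (inside (path_image c)) = path_image c" "frontier (outside (path_image c)) = path_image c"
      using Jordan_inside_outside[OF qc(3,4)] by auto
    have "m \<in> path_image c" using mo qc(5) path_image_open_arc[OF E'(2)] by auto
    then have "m \<in> closure (inside (path_image c))" "m \<in> closure (outside (path_image c))"
      using J by (auto simp: frontier_def)
    then obtain x y where xy: "x \<in> inside (path_image c)" "x \<in> ball m \<epsilon>"
        "y \<in> outside (path_image c)" "y \<in> ball m \<epsilon>"
      using \<epsilon>(1) by (metis closure_approachable mem_ball dist_commute)
    have nx: "x \<notin> path_image (\<gamma> e)" "y \<notin> path_image (\<gamma> e)"
      using xy qc(5) inside_no_overlap outside_no_overlap by blast+
    have "C x \<noteq> C y"
    proof
      assume "C x = C y"
      then have "connected_component (- D) x y"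
        using Cx(1)[OF xy(4) nx(2)] xy nx \<epsilon> unfolding C_def
        by (metis connected_component_eq_empty connected_component_eq_eq in_components_nonempty)
      then have "connected_component (- path_image c) x y"
        by (rule connected_component_of_subset) (use qc in \<open>auto simp: D_def\<close>)
      then have "x \<in> outside (path_image c)"
        using xy(3) outside_same_component connected_component_sym by metis
      then show False using xy(1) inside_Int_outside by blast
    qed
    then have "card (insert (C x) (insert (C y) (FF - {F0}))) = card (FF - {F0}) + 2"
      using Cx(2)[OF xy(2) nx(1)] Cx(2)[OF xy(4) nx(2)] fin(1) by auto
    then show thesis
      using fin Cx(1)[OF xy(2) nx(1)] Cx(1)[OF xy(4) nx(2)] True
      by (intro that[of "insert (C x) (insert (C y) (FF - {F0}))"]) (simp_all add: D A_def)
  next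
    case False
    obtain x where x: "x \<in> ball m \<epsilon>" "x \<notin> path_image (\<gamma> e)"
      using ball_not_subset_arc[OF arc_\<gamma>[OF E'(2)], of "1/2" \<epsilon>] \<epsilon>(1) unfolding m_def by fastforce
    then have "card (insert (C x) (FF - {F0})) = card (FF - {F0}) + 1"
      using Cx(2)[OF x] fin(1) by auto
    then show thesis
      using fin Cx(1)[OF x] False
      by (intro that[of "insert (C x) (FF - {F0})"]) (simp_all add: D A_def)
  qed
qed

text \<open>The half of Euler's formula that bounds the number of faces from below. \<open>r\<close>
  maps a vertex to the representative of its class; classes may be finer than the path components,
  since only equal representatives have to be linked. An edge within a class creates a face, an edge
  between two classes merges them.\<close>

lemma faces_lower_bound:
  assumes "E' \<subseteq> E"
  shows "\<exists>r FF. r ` V \<subseteq> V \<and>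
     (\<forall>u\<in>V. \<forall>v\<in>V. r u = r v \<longrightarrow> path_component (drawing V E') (p u) (p v)) \<and>
     finite FF \<and> FF \<subseteq> components (- drawing V E') \<and>
     card E' + card (r ` V) + 1 \<le> card V + card FF"
  using finite_subset[OF assms finite_E] assms
proof (induction E' rule: finite_induct)
  case empty
  have "- p ` V \<noteq> ({} :: complex set)"
    using finite_V infinite_UNIV_char_0[where 'a=complex] by (metis compl_bot_eq double_compl finite_imageI)
  moreover have "connected (- drawing V {})"
    by (rule connected_acyclic_complement) (auto simp: acyclic_edges_def)
  ultimately have "- drawing V {} \<in> components (- drawing V {})"
    by (simp add: in_components_self drawing_def)
  moreover have "path_component (drawing V {}) (p u) (p u)" if "u \<in> V" for u
    using that by (simp add: path_component_refl p_in_drawing)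
  ultimately show ?case
    using inj_p by (intro exI[of _ id] exI[of _ "{- drawing V {}}"]) (auto dest: inj_onD)
next
  case (insert e E')
  then obtain r FF where r: "r ` V \<subseteq> V"
     "\<And>u v. u \<in> V \<Longrightarrow> v \<in> V \<Longrightarrow> r u = r v \<Longrightarrow> path_component (drawing V E') (p u) (p v)"
    and FF: "finite FF" "FF \<subseteq> components (- drawing V E')"
    and card: "card E' + card (r ` V) + 1 \<le> card V + card FF"
    by blast
  have eE: "e \<in> E" using insert by auto
  obtain u v where uv: "e = {u, v}" "u \<in> V" "v \<in> V"
     "pathstart (\<gamma> e) = p u" "pathfinish (\<gamma> e) = p v"
    using edgeE[OF eE] by metis
  obtain FF' where FF': "finite FF'" "FF' \<subseteq> components (- drawing V (insert e E'))"
    "card FF + (if path_component (drawing V E') (p u) (p v) then 1 else 0) \<le> card FF'"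
    by (rule faces_insert_edge[OF _ eE insert(2) uv(1) FF]) (use insert(4) in auto)
  have sub: "drawing V E' \<subseteq> drawing V (insert e E')" by (auto simp: drawing_insert)
  have pc: "path_component (drawing V (insert e E')) a b" if "path_component (drawing V E') a b" for a b
    using that sub path_component_of_subset by blast
  show ?case
  proof (cases "r u = r v")
    case True
    then have "card FF + 1 \<le> card FF'" using FF'(3) r(2)[OF uv(2,3)] by simp
    then show ?thesis using r FF'(1,2) pc card insert(1,2)
      by (intro exI[of _ r] exI[of _ FF'] conjI ballI impI) simp_all
  next
    case False
    define r' where "r' = (\<lambda>x. if r x = r v then r u else r x)"
    have "r' ` V \<subseteq> r ` V - {r v}" using uv False by (auto simp: r'_def)
    then have "card (r' ` V) \<le> card (r ` V) - 1"
      using finite_V uv(3) by (metis card_Diff_singleton card_mono finite_Diff finite_imageI imageI)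
    moreover have "card (r ` V) > 0" using finite_V uv(3) by (auto simp: card_gt_0_iff)
    moreover have "card FF \<le> card FF'" using FF'(3) by (auto split: if_splits)
    moreover have "r' ` V \<subseteq> V" using r(1) uv by (auto simp: r'_def)
    moreover have "path_component (drawing V (insert e E')) (p a) (p b)"
      if ab: "a \<in> V" "b \<in> V" "r' a = r' b" for a b
    proof -
      let ?P = "path_component (drawing V (insert e E'))"
      have uvP: "?P (p u) (p v)"
        unfolding path_component_def
        by (rule exI[of _ "\<gamma> e"]) (use uv arc_imp_path[OF arc_\<gamma>[OF eE]] in \<open>auto simp: drawing_insert\<close>)
      have vuP: "?P (p v) (p u)" using uvP path_component_sym by blast
      have tr: "?P x z" if "?P x y" "?P y z" for x y z
        using that by (rule path_component_trans)
      have rr: "?P (p x) (p y)" if "x \<in> V" "y \<in> V" "r x = r y" for x y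
        by (rule pc[OF r(2)[OF that]])
      consider "r a = r v" "r b \<noteq> r v" "r b = r u" | "r a \<noteq> r v" "r b = r v" "r a = r u" | "r a = r b"
        using ab(3) unfolding r'_def by metis
      then show ?thesis
      proof cases
        case 1
        show ?thesis by (rule tr[OF rr[of a v] tr[OF vuP rr[of u b]]]) (use 1 ab uv in simp_all)
      next
        case 2
        show ?thesis by (rule tr[OF rr[of a u] tr[OF uvP rr[of v b]]]) (use 2 ab uv in simp_all)
      next
        case 3
        then show ?thesis by (rule rr[OF ab(1,2)])
      qed
    qed
    ultimately show ?thesis using FF'(1,2) card insert(1,2)
      by (intro exI[of _ r'] exI[of _ FF'] conjI ballI impI) simp_all
  qed
qed

end

section \<open>Faces and the edges on their boundary\<close>

context plane_graph
begin

text \<open>Only inner points of the arc count: a face can reach an end vertex of an edge without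
  running along the edge.\<close>

definition touches :: "complex set \<Rightarrow> 'a set \<Rightarrow> bool" where
  "touches F e \<longleftrightarrow> open_arc e \<inter> closure F \<noteq> {}"

text \<open>The open arc together with a small disc around a contact point is connected and avoids
  \<open>A\<close>. Hence all faces touching \<open>e\<close> have points in one component of the
  complement of the drawing without \<open>e\<close>.\<close>

lemma touching_point:
  assumes "e \<in> E" "touches F e" "closed A" "open_arc e \<inter> A = {}"
  obtains x where "x \<in> F" "connected_component (- A) (\<gamma> e (1/2)) x"
proof -
  obtain z where z: "z \<in> open_arc e" "z \<in> closure F"
    using assms(2) by (auto simp: touches_def)
  then have "z \<in> - A" using assms(4) by blast
  then obtain \<epsilon> where \<epsilon>: "\<epsilon> > 0" "ball z \<epsilon> \<subseteq> - A"
    using assms(3) by (meson open_Compl open_contains_ball)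
  obtain x where x: "x \<in> F" "dist x z < \<epsilon>"
    using z(2) \<epsilon>(1) by (meson closure_approachable)
  have "connected (open_arc e \<union> ball z \<epsilon>)"
    by (rule connected_Un) (use z \<epsilon> connected_open_arc[OF assms(1)] in auto)
  moreover have "open_arc e \<union> ball z \<epsilon> \<subseteq> - A"
    using \<epsilon>(2) assms(4) by blast
  moreover have "\<gamma> e (1/2) \<in> open_arc e" "x \<in> ball z \<epsilon>"
    using x by (auto simp: open_arc_def dist_commute)
  ultimately have "connected_component (- A) (\<gamma> e (1/2)) x"
    unfolding connected_component_def by blast
  with x(1) show thesis by (rule that)
qed

lemma path_connected_piece:
  assumes "P \<in> (\<lambda>v. {p v}) ` V \<union> (\<lambda>e. path_image (\<gamma> e)) ` E"
  shows "compact P" "path_connected P"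
  using assms arc_\<gamma> by (auto simp: compact_arc_image arc_imp_path path_connected_path_image)

text \<open>The drawing is a finite union of compact path connected pieces, vertices and arcs. Each
  piece lies inside the path component of \<open>p u\<close> or is disjoint from it, so sorting the
  pieces gives two disjoint compact sets.\<close>

lemma separate_unlinked_ends:
  assumes "e = {u, v}" "e \<in> E" "\<not> path_component (drawing V (E - {e})) (p u) (p v)"
  obtains A1 A2 where "compact A1" "compact A2" "drawing V (E - {e}) = A1 \<union> A2" "A1 \<inter> A2 = {}"
    "p u \<in> A1" "p v \<in> A2"
proof -
  define A where "A = drawing V (E - {e})"
  define P where "P = (\<lambda>v. {p v}) ` V \<union> (\<lambda>e. path_image (\<gamma> e)) ` (E - {e})"
  define A1 where "A1 = \<Union>{Q \<in> P. Q \<subseteq> path_component_set A (p u)}"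
  define A2 where "A2 = \<Union>{Q \<in> P. \<not> Q \<subseteq> path_component_set A (p u)}"
  have uv: "u \<in> V" "v \<in> V" using edge_sub[OF assms(2)] assms(1) by auto
  have AP: "A = \<Union>P" by (auto simp: A_def P_def drawing_def)
  have fin: "finite P" using finite_V finite_E by (simp add: P_def)
  have piece: "compact Q" "path_connected Q" if "Q \<in> P" for Q
    using path_connected_piece[of Q] that by (auto simp: P_def)
  have inA2: "Q \<inter> path_component_set A (p u) = {}"
    if "Q \<in> P" "\<not> Q \<subseteq> path_component_set A (p u)" for Q
  proof (rule ccontr)
    assume "Q \<inter> path_component_set A (p u) \<noteq> {}"
    then obtain z where z: "z \<in> Q" "path_component A (p u) z" by auto
    have "Q \<subseteq> path_component_set A z"
      by (rule path_component_maximal) (use z piece[OF that(1)] that(1) AP in auto)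
    also have "\<dots> = path_component_set A (p u)"
      using path_component_eq z(2) by (metis mem_Collect_eq)
    finally show False using that(2) by blast
  qed
  show thesis
  proof (rule that[of A1 A2])
    show "compact A1" "compact A2"
      unfolding A1_def A2_def by (intro compact_Union; use fin piece in auto)+
    show "drawing V (E - {e}) = A1 \<union> A2"
      unfolding A_def[symmetric] AP A1_def A2_def by blast
    show "A1 \<inter> A2 = {}" using inA2 unfolding A1_def A2_def by blast
    have "{p u} \<in> P" "{p v} \<in> P" using uv by (auto simp: P_def)
    moreover have "p u \<in> path_component_set A (p u)"
      using uv by (simp add: A_def p_in_drawing path_component_refl)
    moreover have "p v \<notin> path_component_set A (p u)"
      using assms(3) by (simp add: A_def)
    ultimately show "p u \<in> A1" "p v \<in> A2" unfolding A1_def A2_def by blast+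
  qed
qed

text \<open>Without \<open>e\<close>, the touching faces are not separated from each other. If
  \<open>e\<close> closes a Jordan curve, Janiszewski's theorem shows that points on the same side
  of the curve remain in one face, and there are only two sides. Otherwise the arc meets each of the
  two separated parts of the drawing in one point, and adding these sets successively separates
  nothing.\<close>

lemma at_most_two_faces:
  assumes "e \<in> E" and F: "\<And>i. i \<in> {1,2,3::nat} \<Longrightarrow> F i \<in> components (- drawing V E) \<and> touches (F i) e"
  shows "F 1 = F 2 \<or> F 1 = F 3 \<or> F 2 = F 3"
proof -
  define A where "A = drawing V (E - {e})"
  obtain u v where uv: "e = {u, v}"
     "pathstart (\<gamma> e) = p u" "pathfinish (\<gamma> e) = p v"
    using edgeE[OF assms(1)] by metis
  have D: "drawing V E = A \<union> path_image (\<gamma> e)"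
    using drawing_insert[of V e "E - {e}"] assms(1) by (simp add: A_def insert_absorb)
  have clA: "compact A" unfolding A_def by (rule compact_drawing) auto
  have arcA: "open_arc e \<inter> A = {}"
    unfolding A_def by (rule open_arc_drawing) (use assms in auto)
  have "\<exists>x. x \<in> F i \<and> connected_component (- A) (\<gamma> e (1/2)) x" if "i \<in> {1,2,3}" for i
    using touching_point[OF assms(1), of "F i" A] F[OF that] compact_imp_closed[OF clA] arcA by metis
  then obtain x where x: "\<And>i. i \<in> {1,2,3} \<Longrightarrow> x i \<in> F i \<and> connected_component (- A) (\<gamma> e (1/2)) (x i)"
    by metis
  have xA: "connected_component (- A) (x i) (x j)" if "i \<in> {1,2,3}" "j \<in> {1,2,3}" for i j
    using x[OF that(1)] x[OF that(2)] connected_component_sym connected_component_trans by metis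
  have eq: "F i = F j" if "i \<in> {1,2,3}" "j \<in> {1,2,3}"
      "connected_component (- drawing V E) (x i) (x j)" for i j
  proof -
    have "F i = connected_component_set (- drawing V E) (x i)"
      "F j = connected_component_set (- drawing V E) (x j)"
      using F that(1,2) x by (metis components_iff connected_component_eq)+
    then show ?thesis using that(3) connected_component_eq by (metis mem_Collect_eq)
  qed
  have xD: "x i \<notin> drawing V E" if "i \<in> {1,2,3}" for i
    using x[OF that] F[OF that] in_components_subset by blast
  show ?thesis
  proof (cases "path_component A (p u) (p v)")
    case True
    obtain q c where qc: "path_image q \<subseteq> A" "arc q" "simple_path c" "pathfinish c = pathstart c"
      "path_image c = path_image (\<gamma> e) \<union> path_image q" "A \<inter> path_image c = path_image q"
      using closing_curve[OF uv(1) assms(1), of "E - {e}"] True unfolding A_def by auto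
    have DJ: "drawing V E = A \<union> path_image c" using D qc by auto
    have same: "F i = F j"
      if ij: "i \<in> {1,2,3}" "j \<in> {1,2,3}" and S: "connected S" "S \<subseteq> - path_image c" "x i \<in> S" "x j \<in> S" for i j S
    proof (rule eq[OF ij])
      show "connected_component (- drawing V E) (x i) (x j)"
        unfolding DJ
      proof (rule Janiszewski)
        show "closed (path_image c)" using qc(3) by (simp add: closed_simple_path_image)
        show "connected (A \<inter> path_image c)" using qc by (simp add: connected_arc_image)
        show "connected_component (- path_image c) (x i) (x j)"
          using S unfolding connected_component_def by blast
      qed (use clA xA ij in auto)
    qed
    have J: "connected (inside (path_image c))" "connected (outside (path_image c))"
      "inside (path_image c) \<union> outside (path_image c) = - path_image c"
      using Jordan_inside_outside[OF qc(3,4)] by auto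
    have side: "x i \<in> inside (path_image c) \<or> x i \<in> outside (path_image c)" if "i \<in> {1,2,3}" for i
      using xD[OF that] J(3) DJ by blast
    have in_eq: "F i = F j" if "i \<in> {1,2,3}" "j \<in> {1,2,3}" "x i \<in> inside (path_image c)" "x j \<in> inside (path_image c)" for i j
      using same[OF that(1,2) J(1) _ that(3,4)] J(3) by blast
    have out_eq: "F i = F j" if "i \<in> {1,2,3}" "j \<in> {1,2,3}" "x i \<in> outside (path_image c)" "x j \<in> outside (path_image c)" for i j
      using same[OF that(1,2) J(2) _ that(3,4)] J(3) by blast
    show ?thesis
      using side[of 1] side[of 2] side[of 3] in_eq[of 1 2] in_eq[of 1 3] in_eq[of 2 3]
        out_eq[of 1 2] out_eq[of 1 3] out_eq[of 2 3] by simp metis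
  next
    case False
    obtain A1 A2 where A12: "compact A1" "compact A2" "A = A1 \<union> A2" "A1 \<inter> A2 = {}"
      "p u \<in> A1" "p v \<in> A2"
      using separate_unlinked_ends[OF uv(1) assms(1)] False unfolding A_def by metis
    have ends: "A \<inter> path_image (\<gamma> e) \<subseteq> {p u, p v}"
      unfolding A_def using drawing_Int_edge[of V "E - {e}" e] assms(1) uv(1) by auto
    have uvp: "p u \<in> path_image (\<gamma> e)" "p v \<in> path_image (\<gamma> e)"
      using ends_in_path[OF assms(1)] uv(1) by auto
    have i1: "A1 \<inter> path_image (\<gamma> e) = {p u}" and i2: "(A1 \<union> path_image (\<gamma> e)) \<inter> A2 = {p v}"
      using ends A12 uvp by blast+
    have cle: "compact (path_image (\<gamma> e))" by (simp add: arc_\<gamma> assms(1) compact_arc_image)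
    have xe: "connected_component (- path_image (\<gamma> e)) (x 1) (x 2)"
    proof -
      have "connected (- path_image (\<gamma> e))"
        by (simp add: arc_\<gamma> connected_arc_complement assms(1))
      then show ?thesis
        using xD[of 1] xD[of 2] D unfolding connected_component_def by (intro exI[of _ "- path_image (\<gamma> e)"]) auto
    qed
    have x1: "connected_component (- A1) (x 1) (x 2)" and x2: "connected_component (- A2) (x 1) (x 2)"
      by (rule connected_component_of_subset[OF xA[of 1 2]]; use A12(3) in auto)+
    have s1: "connected_component (- (A1 \<union> path_image (\<gamma> e))) (x 1) (x 2)"
      by (rule Janiszewski) (use A12(1) cle i1 x1 xe in \<open>auto simp: compact_imp_closed\<close>)
    have "connected_component (- (A1 \<union> path_image (\<gamma> e) \<union> A2)) (x 1) (x 2)"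
      by (rule Janiszewski) (use A12(1,2) cle i2 x2 s1 in \<open>auto simp: compact_imp_closed compact_Un\<close>)
    moreover have "drawing V E = A1 \<union> path_image (\<gamma> e) \<union> A2" using D A12(3) by blast
    ultimately show ?thesis using eq[of 1 2] by simp
  qed
qed

lemma frontier_face:
  assumes "V' \<subseteq> V" "E' \<subseteq> E" "F \<in> components (- drawing V' E')"
  shows "frontier F \<subseteq> drawing V' E'" "open F"
proof -
  have o: "open (- drawing V' E')" using closed_drawing assms(1,2) by blast
  have "frontier F \<subseteq> frontier (- drawing V' E')"
    by (rule frontier_of_components_subset[OF assms(3)])
  also have "\<dots> \<subseteq> drawing V' E'"
    using closed_drawing[OF assms(1,2)] by (simp add: frontier_complement frontier_subset_eq)
  finally show "frontier F \<subseteq> drawing V' E'" .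
  show "open F" using open_components[OF o assms(3)] .
qed

text \<open>A connected set that meets \<open>F\<close> and leaves it must meet the frontier of
  \<open>F\<close>. Used for a face whose frontier lies in a drawing that does not separate the
  plane.\<close>

lemma face_eq_complement:
  assumes "connected (- D)" "frontier F \<subseteq> D" "F \<subseteq> - D" "F \<noteq> {}"
  shows "F = - D"
proof (rule ccontr)
  assume "F \<noteq> - D"
  then have "- D - F \<noteq> {}" "- D \<inter> F \<noteq> {}" using assms by auto
  then have "- D \<inter> frontier F \<noteq> {}"
    using connected_Int_frontier[OF assms(1)] by blast
  then show False using assms(2) by blast
qed

text \<open>If the touched edges formed a forest, their drawing \<open>D\<close> would not separate
  the plane and would contain the frontier of \<open>F\<close>; then \<open>F\<close> is the whole
  complement of \<open>D\<close>, which leaves no room for further edges. In contrapositive form: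
  unless the graph is a forest, every face touches an edge set of minimum degree two.\<close>

lemma acyclic_boundary:
  assumes F: "F \<in> components (- drawing V E)" and ac: "acyclic_edges {e \<in> E. touches F e}"
  shows "acyclic_edges E"
proof -
  define B where "B = {e \<in> E. touches F e}"
  define D where "D = drawing V B"
  have BE: "B \<subseteq> E" by (auto simp: B_def)
  have con: "connected (- D)"
    unfolding D_def by (rule connected_acyclic_complement) (use ac edge_sub in \<open>auto simp: B_def\<close>)
  have DE: "D \<subseteq> drawing V E" using BE by (auto simp: D_def drawing_def)
  have "frontier F \<subseteq> D"
  proof
    fix z assume z: "z \<in> frontier F"
    then consider "z \<in> p ` V" | e where "e \<in> E" "z \<in> path_image (\<gamma> e)"
      using frontier_face(1)[OF _ _ F] by (auto simp: drawing_def)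
    then show "z \<in> D"
    proof cases
      case 2
      show ?thesis
      proof (cases "z \<in> open_arc e")
        case True
        then have "e \<in> B" using z 2 by (auto simp: B_def touches_def frontier_def)
        then show ?thesis using 2 by (auto simp: D_def drawing_def)
      next
        case False
        then have "z \<in> p ` e" using 2 path_image_open_arc by auto
        then show ?thesis using edge_sub[OF 2(1)] by (auto simp: D_def drawing_def)
      qed
    qed (auto simp: D_def drawing_def)
  qed
  then have "F = - D"
    by (rule face_eq_complement[OF con]) (use in_components_subset[OF F] in_components_nonempty[OF F] DE in auto)
  moreover have "F \<subseteq> - drawing V E" using F in_components_subset by blast
  ultimately have sub: "drawing V E \<subseteq> D" by blast
  have "E \<subseteq> B"
  proof (rule subsetI, rule ccontr)
    fix e assume e: "e \<in> E" "e \<notin> B"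
    then have "open_arc e \<inter> D = {}"
      unfolding D_def by (intro open_arc_drawing) (auto simp: BE)
    moreover have "open_arc e \<subseteq> drawing V E"
      using path_image_open_arc[OF e(1)] e(1) by (auto simp: drawing_def)
    moreover have "\<gamma> e (1/2) \<in> open_arc e" by (auto simp: open_arc_def)
    ultimately show False using sub by blast
  qed
  then have "B = E" using BE by blast
  then show ?thesis using ac by (simp add: B_def)
qed

lemma card_touching_faces:
  assumes "e \<in> E" "finite FF" "FF \<subseteq> components (- drawing V E)"
  shows "card {F \<in> FF. touches F e} \<le> 2"
proof (rule ccontr)
  assume "\<not> ?thesis"
  then have "3 \<le> card {F \<in> FF. touches F e}" by simp
  then obtain T where T: "T \<subseteq> {F \<in> FF. touches F e}" "card T = 3"
    by (meson obtain_subset_with_card_n)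
  then obtain F1 F2 F3 where F: "T = {F1, F2, F3}" "F1 \<noteq> F2" "F1 \<noteq> F3" "F2 \<noteq> F3"
    by (auto simp: card_3_iff)
  define G where "G = (\<lambda>i::nat. if i = 1 then F1 else if i = 2 then F2 else F3)"
  have "G i \<in> components (- drawing V E) \<and> touches (G i) e" for i
    using T(1) assms(3) F(1) by (auto simp: G_def)
  then have "G 1 = G 2 \<or> G 1 = G 3 \<or> G 2 = G 3"
    by (intro at_most_two_faces[OF assms(1)]) auto
  then show False using F by (simp add: G_def)
qed

text \<open>\<open>g\<close> acts as a girth that counts only edges of \<open>X\<close>. Outside the
  forest case each face touches at least \<open>g\<close> edges of \<open>X\<close> and each edge
  touches at most two faces, so \<open>g * card FF \<le> 2 * card X\<close>; the lower bound for the
  number of faces, with at least one class of vertices, does the rest. The first alternative is the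
  forest case.\<close>

theorem weighted_face_bound:
  assumes "X \<subseteq> E" "V \<noteq> {}"
    and g: "\<And>Y. Y \<subseteq> E \<Longrightarrow> Y \<noteq> {} \<Longrightarrow> mindeg2 Y \<Longrightarrow> g \<le> card (Y \<inter> X)"
  shows "card E + 1 \<le> card V \<or> g * (card E + 2) \<le> g * card V + 2 * card X"
proof -
  obtain r FF where r: "r ` V \<subseteq> V" and FF: "finite FF" "FF \<subseteq> components (- drawing V E)"
    and card: "card E + card (r ` V) + 1 \<le> card V + card FF"
    using faces_lower_bound[OF order_refl] by blast
  have r1: "card (r ` V) \<ge> 1"
    using assms(2) finite_V by (simp add: Suc_le_eq card_gt_0_iff)
  have finX: "finite X" using assms(1) finite_E finite_subset by blast
  show ?thesis
  proof (cases "acyclic_edges E")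
    case True
    then have con: "connected (- drawing V E)"
      by (intro connected_acyclic_complement) (use edge_sub in auto)
    \<comment> \<open>A forest has a single face, and the lower bound for faces becomes
      \<open>card E < card V\<close>.\<close>
    have "FF \<subseteq> {- drawing V E}"
      using FF(2) components_eq_sing_iff con
      by (metis Compl_empty_eq components_empty empty_subsetI order_trans subset_refl)
    then have "card FF \<le> 1" by (metis card.empty card.insert card_mono empty_iff finite.simps One_nat_def)
    then show ?thesis using card r1 by linarith
  next
    case False
    have lower: "g \<le> card {e \<in> X. touches F e}" if "F \<in> FF" for F
    proof -
      have "\<not> acyclic_edges {e \<in> E. touches F e}"
        using acyclic_boundary False that FF(2) by blast
      then obtain Y where Y: "Y \<subseteq> {e \<in> E. touches F e}" "Y \<noteq> {}" "mindeg2 Y"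
        by (auto simp: acyclic_edges_def)
      have "g \<le> card (Y \<inter> X)" by (rule g) (use Y in auto)
      also have "\<dots> \<le> card {e \<in> X. touches F e}"
        by (rule card_mono) (use finX Y in auto)
      finally show ?thesis .
    qed
    have "g * card FF \<le> (\<Sum>F\<in>FF. card {e \<in> X. touches F e})"
      using sum_mono[of FF "\<lambda>_. g", OF lower] by (simp add: mult.commute)
    also have "\<dots> = (\<Sum>F\<in>FF. \<Sum>e\<in>X. of_bool (touches F e))"
      using finX by (simp add: sum_of_bool_eq Int_def)
    also have "\<dots> = (\<Sum>e\<in>X. \<Sum>F\<in>FF. of_bool (touches F e))"
      by (rule sum.swap)
    also have "\<dots> = (\<Sum>e\<in>X. card {F \<in> FF. touches F e})"
      using FF(1) by (simp add: sum_of_bool_eq Int_def)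
    also have "\<dots> \<le> (\<Sum>e\<in>X. 2)"
      by (rule sum_mono) (use card_touching_faces FF assms(1) in auto)
    also have "\<dots> = 2 * card X" by simp
    finally have "g * card FF \<le> 2 * card X" .
    moreover have "g * (card E + 2) \<le> g * (card V + card FF)"
      by (rule mult_le_mono2) (use card r1 in linarith)
    ultimately show ?thesis by (simp add: algebra_simps)
  qed
qed

end

section \<open>Edge bounds for planar minors\<close>

lemma planar_plane_graph: "planar (V, E) \<Longrightarrow> \<exists>p \<gamma>. plane_graph V E p \<gamma>"
  unfolding planar_def plane_graph_def by blast

lemma plane_graph_planar: "plane_graph V E p \<gamma> \<Longrightarrow> planar (V, E)"
  unfolding planar_def plane_graph_def by blast

lemma planar_subgraph:
  assumes "planar (V, E)" "V' \<subseteq> V" "E' \<subseteq> E" "\<Union>E' \<subseteq> V'"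
  shows "planar (V', E')"
proof -
  obtain p \<gamma> where "plane_graph V E p \<gamma>"
    using planar_plane_graph[OF assms(1)] by blast
  then interpret plane_graph V E p \<gamma> .
  have "plane_graph V' E' p \<gamma>"
    by (rule subgraph[OF assms(2-4)])
  then show ?thesis
    by (rule plane_graph_planar)
qed

lemma planarD:
  assumes "planar (V, E)"
  shows "finite V" "finite E" "\<And>e. e \<in> E \<Longrightarrow> e \<subseteq> V" "\<And>e. e \<in> E \<Longrightarrow> card e = 2"
proof -
  obtain p \<gamma> where "plane_graph V E p \<gamma>"
    using planar_plane_graph[OF assms] by blast
  then interpret plane_graph V E p \<gamma> .
  show "finite V" "finite E" "\<And>e. e \<in> E \<Longrightarrow> e \<subseteq> V" "\<And>e. e \<in> E \<Longrightarrow> card e = 2"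
    by (fact finite_V finite_E edge_sub edge_card)+
qed

lemma planar_weighted_bound:
  assumes "planar (V, E)" "X \<subseteq> E" "V \<noteq> {}"
    and "\<And>Y. Y \<subseteq> E \<Longrightarrow> Y \<noteq> {} \<Longrightarrow> mindeg2 Y \<Longrightarrow> g \<le> card (Y \<inter> X)"
  shows "card E + 1 \<le> card V \<or> g * (card E + 2) \<le> g * card V + 2 * card X"
proof -
  obtain p \<gamma> where "plane_graph V E p \<gamma>"
    using planar_plane_graph[OF assms(1)] by blast
  then interpret plane_graph V E p \<gamma> .
  show ?thesis
    by (rule weighted_face_bound) (use assms in auto)
qed

text \<open>Connectivity as a cut condition: every proper nonempty part is left by an edge. This is
  the step needed to grow a tree, or a maximal connected subset, by one vertex.\<close>

definition connected_in :: "'a set set \<Rightarrow> 'a set \<Rightarrow> bool" where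
  "connected_in E P \<longleftrightarrow> P \<noteq> {} \<and> (\<forall>A. A \<subset> P \<longrightarrow> A \<noteq> {} \<longrightarrow> (\<exists>u\<in>A. \<exists>v\<in>P - A. {u, v} \<in> E))"

lemma connected_in_singleton [simp]: "connected_in E {v}"
  unfolding connected_in_def psubset_eq subset_singleton_iff by blast

lemma connected_in_mono: "connected_in E P \<Longrightarrow> E \<subseteq> E' \<Longrightarrow> connected_in E' P"
  unfolding connected_in_def by blast

text \<open>A tree described by counts: one edge less than vertices, and every nonempty vertex set
  \<open>W\<close> spans fewer than \<open>card W\<close> of its edges. The sparsity condition is
  what the degree count in the minor theorem uses.\<close>

definition tree_on :: "'a set set \<Rightarrow> 'a set \<Rightarrow> 'a set set \<Rightarrow> bool" where
  "tree_on E A N \<longleftrightarrow> finite N \<and> N \<subseteq> E \<and> (\<forall>e\<in>N. e \<subseteq> A \<and> card e = 2) \<and> card N + 1 = card A \<and>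
     (\<forall>W. finite W \<longrightarrow> W \<noteq> {} \<longrightarrow> card {e \<in> N. e \<subseteq> W} + 1 \<le> card W)"

lemma tree_on_insert:
  assumes tree: "tree_on E A N" and "finite A" "u \<in> A" "v \<notin> A" "{u, v} \<in> E"
  shows "tree_on E (insert v A) (insert {u, v} N)"
proof -
  have N: "finite N" "N \<subseteq> E" "\<And>e. e \<in> N \<Longrightarrow> e \<subseteq> A" "\<And>e. e \<in> N \<Longrightarrow> card e = 2" "card N + 1 = card A"
    and forest: "\<And>W. finite W \<Longrightarrow> W \<noteq> {} \<Longrightarrow> card {e \<in> N. e \<subseteq> W} + 1 \<le> card W"
    using tree by (simp_all add: tree_on_def)
  have nv: "v \<notin> e" if "e \<in> N" for e
    using N(3)[OF that] assms(4) by blast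
  then have new: "{u, v} \<notin> N" by blast
  have uv: "u \<noteq> v" using assms(3,4) by blast
  have W: "card {e \<in> insert {u, v} N. e \<subseteq> W} + 1 \<le> card W" if W: "finite W" "W \<noteq> {}" for W
  proof (cases "v \<in> W \<and> u \<in> W")
    case False
    then have "{e \<in> insert {u, v} N. e \<subseteq> W} = {e \<in> N. e \<subseteq> W}" by auto
    then show ?thesis using forest[OF W] by simp
  next
    case True
    have cW: "card W = card (W - {v}) + 1"
      using card.remove[OF W(1), of v] True by simp
    have "{e \<in> insert {u, v} N. e \<subseteq> W} = insert {u, v} {e \<in> N. e \<subseteq> W - {v}}"
      using nv True by blast
    then have "card {e \<in> insert {u, v} N. e \<subseteq> W} = card {e \<in> N. e \<subseteq> W - {v}} + 1"
      using N(1) new by simp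
    moreover have "card {e \<in> N. e \<subseteq> W - {v}} + 1 \<le> card (W - {v})"
      by (rule forest) (use W True uv in auto)
    ultimately show ?thesis using cW by simp
  qed
  have "card (insert {u, v} N) = card N + 1" "card (insert v A) = card A + 1"
    using N(1) new assms(2,4) by simp_all
  moreover have "e \<subseteq> insert v A \<and> card e = 2" if "e \<in> insert {u, v} N" for e
    using that N(3,4) assms(3) uv by auto
  ultimately show ?thesis
    unfolding tree_on_def using N(1,2,5) W assms(5) by simp
qed

lemma spanning_tree:
  assumes "finite P" "connected_in E P"
  obtains N where "tree_on E P N"
proof -
  have "\<exists>A N. A \<subseteq> P \<and> card A = k \<and> tree_on E A N" if "1 \<le> k" "k \<le> card P" for k
    using that
  proof (induction k rule: dec_induct)
    case base
    obtain v where "v \<in> P" using assms(2) by (auto simp: connected_in_def)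
    moreover have "tree_on E {v} {}"
      by (auto simp: tree_on_def Suc_le_eq card_gt_0_iff)
    ultimately show ?case
      by (intro exI[of _ "{v}"] exI[of _ "{}"]) simp
  next
    case (step k)
    then obtain A N where A: "A \<subseteq> P" "card A = k" "tree_on E A N"
      by auto
    have finA: "finite A" using A(1) assms(1) by (rule finite_subset)
    have "A \<noteq> {}" "A \<noteq> P" using A step by auto
    then obtain u v where uv: "u \<in> A" "v \<in> P" "v \<notin> A" "{u, v} \<in> E"
      using assms(2) A(1) unfolding connected_in_def by (metis Diff_iff psubsetI)
    have "tree_on E (insert v A) (insert {u, v} N)"
      by (rule tree_on_insert[OF A(3) finA uv(1,3,4)])
    then show ?case
      using A uv finA by (intro exI[of _ "insert v A"] exI[of _ "insert {u, v} N"]) simp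
  qed
  from this[of "card P"] obtain A N where A: "A \<subseteq> P" "card A = card P" "tree_on E A N"
    using assms by (auto simp: connected_in_def Suc_le_eq card_gt_0_iff)
  then have "A = P" using card_subset_eq[OF assms(1)] by simp
  then show thesis using that A(3) by simp
qed

lemma double_count:
  assumes "finite A" "finite B"
  shows "(\<Sum>a\<in>A. card {b \<in> B. R a b}) = (\<Sum>b\<in>B. card {a \<in> A. R a b})"
proof -
  have "(\<Sum>a\<in>A. card {b \<in> B. R a b}) = (\<Sum>a\<in>A. \<Sum>b\<in>B. of_bool (R a b))"
    using assms by (simp add: sum_of_bool_eq Int_def)
  also have "\<dots> = (\<Sum>b\<in>B. \<Sum>a\<in>A. of_bool (R a b))"
    by (rule sum.swap)
  also have "\<dots> = (\<Sum>b\<in>B. card {a \<in> A. R a b})"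
    using assms by (simp add: sum_of_bool_eq Int_def)
  finally show ?thesis .
qed

text \<open>The sets \<open>P i\<close> are the branch sets and \<open>Q\<close> the edges of the
  minor. Keep a spanning tree of every branch set and one realising edge \<open>f q\<close> per
  minor edge; the realising edges form the weighted set \<open>X\<close>. Trees have one edge less
  than vertices, so \<open>card V' = card NN + card W\<close>, and the bound for the kept graph
  turns into one for the minor. It remains to see that an edge set of minimum degree two in the kept
  graph induces one in the minor.\<close>

theorem planar_minor_weighted:
  assumes planar: "planar (V, E)" and W: "finite W" "W \<noteq> {}"
    and P: "\<And>i. i \<in> W \<Longrightarrow> P i \<subseteq> V" "\<And>i. i \<in> W \<Longrightarrow> connected_in E (P i)"
    and disj: "\<And>i j. i \<in> W \<Longrightarrow> j \<in> W \<Longrightarrow> i \<noteq> j \<Longrightarrow> P i \<inter> P j = {}"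
    and Q: "\<And>q. q \<in> Q \<Longrightarrow> \<exists>i\<in>W. \<exists>j\<in>W. q = {i, j} \<and> i \<noteq> j \<and> (\<exists>u\<in>P i. \<exists>v\<in>P j. {u, v} \<in> E)"
    and g: "\<And>Y. Y \<subseteq> Q \<Longrightarrow> Y \<noteq> {} \<Longrightarrow> mindeg2 Y \<Longrightarrow> g \<le> card Y"
  shows "card Q + 1 \<le> card W \<or> g * (card Q + 2) \<le> g * card W + 2 * card Q"
proof -
  note fin = planarD[OF planar]
  have finP: "finite (P i)" if "i \<in> W" for i
    using P(1)[OF that] fin(1) finite_subset by blast
  have finQ: "finite Q"
  proof -
    have "Q \<subseteq> Pow W" using Q by blast
    then show ?thesis using W(1) by (metis finite_Pow_iff finite_subset)
  qed
  have "\<exists>N. tree_on E (P i) N" if "i \<in> W" for i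
    using spanning_tree[OF finP[OF that] P(2)[OF that]] by metis
  then obtain N where tree: "\<And>i. i \<in> W \<Longrightarrow> tree_on E (P i) (N i)"
    by metis
  have N: "finite (N i)" "N i \<subseteq> E" "e \<in> N i \<Longrightarrow> e \<subseteq> P i \<and> card e = 2" "card (N i) + 1 = card (P i)"
    and forest: "finite A \<Longrightarrow> A \<noteq> {} \<Longrightarrow> card {e \<in> N i. e \<subseteq> A} + 1 \<le> card A" if "i \<in> W" for i e A
    using tree[OF that] by (auto simp: tree_on_def)
  define realises where "realises = (\<lambda>q e. e \<in> E \<and>
      (\<exists>i\<in>W. \<exists>j\<in>W. \<exists>u\<in>P i. \<exists>v\<in>P j. q = {i, j} \<and> i \<noteq> j \<and> e = {u, v}))"
  define f where "f = (\<lambda>q. SOME e. realises q e)"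
  have f: "f q \<in> E \<and> (\<exists>i\<in>W. \<exists>j\<in>W. \<exists>u\<in>P i. \<exists>v\<in>P j. q = {i, j} \<and> i \<noteq> j \<and> f q = {u, v})"
    if "q \<in> Q" for q
  proof -
    have "\<exists>e. realises q e"
      using Q[OF that] unfolding realises_def by blast
    then have "realises q (f q)"
      unfolding f_def by (rule someI_ex)
    then show ?thesis by (simp add: realises_def)
  qed
  have part: "i \<in> q \<longleftrightarrow> P i \<inter> f q \<noteq> {}"
    and card_part: "card (f q \<inter> P i) \<le> 1" if q: "q \<in> Q" and i: "i \<in> W" for q i
  proof -
    obtain a b u v where ab: "a \<in> W" "b \<in> W" "u \<in> P a" "v \<in> P b" "q = {a, b}" "a \<noteq> b" "f q = {u, v}"
      using f[OF q] by blast
    show "i \<in> q \<longleftrightarrow> P i \<inter> f q \<noteq> {}"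
      using ab disj[OF i ab(1)] disj[OF i ab(2)] by auto
    have "u \<notin> P i \<or> v \<notin> P i" using ab disj[OF i ab(1)] disj[OF i ab(2)] by auto
    then have "f q \<inter> P i \<subseteq> {u} \<or> f q \<inter> P i \<subseteq> {v}" using ab by auto
    then show "card (f q \<inter> P i) \<le> 1"
      using card_mono[of "{u}" "f q \<inter> P i"] card_mono[of "{v}" "f q \<inter> P i"] by auto
  qed
  have qW: "q \<subseteq> W" if "q \<in> Q" for q using Q[OF that] by auto
  have inj: "inj_on f Q"
  proof (rule inj_onI)
    fix q r assume "q \<in> Q" "r \<in> Q" "f q = f r"
    then have "i \<in> q \<longleftrightarrow> i \<in> r" if "i \<in> W" for i using part[OF _ that] by simp
    then show "q = r" using qW \<open>q \<in> Q\<close> \<open>r \<in> Q\<close> by blast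
  qed
  define X where "X = f ` Q"
  define NN where "NN = (\<Union>i\<in>W. N i)"
  define V' where "V' = (\<Union>i\<in>W. P i)"
  have X: "finite X" "card X = card Q" using finQ inj by (auto simp: X_def card_image)
  have Ndisj: "N i \<inter> N j = {}" if "i \<in> W" "j \<in> W" "i \<noteq> j" for i j
  proof (rule ccontr)
    assume "N i \<inter> N j \<noteq> {}"
    then obtain e where e: "e \<in> N i" "e \<in> N j" by blast
    then have "e \<subseteq> P i \<inter> P j" "card e = 2"
      using N(3)[OF that(1) e(1)] N(3)[OF that(2) e(2)] by simp_all
    then show False using disj[OF that] by simp
  qed
  have NX: "NN \<inter> X = {}"
  proof (rule ccontr)
    assume "NN \<inter> X \<noteq> {}"
    then obtain i q where iq: "i \<in> W" "q \<in> Q" "f q \<in> N i" by (auto simp: NN_def X_def)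
    then have "f q \<inter> P i = f q" "card (f q) = 2" using N(3)[OF iq(1,3)] by auto
    then show False using card_part[OF iq(2,1)] by simp
  qed
  have finNN: "finite NN" using W N(1) by (simp add: NN_def)
  have "card NN = (\<Sum>i\<in>W. card (N i))"
    unfolding NN_def by (rule card_UN_disjoint) (use W N(1) Ndisj in auto)
  moreover have "card V' = (\<Sum>i\<in>W. card (P i))"
    unfolding V'_def by (rule card_UN_disjoint) (use W finP disj in auto)
  moreover have "(\<Sum>i\<in>W. card (P i)) = (\<Sum>i\<in>W. card (N i)) + card W"
  proof -
    have "(\<Sum>i\<in>W. card (P i)) = (\<Sum>i\<in>W. Suc (card (N i)))"
      by (rule sum.cong[OF refl]) (use N(4) in simp)
    then show ?thesis by (simp add: sum_Suc)
  qed
  ultimately have cV: "card V' = card NN + card W" by linarith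
  have cE: "card (NN \<union> X) = card NN + card Q"
    using card_Un_disjoint[OF finNN X(1) NX] X(2) by simp
  have fE: "f q \<in> E" if "q \<in> Q" for q
    using f[OF that] by (rule conjunct1)
  have XE: "X \<subseteq> E" unfolding X_def by (rule image_subsetI) (rule fE)
  have NE: "NN \<subseteq> E" unfolding NN_def by (rule UN_least) (rule N(2))
  have pl: "planar (V', NN \<union> X)"
  proof (rule planar_subgraph[OF planar])
    show "V' \<subseteq> V" using P(1) by (auto simp: V'_def)
    show "NN \<union> X \<subseteq> E" using NE XE by blast
    have "f q \<subseteq> V'" if q: "q \<in> Q" for q
    proof -
      obtain i j u v where "i \<in> W" "j \<in> W" "u \<in> P i" "v \<in> P j" "f q = {u, v}"
        using f[OF q] by blast
      then show ?thesis unfolding V'_def by blast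
    qed
    moreover have "e \<subseteq> V'" if e: "e \<in> NN" for e
    proof -
      obtain i where "i \<in> W" "e \<in> N i" using e unfolding NN_def by blast
      then show ?thesis using N(3)[of i e] unfolding V'_def by blast
    qed
    ultimately show "\<Union>(NN \<union> X) \<subseteq> V'" unfolding X_def by blast
  qed
  have "card (NN \<union> X) + 1 \<le> card V' \<or> g * (card (NN \<union> X) + 2) \<le> g * card V' + 2 * card X"
  proof (rule planar_weighted_bound[OF pl])
    show "V' \<noteq> {}" using W(2) P(2) by (auto simp: V'_def connected_in_def)
    fix Y assume Y: "Y \<subseteq> NN \<union> X" "Y \<noteq> {}" "mindeg2 Y"
    have finY: "finite Y" using Y(1) finNN X(1) finite_subset by blast
    have e2: "card e = 2" if "e \<in> Y" for e
      by (rule fin(4)) (use Y(1) that NE XE in blast)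
    define YQ where "YQ = {q \<in> Q. f q \<in> Y}"
    have YQ: "f ` YQ = Y \<inter> X" by (auto simp: YQ_def X_def)
    have cYQ: "card (Y \<inter> X) = card YQ"
      unfolding YQ[symmetric] by (rule card_image, rule inj_on_subset[OF inj]) (auto simp: YQ_def)
    \<comment> \<open>The vertices \<open>A\<close> of the branch set that \<open>Y\<close> touches
      have degree sum at least \<open>2 * card A\<close>. Tree edges inside \<open>A\<close>
      contribute at most \<open>2 * (card A - 1)\<close>, so at least two incidences come from
      realising edges, each of which has at most one end in the branch set.\<close>
    have two: "2 \<le> card {q \<in> YQ. i \<in> q}" if i: "i \<in> W" and touched: "P i \<inter> \<Union>Y \<noteq> {}" for i
    proof -
      define A where "A = P i \<inter> \<Union>Y"
      have finA: "finite A" using finP[OF i] by (simp add: A_def)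
      have deg: "2 \<le> card {e \<in> Y. v \<in> e}" if v: "v \<in> A" for v
      proof -
        obtain e where e: "e \<in> Y" "v \<in> e" using v by (auto simp: A_def)
        then obtain e' where "e' \<in> Y" "e' \<noteq> e" "v \<in> e'" using Y(3) unfolding mindeg2_def by blast
        then have "{e, e'} \<subseteq> {e \<in> Y. v \<in> e}" "card {e, e'} = 2" using e by auto
        then show ?thesis using finY card_mono[of "{e \<in> Y. v \<in> e}" "{e, e'}"] by simp
      qed
      have "2 * card A \<le> (\<Sum>v\<in>A. card {e \<in> Y. v \<in> e})"
        using sum_mono[of A "\<lambda>_. 2", OF deg] by (simp add: mult.commute)
      also have "\<dots> = (\<Sum>e\<in>Y. card {v \<in> A. v \<in> e})"
        by (rule double_count[OF finA finY])
      also have "\<dots> \<le> (\<Sum>e\<in>Y. (if e \<in> {e \<in> N i. e \<subseteq> A} then 2 else 0) + (if e \<in> f ` {q \<in> YQ. i \<in> q} then 1 else 0))"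
      proof (rule sum_mono)
        fix e assume e: "e \<in> Y"
        have le2: "card {v \<in> A. v \<in> e} \<le> 2"
        proof -
          have "finite e" using e2[OF e] by (metis card.infinite zero_neq_numeral)
          then have "card {v \<in> A. v \<in> e} \<le> card e" by (intro card_mono) auto
          then show ?thesis using e2[OF e] by simp
        qed
        show "card {v \<in> A. v \<in> e} \<le> (if e \<in> {e \<in> N i. e \<subseteq> A} then 2 else 0) + (if e \<in> f ` {q \<in> YQ. i \<in> q} then 1 else 0)"
        proof (cases "{v \<in> A. v \<in> e} = {}")
          case False
          then have touch: "P i \<inter> e \<noteq> {}" by (auto simp: A_def)
          show ?thesis
          proof (cases "e \<in> X")
            case True
            then obtain q where q: "q \<in> Q" "e = f q" by (auto simp: X_def)
            then have "q \<in> {q \<in> YQ. i \<in> q}" using part[OF q(1) i] touch e by (auto simp: YQ_def)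
            moreover have "{v \<in> A. v \<in> e} \<subseteq> f q \<inter> P i" using q by (auto simp: A_def)
            then have "card {v \<in> A. v \<in> e} \<le> 1"
              using card_part[OF q(1) i] finP[OF i] by (meson card_mono finite_Int le_trans)
            ultimately show ?thesis using q by auto
          next
            case False
            then obtain j where j: "j \<in> W" "e \<in> N j" using e Y(1) by (auto simp: NN_def)
            then have "e \<subseteq> P j" using N(3)[OF j] by simp
            then have "j = i" using touch disj[OF i j(1)] by blast
            then have "e \<in> {e \<in> N i. e \<subseteq> A}" using j \<open>e \<subseteq> P j\<close> e by (auto simp: A_def)
            then show ?thesis using le2 by auto
          qed
        next
          case True
          then show ?thesis by (simp only: True card.empty)
        qed
      qed
      also have "\<dots> = 2 * card (Y \<inter> {e \<in> N i. e \<subseteq> A}) + card (Y \<inter> f ` {q \<in> YQ. i \<in> q})"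
        using finY by (simp add: sum.distrib sum.If_cases)
      also have "\<dots> \<le> 2 * card {e \<in> N i. e \<subseteq> A} + card {q \<in> YQ. i \<in> q}"
      proof (intro add_mono mult_left_mono)
        show "card (Y \<inter> {e \<in> N i. e \<subseteq> A}) \<le> card {e \<in> N i. e \<subseteq> A}"
          by (rule card_mono) (use N(1)[OF i] in auto)
        have "card (Y \<inter> f ` {q \<in> YQ. i \<in> q}) \<le> card (f ` {q \<in> YQ. i \<in> q})"
          by (rule card_mono) (use finQ in \<open>auto simp: YQ_def\<close>)
        also have "\<dots> \<le> card {q \<in> YQ. i \<in> q}"
          by (rule card_image_le) (use finQ in \<open>auto simp: YQ_def\<close>)
        finally show "card (Y \<inter> f ` {q \<in> YQ. i \<in> q}) \<le> card {q \<in> YQ. i \<in> q}" .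
      qed auto
      finally have "2 * card A \<le> 2 * card {e \<in> N i. e \<subseteq> A} + card {q \<in> YQ. i \<in> q}" .
      moreover have "card {e \<in> N i. e \<subseteq> A} + 1 \<le> card A"
        by (rule forest[OF i finA]) (use touched in \<open>auto simp: A_def\<close>)
      ultimately show ?thesis by linarith
    qed
    have "YQ \<noteq> {}"
    proof -
      obtain e where e: "e \<in> Y" using Y(2) by blast
      then have "e \<noteq> {}" using e2 by fastforce
      then obtain v where v: "v \<in> e" by blast
      have "e \<subseteq> V'" using planarD(3)[OF pl] e Y(1) by blast
      then obtain i where "i \<in> W" "v \<in> P i" using v by (auto simp: V'_def)
      then have "2 \<le> card {q \<in> YQ. i \<in> q}" using two[of i] e v by blast
      then have "{q \<in> YQ. i \<in> q} \<noteq> {}" by (intro notI) simp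
      then show ?thesis by blast
    qed
    moreover have "mindeg2 YQ"
      unfolding mindeg2_def
    proof (intro ballI)
      fix q i assume qi: "q \<in> YQ" "i \<in> q"
      then have q: "q \<in> Q" "f q \<in> Y" by (auto simp: YQ_def)
      have i: "i \<in> W" using qW[OF q(1)] qi(2) by blast
      then have "P i \<inter> \<Union>Y \<noteq> {}" using part[OF q(1) i] qi(2) q(2) by blast
      then have *: "2 \<le> card {q \<in> YQ. i \<in> q}" using two i by blast
      show "\<exists>q'\<in>YQ. q' \<noteq> q \<and> i \<in> q'"
      proof (rule ccontr)
        assume "\<not> ?thesis"
        then have "{q \<in> YQ. i \<in> q} \<subseteq> {q}" by auto
        then have "card {q \<in> YQ. i \<in> q} \<le> card {q}" by (intro card_mono) auto
        then show False using * by simp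
      qed
    qed
    moreover have "YQ \<subseteq> Q" by (auto simp: YQ_def)
    ultimately show "g \<le> card (Y \<inter> X)" using g cYQ by simp
  qed auto
  then show ?thesis
    unfolding cE cV X(2) by (auto simp: algebra_simps)
qed

lemma mindeg2_card_ge_3:
  assumes "mindeg2 Y" "Y \<noteq> {}" "finite Y" "\<And>e. e \<in> Y \<Longrightarrow> card e = 2"
  shows "3 \<le> card Y"
proof -
  obtain e where e: "e \<in> Y" using assms(2) by blast
  then obtain u v where uv: "e = {u, v}" "u \<noteq> v" using assms(4) by (meson card_2_iff)
  obtain e1 where e1: "e1 \<in> Y" "e1 \<noteq> e" "u \<in> e1" using assms(1) e uv unfolding mindeg2_def by blast
  obtain e2 where e2: "e2 \<in> Y" "e2 \<noteq> e" "v \<in> e2" using assms(1) e uv unfolding mindeg2_def by blast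
  have "e1 \<noteq> e2"
  proof
    assume "e1 = e2"
    then have "e \<subseteq> e1" "card e1 = card e" using e1 e2 uv assms(4) e by auto
    then show False using card_subset_eq e1(2) assms(4)[OF e1(1)] by (metis card.infinite zero_neq_numeral)
  qed
  then have "card {e, e1, e2} = 3" using e1 e2 by auto
  moreover have "{e, e1, e2} \<subseteq> Y" using e e1 e2 by auto
  ultimately show ?thesis using assms(3) by (metis card_mono)
qed

text \<open>The girth of a bipartite graph: follow \<open>e\<close> to a second edge at each end.
  These two edges reach new vertices on opposite sides, so the second edge at \<open>b'\<close> is a
  fourth one.\<close>

lemma mindeg2_bipartite_card_ge_4:
  assumes "mindeg2 Y" "Y \<noteq> {}" "finite Y" "A \<inter> B = {}" "\<And>e. e \<in> Y \<Longrightarrow> \<exists>a\<in>A. \<exists>b\<in>B. e = {a, b}"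
  shows "4 \<le> card Y"
proof -
  obtain e where e: "e \<in> Y" using assms(2) by blast
  obtain a b where ab: "e = {a, b}" "a \<in> A" "b \<in> B" using assms(5)[OF e] by blast
  obtain e1 where e1: "e1 \<in> Y" "e1 \<noteq> e" "a \<in> e1" using assms(1) e ab unfolding mindeg2_def by blast
  obtain e2 where e2: "e2 \<in> Y" "e2 \<noteq> e" "b \<in> e2" using assms(1) e ab unfolding mindeg2_def by blast
  obtain b' where b': "e1 = {a, b'}" "b' \<in> B" using assms(5)[OF e1(1)] e1(3) ab assms(4) by blast
  obtain a' where a': "e2 = {a', b}" "a' \<in> A" using assms(5)[OF e2(1)] e2(3) ab assms(4) by blast
  have ne: "b' \<noteq> b" "a' \<noteq> a" using e1 e2 a' b' ab by auto
  obtain e3 where e3: "e3 \<in> Y" "e3 \<noteq> e1" "b' \<in> e3" using assms(1) e1 b' unfolding mindeg2_def by blast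
  have "b' \<notin> e" "b' \<notin> e2" using ne ab a' b' assms(4) by auto
  then have "e3 \<noteq> e" "e3 \<noteq> e2" "e1 \<noteq> e2" using e3(3) b' by auto
  then have "card {e, e1, e2, e3} = 4" using e1(2) e2(2) e3(2) by simp
  moreover have "{e, e1, e2, e3} \<subseteq> Y" using e e1 e2 e3 by auto
  ultimately show ?thesis using assms(3) by (metis card_mono)
qed

text \<open>The case \<open>g = 3\<close>, where the inequality solves to
  \<open>q \<le> 3 w - 6\<close>. In the forest case \<open>q \<le> w - 1\<close>, which is at most
  \<open>3 w - 6\<close> once \<open>w \<ge> 3\<close>.\<close>

lemma planar_minor_edge_bound:
  assumes "planar (V, E)" "finite W" "3 \<le> card W"
    and "\<And>i. i \<in> W \<Longrightarrow> P i \<subseteq> V" "\<And>i. i \<in> W \<Longrightarrow> connected_in E (P i)"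
    and "\<And>i j. i \<in> W \<Longrightarrow> j \<in> W \<Longrightarrow> i \<noteq> j \<Longrightarrow> P i \<inter> P j = {}"
    and Q: "\<And>q. q \<in> Q \<Longrightarrow> \<exists>i\<in>W. \<exists>j\<in>W. q = {i, j} \<and> i \<noteq> j \<and> (\<exists>u\<in>P i. \<exists>v\<in>P j. {u, v} \<in> E)"
  shows "card Q + 6 \<le> 3 * card W"
proof -
  have "Q \<subseteq> Pow W" using Q by blast
  then have finQ: "finite Q" using assms(2) by (metis finite_Pow_iff finite_subset)
  have Q2: "card q = 2" if "q \<in> Q" for q using Q[OF that] by auto
  have "card Q + 1 \<le> card W \<or> 3 * (card Q + 2) \<le> 3 * card W + 2 * card Q"
  proof (rule planar_minor_weighted[OF assms(1,2) _ assms(4,5,6) Q])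
    show "3 \<le> card Y" if "Y \<subseteq> Q" "Y \<noteq> {}" "mindeg2 Y" for Y
      by (rule mindeg2_card_ge_3[OF that(3,2) finite_subset[OF that(1) finQ]]) (use that(1) Q2 in blast)
  qed (use assms(3) in auto)
  then show ?thesis using assms(3) by presburger
qed

text \<open>The case \<open>g = 4\<close>, giving \<open>q \<le> 2 w - 4\<close>; again three
  vertices make the forest case no worse.\<close>

lemma planar_minor_bipartite_bound:
  assumes "planar (V, E)" "finite A" "finite B" "A \<inter> B = {}" "3 \<le> card A + card B"
    and "\<And>i. i \<in> A \<union> B \<Longrightarrow> P i \<subseteq> V" "\<And>i. i \<in> A \<union> B \<Longrightarrow> connected_in E (P i)"
    and "\<And>i j. i \<in> A \<union> B \<Longrightarrow> j \<in> A \<union> B \<Longrightarrow> i \<noteq> j \<Longrightarrow> P i \<inter> P j = {}"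
    and Q: "\<And>q. q \<in> Q \<Longrightarrow> \<exists>i\<in>A. \<exists>j\<in>B. q = {i, j} \<and> (\<exists>u\<in>P i. \<exists>v\<in>P j. {u, v} \<in> E)"
  shows "card Q + 4 \<le> 2 * (card A + card B)"
proof -
  have "Q \<subseteq> Pow (A \<union> B)" using Q by blast
  then have finQ: "finite Q" using assms(2,3) by (metis finite_Pow_iff finite_UnI finite_subset)
  have cW: "card (A \<union> B) = card A + card B" using assms(2-4) by (simp add: card_Un_disjoint)
  have "card Q + 1 \<le> card (A \<union> B) \<or> 4 * (card Q + 2) \<le> 4 * card (A \<union> B) + 2 * card Q"
  proof (rule planar_minor_weighted[OF assms(1)])
    show "\<exists>i\<in>A \<union> B. \<exists>j\<in>A \<union> B. q = {i, j} \<and> i \<noteq> j \<and> (\<exists>u\<in>P i. \<exists>v\<in>P j. {u, v} \<in> E)" if "q \<in> Q" for q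
      using Q[OF that] assms(4) by blast
    show "4 \<le> card Y" if "Y \<subseteq> Q" "Y \<noteq> {}" "mindeg2 Y" for Y
      by (rule mindeg2_bipartite_card_ge_4[OF that(3,2) finite_subset[OF that(1) finQ] assms(4)])
         (use that(1) Q in blast)
  qed (use assms in auto)
  then show ?thesis using assms(5) cW by presburger
qed

section \<open>Minimum degree of maximal planar graphs\<close>

text \<open>\<open>t\<close> is the first time in \<open>B2\<close> and \<open>s\<close> the last
  time before it in \<open>B1\<close>. Strictly between them the path avoids both sets, so
  \<open>h s\<close> and \<open>h t\<close> are limits of points outside.\<close>

lemma path_crossing:
  fixes h :: "real \<Rightarrow> complex"
  assumes "path h" "closed B1" "closed B2" "B1 \<inter> B2 = {}" "pathstart h \<in> B1" "pathfinish h \<in> B2"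
  obtains s t where "0 \<le> s" "s < t" "t \<le> 1" "h s \<in> frontier B1 \<or> s = 0" "h s \<in> B1" "h t \<in> frontier B2"
    "\<And>u. s < u \<Longrightarrow> u < t \<Longrightarrow> h u \<notin> B1 \<union> B2" "h s \<in> closure (- B1)"
proof -
  have ch: "continuous_on {0..1} h" using assms(1) by (simp add: path_def)
  define T where "T = {0..1} \<inter> h -` B2"
  have clT: "compact T" unfolding T_def compact_eq_bounded_closed
    using continuous_closed_preimage[OF ch _ assms(3)] by (auto intro: bounded_Int)
  have neT: "1 \<in> T" using assms(6) by (simp add: T_def pathfinish_def)
  define t where "t = Inf T"
  have t: "t \<in> T" unfolding t_def
    using neT compact_imp_closed[OF clT] compact_imp_bounded[OF clT]
    by (intro closed_contains_Inf bounded_imp_bdd_below) auto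
  have t_le: "t \<le> u" if "u \<in> T" for u
    unfolding t_def using that compact_imp_bounded[OF clT] by (intro cInf_lower bounded_imp_bdd_below)
  have t01: "0 \<le> t" "t \<le> 1" "h t \<in> B2" using t by (auto simp: T_def)
  have "t \<noteq> 0" using t01(3) assms(4,5) by (auto simp: pathstart_def)
  then have t0: "0 < t" using t01(1) by simp
  define S where "S = {0..t} \<inter> h -` B1"
  have cht: "continuous_on {0..t} h" by (rule continuous_on_subset[OF ch]) (use t01 in auto)
  have clS: "compact S" unfolding S_def compact_eq_bounded_closed
    using continuous_closed_preimage[OF cht _ assms(2)] by (auto intro: bounded_Int)
  have neS: "0 \<in> S" using assms(5) t0 by (simp add: S_def pathstart_def)
  define s where "s = Sup S"
  have s: "s \<in> S" unfolding s_def
    using neS compact_imp_closed[OF clS] compact_imp_bounded[OF clS]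
    by (intro closed_contains_Sup bounded_imp_bdd_above) auto
  have s_ge: "u \<le> s" if "u \<in> S" for u
    unfolding s_def using that compact_imp_bounded[OF clS] by (intro cSup_upper bounded_imp_bdd_above)
  have s01: "0 \<le> s" "s \<le> t" "h s \<in> B1" using s by (auto simp: S_def)
  have "s \<noteq> t" using s01(3) t01(3) assms(4) by auto
  then have st: "s < t" using s01(2) by simp
  have nB1: "h u \<notin> B1" if "s < u" "u \<le> t" for u
  proof
    assume "h u \<in> B1"
    then have "u \<in> S" using that s01 by (simp add: S_def)
    then show False using s_ge that by fastforce
  qed
  have nB2: "h u \<notin> B2" if "0 \<le> u" "u < t" for u
  proof
    assume "h u \<in> B2"
    then have "u \<in> T" using that t01 by (simp add: T_def)
    then show False using t_le that by fastforce
  qed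
  have "h ` closure {0..<t} \<subseteq> closure (- B2)"
  proof (rule image_closure_subset)
    show "continuous_on (closure {0..<t}) h" using cht t0 by (simp add: closure_atLeastLessThan)
    show "h ` {0..<t} \<subseteq> closure (- B2)" using nB2 closure_subset[of "- B2"] by fastforce
  qed simp
  moreover have "t \<in> closure {0..<t}" using t0 by (simp add: closure_atLeastLessThan)
  ultimately have ft: "h t \<in> closure (- B2)" by blast
  have "h ` closure {s<..t} \<subseteq> closure (- B1)"
  proof (rule image_closure_subset)
    show "continuous_on (closure {s<..t}) h"
      by (rule continuous_on_subset[OF cht]) (use st s01 in \<open>simp add: closure_greaterThanAtMost\<close>)
    show "h ` {s<..t} \<subseteq> closure (- B1)" using nB1 closure_subset[of "- B1"] by fastforce
  qed simp
  moreover have "s \<in> closure {s<..t}" using st by (simp add: closure_greaterThanAtMost)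
  ultimately have fs: "h s \<in> closure (- B1)" by blast
  show thesis
  proof (rule that[of s t])
    show "h t \<in> frontier B2"
      using ft t01(3) assms(3) by (simp add: frontier_closures)
    show "h s \<in> frontier B1 \<or> s = 0"
      using fs s01(3) assms(2) by (simp add: frontier_closures)
    show "h u \<notin> B1 \<union> B2" if "s < u" "u < t" for u
      using nB1[of u] nB2[of u] that s01 by simp
  qed (use s01 st t01 fs in auto)
qed

text \<open>The part of the arc before its last point \<open>z\<close> in the closed disc is
  replaced by a radius. The rest of the arc, \<open>S\<close>, meets the disc only in
  \<open>z\<close>, so the concatenation is injective.\<close>

lemma exit_arc:
  fixes \<theta> :: "real \<Rightarrow> complex"
  assumes "arc \<theta>" "pathstart \<theta> = a" "pathfinish \<theta> = b" "0 < r" "r < dist a b"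
  obtains z S \<eta> where "z \<in> path_image \<theta>" "dist a z = r" "S \<subseteq> path_image \<theta>" "S \<inter> cball a r = {z}"
    "arc \<eta>" "pathstart \<eta> = a" "pathfinish \<eta> = b" "path_image \<eta> = closed_segment a z \<union> S"
proof -
  have c\<theta>: "continuous_on {0..1} \<theta>" and inj: "inj_on \<theta> {0..1}"
    using assms(1) by (auto simp: arc_def path_def)
  have \<theta>01: "\<theta> 0 = a" "\<theta> 1 = b" using assms by (auto simp: pathstart_def pathfinish_def)
  define T where "T = {0..1} \<inter> \<theta> -` cball a r"
  have clT: "compact T" unfolding T_def compact_eq_bounded_closed
    using continuous_closed_preimage[OF c\<theta>] by (auto intro: bounded_Int)
  define t where "t = Sup T"
  have neT: "0 \<in> T" using assms(4) \<theta>01 by (simp add: T_def)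
  have t: "t \<in> T" unfolding t_def
    using neT compact_imp_closed[OF clT] compact_imp_bounded[OF clT]
    by (intro closed_contains_Sup bounded_imp_bdd_above) auto
  have t_ge: "u \<le> t" if "u \<in> T" for u
    unfolding t_def using that compact_imp_bounded[OF clT] by (intro cSup_upper bounded_imp_bdd_above)
  have t01: "0 \<le> t" "t \<le> 1" "dist a (\<theta> t) \<le> r" using t by (auto simp: T_def)
  have "t \<noteq> 1" using t01(3) \<theta>01 assms(5) by auto
  then have t1: "t < 1" using t01 by simp
  \<comment> \<open>The distance \<open>r\<close> is attained at some time after \<open>t\<close>;
    as \<open>t\<close> is the last time in the disc, it is attained at \<open>t\<close> itself, so
    the exit point lies on the circle.\<close>
  have "\<exists>u\<ge>t. u \<le> 1 \<and> dist a (\<theta> u) = r"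
  proof (rule IVT')
    show "continuous_on {t..1} (\<lambda>u. dist a (\<theta> u))"
      by (intro continuous_intros continuous_on_subset[OF c\<theta>]) (use t01 in auto)
  qed (use t01 t1 \<theta>01 assms in auto)
  then obtain u where u: "u \<ge> t" "u \<le> 1" "dist a (\<theta> u) = r" by blast
  then have "u \<in> T" using t01 by (simp add: T_def)
  then have "u = t" using t_ge u(1) by fastforce
  then have dt: "dist a (\<theta> t) = r" using u by simp
  have "t \<noteq> 0" using dt \<theta>01 assms(4) by auto
  then have t0: "0 < t" using t01 by simp
  define S where "S = \<theta> ` {t..1}"
  have Sb: "S \<inter> cball a r = {\<theta> t}"
  proof -
    have "v = t" if "t \<le> v" "v \<le> 1" "dist a (\<theta> v) \<le> r" for v
    proof -
      have "v \<in> T" using that t0 by (simp add: T_def)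
      then show ?thesis using t_ge that(1) by fastforce
    qed
    then have "S \<inter> cball a r \<subseteq> {\<theta> t}" by (auto simp: S_def) metis
    then show ?thesis using t01 by (auto simp: S_def)
  qed
  have Sub: "path_image (subpath t 1 \<theta>) = S"
    using t01 by (simp add: path_image_subpath S_def)
  have ends: "pathstart (subpath t 1 \<theta>) = \<theta> t" "pathfinish (subpath t 1 \<theta>) = b"
    using \<theta>01 by simp_all
  define \<eta> where "\<eta> = linepath a (\<theta> t) +++ subpath t 1 \<theta>"
  have segb: "closed_segment a (\<theta> t) \<subseteq> cball a r"
    by (rule closed_segment_subset) (use dt assms(4) in auto)
  show thesis
  proof (rule that[of "\<theta> t" S \<eta>])
    show "arc \<eta>" unfolding \<eta>_def
    proof (rule arc_join)
      show "arc (linepath a (\<theta> t))" by (rule arc_linepath) (use dt assms(4) in auto)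
      show "arc (subpath t 1 \<theta>)" by (rule arc_subpath_arc) (use assms(1) t01 t1 in auto)
      show "path_image (linepath a (\<theta> t)) \<inter> path_image (subpath t 1 \<theta>) \<subseteq> {pathstart (subpath t 1 \<theta>)}"
        unfolding Sub ends using segb Sb by auto
    qed simp
    show "path_image \<eta> = closed_segment a (\<theta> t) \<union> S"
      unfolding \<eta>_def by (subst path_image_join) (simp_all add: Sub)
  qed (use t01 dt Sb ends in \<open>auto simp: S_def \<eta>_def path_image_def\<close>)
qed

section \<open>Straightening the edges near a vertex\<close>

context plane_graph
begin

text \<open>A redrawing that differs from the old one only in the edges at \<open>x\<close>, and
  outside the disc uses nothing new. The third clause is the gain: from a point of the circle that
  is not on the old drawing, the radius reaches \<open>p x\<close> without meeting the new drawing.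
  The last clause keeps the disc clear of everything not incident with \<open>x\<close>.\<close>

definition straightened :: "'a \<Rightarrow> real \<Rightarrow> ('a set \<Rightarrow> real \<Rightarrow> complex) \<Rightarrow> bool" where
  "straightened x r \<gamma>' \<longleftrightarrow> plane_graph V E p \<gamma>' \<and>
     plane_graph.drawing p \<gamma>' V E \<subseteq> drawing V E \<union> cball (p x) r \<and>
     (\<forall>z. dist (p x) z = r \<longrightarrow> z \<notin> drawing V E \<longrightarrow>
        closed_segment (p x) z \<inter> plane_graph.drawing p \<gamma>' V E \<subseteq> {p x}) \<and>
     (\<forall>e. x \<notin> e \<longrightarrow> \<gamma>' e = \<gamma> e) \<and>
     cball (p x) r \<inter> drawing (V - {x}) {e \<in> E. x \<notin> e} = {}"

text \<open>The disc is chosen inside the complement of all vertices and arcs not incident with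
  \<open>x\<close>, and every edge at \<open>x\<close> is replaced by a radius up to its last exit
  point \<open>z e\<close> from the disc. Different edges have different exit points, and radii to
  different points meet only in the centre.\<close>

lemma straighten_at:
  assumes x: "x \<in> V" and "0 < \<epsilon>"
  obtains r \<gamma>' where "0 < r" "r < \<epsilon>" "straightened x r \<gamma>'"
proof -
  define C where "C = drawing (V - {x}) {e \<in> E. x \<notin> e}"
  have clC: "closed C" unfolding C_def by (rule closed_drawing) auto
  have "p x \<notin> C"
  proof
    assume "p x \<in> C"
    then consider v where "v \<in> V" "v \<noteq> x" "p x = p v" | e where "e \<in> E" "x \<notin> e" "p x \<in> path_image (\<gamma> e)"
      unfolding C_def drawing_def by auto
    then show False
    proof cases
      case 1
      then show False using inj_onD[OF inj_p] x by blast
    next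
      case 2
      then have "p x \<in> p ` e" using vert_\<gamma> x by blast
      then show False using inj_onD[OF inj_p] x edge_sub 2 by blast
    qed
  qed
  then obtain r0 where r0: "r0 > 0" "ball (p x) r0 \<subseteq> - C"
    using clC by (metis ComplI open_Compl open_contains_ball)
  define r where "r = min r0 \<epsilon> / 2"
  have r: "0 < r" "r < \<epsilon>" "r < r0" using r0 assms by (auto simp: r_def)
  have "cball (p x) r \<subseteq> ball (p x) r0" using r(3) by (auto simp: subset_iff)
  then have cb: "cball (p x) r \<inter> C = {}" using r0(2) by blast
  define good where "good = (\<lambda>e z S \<eta>. z \<in> path_image (\<gamma> e) \<and> dist (p x) z = r \<and> S \<subseteq> path_image (\<gamma> e) \<and>
     S \<inter> cball (p x) r = {z} \<and> arc \<eta> \<and> {pathstart \<eta>, pathfinish \<eta>} = p ` e \<and>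
     path_image \<eta> = closed_segment (p x) z \<union> S)"
  have "\<exists>z S \<eta>. good e z S \<eta>" if e: "e \<in> E" "x \<in> e" for e
  proof -
    obtain a b where ab: "e = {a, b}" "a \<noteq> b" "a \<in> V" "b \<in> V"
      "pathstart (\<gamma> e) = p a" "pathfinish (\<gamma> e) = p b" "p a \<noteq> p b"
      using edgeE[OF e(1)] by metis
    obtain y \<theta> where y: "e = {x, y}" "y \<in> V" "y \<noteq> x" "arc \<theta>" "pathstart \<theta> = p x" "pathfinish \<theta> = p y"
        "path_image \<theta> = path_image (\<gamma> e)"
    proof (cases "a = x")
      case True
      then show thesis using that[of b "\<gamma> e"] ab arc_\<gamma>[OF e(1)] by simp
    next
      case False
      then have "b = x" using e(2) ab(1) by simp
      then show thesis using that[of a "reversepath (\<gamma> e)"] ab arc_\<gamma>[OF e(1)]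
        by (simp add: arc_reversepath insert_commute)
    qed
    have "p y \<in> C" using y by (auto simp: C_def drawing_def)
    then have "r < dist (p x) (p y)" using cb by (metis IntI emptyE linorder_not_less mem_cball)
    from exit_arc[OF y(4-6) r(1) this] obtain z S \<eta> where
      *: "z \<in> path_image \<theta>" "dist (p x) z = r" "S \<subseteq> path_image \<theta>" "S \<inter> cball (p x) r = {z}"
      "arc \<eta>" "pathstart \<eta> = p x" "pathfinish \<eta> = p y" "path_image \<eta> = closed_segment (p x) z \<union> S"
      by metis
    have "good e z S \<eta>" unfolding good_def using * y(7) by (simp add: y(1))
    then show ?thesis by blast
  qed
  then obtain z S \<eta> where good: "\<And>e. e \<in> E \<Longrightarrow> x \<in> e \<Longrightarrow> good e (z e) (S e) (\<eta> e)"
    by metis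
  have G: "z e \<in> path_image (\<gamma> e)" "dist (p x) (z e) = r" "S e \<subseteq> path_image (\<gamma> e)"
     "S e \<inter> cball (p x) r = {z e}" "arc (\<eta> e)" "{pathstart (\<eta> e), pathfinish (\<eta> e)} = p ` e"
     "path_image (\<eta> e) = closed_segment (p x) (z e) \<union> S e" if "e \<in> E" "x \<in> e" for e
    using good[OF that] by (simp_all add: good_def)
  have seg: "closed_segment (p x) w \<subseteq> cball (p x) r" if "dist (p x) w = r" for w
    by (rule closed_segment_subset) (use that r(1) in auto)
  have seg_eq: "u = w" if u: "u \<in> closed_segment (p x) w" "dist (p x) u = r" and w: "dist (p x) w = r" for u w
  proof -
    obtain c where c: "0 \<le> c" "c \<le> 1" "u = (1 - c) *\<^sub>R p x + c *\<^sub>R w"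
      using u(1) by (auto simp: in_segment)
    then have "u - p x = c *\<^sub>R (w - p x)" by (simp add: algebra_simps)
    then have "dist (p x) u = c * dist (p x) w"
      using c(1) by (simp add: dist_norm norm_minus_commute)
    then have "c = 1" using u(2) w r(1) by simp
    then show ?thesis using c(3) by simp
  qed
  have seg_meet: "closed_segment (p x) u \<inter> closed_segment (p x) w \<subseteq> {p x}"
    if u: "dist (p x) u = r" and w: "dist (p x) w = r" and ne: "u \<noteq> w" for u w
  proof
    fix v assume v: "v \<in> closed_segment (p x) u \<inter> closed_segment (p x) w"
    obtain c where c: "0 \<le> c" "v = (1 - c) *\<^sub>R p x + c *\<^sub>R u" using v by (auto simp: in_segment)
    obtain d where d: "0 \<le> d" "v = (1 - d) *\<^sub>R p x + d *\<^sub>R w" using v by (auto simp: in_segment)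
    have vc: "v - p x = c *\<^sub>R (u - p x)"
      using c(2) by (simp add: algebra_simps)
    have vd: "v - p x = d *\<^sub>R (w - p x)"
      using d(2) by (simp add: algebra_simps)
    have "norm (v - p x) = c * r"
      unfolding vc using c(1) u by (simp add: dist_norm norm_minus_commute)
    moreover have "norm (v - p x) = d * r"
      unfolding vd using d(1) w by (simp add: dist_norm norm_minus_commute)
    ultimately have "c = d" using r(1) by simp
    then have "c = 0" using vc vd ne by auto
    then show "v \<in> {p x}" using c(2) by simp
  qed
  define \<gamma>' where "\<gamma>' = (\<lambda>e. if e \<in> E \<and> x \<in> e then \<eta> e else \<gamma> e)"
  have off: "path_image (\<gamma> e) \<inter> cball (p x) r = {}" if "e \<in> E" "x \<notin> e" for e
    using cb that unfolding C_def drawing_def by blast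
  have offv: "p v \<notin> cball (p x) r" if "v \<in> V" "v \<noteq> x" for v
    using cb that unfolding C_def drawing_def by blast
  have im: "path_image (\<gamma>' e) \<subseteq> path_image (\<gamma> e) \<union> cball (p x) r" if "e \<in> E" for e
    using G(3,7)[OF that] seg[OF G(2)[OF that]] by (cases "x \<in> e") (auto simp: \<gamma>'_def that)
  have disj: "path_image (\<gamma>' e) \<inter> path_image (\<gamma>' e') \<subseteq> p ` (e \<inter> e')"
    if e: "e \<in> E" "e' \<in> E" "e \<noteq> e'" and xe: "x \<in> e" for e e'
  proof (cases "x \<in> e'")
    case False
    then have "\<gamma>' e' = \<gamma> e'" by (simp add: \<gamma>'_def)
    then show ?thesis using im[OF e(1)] off[OF e(2) False] disj_\<gamma>[OF e] by auto
  next
    case True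
    \<comment> \<open>A common exit point would be the point of a common end vertex inside the disc;
      only \<open>p x\<close> is available, but the exit point has distance \<open>r\<close> from
      it.\<close>
    have "z e \<noteq> z e'"
    proof
      assume eq: "z e = z e'"
      then have "z e \<in> p ` (e \<inter> e')"
        using G(1)[OF e(1) xe] G(1)[OF e(2) True] disj_\<gamma>[OF e] by auto
      moreover have "z e \<in> cball (p x) r" using G(2)[OF e(1) xe] by simp
      moreover have "e \<inter> e' \<subseteq> V" using edge_sub[OF e(1)] by auto
      ultimately have "z e = p x" using offv by (metis imageE subsetD)
      then show False using G(2)[OF e(1) xe] r(1) by simp
    qed
    then have 1: "closed_segment (p x) (z e) \<inter> closed_segment (p x) (z e') \<subseteq> {p x}"
      using seg_meet G(2)[OF e(1) xe] G(2)[OF e(2) True] by blast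
    have 2: "closed_segment (p x) (z e) \<inter> S e' = {}"
    proof (rule ccontr)
      assume "\<not> ?thesis"
      then obtain v where v: "v \<in> closed_segment (p x) (z e)" "v \<in> S e'" by blast
      then have "v = z e'" using seg[OF G(2)[OF e(1) xe]] G(4)[OF e(2) True] by blast
      then have "z e' = z e" using seg_eq[OF v(1)] G(2)[OF e(1) xe] G(2)[OF e(2) True] by simp
      then show False using \<open>z e \<noteq> z e'\<close> by simp
    qed
    have 3: "closed_segment (p x) (z e') \<inter> S e = {}"
    proof (rule ccontr)
      assume "\<not> ?thesis"
      then obtain v where v: "v \<in> closed_segment (p x) (z e')" "v \<in> S e" by blast
      then have "v = z e" using seg[OF G(2)[OF e(2) True]] G(4)[OF e(1) xe] by blast
      then have "z e = z e'" using seg_eq[OF v(1)] G(2)[OF e(1) xe] G(2)[OF e(2) True] by simp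
      then show False using \<open>z e \<noteq> z e'\<close> by simp
    qed
    have 4: "S e \<inter> S e' \<subseteq> p ` (e \<inter> e')"
      using G(3)[OF e(1) xe] G(3)[OF e(2) True] disj_\<gamma>[OF e] by blast
    have "p x \<in> p ` (e \<inter> e')" using xe True by blast
    then show ?thesis
      using 1 2 3 4 G(7)[OF e(1) xe] G(7)[OF e(2) True] e xe True
      by (auto simp: \<gamma>'_def)
  qed
  have pg: "plane_graph V E p \<gamma>'"
  proof
    show "simple_graph (V, E)" by (rule simple)
    have "arc (\<gamma>' e) \<and> {pathstart (\<gamma>' e), pathfinish (\<gamma>' e)} = p ` e" if "e \<in> E" for e
      using that G(5,6)[OF that] arc_\<gamma>[OF that] ends_\<gamma>[OF that] by (cases "x \<in> e") (simp_all add: \<gamma>'_def)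
    moreover have "path_image (\<gamma>' e) \<inter> p ` V \<subseteq> p ` e" if "e \<in> E" for e
    proof (cases "x \<in> e")
      case True
      then show ?thesis using im[OF that] vert_\<gamma>[OF that] offv by blast
    next
      case False
      then show ?thesis using vert_\<gamma>[OF that] by (simp add: \<gamma>'_def)
    qed
    moreover have "path_image (\<gamma>' e) \<inter> path_image (\<gamma>' e') \<subseteq> p ` (e \<inter> e')"
      if e: "e \<in> E" "e' \<in> E" "e \<noteq> e'" for e e'
    proof -
      consider "x \<in> e" | "x \<in> e'" | "x \<notin> e" "x \<notin> e'" by blast
      then show ?thesis
      proof cases
        case 2
        then show ?thesis using disj[OF e(2,1) e(3)[symmetric]] by (simp add: Int_commute)
      qed (use disj[OF e] disj_\<gamma>[OF e] in \<open>simp_all add: \<gamma>'_def\<close>)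
    qed
    ultimately show "plane_embedding (V, E) p \<gamma>'"
      unfolding plane_embedding_def fst_conv snd_conv using inj_p by blast
  qed
  interpret R: plane_graph V E p \<gamma>' by (rule pg)
  have "straightened x r \<gamma>'"
    unfolding straightened_def
  proof (intro conjI allI impI)
    show "R.drawing V E \<subseteq> drawing V E \<union> cball (p x) r"
      using im unfolding R.drawing_def drawing_def by blast
    show "closed_segment (p x) w \<inter> R.drawing V E \<subseteq> {p x}" if w: "dist (p x) w = r" "w \<notin> drawing V E" for w
    proof
      fix v assume v: "v \<in> closed_segment (p x) w \<inter> R.drawing V E"
      have vb: "v \<in> cball (p x) r" using v seg[OF w(1)] by blast
      consider u where "u \<in> V" "v = p u" | e where "e \<in> E" "v \<in> path_image (\<gamma>' e)"
        using v by (auto simp: R.drawing_def)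
      then show "v \<in> {p x}"
      proof cases
        case 1
        then show ?thesis using offv vb by blast
      next
        case 2
        have xe: "x \<in> e" using off[OF 2(1)] 2 vb by (auto simp: \<gamma>'_def split: if_splits)
        have "z e \<in> drawing V E" using G(1)[OF 2(1) xe] 2(1) by (auto simp: drawing_def)
        then have ne: "w \<noteq> z e" using w(2) by auto
        have "v \<in> closed_segment (p x) (z e) \<union> S e" using 2 G(7)[OF 2(1) xe] xe by (simp add: \<gamma>'_def)
        moreover have "v \<notin> S e"
        proof
          assume "v \<in> S e"
          then have "v = z e" using vb G(4)[OF 2(1) xe] by blast
          then show False using seg_eq[of v w] v w(1) G(2)[OF 2(1) xe] ne by simp
        qed
        ultimately show ?thesis using seg_meet[OF w(1) G(2)[OF 2(1) xe] ne] v by blast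
      qed
    qed
    show "cball (p x) r \<inter> drawing (V - {x}) {e \<in> E. x \<notin> e} = {}" using cb by (simp add: C_def)
  qed (use pg in \<open>auto simp: \<gamma>'_def\<close>)
  with r(1,2) show thesis by (rule that)
qed

lemma straightenedD:
  assumes "straightened x r \<gamma>'"
  shows "plane_graph V E p \<gamma>'"
    and "plane_graph.drawing p \<gamma>' V E \<subseteq> drawing V E \<union> cball (p x) r"
    and "\<And>z. dist (p x) z = r \<Longrightarrow> z \<notin> drawing V E \<Longrightarrow>
        closed_segment (p x) z \<inter> plane_graph.drawing p \<gamma>' V E \<subseteq> {p x}"
    and "\<And>e. x \<notin> e \<Longrightarrow> \<gamma>' e = \<gamma> e"
    and "cball (p x) r \<inter> drawing (V - {x}) {e \<in> E. x \<notin> e} = {}"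
  using assms by (simp_all add: straightened_def)

end

lemma plane_graphI:
  assumes "simple_graph (V, E)" "inj_on p V" "\<And>e. e \<in> E \<Longrightarrow> arc (\<gamma> e)"
    "\<And>e. e \<in> E \<Longrightarrow> {pathstart (\<gamma> e), pathfinish (\<gamma> e)} = p ` e"
    "\<And>e. e \<in> E \<Longrightarrow> path_image (\<gamma> e) \<inter> p ` V \<subseteq> p ` e"
    "\<And>e e'. e \<in> E \<Longrightarrow> e' \<in> E \<Longrightarrow> e \<noteq> e' \<Longrightarrow> path_image (\<gamma> e) \<inter> path_image (\<gamma> e') \<subseteq> p ` (e \<inter> e')"
  shows "plane_graph V E p \<gamma>"
  unfolding plane_graph_def plane_embedding_def fst_conv snd_conv
  using assms by (intro conjI ballI impI) simp_all

section \<open>Drawing a new edge inside a face\<close>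

context plane_graph
begin

lemma cball_meets_closure:
  assumes "z \<in> closure F" "0 < r"
  obtains y :: complex where "y \<in> F" "y \<in> cball z r"
proof -
  obtain y where "y \<in> F" "dist y z < r"
    using assms by (meson closure_approachable)
  then show thesis
    by (intro that[of y]) (auto simp: dist_commute)
qed

text \<open>
  After straightening the edges near both vertices, an arc inside the face that runs from one small
  disc to the other extends along radii to the two vertices.
\<close>

lemma add_edge_in_face:
  assumes x: "x \<in> V" and w: "w \<in> V" and "x \<noteq> w" "{w, x} \<notin> E"
    and F: "open F" "connected F" "F \<inter> drawing V E = {}" "p x \<in> closure F" "p w \<in> closure F"
  shows "planar (V, insert {w, x} E)"
proof -
  have "p x \<noteq> p w" using inj_onD[OF inj_p] x w assms(3) by blast
  then have d: "dist (p x) (p w) / 2 > 0" by simp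
  obtain r \<gamma>1 where r: "0 < r" "r < dist (p x) (p w) / 2" and S1: "straightened x r \<gamma>1"
    by (rule straighten_at[OF x d])
  interpret P1: plane_graph V E p \<gamma>1 by (rule straightenedD(1)[OF S1])
  note D1 = straightenedD(2)[OF S1] and radius1 = straightenedD(3)[OF S1]
  \<comment> \<open>The second straightening is applied to the result of the first. Both radii are
    below half the distance of the two vertices, so the discs are disjoint and the radii at
    \<open>x\<close> stay clear.\<close>
  obtain r2 \<gamma>2 where r2: "0 < r2" "r2 < dist (p x) (p w) / 2" and S2: "P1.straightened w r2 \<gamma>2"
    by (rule P1.straighten_at[OF w d])
  interpret P2: plane_graph V E p \<gamma>2 by (rule P1.straightenedD(1)[OF S2])
  note D2 = P1.straightenedD(2)[OF S2] and radius2 = P1.straightenedD(3)[OF S2]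
  define B1 where "B1 = cball (p w) r2"
  define B2 where "B2 = cball (p x) r"
  have disj: "B1 \<inter> B2 = {}"
  proof (rule ccontr)
    assume "B1 \<inter> B2 \<noteq> {}"
    then obtain v where "dist (p w) v \<le> r2" "dist (p x) v \<le> r" by (auto simp: B1_def B2_def)
    then have "dist (p x) (p w) \<le> r + r2"
      using dist_triangle2[of "p x" "p w" v] by linarith
    then show False using r r2 by linarith
  qed
  obtain y1 where y1: "y1 \<in> F" "y1 \<in> B1"
    using cball_meets_closure[OF F(5) r2(1)] unfolding B1_def by metis
  obtain y2 where y2: "y2 \<in> F" "y2 \<in> B2"
    using cball_meets_closure[OF F(4) r(1)] unfolding B2_def by metis
  obtain h where h: "path h" "path_image h \<subseteq> F" "pathstart h = y1" "pathfinish h = y2"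
    using connected_open_path_connected[OF F(1,2)] y1(1) y2(1) unfolding path_connected_def by metis
  obtain s t where st: "0 \<le> s" "s < t" "t \<le> 1" "h s \<in> B1" "h t \<in> frontier B2"
      "\<And>u. s < u \<Longrightarrow> u < t \<Longrightarrow> h u \<notin> B1 \<union> B2" "h s \<in> closure (- B1)"
    by (rule path_crossing[OF h(1) _ _ disj])
       (simp_all add: h(3,4) y1(2) y2(2), simp_all add: B1_def B2_def)
  have hs: "dist (p w) (h s) = r2"
  proof -
    have "h s \<in> frontier B1"
      using st(4,7) by (simp add: frontier_closures B1_def)
    then show ?thesis using r2(1) by (simp add: B1_def)
  qed
  have ht: "dist (p x) (h t) = r" using st(5) r(1) by (simp add: B2_def)
  have hF: "h u \<in> F" if "s \<le> u" "u \<le> t" for u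
    using h(2) that st(1,3) by (auto simp: path_image_def)
  have hD: "h u \<notin> drawing V E" if "s \<le> u" "u \<le> t" for u
    using hF[OF that] F(3) by blast
  have htB2: "h t \<in> B2" using ht by (simp add: B2_def)
  have "h s \<notin> P1.drawing V E"
    using D1 hD[OF order_refl less_imp_le[OF st(2)]] st(4) disj unfolding B2_def by blast
  then have seg1: "closed_segment (p w) (h s) \<inter> P2.drawing V E \<subseteq> {p w}"
    by (rule radius2[OF hs])
  have segB2: "closed_segment (p x) (h t) \<subseteq> B2"
    unfolding B2_def by (rule closed_segment_subset) (use ht r in auto)
  have "closed_segment (p x) (h t) \<inter> P1.drawing V E \<subseteq> {p x}"
    by (rule radius1[OF ht]) (use hD st in auto)
  then have seg2: "closed_segment (p x) (h t) \<inter> P2.drawing V E \<subseteq> {p x}"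
    using D2 segB2 disj unfolding B1_def by blast
  have mid: "h u \<notin> P2.drawing V E" if u: "s \<le> u" "u \<le> t" for u
  proof -
    consider "u = s" | "u = t" | "s < u" "u < t" using u by linarith
    then show ?thesis
    proof cases
      case 1
      have "h s \<noteq> p w" using hs r2(1) by auto
      then show ?thesis using seg1 1 by auto
    next
      case 2
      have "h t \<noteq> p x" using ht r(1) by auto
      then show ?thesis using seg2 2 by auto
    next
      case 3
      then have "h u \<notin> B1" "h u \<notin> B2" using st(6) by blast+
      then show ?thesis using D1 D2 hD[OF u] unfolding B1_def B2_def by blast
    qed
  qed
  define g where "g = linepath (p w) (h s) +++ subpath s t h +++ linepath (h t) (p x)"
  have sub: "path_image (subpath s t h) = h ` {s..t}"
    using st by (simp add: path_image_subpath)
  have pg: "path g"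
    unfolding g_def using path_subpath[OF h(1), of s t] st by simp
  have im: "path_image g = closed_segment (p w) (h s) \<union> (h ` {s..t} \<union> closed_segment (p x) (h t))"
    unfolding g_def by (simp add: path_image_join sub closed_segment_commute)
  have "h ` {s..t} \<inter> P2.drawing V E = {}"
    using mid by auto
  then have gim: "path_image g \<inter> P2.drawing V E \<subseteq> {p w, p x}"
    unfolding im using seg1 seg2 by blast
  obtain q where q: "arc q" "path_image q \<subseteq> path_image g" "pathstart q = p w" "pathfinish q = p x"
    by (rule path_contains_arc[OF pg, of "p w" "p x"]) (use \<open>p x \<noteq> p w\<close> in \<open>auto simp: g_def\<close>)
  have qD: "path_image q \<inter> P2.drawing V E \<subseteq> {p w, p x}" using q(2) gim by blast
  define \<gamma>3 where "\<gamma>3 = \<gamma>2({w, x} := q)"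
  have meet: "path_image q \<inter> path_image (\<gamma>2 e) \<subseteq> p ` ({w, x} \<inter> e)" if e: "e \<in> E" for e
  proof
    fix z assume z: "z \<in> path_image q \<inter> path_image (\<gamma>2 e)"
    then have "z \<in> P2.drawing V E" using e by (auto simp: P2.drawing_def)
    then obtain v where v: "v \<in> {w, x}" "z = p v" using qD z by blast
    have "v \<in> V" using v(1) x w by blast
    then have "z \<in> p ` V" using v(2) by simp
    then have "z \<in> p ` e" using P2.vert_\<gamma>[OF e] z by blast
    then obtain v' where v': "v' \<in> e" "p v = p v'" using v(2) by auto
    then have "v = v'" using inj_onD[OF inj_p v'(2)] \<open>v \<in> V\<close> edge_sub[OF e] by blast
    then have "v \<in> e" using v' by simp
    then show "z \<in> p ` ({w, x} \<inter> e)" using v by blast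
  qed
  have qV: "path_image q \<inter> p ` V \<subseteq> p ` {w, x}" using qD by (auto simp: P2.drawing_def)
  have "plane_graph V (insert {w, x} E) p \<gamma>3"
  proof (rule plane_graphI)
    show "simple_graph (V, insert {w, x} E)"
      using simple x w assms(3) by (auto simp: simple_graph_def)
    show "inj_on p V" by (rule inj_p)
    show "arc (\<gamma>3 e)" "{pathstart (\<gamma>3 e), pathfinish (\<gamma>3 e)} = p ` e"
      "path_image (\<gamma>3 e) \<inter> p ` V \<subseteq> p ` e" if "e \<in> insert {w, x} E" for e
      using that q P2.arc_\<gamma>[of e] P2.ends_\<gamma>[of e] qV P2.vert_\<gamma>[of e]
      by (cases "e = {w, x}"; simp add: \<gamma>3_def)+
    show "path_image (\<gamma>3 e) \<inter> path_image (\<gamma>3 e') \<subseteq> p ` (e \<inter> e')"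
      if e: "e \<in> insert {w, x} E" "e' \<in> insert {w, x} E" "e \<noteq> e'" for e e'
    proof -
      consider "e = {w, x}" "e' \<in> E" "e' \<noteq> {w, x}" | "e' = {w, x}" "e \<in> E" "e \<noteq> {w, x}"
        | "e \<in> E" "e' \<in> E" "e \<noteq> {w, x}" "e' \<noteq> {w, x}"
        using e by blast
      then show ?thesis
      proof cases
        case 1
        then show ?thesis using meet[of e'] by (simp add: \<gamma>3_def)
      next
        case 2
        then show ?thesis using meet[of e] by (simp add: \<gamma>3_def Int_commute)
      next
        case 3
        then show ?thesis using P2.disj_\<gamma>[OF 3(1,2) e(3)] by (simp add: \<gamma>3_def)
      qed
    qed
  qed
  then show ?thesis by (rule plane_graph_planar)
qed

text \<open>Assume the closure of \<open>F\<close> reaches the arc first at a time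
  \<open>t > 0\<close>. Close to that point lie a point \<open>x\<close> of \<open>F\<close> and an
  earlier point \<open>\<theta> u\<close> of the arc. The tail \<open>R\<close> from
  \<open>t\<close> on meets the rest of the drawing only in its far end, so by Janiszewski's theorem
  \<open>x\<close> and \<open>\<theta> u\<close> are connected off \<open>A \<union> R\<close>. The
  connection cannot meet the frontier of \<open>F\<close>, which on the arc occurs only from time
  \<open>t\<close> on; so \<open>\<theta> u\<close> would be a point of the drawing inside
  \<open>F\<close>.\<close>

lemma edge_start_in_closure:
  assumes e: "e \<in> E" and F: "F \<in> components (- drawing V E)" "touches F e"
    and \<theta>: "arc \<theta>" "path_image \<theta> = path_image (\<gamma> e)" "{pathstart \<theta>, pathfinish \<theta>} = p ` e"
  shows "pathstart \<theta> \<in> closure F"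
proof (rule ccontr)
  assume start: "pathstart \<theta> \<notin> closure F"
  define A where "A = drawing V (E - {e})"
  have D: "drawing V E = A \<union> path_image \<theta>"
    using drawing_insert[of V e "E - {e}"] e \<theta>(2) by (simp add: A_def insert_absorb)
  have clA: "compact A" unfolding A_def by (rule compact_drawing) auto
  have c\<theta>: "continuous_on {0..1} \<theta>" and inj: "inj_on \<theta> {0..1}"
    using \<theta>(1) by (auto simp: arc_def path_def)
  have pe: "p ` e = {\<theta> 0, \<theta> 1}" using \<theta>(3) by (simp add: pathstart_def pathfinish_def)
  have inner: "\<theta> u \<in> open_arc e" if "0 < u" "u < 1" for u
  proof -
    have "\<theta> u \<noteq> \<theta> 0" "\<theta> u \<noteq> \<theta> 1" using inj that by (auto dest!: inj_onD)
    moreover have "\<theta> u \<in> path_image (\<gamma> e)" using that \<theta>(2) by (auto simp: path_image_def)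
    ultimately show ?thesis using path_image_open_arc[OF e] pe by auto
  qed
  have arcA: "open_arc e \<inter> A = {}"
    unfolding A_def by (rule open_arc_drawing) (use e in auto)
  define T where "T = {0..1} \<inter> \<theta> -` closure F"
  have clT: "compact T" unfolding T_def compact_eq_bounded_closed
    using continuous_closed_preimage[OF c\<theta>] by (auto intro: bounded_Int)
  obtain m where m: "m \<in> open_arc e" "m \<in> closure F" using F(2) by (auto simp: touches_def)
  have "m \<in> path_image \<theta>"
    using m(1) \<theta>(2) path_image_open_arc[OF e] by blast
  moreover have "m \<notin> p ` e"
    using m(1) edge_interior_notin[OF e] unfolding open_arc_def by fastforce
  ultimately obtain tm where tm: "tm \<in> {0..1}" "m = \<theta> tm" "tm \<noteq> 1"
    using pe unfolding path_image_def by fast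
  then have tmT: "tm \<in> T" using m(2) by (simp add: T_def)
  define t where "t = Inf T"
  have t: "t \<in> T" unfolding t_def
    using tmT compact_imp_closed[OF clT] compact_imp_bounded[OF clT]
    by (intro closed_contains_Inf bounded_imp_bdd_below) auto
  have t_le: "t \<le> u" if "u \<in> T" for u
    unfolding t_def using that compact_imp_bounded[OF clT] by (intro cInf_lower bounded_imp_bdd_below)
  have t01: "0 \<le> t" "\<theta> t \<in> closure F" using t by (auto simp: T_def)
  have t1: "t < 1" using t_le[OF tmT] tm by auto
  have "t \<noteq> 0" using t01 start by (auto simp: pathstart_def)
  then have t0: "0 < t" using t01(1) by simp
  have mA: "\<theta> t \<in> - A" using inner[OF t0 t1] arcA by blast
  then obtain \<epsilon> where \<epsilon>: "\<epsilon> > 0" "ball (\<theta> t) \<epsilon> \<subseteq> - A"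
    using compact_imp_closed[OF clA] by (meson open_Compl open_contains_ball)
  obtain x where x: "x \<in> F" "dist x (\<theta> t) < \<epsilon>"
    using t01(2) \<epsilon>(1) by (meson closure_approachable)
  have "\<theta> ` closure {0..<t} \<subseteq> closure (\<theta> ` {0..<t})"
  proof (rule image_closure_subset)
    show "continuous_on (closure {0..<t}) \<theta>"
      by (rule continuous_on_subset[OF c\<theta>]) (use t0 t1 in \<open>simp add: closure_atLeastLessThan\<close>)
  qed (auto simp: closure_subset)
  moreover have "t \<in> closure {0..<t}" using t0 by (simp add: closure_atLeastLessThan)
  ultimately have "\<theta> t \<in> closure (\<theta> ` {0..<t})" by blast
  then obtain y where "y \<in> \<theta> ` {0..<t}" "dist y (\<theta> t) < \<epsilon>"
    using \<epsilon>(1) by (meson closure_approachable)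
  then obtain u where u: "0 \<le> u" "u < t" "dist (\<theta> u) (\<theta> t) < \<epsilon>"
    by auto
  define R where "R = path_image (subpath t 1 \<theta>)"
  have R: "R = \<theta> ` {t..1}" using t1 by (simp add: R_def path_image_subpath)
  have arcR: "arc (subpath t 1 \<theta>)" by (rule arc_subpath_arc) (use \<theta>(1) t0 t1 in auto)
  have yR: "\<theta> v \<notin> R" if "0 \<le> v" "v < t" for v
    using inj that t1 unfolding R by (auto dest!: inj_onD)
  have xD: "x \<notin> drawing V E" using x(1) in_components_subset[OF F(1)] by blast
  have RD: "R \<subseteq> path_image \<theta>" unfolding R path_image_def using t0 by auto
  have AR: "A \<inter> R = {\<theta> 1}"
  proof
    show "A \<inter> R \<subseteq> {\<theta> 1}"
    proof
      fix z assume z: "z \<in> A \<inter> R"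
      then obtain v where v: "v \<in> {t..1}" "z = \<theta> v" unfolding R by blast
      then have "v = 1" using inner[of v] arcA z t0 by (cases "v = 1") auto
      then show "z \<in> {\<theta> 1}" using v by simp
    qed
    have "\<theta> 1 \<in> p ` V" using pe edge_sub[OF e] by blast
    then have "\<theta> 1 \<in> A" by (auto simp: A_def drawing_def)
    then show "{\<theta> 1} \<subseteq> A \<inter> R" using t1 by (auto simp: R)
  qed
  have "connected_component (- (A \<union> R)) x (\<theta> u)"
  proof (rule Janiszewski[OF clA])
    show "closed R" unfolding R_def by (rule closed_arc_image[OF arcR])
    show "connected (A \<inter> R)" unfolding AR by simp
    show "connected_component (- A) x (\<theta> u)"
      unfolding connected_component_def
      by (rule exI[of _ "ball (\<theta> t) \<epsilon>"]) (use \<epsilon>(2) x u in \<open>auto simp: dist_commute\<close>)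
    have "connected (- R)" unfolding R_def by (rule connected_arc_complement[OF arcR]) simp
    then show "connected_component (- R) x (\<theta> u)"
      unfolding connected_component_def
      by (intro exI[of _ "- R"]) (use xD D RD yR[OF u(1,2)] in auto)
  qed
  then obtain S where S: "connected S" "S \<subseteq> - (A \<union> R)" "x \<in> S" "\<theta> u \<in> S"
    unfolding connected_component_def by blast
  have SF: "S \<inter> frontier F = {}"
  proof (rule ccontr)
    assume "S \<inter> frontier F \<noteq> {}"
    then obtain z where z: "z \<in> S" "z \<in> frontier F" by blast
    then have "z \<in> A \<union> path_image \<theta>" using frontier_face(1)[OF _ _ F(1)] D by blast
    then have "z \<in> path_image \<theta>" using z(1) S(2) by blast
    then obtain v where v: "v \<in> {0..1}" "z = \<theta> v" by (auto simp: path_image_def)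
    have "v \<in> T" using v z(2) by (simp add: T_def frontier_def)
    then have "z \<in> R" using t_le v by (auto simp: R)
    then show False using z(1) S(2) by blast
  qed
  have "S - F = {}"
    using connected_Int_frontier[OF S(1), of F] SF S(3) x(1) by blast
  then have "\<theta> u \<in> F" using S(4) by blast
  moreover have "\<theta> u \<in> drawing V E" using D u t1 by (auto simp: path_image_def)
  ultimately show False using in_components_subset[OF F(1)] by blast
qed

lemma edge_ends_in_closure:
  assumes e: "e \<in> E" and F: "F \<in> components (- drawing V E)" "touches F e"
  shows "p ` e \<subseteq> closure F"
proof -
  have "pathstart (\<gamma> e) \<in> closure F"
    by (rule edge_start_in_closure[OF e F]) (use arc_\<gamma>[OF e] ends_\<gamma>[OF e] in auto)
  moreover have "pathstart (reversepath (\<gamma> e)) \<in> closure F"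
    by (rule edge_start_in_closure[OF e F])
       (use arc_\<gamma>[OF e] ends_\<gamma>[OF e] in \<open>auto simp: arc_reversepath insert_commute\<close>)
  ultimately show ?thesis unfolding ends_\<gamma>[OF e, symmetric] by simp
qed

end

text \<open>Suppose that \<open>w\<close> has at most two neighbours. Delete \<open>w\<close> and
  let \<open>F\<close> be the face in which it was. By maximality every vertex on the boundary of
  \<open>F\<close> is a neighbour of \<open>w\<close>, so that boundary is drawn with at most two
  vertices and one edge and does not separate the plane. Then \<open>F\<close> is the complement of
  this small drawing and no fourth vertex can exist.\<close>

theorem maximal_planar_min_degree:
  assumes max: "maximal_planar (V, E)" and "4 \<le> card V" and w: "w \<in> V"
  shows "3 \<le> card {u \<in> V. {w, u} \<in> E}"
proof (rule ccontr)
  assume few: "\<not> ?thesis"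
  define N where "N = {u \<in> V. {w, u} \<in> E}"
  have cN: "card N \<le> 2" using few by (simp add: N_def)
  have "planar (V, E)" using max by (simp add: maximal_planar_def)
  then obtain p \<gamma> where "plane_graph V E p \<gamma>"
    using planar_plane_graph by blast
  then interpret plane_graph V E p \<gamma> .
  have finN: "finite N" using finite_V by (simp add: N_def)
  define V1 where "V1 = V - {w}"
  define E1 where "E1 = {e \<in> E. w \<notin> e}"
  interpret Q: plane_graph V1 E1 p \<gamma>
    by (rule subgraph) (use edge_sub in \<open>auto simp: V1_def E1_def\<close>)
  define D1 where "D1 = drawing V1 E1"
  define star where "star = drawing {w} {e \<in> E. w \<in> e}"
  have D: "drawing V E = D1 \<union> star"
    using w unfolding D1_def star_def drawing_def V1_def E1_def by blast
  have NV: "N \<subseteq> V1" using edge_card[of "{w}"] by (auto simp: N_def V1_def)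
  have pwD1: "p w \<notin> D1"
  proof
    assume "p w \<in> D1"
    then consider v where "v \<in> V1" "p w = p v" | e where "e \<in> E1" "p w \<in> path_image (\<gamma> e)"
      unfolding D1_def drawing_def by auto
    then show False
    proof cases
      case 1
      then show False using inj_onD[OF inj_p] w by (auto simp: V1_def)
    next
      case 2
      then have eE: "e \<in> E" by (simp add: E1_def)
      have "p w \<in> p ` e" using vert_\<gamma>[OF eE] w 2(2) by blast
      then have "w \<in> e" using inj_onD[OF inj_p] w edge_sub[OF eE] by blast
      then show False using 2(1) by (simp add: E1_def)
    qed
  qed
  define F where "F = connected_component_set (- D1) (p w)"
  have Fc: "F \<in> components (- D1)" using pwD1 by (auto simp: F_def components_def)
  have pwF: "p w \<in> F" using pwD1 by (simp add: F_def)
  have clD1: "closed D1" unfolding D1_def by (rule closed_drawing) (auto simp: V1_def E1_def)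
  have openF: "open F" using Fc clD1 open_components by blast
  have conF: "connected F" using Fc in_components_connected by blast
  have FD1: "F \<inter> D1 = {}" using in_components_subset[OF Fc] by blast
  have clstar: "closed star" unfolding star_def by (rule closed_drawing) (use w in auto)
  \<comment> \<open>Follow a path in \<open>F\<close> from \<open>w\<close> towards a small disc
    around \<open>p x\<close>, after it has left the edges at \<open>w\<close> for the last time at
    \<open>h s\<close>. From there on, continued by a radius, it runs in one face \<open>F2\<close>
    of the whole straightened drawing; if \<open>p w\<close> is in the closure of \<open>F2\<close>,
    the edge \<open>{w, x}\<close> can be added, against maximality.\<close>
  have near: "x \<in> N" if x: "x \<in> V1" "p x \<in> closure F" for x
  proof (rule ccontr)
    assume xN: "x \<notin> N"
    have xV: "x \<in> V" "x \<noteq> w" using x(1) by (auto simp: V1_def)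
    obtain r \<gamma>' where r: "0 < r" "r < 1" and S: "straightened x r \<gamma>'"
      by (rule straighten_at[OF xV(1) zero_less_one])
    interpret R: plane_graph V E p \<gamma>' by (rule straightenedD(1)[OF S])
    note D' = straightenedD(2)[OF S] and radius = straightenedD(3)[OF S]
      and same = straightenedD(4)[OF S] and away = straightenedD(5)[OF S]
    define B where "B = cball (p x) r"
    have noedge: "{w, x} \<notin> E" using xN xV by (simp add: N_def)
    have star_x: "x \<notin> e" if "e \<in> E" "w \<in> e" for e
    proof
      assume "x \<in> e"
      then have "{w, x} \<subseteq> e" using that(2) by simp
      then have "{w, x} = e"
        using card_subset_eq[of e "{w, x}"] edge_card[OF that(1)] xV(2) finite_subset[OF edge_sub[OF that(1)] finite_V]
        by simp
      then show False using noedge that(1) by simp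
    qed
    have "star \<subseteq> drawing (V - {x}) {e \<in> E. x \<notin> e}"
      using w xV star_x unfolding star_def drawing_def by blast
    then have starB: "star \<inter> B = {}" using away by (auto simp: B_def)
    obtain y where y: "y \<in> F" "y \<in> B"
      using cball_meets_closure[OF x(2) r(1)] unfolding B_def by metis
    obtain h where h: "path h" "path_image h \<subseteq> F" "pathstart h = p w" "pathfinish h = y"
      using connected_open_path_connected[OF openF conF] pwF y(1) unfolding path_connected_def by metis
    have "p w \<in> star" by (simp add: star_def drawing_def)
    then obtain s t where st: "0 \<le> s" "s < t" "t \<le> 1" "h s \<in> star" "h t \<in> frontier B"
        "\<And>u. s < u \<Longrightarrow> u < t \<Longrightarrow> h u \<notin> star \<union> B"
      by (rule_tac path_crossing[OF h(1) clstar, of B]) (use starB y h in \<open>auto simp: B_def\<close>)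
    have ht: "dist (p x) (h t) = r" using st(5) r(1) by (simp add: B_def)
    have hF: "h u \<in> F" if "s \<le> u" "u \<le> t" for u
      using h(2) that st(1,3) by (auto simp: path_image_def)
    have hD1: "h u \<notin> D1" if "s \<le> u" "u \<le> t" for u
      using hF[OF that] FD1 by blast
    have htB: "h t \<in> B" using ht by (simp add: B_def)
    have htD: "h t \<notin> drawing V E" using D htB starB hD1[of t] st(2) by auto
    have seg: "closed_segment (p x) (h t) \<inter> R.drawing V E \<subseteq> {p x}"
      by (rule radius[OF ht htD])
    have htx: "h t \<noteq> p x" using ht r(1) by auto
    have mid: "h u \<notin> R.drawing V E" if u: "s < u" "u < t" for u
      using st(6)[OF u] hD1[of u] u D' D unfolding B_def by auto
    have htR: "h t \<notin> R.drawing V E" using seg htx by auto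
    define U where "U = h ` {s<..t} \<union> (closed_segment (h t) (p x) - {p x})"
    have U: "U \<inter> R.drawing V E = {}"
      using mid htR seg unfolding U_def closed_segment_commute[of "h t"] by (force simp: le_less)
    have "connected (h ` {s<..t})"
    proof (rule connected_continuous_image)
      show "continuous_on {s<..t} h"
        by (rule continuous_on_subset[of "{0..1}"]) (use h(1) st in \<open>auto simp: path_def\<close>)
    qed simp
    moreover have "connected (closed_segment (h t) (p x) - {p x})"
    proof -
      have "closure (open_segment (h t) (p x)) = closed_segment (h t) (p x)"
        using htx by (simp add: closure_open_segment)
      then have "closed_segment (h t) (p x) - {p x} \<subseteq> closure (open_segment (h t) (p x))"
        by blast
      moreover have "open_segment (h t) (p x) \<subseteq> closed_segment (h t) (p x) - {p x}"
        unfolding open_segment_def by blast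
      moreover have "connected (open_segment (h t) (p x))"
        by (rule convex_connected) (rule convex_open_segment)
      ultimately show ?thesis
        using connected_intermediate_closure by metis
    qed
    moreover have "h t \<in> h ` {s<..t} \<inter> (closed_segment (h t) (p x) - {p x})"
      using st(2) htx by simp
    ultimately have conU: "connected U"
      unfolding U_def by (intro connected_Un) blast+
    define F2 where "F2 = connected_component_set (- R.drawing V E) (h t)"
    have F2: "F2 \<in> components (- R.drawing V E)" unfolding F2_def components_def using htR by blast
    have UF2: "U \<subseteq> F2"
      unfolding F2_def
    proof (rule connected_component_maximal[OF _ conU])
      show "h t \<in> U" using st(2) by (simp add: U_def)
      show "U \<subseteq> - R.drawing V E" using U by blast
    qed
    have pxF2: "p x \<in> closure F2"
    proof -
      have "p x \<in> closure (open_segment (h t) (p x))"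
        using htx by (simp add: closure_open_segment)
      moreover have "open_segment (h t) (p x) \<subseteq> F2"
        using UF2 unfolding U_def open_segment_def by blast
      ultimately show ?thesis using closure_mono by blast
    qed
    have hsF2: "h s \<in> closure F2"
    proof -
      have "h ` closure {s<..t} \<subseteq> closure F2"
      proof (rule image_closure_subset)
        show "continuous_on (closure {s<..t}) h"
          by (rule continuous_on_subset[of "{0..1}"])
             (use h(1) st in \<open>auto simp: path_def closure_greaterThanAtMost\<close>)
        show "h ` {s<..t} \<subseteq> closure F2"
          using UF2 closure_subset[of F2] unfolding U_def by blast
      qed simp
      moreover have "s \<in> closure {s<..t}" using st by (simp add: closure_greaterThanAtMost)
      ultimately show ?thesis by blast
    qed
    \<comment> \<open>The path may leave an edge at \<open>w\<close> in an inner point of its arc.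
      Then \<open>F2\<close> touches that edge, and the closure of a face contains both ends of
      every edge it touches.\<close>
    have pwF2: "p w \<in> closure F2"
    proof (cases "h s = p w")
      case True
      then show ?thesis using hsF2 by simp
    next
      case False
      then obtain e where e: "e \<in> E" "w \<in> e" "h s \<in> path_image (\<gamma> e)"
        using st(4) by (auto simp: star_def drawing_def)
      have same_e: "\<gamma>' e = \<gamma> e" by (rule same[OF star_x[OF e(1,2)]])
      have "h s \<notin> p ` e"
      proof
        assume "h s \<in> p ` e"
        then obtain v where "v \<in> e" "h s = p v" by blast
        then have "p v \<in> D1" using False edge_sub[OF e(1)] by (auto simp: D1_def V1_def drawing_def)
        then show False using hD1[of s] st(2) \<open>h s = p v\<close> by simp
      qed
      then have "h s \<in> R.open_arc e"
        using path_image_open_arc[OF e(1)] e(3) same_e by (simp add: R.open_arc_def open_arc_def)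
      then have "R.touches F2 e" using hsF2 by (auto simp: R.touches_def)
      then have "p ` e \<subseteq> closure F2" using R.edge_ends_in_closure[OF e(1) F2] by simp
      then show ?thesis using e(2) by blast
    qed
    have "planar (V, insert {w, x} E)"
    proof (rule R.add_edge_in_face[OF xV(1) w xV(2) noedge _ _ _ pxF2 pwF2])
      show "open F2" by (rule R.frontier_face(2)[OF _ _ F2]) auto
      show "connected F2" using F2 in_components_connected by blast
      show "F2 \<inter> R.drawing V E = {}" using in_components_subset[OF F2] by blast
    qed
    then show False using max w xV noedge unfolding maximal_planar_def by auto
  qed
  define E2 where "E2 = {e \<in> E1. e \<subseteq> N}"
  define D2 where "D2 = drawing N E2"
  have E2: "E2 \<subseteq> {N}"
  proof
    fix e assume e: "e \<in> E2"
    then have "e \<subseteq> N" "card e = 2" using edge_card by (auto simp: E2_def E1_def)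
    then have "e = N" using card_seteq[OF finN] cN by simp
    then show "e \<in> {N}" by simp
  qed
  have ac: "acyclic_edges E2"
    unfolding acyclic_edges_def
  proof (intro allI impI notI)
    fix Y assume Y: "Y \<subseteq> E2" "Y \<noteq> {}" "mindeg2 Y"
    then have YN: "Y = {N}" using E2 by blast
    then have "N \<in> E" using Y(1) by (auto simp: E2_def E1_def)
    then obtain v where "v \<in> N" using edge_card by (metis card.empty equals0I zero_neq_numeral)
    then show False using Y(3) YN by (auto simp: mindeg2_def)
  qed
  have con: "connected (- D2)"
    unfolding D2_def by (rule Q.connected_acyclic_complement) (use NV ac in \<open>auto simp: E2_def\<close>)
  have D2D1: "D2 \<subseteq> D1" using NV unfolding D1_def D2_def drawing_def E2_def by blast
  have "frontier F \<subseteq> D2"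
  proof
    fix z assume z: "z \<in> frontier F"
    then have zc: "z \<in> closure F" by (simp add: frontier_def)
    have zD: "z \<in> D1"
      using z Q.frontier_face(1)[OF _ _ Fc[unfolded D1_def]] unfolding D1_def by auto
    show "z \<in> D2"
    proof (cases "z \<in> p ` V1")
      case True
      then obtain v where v: "v \<in> V1" "z = p v" by blast
      then have "v \<in> N" using near zc by blast
      then show ?thesis using v by (auto simp: D2_def drawing_def)
    next
      case False
      then obtain e where e: "e \<in> E1" "z \<in> path_image (\<gamma> e)"
        using zD by (auto simp: D1_def drawing_def)
      have "e \<subseteq> V1" using Q.edge_sub[OF e(1)] .
      then have "z \<in> open_arc e"
        using Q.path_image_open_arc[OF e(1)] e(2) False by blast
      then have "Q.touches F e" using zc by (auto simp: Q.touches_def)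
      then have "p ` e \<subseteq> closure F"
        using Q.edge_ends_in_closure[OF e(1) Fc[unfolded D1_def]] by simp
      then have "e \<subseteq> N" using near \<open>e \<subseteq> V1\<close> by blast
      then show ?thesis using e by (auto simp: D2_def E2_def drawing_def)
    qed
  qed
  then have "F = - D2"
    by (rule face_eq_complement[OF con]) (use FD1 D2D1 pwF in auto)
  then have D12: "D1 \<subseteq> D2" using FD1 by blast
  have "card N < card V1"
    using cN assms(2) w finite_V by (simp add: V1_def)
  then obtain x where x: "x \<in> V1" "x \<notin> N"
    using finN card_mono by (metis linorder_not_less subsetI)
  have xV: "x \<in> V" using x(1) by (simp add: V1_def)
  have "p x \<in> D2" using D12 x(1) by (auto simp: D1_def drawing_def)
  then consider v where "v \<in> N" "p x = p v" | e where "e \<in> E2" "p x \<in> path_image (\<gamma> e)"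
    unfolding D2_def drawing_def by auto
  then show False
  proof cases
    case 1
    then show False using inj_onD[OF inj_p] x xV by (auto simp: N_def)
  next
    case 2
    then have eE: "e \<in> E" "e \<subseteq> N" by (auto simp: E2_def E1_def)
    have "p x \<in> p ` e" using vert_\<gamma>[OF eE(1)] xV 2(2) by blast
    then have "x \<in> e" using inj_onD[OF inj_p] xV edge_sub[OF eE(1)] by blast
    then show False using x(2) eE(2) by blast
  qed
qed

section \<open>The Tutte-Berge formula\<close>

lemma card_matching_vertices:
  assumes "disjoint M" "\<And>e. e \<in> M \<Longrightarrow> card e = 2"
  shows "card (\<Union>M) = 2 * card M"
proof -
  have "finite e" if "e \<in> M" for e
    using assms(2)[OF that] by (metis card.infinite zero_neq_numeral)
  moreover have "pairwise disjnt M"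
    using assms(1) by (simp add: pairwise_disjnt_iff disjoint_def disjnt_def pairwise_def)
  ultimately have "card (\<Union>M) = sum card M"
    by (intro card_Union_disjoint)
  also have "\<dots> = 2 * card M"
    using assms(2) by simp
  finally show ?thesis .
qed

lemma finite_has_max:
  fixes f :: "'b \<Rightarrow> nat"
  assumes "finite A" "A \<noteq> {}"
  obtains x where "x \<in> A" "\<forall>y\<in>A. f y \<le> f x"
proof -
  have "Max (f ` A) \<in> f ` A" using assms by simp
  then obtain x where x: "x \<in> A" "Max (f ` A) = f x" by (rule imageE) simp
  have "\<forall>y\<in>A. f y \<le> f x"
    using Max_ge[of "f ` A"] assms(1) x(2) by simp
  with x(1) show thesis by (rule that)
qed

section \<open>Maximum matchings and Gallai's lemma\<close>

locale finite_graph =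
  fixes V :: "'a set" and E :: "'a set set"
  assumes finV: "finite V" and edge_subset: "e \<in> E \<Longrightarrow> e \<subseteq> V" and card_edge: "e \<in> E \<Longrightarrow> card e = 2"
begin

lemma finE: "finite E"
  by (rule finite_subset[of E "Pow V"]) (use finV edge_subset in auto)

definition max_matching :: "'a set set \<Rightarrow> bool" where
  "max_matching M \<longleftrightarrow> M \<subseteq> E \<and> disjoint M \<and> (\<forall>N. N \<subseteq> E \<longrightarrow> disjoint N \<longrightarrow> card N \<le> card M)"

lemma max_matchingD:
  assumes "max_matching M"
  shows "M \<subseteq> E" "disjoint M" "N \<subseteq> E \<Longrightarrow> disjoint N \<Longrightarrow> card N \<le> card M" "finite M" "card (\<Union>M) = 2 * card M"
    "\<Union>M \<subseteq> V"
proof -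
  show *: "M \<subseteq> E" "disjoint M" "N \<subseteq> E \<Longrightarrow> disjoint N \<Longrightarrow> card N \<le> card M"
    using assms by (simp_all add: max_matching_def)
  show "finite M" using *(1) finE by (rule finite_subset)
  show "card (\<Union>M) = 2 * card M"
    by (rule card_matching_vertices) (use *(1,2) card_edge in auto)
  show "\<Union>M \<subseteq> V" using *(1) edge_subset by blast
qed

lemma max_matching_exists: "\<exists>M. max_matching M"
proof -
  define A where "A = {M. M \<subseteq> E \<and> disjoint M}"
  have "finite A" "A \<noteq> {}" using finE by (auto simp: A_def)
  then obtain M where "M \<in> A" "\<forall>N\<in>A. card N \<le> card M"
    by (rule finite_has_max[where f = card])
  then have "max_matching M" unfolding A_def max_matching_def by simp
  then show ?thesis by blast
qed

lemma max_matching_same_card: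
  assumes "max_matching M" "max_matching N" shows "card M = card N"
  using max_matchingD(3)[OF assms(1) max_matchingD(1,2)[OF assms(2)]]
    max_matchingD(3)[OF assms(2) max_matchingD(1,2)[OF assms(1)]] by simp

lemma disjoint_insert_matching:
  assumes "disjoint N" "e \<inter> \<Union>N = {}"
  shows "disjoint (insert e N)"
  using assms by (auto simp: disjoint_def)

definition jointly_missed :: "'a \<Rightarrow> 'a \<Rightarrow> bool" where
  "jointly_missed u v \<longleftrightarrow> (\<exists>M. max_matching M \<and> u \<notin> \<Union>M \<and> v \<notin> \<Union>M)"

lemma adjacent_not_jointly_missed:
  assumes "{u, v} \<in> E"
  shows "\<not> jointly_missed u v"
proof
  assume "jointly_missed u v"
  then obtain M where M: "max_matching M" "u \<notin> \<Union>M" "v \<notin> \<Union>M"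
    by (auto simp: jointly_missed_def)
  have "disjoint (insert {u, v} M)"
    by (rule disjoint_insert_matching) (use M max_matchingD(2) in auto)
  then have "card (insert {u, v} M) \<le> card M"
    using max_matchingD(1,3)[OF M(1)] assms by simp
  moreover have "{u, v} \<notin> M" using M(2) by blast
  ultimately show False using max_matchingD(4)[OF M(1)] by simp
qed

text \<open>Transitivity of not being jointly missed is the exchange step in the proof of Gallai's lemma.\<close>

lemma jointly_missed_trans:
  assumes uw: "\<not> jointly_missed u w" and wv: "\<not> jointly_missed w v" and "u \<noteq> v"
    and w: "\<exists>N. max_matching N \<and> w \<notin> \<Union>N"
  shows "\<not> jointly_missed u v"
proof
  assume "jointly_missed u v"
  then obtain M where M: "max_matching M" "u \<notin> \<Union>M" "v \<notin> \<Union>M"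
    by (auto simp: jointly_missed_def)
  note MD = max_matchingD[OF M(1)]
  define A where "A = {N. max_matching N \<and> w \<notin> \<Union>N}"
  have "A \<subseteq> Pow E" using max_matchingD(1) by (auto simp: A_def)
  then have "finite A" using finE finite_subset by blast
  moreover have "A \<noteq> {}" using w by (auto simp: A_def)
  ultimately obtain N where N: "N \<in> A" and best: "\<forall>N'\<in>A. card (M \<inter> N') \<le> card (M \<inter> N)"
    by (rule finite_has_max[where f = "\<lambda>N. card (M \<inter> N)"])
  have Nm: "max_matching N" "w \<notin> \<Union>N" using N by (simp_all add: A_def)
  note ND = max_matchingD[OF Nm(1)]
  have u: "u \<in> \<Union>N" using uw Nm unfolding jointly_missed_def by blast
  have v: "v \<in> \<Union>N" using wv Nm unfolding jointly_missed_def by blast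
  have wM: "w \<in> \<Union>M" using uw M unfolding jointly_missed_def by blast
  have fin: "finite (\<Union>M)" "finite (\<Union>N)"
    by (rule finite_subset[OF MD(6) finV], rule finite_subset[OF ND(6) finV])
  \<comment> \<open>\<open>M\<close> and \<open>N\<close> cover equally many vertices and
    \<open>u\<close>, \<open>v\<close> are covered by \<open>N\<close> only. So at least two
    vertices are covered by \<open>M\<close> only, and one of them differs from
    \<open>w\<close>.\<close>
  have "card {u, v} \<le> card (\<Union>N - \<Union>M)"
    by (rule card_mono) (use fin u v M in auto)
  also have "card (\<Union>N - \<Union>M) = card (\<Union>M - \<Union>N)"
    using fin MD(5) ND(5) max_matching_same_card[OF M(1) Nm(1)]
    by (metis card_Diff_subset_Int Int_commute finite_Int)
  finally have "card {w} < card (\<Union>M - \<Union>N)" using assms(3) by simp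
  then have "\<not> \<Union>M - \<Union>N \<subseteq> {w}"
    by (metis card_mono finite.emptyI finite.insertI linorder_not_less)
  then obtain x where x: "x \<in> \<Union>M" "x \<notin> \<Union>N" "x \<noteq> w" by blast
  then obtain e1 where e1: "e1 \<in> M" "x \<in> e1" by blast
  then have e1E: "e1 \<in> E" using MD(1) by blast
  obtain y where y: "e1 = {x, y}" "y \<noteq> x"
    using card_edge[OF e1E] e1(2) by (auto simp: card_2_iff)
  have yN: "y \<in> \<Union>N"
  proof (rule ccontr)
    assume "y \<notin> \<Union>N"
    then have "disjoint (insert e1 N)"
      using x(2) by (intro disjoint_insert_matching ND(2)) (simp add: y)
    then have "card (insert e1 N) \<le> card N" using ND(1,3) e1E by simp
    moreover have "e1 \<notin> N" using x(2) e1(2) by blast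
    ultimately show False using ND(4) by simp
  qed
  then obtain e2 where e2: "e2 \<in> N" "y \<in> e2" by blast
  have e12: "e1 \<noteq> e2" "e1 \<notin> N" using e1(2) e2(1) x(2) by blast+
  have e2M: "e2 \<notin> M"
  proof
    assume "e2 \<in> M"
    then have "e1 \<inter> e2 = {}" using MD(2) e1(1) e12(1) by (auto simp: disjoint_def)
    then show False using e2(2) y(1) by blast
  qed
  \<comment> \<open>Trading \<open>e2\<close> for \<open>e1\<close> keeps a maximum matching that
    misses \<open>w\<close> but shares one more edge with \<open>M\<close>, against the choice of
    \<open>N\<close>.\<close>
  define N' where "N' = insert e1 (N - {e2})"
  have "e1 \<inter> \<Union>(N - {e2}) = {}"
  proof -
    have "y \<notin> e" if "e \<in> N - {e2}" for e
    proof -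
      have "e \<inter> e2 = {}" using ND(2) e2(1) that by (auto simp: disjoint_def)
      then show ?thesis using e2(2) by blast
    qed
    then show ?thesis using x(2) y(1) by blast
  qed
  then have disj: "disjoint N'"
    unfolding N'_def by (intro disjoint_insert_matching) (use ND(2) in \<open>auto simp: disjoint_def\<close>)
  have cN': "card N' = card N"
    using ND(4) e12(2) card_Suc_Diff1[OF ND(4) e2(1)] by (simp add: N'_def)
  have NE: "N' \<subseteq> E" using ND(1) e1E by (auto simp: N'_def)
  have "max_matching N'"
    unfolding max_matching_def using NE disj cN' ND(3) by simp
  moreover have "w \<notin> \<Union>N'"
  proof -
    have "w \<notin> e1" using x(3) yN Nm(2) y(1) by blast
    then show ?thesis using Nm(2) by (auto simp: N'_def)
  qed
  ultimately have "N' \<in> A" by (simp add: A_def)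
  then have "card (M \<inter> N') \<le> card (M \<inter> N)" using best by blast
  moreover have "M \<inter> N' = insert e1 (M \<inter> N)"
    using e1(1) e2M by (auto simp: N'_def)
  then have "card (M \<inter> N') = card (M \<inter> N) + 1"
    using e12(2) MD(4) by simp
  ultimately show False by simp
qed

definition adj :: "('a \<times> 'a) set" where
  "adj = {(u, v). {u, v} \<in> E}"

lemma sym_adj: "sym adj"
  unfolding adj_def sym_def by (simp add: insert_commute)

lemma reach_in_V: "(u, v) \<in> adj\<^sup>* \<Longrightarrow> u \<in> V \<Longrightarrow> v \<in> V"
proof (induction rule: rtrancl_induct)
  case (step y z)
  then show ?case using edge_subset[of "{y, z}"] by (simp add: adj_def)
qed

lemma reachable_not_jointly_missed:
  assumes missed: "\<forall>v\<in>V. \<exists>N. max_matching N \<and> v \<notin> \<Union>N"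
  shows "(u, v) \<in> adj\<^sup>* \<Longrightarrow> u \<in> V \<Longrightarrow> u = v \<or> \<not> jointly_missed u v"
proof (induction rule: rtrancl_induct)
  case (step y z)
  have yz: "\<not> jointly_missed y z"
    using step(2) adjacent_not_jointly_missed by (simp add: adj_def)
  have yV: "y \<in> V" using reach_in_V[OF step(1) step(4)] .
  show ?case
  proof (cases "u = y \<or> u = z")
    case False
    then have "\<not> jointly_missed u y" using step by simp
    then show ?thesis using jointly_missed_trans[OF _ yz _ bspec[OF missed yV]] False by blast
  qed (use yz in auto)
qed simp

text \<open>Gallai's case, with empty \<open>S\<close>. Two vertices of one component are never
  jointly missed, so \<open>M\<close> misses at most one vertex of each component \<open>C\<close>
  and contains at least \<open>card C div 2\<close> edges inside it.\<close>

lemma tutte_berge_all_missed: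
  assumes missed: "\<forall>v\<in>V. \<exists>N. max_matching N \<and> v \<notin> \<Union>N" and M: "max_matching M"
  shows "\<exists>\<C>. finite \<C> \<and> disjoint \<C> \<and> \<Union>\<C> = V \<and> (\<forall>C\<in>\<C>. connected_in E C) \<and>
    (\<forall>e\<in>E. \<exists>C\<in>\<C>. e \<subseteq> C) \<and> (\<Sum>C\<in>\<C>. card C div 2) \<le> card M"
proof -
  note MD = max_matchingD[OF M]
  define cl where "cl = (\<lambda>u. {v \<in> V. (u, v) \<in> adj\<^sup>*})"
  define \<C> where "\<C> = cl ` V"
  have symr: "(v, u) \<in> adj\<^sup>*" if "(u, v) \<in> adj\<^sup>*" for u v
    using that sym_rtrancl[OF sym_adj] by (auto simp: sym_def)
  have clD: "(u, v) \<in> adj\<^sup>*" "v \<in> V" if "v \<in> cl u" for u v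
    using that unfolding cl_def by blast+
  have self: "u \<in> cl u" if "u \<in> V" for u using that by (simp add: cl_def)
  have cl_eq: "cl u = cl v" if "(u, v) \<in> adj\<^sup>*" for u v
    using rtrancl_trans[OF that] rtrancl_trans[OF symr[OF that]] by (auto simp: cl_def)
  have fin: "finite \<C>" using finV by (simp add: \<C>_def)
  have disj: "disjoint \<C>"
  proof (rule disjointI)
    fix C C' assume CC: "C \<in> \<C>" "C' \<in> \<C>" "C \<noteq> C'"
    then obtain u v where uv: "C = cl u" "C' = cl v" by (auto simp: \<C>_def)
    show "C \<inter> C' = {}"
    proof (rule ccontr)
      assume "C \<inter> C' \<noteq> {}"
      then obtain z where "(u, z) \<in> adj\<^sup>*" "(v, z) \<in> adj\<^sup>*" by (auto simp: uv cl_def)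
      then show False using cl_eq[of u z] cl_eq[of v z] uv CC(3) by simp
    qed
  qed
  have un: "\<Union>\<C> = V" using self by (auto simp: \<C>_def cl_def)
  have con: "connected_in E C" if C: "C \<in> \<C>" for C
    unfolding connected_in_def
  proof (intro conjI allI impI)
    obtain u where u: "u \<in> V" "C = cl u" using C by (auto simp: \<C>_def)
    then show "C \<noteq> {}" using self by blast
    fix A assume A: "A \<subset> C" "A \<noteq> {}"
    then obtain a c where ac: "a \<in> A" "c \<in> C" "c \<notin> A" by blast
    have "a \<in> C" using ac(1) A(1) by (rule subsetD[OF psubset_imp_subset, rotated])
    then have "a \<in> cl u" "c \<in> cl u" using ac(2) by (simp_all only: u(2))
    note r = rtrancl_trans[OF symr[OF clD(1)[OF this(1)]] clD(1)[OF this(2)]]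
    show "\<exists>x\<in>A. \<exists>y\<in>C - A. {x, y} \<in> E"
    proof (rule ccontr)
      assume no: "\<not> ?thesis"
      have "d \<in> A" if "(a, d) \<in> adj\<^sup>*" for d
        using that
      proof (induction rule: rtrancl_induct)
        case (step y z)
        have yz: "{y, z} \<in> E" using step(2) by (simp add: adj_def)
        have "y \<in> cl u" using step(3) A(1) u(2) by blast
        then have "(u, y) \<in> adj\<^sup>*" by (rule clD)
        then have "(u, z) \<in> adj\<^sup>*" using step(2) by (rule rtrancl_into_rtrancl)
        moreover have "z \<in> V" using edge_subset[OF yz] by simp
        ultimately have "z \<in> C" using u(2) by (simp add: cl_def)
        then show ?case using no step(3) yz by blast
      qed (rule ac(1))
      then show False using r ac(3) by blast
    qed
  qed
  have edge_cl: "e \<subseteq> cl u" if e: "e \<in> E" "u \<in> e" for e u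
  proof -
    obtain v where v: "e = {u, v}" using card_edge[OF e(1)] e(2) by (auto simp: card_2_iff)
    then have "(u, v) \<in> adj\<^sup>*" using e(1) by (auto simp: adj_def)
    then show ?thesis using edge_subset[OF e(1)] v by (auto simp: cl_def)
  qed
  have edges: "\<exists>C\<in>\<C>. e \<subseteq> C" if e: "e \<in> E" for e
  proof -
    have "e \<noteq> {}" using card_edge[OF e] by auto
    then obtain u where "u \<in> e" by blast
    then show ?thesis using edge_cl[OF e] edge_subset[OF e] by (auto simp: \<C>_def)
  qed
  have half: "card C div 2 \<le> card {e \<in> M. e \<subseteq> C}" if C: "C \<in> \<C>" for C
  proof -
    obtain u where u: "u \<in> V" "C = cl u" using C by (auto simp: \<C>_def)
    have finC: "finite C" using u(2) finV by (simp add: cl_def)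
    define MC where "MC = {e \<in> M. e \<subseteq> C}"
    have cov: "C \<inter> \<Union>M \<subseteq> \<Union>MC"
    proof
      fix v assume v: "v \<in> C \<inter> \<Union>M"
      then obtain e where e: "e \<in> M" "v \<in> e" by blast
      have "e \<subseteq> cl v" using edge_cl e MD(1) by blast
      also have "cl v = C" using cl_eq[of u v] v u(2) by (simp add: cl_def)
      finally show "v \<in> \<Union>MC" using e by (auto simp: MC_def)
    qed
    have one: "card (C - \<Union>M) \<le> 1"
    proof (rule ccontr)
      assume "\<not> ?thesis"
      then have "2 \<le> card (C - \<Union>M)" by simp
      then obtain T where "T \<subseteq> C - \<Union>M" "card T = 2" by (meson obtain_subset_with_card_n)
      then obtain a b where ab: "a \<in> C" "b \<in> C" "a \<notin> \<Union>M" "b \<notin> \<Union>M" "a \<noteq> b"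
        by (auto simp: card_2_iff)
      have ua: "a \<in> cl u" "b \<in> cl u"
        using ab(1,2) unfolding u(2) by simp_all
      have "(a, b) \<in> adj\<^sup>*"
        by (rule rtrancl_trans[OF symr[OF clD(1)[OF ua(1)]] clD(1)[OF ua(2)]])
      moreover have "a \<in> V" using ua(1) by (rule clD)
      ultimately have "\<not> jointly_missed a b"
        using reachable_not_jointly_missed[OF missed] ab(5) by blast
      then show False using M ab unfolding jointly_missed_def by blast
    qed
    have "card (\<Union>MC) = 2 * card MC"
      by (rule card_matching_vertices) (use MD(1,2) card_edge in \<open>auto simp: MC_def disjoint_def\<close>)
    moreover have "C = (C \<inter> \<Union>M) \<union> (C - \<Union>M)" by blast
    then have "card C \<le> card (C \<inter> \<Union>M) + card (C - \<Union>M)" by (metis card_Un_le)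
    moreover have "card (C \<inter> \<Union>M) \<le> card (\<Union>MC)"
      by (rule card_mono[OF _ cov], rule finite_subset[OF _ finC]) (auto simp: MC_def)
    ultimately show ?thesis using one unfolding MC_def[symmetric] by linarith
  qed
  have "(\<Sum>C\<in>\<C>. card C div 2) \<le> (\<Sum>C\<in>\<C>. card {e \<in> M. e \<subseteq> C})"
    by (rule sum_mono) (rule half)
  also have "\<dots> = card (\<Union>C\<in>\<C>. {e \<in> M. e \<subseteq> C})"
  proof (rule card_UN_disjoint[symmetric, OF fin])
    show "\<forall>C\<in>\<C>. finite {e \<in> M. e \<subseteq> C}" using MD(4) by simp
    show "\<forall>C\<in>\<C>. \<forall>C'\<in>\<C>. C \<noteq> C' \<longrightarrow> {e \<in> M. e \<subseteq> C} \<inter> {e \<in> M. e \<subseteq> C'} = {}"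
    proof (intro ballI impI)
      fix C C' assume "C \<in> \<C>" "C' \<in> \<C>" "C \<noteq> C'"
      then have "C \<inter> C' = {}" using disj by (simp add: disjoint_def)
      moreover have "e \<noteq> {}" if "e \<in> M" for e using card_edge that MD(1) by fastforce
      ultimately show "{e \<in> M. e \<subseteq> C} \<inter> {e \<in> M. e \<subseteq> C'} = {}" by blast
    qed
  qed
  also have "\<dots> \<le> card M"
    by (rule card_mono[OF MD(4)]) blast
  finally show ?thesis using fin disj un con edges by blast
qed

end

text \<open>Either every vertex is missed by some maximum matching, which is Gallai's case, or some
  \<open>v\<close> is covered by all of them. Deleting such a \<open>v\<close> lowers the matching
  number, so the induction hypothesis applies with \<open>card M\<close> in place of
  \<open>t\<close>, and \<open>v\<close> is added to \<open>S\<close>.\<close>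

theorem tutte_berge:
  assumes "finite V" "\<And>e. e \<in> E \<Longrightarrow> e \<subseteq> V" "\<And>e. e \<in> E \<Longrightarrow> card e = 2"
    and "\<And>M. M \<subseteq> E \<Longrightarrow> disjoint M \<Longrightarrow> card M < t"
  shows "\<exists>S \<C>. S \<subseteq> V \<and> finite \<C> \<and> disjoint \<C> \<and> \<Union>\<C> = V - S \<and> (\<forall>C\<in>\<C>. connected_in E C) \<and>
    (\<forall>e\<in>E. e \<inter> S \<noteq> {} \<or> (\<exists>C\<in>\<C>. e \<subseteq> C)) \<and> card S + (\<Sum>C\<in>\<C>. card C div 2) < t"
  using assms
proof (induction "card V" arbitrary: V E t rule: less_induct)
  case less
  interpret finite_graph V E by unfold_locales (fact less.prems)+
  obtain M where M: "max_matching M" using max_matching_exists by (rule exE)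
  note MD = max_matchingD[OF M]
  show ?case
  proof (cases "\<forall>v\<in>V. \<exists>N. max_matching N \<and> v \<notin> \<Union>N")
    case True
    from tutte_berge_all_missed[OF True M] obtain \<C> where
      \<C>: "finite \<C>" "disjoint \<C>" "\<Union>\<C> = V" "\<forall>C\<in>\<C>. connected_in E C"
      "\<forall>e\<in>E. \<exists>C\<in>\<C>. e \<subseteq> C" "(\<Sum>C\<in>\<C>. card C div 2) \<le> card M"
      by (elim exE conjE) (rule that; assumption)
    have "card M < t" using less.prems(4)[OF MD(1,2)] .
    with \<C> show ?thesis
      by (intro exI[of _ "{}"] exI[of _ \<C>] conjI) simp_all
  next
    case False
    then obtain v where v: "v \<in> V" and cov: "\<not> (\<exists>N. max_matching N \<and> v \<notin> \<Union>N)" by blast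
    define E' where "E' = {e \<in> E. v \<notin> e}"
    have small: "card N < card M" if N: "N \<subseteq> E'" "disjoint N" for N
    proof (rule ccontr)
      assume "\<not> ?thesis"
      moreover have NE: "N \<subseteq> E" using N(1) by (auto simp: E'_def)
      ultimately have "card N = card M" using MD(3)[OF NE N(2)] by simp
      then have "max_matching N"
        using N(2) NE MD(3) unfolding max_matching_def by simp
      then show False using cov N(1) unfolding E'_def by blast
    qed
    have "card (V - {v}) < card V" using v finV by (intro psubset_card_mono) auto
    then have "\<exists>S \<C>. S \<subseteq> V - {v} \<and> finite \<C> \<and> disjoint \<C> \<and> \<Union>\<C> = V - {v} - S \<and>
        (\<forall>C\<in>\<C>. connected_in E' C) \<and> (\<forall>e\<in>E'. e \<inter> S \<noteq> {} \<or> (\<exists>C\<in>\<C>. e \<subseteq> C)) \<and>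
        card S + (\<Sum>C\<in>\<C>. card C div 2) < card M"
    proof (rule less.hyps)
      show "finite (V - {v})" using finV by simp
      show "e \<subseteq> V - {v}" if "e \<in> E'" for e using that edge_subset[of e] by (auto simp: E'_def)
      show "card e = 2" if "e \<in> E'" for e using that card_edge[of e] by (simp add: E'_def)
    qed (rule small)
    then obtain S \<C> where IH: "S \<subseteq> V - {v}" "finite \<C>" "disjoint \<C>" "\<Union>\<C> = V - {v} - S"
      "\<forall>C\<in>\<C>. connected_in E' C" "\<forall>e\<in>E'. e \<inter> S \<noteq> {} \<or> (\<exists>C\<in>\<C>. e \<subseteq> C)"
      "card S + (\<Sum>C\<in>\<C>. card C div 2) < card M"
      by (elim exE conjE) (rule that; assumption)
    have "card M < t" using less.prems(4)[OF MD(1,2)] .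
    moreover have "card (insert v S) = card S + 1"
      using IH(1) finite_subset[OF IH(1)] finV by (subst card_insert_disjoint) auto
    ultimately have "card (insert v S) + (\<Sum>C\<in>\<C>. card C div 2) < t" using IH(7) by simp
    moreover have "\<forall>C\<in>\<C>. connected_in E C"
      using IH(5) connected_in_mono[of E' _ E] by (auto simp: E'_def)
    moreover have "e \<inter> insert v S \<noteq> {} \<or> (\<exists>C\<in>\<C>. e \<subseteq> C)" if "e \<in> E" for e
    proof (cases "v \<in> e")
      case False
      then have "e \<in> E'" using that by (simp add: E'_def)
      then show ?thesis using IH(6) by blast
    qed auto
    ultimately show ?thesis
      using IH(1-4) v by (intro exI[of _ "insert v S"] exI[of _ \<C>] conjI ballI) auto
  qed
qed

section \<open>Planar graphs without a large matching\<close>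

definition induced :: "'a set set \<Rightarrow> 'a set \<Rightarrow> 'a set set" where
  "induced E A = {e \<in> E. e \<subseteq> A}"

definition cross :: "'a set set \<Rightarrow> 'a set \<Rightarrow> 'a set \<Rightarrow> 'a set set" where
  "cross E A B = {e \<in> E. \<exists>a\<in>A. \<exists>b\<in>B. e = {a, b}}"

definition nbrs :: "'a set set \<Rightarrow> 'a set \<Rightarrow> 'a set \<Rightarrow> 'a set" where
  "nbrs E A B = {b \<in> B. \<exists>a\<in>A. {a, b} \<in> E}"

lemma connected_in_insert:
  assumes con: "connected_in E A" and "u \<in> A" "{u, v} \<in> E"
  shows "connected_in E (insert v A)"
proof (cases "v \<in> A")
  case True
  then show ?thesis using con by (simp add: insert_absorb)
next
  case False
  have "\<exists>x\<in>B. \<exists>y\<in>insert v A - B. {x, y} \<in> E" if B: "B \<subset> insert v A" "B \<noteq> {}" for B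
  proof (cases "B \<inter> A = {} \<or> A \<subseteq> B")
    case True
    then consider "B \<inter> A = {}" | "A \<subseteq> B" by blast
    then show ?thesis
    proof cases
      case 1
      then have "v \<in> B" "u \<notin> B" using B assms(2) by blast+
      moreover have "{v, u} \<in> E" using assms(3) by (simp add: insert_commute)
      ultimately show ?thesis using assms(2) by blast
    next
      case 2
      then have "v \<notin> B" using B(1) by blast
      then show ?thesis using 2 assms(2,3) by blast
    qed
  next
    case False
    then have "B \<inter> A \<subset> A" "B \<inter> A \<noteq> {}" by blast+
    then obtain x y where "x \<in> B \<inter> A" "y \<in> A - B \<inter> A" "{x, y} \<in> E"
      using con unfolding connected_in_def by metis
    then show ?thesis by blast
  qed
  then show ?thesis unfolding connected_in_def by simp
qed

section \<open>Edge bounds after contracting connected sets\<close>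

locale planar_edges =
  fixes V :: "'a set" and E :: "'a set set"
  assumes planar: "planar (V, E)"
begin

lemmas finite_V = planarD(1)[OF planar] and finite_E = planarD(2)[OF planar]
  and edge_sub = planarD(3)[OF planar] and edge_card = planarD(4)[OF planar]

lemma finite_sub: "A \<subseteq> V \<Longrightarrow> finite A"
  by (rule finite_subset[OF _ finite_V])

lemma finite_induced [simp]: "finite (induced E A)" and finite_cross [simp]: "finite (cross E A B)"
  using finite_E by (simp_all add: induced_def cross_def)

lemma edge_doubleton:
  assumes "e \<in> E" "x \<in> e" obtains y where "e = {x, y}" "x \<noteq> y"
  using edge_card[OF assms(1)] assms(2) by (auto simp: card_2_iff)

lemma minor_bound:
  assumes R: "R \<subseteq> V" "3 \<le> card R" and P: "\<And>i. i \<in> R \<Longrightarrow> P i \<subseteq> V" "\<And>i. i \<in> R \<Longrightarrow> connected_in E (P i)"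
    and "\<And>i j. i \<in> R \<Longrightarrow> j \<in> R \<Longrightarrow> i \<noteq> j \<Longrightarrow> P i \<inter> P j = {}"
    and "\<And>q. q \<in> Q \<Longrightarrow> \<exists>i\<in>R. \<exists>j\<in>R. q = {i, j} \<and> i \<noteq> j \<and> (\<exists>u\<in>P i. \<exists>v\<in>P j. {u, v} \<in> E)"
  shows "card Q + 6 \<le> 3 * card R"
  by (rule planar_minor_edge_bound[OF planar finite_sub[OF R(1)] R(2) P assms(5,6)])

lemma edge_bound:
  assumes "Q \<subseteq> E" "\<Union>Q \<subseteq> A" "A \<subseteq> V" "3 \<le> card A"
  shows "card Q + 6 \<le> 3 * card A"
proof (rule minor_bound[OF assms(3,4), of "\<lambda>i. {i}"])
  fix q assume q: "q \<in> Q"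
  then have "q \<in> E" "q \<subseteq> A" using assms(1,2) by blast+
  then obtain a b where "q = {a, b}" "a \<noteq> b" using edge_card by (meson card_2_iff)
  then show "\<exists>i\<in>A. \<exists>j\<in>A. q = {i, j} \<and> i \<noteq> j \<and> (\<exists>u\<in>{i}. \<exists>v\<in>{j}. {u, v} \<in> E)"
    using \<open>q \<in> E\<close> \<open>q \<subseteq> A\<close> by auto
qed (use assms(3) in auto)

lemma induced_bound:
  assumes "A \<subseteq> V" "3 \<le> card A"
  shows "card (induced E A) + 6 \<le> 3 * card A"
  by (rule edge_bound) (use assms in \<open>auto simp: induced_def\<close>)

lemma bipartite_bound:
  assumes "Q \<subseteq> E" "\<And>q. q \<in> Q \<Longrightarrow> \<exists>a\<in>A. \<exists>b\<in>B. q = {a, b}"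
    and "A \<subseteq> V" "B \<subseteq> V" "A \<inter> B = {}" "3 \<le> card A + card B"
  shows "card Q + 4 \<le> 2 * (card A + card B)"
proof (rule planar_minor_bipartite_bound[OF planar finite_sub[OF assms(3)] finite_sub[OF assms(4)] assms(5,6), of "\<lambda>i. {i}"])
  fix q assume q: "q \<in> Q"
  then obtain a b where "a \<in> A" "b \<in> B" "q = {a, b}" using assms(2) by blast
  then show "\<exists>i\<in>A. \<exists>j\<in>B. q = {i, j} \<and> (\<exists>u\<in>{i}. \<exists>v\<in>{j}. {u, v} \<in> E)"
    using q assms(1) by auto
qed (use assms(3,4) in auto)

lemma cross_bound:
  assumes "A \<subseteq> V" "B \<subseteq> V" "A \<inter> B = {}" "3 \<le> card A + card B"
  shows "card (cross E A B) + 4 \<le> 2 * (card A + card B)"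
  by (rule bipartite_bound[OF _ _ assms]) (auto simp: cross_def)

text \<open>The connected set \<^term>\<open>P\<close> is contracted onto its vertex \<^term>\<open>y\<close>.\<close>

lemma virtual_edge_bound:
  assumes R: "R \<subseteq> V" "3 \<le> card R" and yz: "z \<in> R" "z \<noteq> y"
    and P: "P \<subseteq> V" "connected_in E P" "P \<inter> R = {y}" and adj: "\<exists>u\<in>P. {u, z} \<in> E"
  shows "card (insert {y, z} (induced E R)) + 6 \<le> 3 * card R"
proof -
  define PP where "PP = (\<lambda>i. if i = y then P else {i})"
  have y: "y \<in> R" "y \<in> P" using P(3) by blast+
  have own: "i \<in> PP i" for i using y by (simp add: PP_def)
  show ?thesis
  proof (rule minor_bound[OF R, of PP])
    show "PP i \<subseteq> V" if "i \<in> R" for i using that R(1) P(1) by (auto simp: PP_def)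
    show "connected_in E (PP i)" for i using P(2) by (simp add: PP_def)
    show "PP i \<inter> PP j = {}" if "i \<in> R" "j \<in> R" "i \<noteq> j" for i j
      using that P(3) by (auto simp: PP_def)
    fix q assume q: "q \<in> insert {y, z} (induced E R)"
    show "\<exists>i\<in>R. \<exists>j\<in>R. q = {i, j} \<and> i \<noteq> j \<and> (\<exists>u\<in>PP i. \<exists>v\<in>PP j. {u, v} \<in> E)"
    proof (cases "q = {y, z}")
      case True
      obtain u where "u \<in> P" "{u, z} \<in> E" using adj by blast
      then have "\<exists>u\<in>PP y. \<exists>v\<in>PP z. {u, v} \<in> E" using yz(2) by (auto simp: PP_def)
      then show ?thesis using True y(1) yz by blast
    next
      case False
      then have qE: "q \<in> E" "q \<subseteq> R" using q by (auto simp: induced_def)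
      then obtain a b where ab: "q = {a, b}" "a \<noteq> b" using edge_card by (meson card_2_iff)
      then have "\<exists>u\<in>PP a. \<exists>v\<in>PP b. {u, v} \<in> E" using own[of a] own[of b] qE(1) by blast
      then show ?thesis using ab qE(2) by auto
    qed
  qed
qed

text \<open>The bipartite bound with \<open>S\<close> on one side and, on the other,
  \<open>I\<close> and one new vertex per contracted set \<open>P r\<close>; the index
  \<open>r\<close> serves as name of that vertex. Every neighbour of \<open>P r\<close> in
  \<open>S\<close> contributes one edge.\<close>

lemma contracted_bipartite_bound:
  assumes S: "S \<subseteq> V" "I \<subseteq> V" "R \<subseteq> V" "S \<inter> I = {}" "R \<inter> (S \<union> I) = {}"
    and P: "\<And>r. r \<in> R \<Longrightarrow> P r \<subseteq> V - (S \<union> I)" "\<And>r. r \<in> R \<Longrightarrow> connected_in E (P r)"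
    and disj: "\<And>r r'. r \<in> R \<Longrightarrow> r' \<in> R \<Longrightarrow> r \<noteq> r' \<Longrightarrow> P r \<inter> P r' = {}"
    and three: "3 \<le> card S + card I + card R"
  shows "(\<Sum>r\<in>R. card (nbrs E (P r) S)) + card (cross E S I) + 4 \<le> 2 * (card S + card I + card R)"
proof -
  define PP where "PP = (\<lambda>i. if i \<in> R then P i else {i})"
  define Q2 where "Q2 = (\<Union>r\<in>R. (\<lambda>x. {x, r}) ` nbrs E (P r) S)"
  have fin: "finite S" "finite I" "finite R" using S finite_sub by auto
  have finN: "finite (nbrs E (P r) S)" for r using fin(1) by (simp add: nbrs_def)
  have cIR: "card (I \<union> R) = card I + card R" using fin S(5) by (intro card_Un_disjoint) auto
  have inj: "inj_on (\<lambda>x. {x, r}) (nbrs E (P r) S)" if r: "r \<in> R" for r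
  proof (rule inj_onI)
    fix a b assume "a \<in> nbrs E (P r) S" "b \<in> nbrs E (P r) S" "{a, r} = {b, r}"
    then show "a = b" by (auto simp: doubleton_eq_iff)
  qed
  have "card Q2 = (\<Sum>r\<in>R. card ((\<lambda>x. {x, r}) ` nbrs E (P r) S))"
    unfolding Q2_def
  proof (rule card_UN_disjoint[OF fin(3)])
    show "\<forall>r\<in>R. \<forall>r'\<in>R. r \<noteq> r' \<longrightarrow> (\<lambda>x. {x, r}) ` nbrs E (P r) S \<inter> (\<lambda>x. {x, r'}) ` nbrs E (P r') S = {}"
    proof (intro ballI impI)
      fix r r' assume r: "r \<in> R" "r' \<in> R" "r \<noteq> r'"
      then have "r \<notin> S" "r' \<notin> S" using S(5) by blast+
      then show "(\<lambda>x. {x, r}) ` nbrs E (P r) S \<inter> (\<lambda>x. {x, r'}) ` nbrs E (P r') S = {}"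
        using r(3) by (auto simp: nbrs_def doubleton_eq_iff)
    qed
  qed (use finN in auto)
  also have "\<dots> = (\<Sum>r\<in>R. card (nbrs E (P r) S))"
    by (rule sum.cong[OF refl]) (rule card_image[OF inj])
  finally have cQ2: "card Q2 = (\<Sum>r\<in>R. card (nbrs E (P r) S))" .
  have finQ2: "finite Q2" using fin(3) finN by (simp add: Q2_def)
  have disjQ: "cross E S I \<inter> Q2 = {}"
  proof (rule ccontr)
    assume "cross E S I \<inter> Q2 \<noteq> {}"
    then obtain q where q: "q \<in> cross E S I" "q \<in> Q2" by blast
    then have "q \<subseteq> S \<union> I" by (auto simp: cross_def)
    moreover obtain r where "r \<in> R" "r \<in> q" using q(2) by (auto simp: Q2_def)
    ultimately show False using S(5) by blast
  qed
  have "card (cross E S I \<union> Q2) + 4 \<le> 2 * (card S + card (I \<union> R))"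
  proof (rule planar_minor_bipartite_bound[OF planar fin(1), where P = PP])
    show "finite (I \<union> R)" using fin by simp
    show "S \<inter> (I \<union> R) = {}" using S(4,5) by blast
    show "3 \<le> card S + card (I \<union> R)" using three cIR by simp
    show "PP i \<subseteq> V" if "i \<in> S \<union> (I \<union> R)" for i
      using that S(1,2) P(1)[of i] by (cases "i \<in> R") (auto simp: PP_def)
    show "connected_in E (PP i)" if "i \<in> S \<union> (I \<union> R)" for i
      using P(2) by (simp add: PP_def)
    show "PP i \<inter> PP j = {}" if ij: "i \<in> S \<union> (I \<union> R)" "j \<in> S \<union> (I \<union> R)" "i \<noteq> j" for i j
    proof (cases "i \<in> R"; cases "j \<in> R")
      assume "i \<in> R" "j \<in> R"
      then show ?thesis using disj ij(3) by (simp add: PP_def)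
    next
      assume "i \<in> R" "j \<notin> R"
      then show ?thesis using P(1)[of i] ij(2) by (auto simp: PP_def)
    next
      assume "i \<notin> R" "j \<in> R"
      then show ?thesis using P(1)[of j] ij(1) by (auto simp: PP_def)
    next
      assume "i \<notin> R" "j \<notin> R"
      then show ?thesis using ij(3) by (simp add: PP_def)
    qed
    fix q assume "q \<in> cross E S I \<union> Q2"
    then consider a b where "a \<in> S" "b \<in> I" "q = {a, b}" "q \<in> E"
      | r x where "r \<in> R" "x \<in> nbrs E (P r) S" "q = {x, r}"
      unfolding cross_def Q2_def by blast
    then show "\<exists>i\<in>S. \<exists>j\<in>I \<union> R. q = {i, j} \<and> (\<exists>u\<in>PP i. \<exists>v\<in>PP j. {u, v} \<in> E)"
    proof cases
      case 1
      then have "PP a = {a}" "PP b = {b}" using S(5) by (auto simp: PP_def)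
      then have "\<exists>u\<in>PP a. \<exists>v\<in>PP b. {u, v} \<in> E" using 1 by simp
      then show ?thesis using 1(1-3) by blast
    next
      case 2
      then obtain c where c: "c \<in> P r" "{c, x} \<in> E" "x \<in> S" by (auto simp: nbrs_def)
      have "PP x = {x}" "PP r = P r" using c(3) S(5) 2(1) by (auto simp: PP_def)
      moreover have "{x, c} \<in> E" using c(2) by (simp add: insert_commute)
      ultimately have "\<exists>u\<in>PP x. \<exists>v\<in>PP r. {u, v} \<in> E" using c(1) by blast
      then show ?thesis using 2 c(3) by blast
    qed
  qed
  moreover have "card (cross E S I \<union> Q2) = card (cross E S I) + card Q2"
    using finQ2 disjQ by (simp add: card_Un_disjoint)
  ultimately show ?thesis using cQ2 cIR by simp
qed

text \<open>A bipartite planar graph on \<open>k\<close> vertices misses \<open>2 k\<close> by at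
  least 2, 3 or 4 edges for \<open>k = 1\<close>, \<open>k = 2\<close>, \<open>k \<ge> 3\<close>. A
  disconnected graph pays this twice: at least 6 in total for five or more vertices and at least 5
  for three or more, beyond what \<open>dense\<close> permits.\<close>

lemma dense_bipartite_connected:
  assumes S: "S \<subseteq> V" "I \<subseteq> V" "S \<inter> I = {}" 
    and dense: "5 \<le> card S + card I \<and> 2 * (card S + card I) \<le> card (cross E S I) + 5 \<or>
      3 \<le> card S + card I \<and> 2 * (card S + card I) \<le> card (cross E S I) + 4"
  shows "connected_in E (S \<union> I)"
proof -
  have fin: "finite S" "finite I" using S finite_sub by auto
  have small: "card (cross E A B) + (if card A + card B = 1 then 2 else if card A + card B = 2 then 3 else 4)
      \<le> 2 * (card A + card B)"
    if AB: "A \<subseteq> S" "B \<subseteq> I" "A \<union> B \<noteq> {}" for A B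
  proof -
    have finAB: "finite A" "finite B" using AB fin finite_subset by blast+
    have "card A + card B \<noteq> 0" using AB(3) finAB by simp
    then consider "card A = 0" | "card B = 0" | "card A = 1" "card B = 1" | "3 \<le> card A + card B" by linarith
    then show ?thesis
    proof cases
      case 3
      then obtain a b where "A = {a}" "B = {b}" by (meson card_1_singletonE)
      then have "cross E A B \<subseteq> {{a, b}}" by (auto simp: cross_def)
      then have "card (cross E A B) \<le> card {{a, b}}" by (rule card_mono[rotated]) simp
      then show ?thesis using 3 by simp
    next
      case 4
      have "A \<subseteq> V" "B \<subseteq> V" "A \<inter> B = {}" using AB(1,2) S by blast+
      then show ?thesis using cross_bound[of A B] 4 by simp
    next
      case 1
      then have "cross E A B = {}" using finAB by (auto simp: cross_def)
      then show ?thesis using \<open>card A + card B \<noteq> 0\<close> by simp arith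
    next
      case 2
      then have "cross E A B = {}" using finAB by (auto simp: cross_def)
      then show ?thesis using \<open>card A + card B \<noteq> 0\<close> by simp arith
    qed
  qed
  have "\<exists>u\<in>A. \<exists>v\<in>S \<union> I - A. {u, v} \<in> E" if A: "A \<subset> S \<union> I" "A \<noteq> {}" for A
  proof (rule ccontr)
    assume no: "\<not> ?thesis"
    define A1 where "A1 = S \<inter> A" define A2 where "A2 = I \<inter> A"
    define B1 where "B1 = S - A" define B2 where "B2 = I - A"
    have "cross E S I \<subseteq> cross E A1 A2 \<union> cross E B1 B2"
    proof
      fix e assume "e \<in> cross E S I"
      then obtain a b where ab: "e \<in> E" "a \<in> S" "b \<in> I" "e = {a, b}" by (auto simp: cross_def)
      have "a \<in> A \<longleftrightarrow> b \<in> A"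
        using no ab by (metis DiffI UnCI insert_commute)
      then show "e \<in> cross E A1 A2 \<union> cross E B1 B2"
        using ab by (auto simp: cross_def A1_def A2_def B1_def B2_def)
    qed
    then have "card (cross E S I) \<le> card (cross E A1 A2 \<union> cross E B1 B2)"
      by (rule card_mono[rotated]) simp
    also have "\<dots> \<le> card (cross E A1 A2) + card (cross E B1 B2)" by (rule card_Un_le)
    finally have c: "card (cross E S I) \<le> card (cross E A1 A2) + card (cross E B1 B2)" .
    have cS: "card S = card A1 + card B1" "card I = card A2 + card B2"
      using fin by (simp_all add: A1_def A2_def B1_def B2_def card_Int_Diff)
    have "A1 \<union> A2 \<noteq> {}" "B1 \<union> B2 \<noteq> {}" using A by (auto simp: A1_def A2_def B1_def B2_def)
    moreover have "A1 \<subseteq> S" "A2 \<subseteq> I" "B1 \<subseteq> S" "B2 \<subseteq> I"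
      by (auto simp: A1_def A2_def B1_def B2_def)
    ultimately show False
      using small[of A1 A2] small[of B1 B2] c cS dense by (simp split: if_splits)
  qed
  moreover have "S \<union> I \<noteq> {}" using dense by auto
  ultimately show ?thesis unfolding connected_in_def by blast
qed

text \<open>A largest connected \<open>P\<close> that contains \<open>y\<close> and avoids
  \<open>z\<close> is left by some edge; this edge must lead to \<open>z\<close>, since otherwise
  \<open>P\<close> could grow. Contracting such a \<open>P\<close> onto \<open>y\<close> creates the
  edge \<open>{y, z}\<close>.\<close>

lemma connected_avoiding:
  assumes con: "connected_in E U" and U: "U \<subseteq> V" "y \<in> U" "z \<in> U" "y \<noteq> z"
  obtains P where "P \<subseteq> U - {z}" "y \<in> P" "connected_in E P" "\<exists>u\<in>P. {u, z} \<in> E"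
proof -
  define A where "A = {P. P \<subseteq> U - {z} \<and> y \<in> P \<and> connected_in E P}"
  have "A \<subseteq> Pow V" using U(1) by (auto simp: A_def)
  then have "finite A" using finite_V by (metis finite_Pow_iff finite_subset)
  moreover have "{y} \<in> A" using U by (simp add: A_def)
  then have "A \<noteq> {}" by blast
  ultimately obtain P where P: "P \<in> A" and best: "\<forall>P'\<in>A. card P' \<le> card P"
    by (rule finite_has_max[where f = card])
  have PA: "P \<subseteq> U - {z}" "y \<in> P" "connected_in E P" using P by (simp_all add: A_def)
  have "P \<subset> U" "P \<noteq> {}" using PA U(3) by blast+
  then obtain u v where uv: "u \<in> P" "v \<in> U - P" "{u, v} \<in> E"
    using con unfolding connected_in_def by metis
  have "v = z"
  proof (rule ccontr)
    assume "v \<noteq> z"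
    then have "insert v P \<in> A"
      using PA uv connected_in_insert[OF PA(3) uv(1,3)] by (simp add: A_def)
    then have "card (insert v P) \<le> card P" using best by blast
    moreover have "finite P" using PA(1) U(1) by (intro finite_sub) blast
    ultimately show False using uv(2) by simp
  qed
  then show thesis using that[OF PA] uv by blast
qed

end

text \<open>Any two of the sets share at least \<open>7 - 5 = 2\<close> elements. As the sizes add
  up to 7, one set has at most two elements and is therefore contained in both others.\<close>

lemma common_pair_of_three_sets:
  assumes fin: "finite A" "finite B" "finite C" and sum: "card A + card B + card C = 7"
    and "card (A \<union> B) + card C \<le> 5" "card (A \<union> C) + card B \<le> 5" "card (B \<union> C) + card A \<le> 5"
  shows "\<exists>y z. y \<noteq> z \<and> {y, z} \<subseteq> A \<inter> B \<inter> C"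
proof -
  have AB: "2 \<le> card (A \<inter> B)" and AC: "2 \<le> card (A \<inter> C)" and BC: "2 \<le> card (B \<inter> C)"
    using card_Un_Int[OF fin(1,2)] card_Un_Int[OF fin(1,3)] card_Un_Int[OF fin(2,3)] assms(4-7) by linarith+
  have *: "\<exists>y z. y \<noteq> z \<and> {y, z} \<subseteq> X"
    if "finite X" "card X \<le> 2" "2 \<le> card (X \<inter> Y)" "2 \<le> card (X \<inter> Z)" for X :: "'a set" and Y Z
  proof -
    have "card (X \<inter> Y) \<le> card X" by (rule card_mono) (use that(1) in auto)
    then have "card X = 2" using that(2,3) by linarith
    then show ?thesis by (auto simp: card_2_iff)
  qed
  have sub: "X \<subseteq> Y" if "finite X" "card X \<le> 2" "2 \<le> card (X \<inter> Y)" for X Y :: "'a set"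
    using card_seteq[of X "X \<inter> Y"] that by auto
  consider "card A \<le> 2" | "card B \<le> 2" | "card C \<le> 2" using sum by linarith
  then show ?thesis
  proof cases
    case 1
    then have "A \<subseteq> B" "A \<subseteq> C" using sub[OF fin(1)] AB AC by auto
    then have "A \<inter> B \<inter> C = A" by blast
    then show ?thesis using *[OF fin(1) 1 AB AC] by simp
  next
    case 2
    then have "B \<subseteq> A" "B \<subseteq> C" using sub[OF fin(2)] AB BC by (auto simp: Int_commute)
    then have "A \<inter> B \<inter> C = B" by blast
    then show ?thesis using *[OF fin(2) 2 _ BC, of A] AB by (simp add: Int_commute)
  next
    case 3
    then have "C \<subseteq> A" "C \<subseteq> B" using sub[OF fin(3)] AC BC by (auto simp: Int_commute)
    then have "A \<inter> B \<inter> C = C" by blast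
    then show ?thesis using *[OF fin(3) 3, of A B] AC BC by (simp add: Int_commute)
  qed
qed

context planar_edges
begin

text \<open>\<open>T\<close> collects the edges inside \<open>U\<close> that meet \<open>C\<close>.
  If the two neighbours \<open>y\<close>, \<open>z\<close> of \<open>C\<close> are adjacent, their
  edge is not in \<open>T\<close>, so \<open>T\<close> falls one short of its bound. If they are not
  adjacent, contracting \<open>C\<close> would add \<open>{y, z}\<close> to the rest, so the rest
  falls one short. When only one edge is missing in total, the other half is tight, which is what
  the second claim records.\<close>

lemma cut_cases:
  assumes U: "U \<subseteq> V" "C \<subseteq> U" "connected_in E C" "2 \<le> card C" "3 \<le> card (U - C)"
    and X: "X = nbrs E C (U - C)" "card X \<le> 2"
  shows "card (induced E U) + 7 \<le> 3 * card U"
    and "card (induced E U) + 7 = 3 * card U \<Longrightarrow> \<exists>y z. X = {y, z} \<and> y \<noteq> z \<and>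
      ({y, z} \<in> E \<and> card (induced E (U - C)) + 6 = 3 * card (U - C) \<or>
       {y, z} \<notin> E \<and> card (induced E (C \<union> {y, z})) = 3 * card C)"
proof -
  define R where "R = U - C"
  define T where "T = induced E (C \<union> X) - induced E X"
  have CV: "C \<subseteq> V" "R \<subseteq> V" using U by (auto simp: R_def)
  have XR: "X \<subseteq> R" by (auto simp: X nbrs_def R_def)
  have fin: "finite C" "finite R" "finite X" using finite_sub CV XR by (meson order_trans)+
  have cU: "card U = card C + card R"
    using U(2) fin by (metis R_def card_Un_disjoint Diff_disjoint Un_Diff_cancel Un_absorb1)
  have cCX: "card (C \<union> X) = card C + card X"
    using XR fin by (intro card_Un_disjoint) (auto simp: R_def)
  have CXV: "C \<union> X \<subseteq> V" using CV XR by blast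
  have "induced E U \<subseteq> T \<union> induced E R"
  proof
    fix e assume "e \<in> induced E U"
    then have e: "e \<in> E" "e \<subseteq> U" by (auto simp: induced_def)
    show "e \<in> T \<union> induced E R"
    proof (cases "e \<inter> C = {}")
      case True
      then show ?thesis using e by (auto simp: induced_def R_def)
    next
      case False
      then obtain a where a: "a \<in> e" "a \<in> C" by blast
      obtain b where b: "e = {a, b}" using edge_doubleton[OF e(1) a(1)] by metis
      have "b \<in> C \<union> X"
        using a(2) b e by (auto simp: X nbrs_def)
      moreover have "a \<notin> X" using a(2) XR by (auto simp: R_def)
      ultimately show ?thesis using a(2) b e(1) by (auto simp: T_def induced_def)
    qed
  qed
  then have "card (induced E U) \<le> card (T \<union> induced E R)"
    by (rule card_mono[rotated]) (simp add: T_def)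
  also have "\<dots> \<le> card T + card (induced E R)" by (rule card_Un_le)
  finally have le: "card (induced E U) \<le> card T + card (induced E R)" .
  have R3: "3 \<le> card R" using U(5) by (simp add: R_def)
  have iR: "card (induced E R) + 6 \<le> 3 * card R" by (rule induced_bound[OF CV(2) R3])
  have TCX: "card T \<le> card (induced E (C \<union> X))"
    unfolding T_def by (rule card_mono) auto
  have iCX: "3 \<le> card (C \<union> X) \<Longrightarrow> card (induced E (C \<union> X)) + 6 \<le> 3 * card C + 3 * card X"
    using induced_bound[OF CXV] cCX by simp
  have two: "\<exists>y z. X = {y, z} \<and> y \<noteq> z \<and> card T + card (induced E R) + 7 \<le> 3 * card U \<and>
      ({y, z} \<in> E \<and> card T + 1 \<le> 3 * card C \<or>
       {y, z} \<notin> E \<and> card (induced E R) + 7 \<le> 3 * card R \<and> card T \<le> 3 * card C)" if X2: "card X = 2"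
  proof -
    obtain y z where yz: "X = {y, z}" "y \<noteq> z" using X2 by (auto simp: card_2_iff)
    have b: "card (induced E (C \<union> X)) \<le> 3 * card C" using iCX cCX X2 U(4) by simp
    show ?thesis
    proof (cases "{y, z} \<in> E")
      case True
      then have "{y, z} \<in> induced E (C \<union> X)" "{y, z} \<notin> T" by (auto simp: induced_def T_def yz)
      then have "insert {y, z} T \<subseteq> induced E (C \<union> X)" by (auto simp: T_def)
      then have "card (insert {y, z} T) \<le> card (induced E (C \<union> X))" by (rule card_mono[rotated]) simp
      then have "card T + 1 \<le> 3 * card C" using b \<open>{y, z} \<notin> T\<close> by (simp add: T_def)
      then show ?thesis using True yz iR cU by (intro exI[of _ y] exI[of _ z]) simp
    next
      case False
      obtain c where c: "c \<in> C" "{c, y} \<in> E" using yz X(1) by (auto simp: nbrs_def)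
      obtain c' where c': "c' \<in> C" "{c', z} \<in> E" using yz X(1) by (auto simp: nbrs_def)
      have "card (insert {y, z} (induced E R)) + 6 \<le> 3 * card R"
      proof (rule virtual_edge_bound[OF CV(2) R3, of z y "insert y C"])
        show "connected_in E (insert y C)" by (rule connected_in_insert[OF U(3) c])
      qed (use yz XR CV c' in \<open>auto simp: R_def\<close>)
      moreover have "{y, z} \<notin> induced E R" using False by (simp add: induced_def)
      ultimately have "card (induced E R) + 7 \<le> 3 * card R" by simp
      then show ?thesis using False yz TCX b cU by (intro exI[of _ y] exI[of _ z]) simp
    qed
  qed
  \<comment> \<open>At most one neighbour costs three edges, so equality in the bound forces exactly
    two.\<close>
  have one: "card T + 3 \<le> 3 * card C" if "card X \<le> 1"
  proof (cases "3 \<le> card (C \<union> X)")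
    case True
    then show ?thesis using iCX TCX that by simp
  next
    case False
    then have c2: "card (C \<union> X) = 2" "card C = 2" using cCX U(4) by linarith+
    have "induced E (C \<union> X) \<subseteq> {C \<union> X}"
    proof
      fix e assume "e \<in> induced E (C \<union> X)"
      then have "e \<subseteq> C \<union> X" "card e = 2" using edge_card by (auto simp: induced_def)
      then have "e = C \<union> X" using card_seteq[of "C \<union> X" e] fin c2 by simp
      then show "e \<in> {C \<union> X}" by simp
    qed
    then have "card (induced E (C \<union> X)) \<le> card {C \<union> X}" by (rule card_mono[rotated]) simp
    then show ?thesis using TCX c2 by simp
  qed
  show "card (induced E U) + 7 \<le> 3 * card U"
  proof (cases "card X = 2")
    case True
    then show ?thesis using two le by auto
  next
    case False
    then show ?thesis using one le iR cU X(2) by simp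
  qed
  assume eq: "card (induced E U) + 7 = 3 * card U"
  then have "card X = 2" using one le iR cU X(2) by (cases "card X = 2") auto
  from two[OF this] obtain y z where yz: "X = {y, z}" "y \<noteq> z"
    and d: "{y, z} \<in> E \<and> card T + 1 \<le> 3 * card C \<or>
       {y, z} \<notin> E \<and> card (induced E R) + 7 \<le> 3 * card R \<and> card T \<le> 3 * card C" by blast
  have b: "card (induced E (C \<union> X)) \<le> 3 * card C" using iCX cCX \<open>card X = 2\<close> U(4) by simp
  from d show "\<exists>y z. X = {y, z} \<and> y \<noteq> z \<and>
      ({y, z} \<in> E \<and> card (induced E (U - C)) + 6 = 3 * card (U - C) \<or>
       {y, z} \<notin> E \<and> card (induced E (C \<union> {y, z})) = 3 * card C)"
  proof
    assume "{y, z} \<in> E \<and> card T + 1 \<le> 3 * card C"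
    then have "{y, z} \<in> E \<and> card (induced E (U - C)) + 6 = 3 * card (U - C)"
      using le iR cU eq by (simp add: R_def[symmetric])
    then show ?thesis using yz by blast
  next
    assume "{y, z} \<notin> E \<and> card (induced E R) + 7 \<le> 3 * card R \<and> card T \<le> 3 * card C"
    then have "{y, z} \<notin> E \<and> card (induced E (C \<union> {y, z})) = 3 * card C"
      using le cU eq TCX b yz(1) by auto
    then show ?thesis using yz by blast
  qed
qed

text \<open>The dense bipartite graph between \<open>S\<close> and \<open>I\<close> is connected, so
  \<open>y\<close> and \<open>z\<close> are linked outside \<open>C\<close>. Contracting this link
  onto \<open>y\<close> puts the edge \<open>{y, z}\<close> into \<open>C \<union> {y, z}\<close>,
  whose bound is \<open>3 * (card C + 2) - 6\<close>. It rules out the nonadjacent alternative of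
  \<open>cut_cases\<close>.\<close>

lemma no_outside_path:
  assumes S: "S \<subseteq> V" "I \<subseteq> V" "C \<subseteq> V" "S \<inter> I = {}" "C \<inter> (S \<union> I) = {}" and "2 \<le> card C"
    and dense: "5 \<le> card S + card I \<and> 2 * (card S + card I) \<le> card (cross E S I) + 5 \<or>
      3 \<le> card S + card I \<and> 2 * (card S + card I) \<le> card (cross E S I) + 4"
    and yz: "y \<in> S" "z \<in> S" "y \<noteq> z"
  shows "card (insert {y, z} (induced E (C \<union> {y, z}))) \<le> 3 * card C"
proof -
  have con: "connected_in E (S \<union> I)" by (rule dense_bipartite_connected[OF S(1,2,4) dense])
  obtain P where P: "P \<subseteq> S \<union> I - {z}" "y \<in> P" "connected_in E P" "\<exists>u\<in>P. {u, z} \<in> E"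
    by (rule connected_avoiding[OF con, of y z]) (use S yz in auto)
  have c: "card (C \<union> {y, z}) = card C + 2"
  proof -
    have "finite C" using S(3) finite_sub by blast
    moreover have "C \<inter> {y, z} = {}" using S(5) yz by blast
    ultimately show ?thesis using yz(3) by (simp add: card_Un_disjoint)
  qed
  have "card (insert {y, z} (induced E (C \<union> {y, z}))) + 6 \<le> 3 * card (C \<union> {y, z})"
  proof (rule virtual_edge_bound[where P = P])
    show "P \<inter> (C \<union> {y, z}) = {y}" using P(1,2) S(5) by blast
    show "P \<subseteq> V" using P(1) S(1,2) by blast
    show "C \<union> {y, z} \<subseteq> V" using S yz by blast
  qed (use P yz c assms(6) in auto)
  then show ?thesis using c by simp
qed

lemma cross_sum:
  assumes "A \<subseteq> V" "B \<subseteq> V" "A \<inter> B = {}"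
  shows "card (cross E A B) = (\<Sum>b\<in>B. card (nbrs E {b} A))"
proof -
  have fin: "finite A" "finite B" using assms finite_sub by auto
  have eq: "cross E A B = (\<Union>b\<in>B. (\<lambda>a. {a, b}) ` nbrs E {b} A)"
  proof
    show "cross E A B \<subseteq> (\<Union>b\<in>B. (\<lambda>a. {a, b}) ` nbrs E {b} A)"
    proof
      fix e assume "e \<in> cross E A B"
      then obtain a b where ab: "e \<in> E" "a \<in> A" "b \<in> B" "e = {a, b}" by (auto simp: cross_def)
      then have "a \<in> nbrs E {b} A" by (simp add: nbrs_def insert_commute)
      then show "e \<in> (\<Union>b\<in>B. (\<lambda>a. {a, b}) ` nbrs E {b} A)" using ab by blast
    qed
    show "(\<Union>b\<in>B. (\<lambda>a. {a, b}) ` nbrs E {b} A) \<subseteq> cross E A B"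
    proof
      fix e assume "e \<in> (\<Union>b\<in>B. (\<lambda>a. {a, b}) ` nbrs E {b} A)"
      then obtain a b where ab: "b \<in> B" "a \<in> A" "{b, a} \<in> E" "e = {a, b}" by (auto simp: nbrs_def)
      then have "e \<in> E" by (simp add: insert_commute)
      then show "e \<in> cross E A B" using ab unfolding cross_def by blast
    qed
  qed
  have "card (cross E A B) = (\<Sum>b\<in>B. card ((\<lambda>a. {a, b}) ` nbrs E {b} A))"
    unfolding eq
  proof (rule card_UN_disjoint[OF fin(2)])
    show "\<forall>b\<in>B. finite ((\<lambda>a. {a, b}) ` nbrs E {b} A)" using fin(1) by (simp add: nbrs_def)
    show "\<forall>b\<in>B. \<forall>b'\<in>B. b \<noteq> b' \<longrightarrow> (\<lambda>a. {a, b}) ` nbrs E {b} A \<inter> (\<lambda>a. {a, b'}) ` nbrs E {b'} A = {}"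
      using assms(3) by (auto simp: nbrs_def doubleton_eq_iff)
  qed
  also have "\<dots> = (\<Sum>b\<in>B. card (nbrs E {b} A))"
  proof (rule sum.cong[OF refl], rule card_image, rule inj_onI)
    fix b a a' assume "{a, b} = {a', b}"
    then show "a = a'" by (auto simp: doubleton_eq_iff)
  qed
  finally show ?thesis .
qed

lemma induced_Un:
  assumes "A \<inter> B = {}"
  shows "induced E (A \<union> B) \<subseteq> induced E A \<union> induced E B \<union> cross E A B"
proof
  fix e assume "e \<in> induced E (A \<union> B)"
  then have e: "e \<in> E" "e \<subseteq> A \<union> B" by (auto simp: induced_def)
  then obtain a b where "e = {a, b}" using edge_card by (meson card_2_iff)
  then show "e \<in> induced E A \<union> induced E B \<union> cross E A B"
    using e unfolding induced_def cross_def by (auto simp: insert_commute)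
qed

lemma card_induced_Un_le:
  assumes "A \<inter> B = {}"
  shows "card (induced E (A \<union> B)) \<le> card (induced E A) + card (induced E B) + card (cross E A B)"
proof -
  have "card (induced E (A \<union> B)) \<le> card (induced E A \<union> induced E B \<union> cross E A B)"
    by (rule card_mono[OF _ induced_Un[OF assms]]) simp
  also have "\<dots> \<le> card (induced E A \<union> induced E B) + card (cross E A B)" by (rule card_Un_le)
  also have "\<dots> \<le> card (induced E A) + card (induced E B) + card (cross E A B)"
    using card_Un_le[of "induced E A" "induced E B"] by simp
  finally show ?thesis .
qed

text \<open>
  If the core were not triangulated, the triangle would send seven edges to it and, together with
  two of its neighbours and a path between them outside, form a subdivided complete graph on
  five vertices.
\<close>

lemma triangle_forces_tight_core:
  assumes S: "S \<subseteq> V" "I \<subseteq> V" "C \<subseteq> V" "S \<inter> I = {}" "C \<inter> (S \<union> I) = {}" and C3: "card C = 3"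
    and i: "3 * (card S + 3) \<le> card (induced E (S \<union> C)) + 6"
    and n: "5 \<le> card S + card I" and c: "2 * (card S + card I) \<le> card (cross E S I) + 5"
  shows "3 * card S \<le> card (induced E S) + 6"
proof (rule ccontr)
  assume contra: "\<not> ?thesis"
  have fin: "finite S" "finite I" "finite C" using S finite_sub by auto
  have SC: "S \<inter> C = {}" using S(5) by blast
  have iC: "card (induced E C) \<le> 3" using induced_bound[OF S(3)] C3 by simp
  have iSC: "card (induced E (S \<union> C)) \<le> card (induced E S) + card (induced E C) + card (cross E S C)"
    by (rule card_induced_Un_le[OF SC])
  \<comment> \<open>The bipartite bound for \<open>S\<close> against \<open>I \<union> C\<close> is
    \<open>2 * (card S + card I) + 2\<close>; at least \<open>2 * (card S + card I) - 5\<close>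
    edges go to \<open>I\<close>, so at most seven are left for \<open>C\<close>. The assumption to
    be refuted requires seven.\<close>
  have "card (cross E S (I \<union> C)) + 4 \<le> 2 * (card S + card (I \<union> C))"
    by (rule cross_bound) (use S n fin in \<open>auto simp: card_Un_disjoint Int_commute Int_Un_distrib\<close>)
  moreover have "card (I \<union> C) = card I + 3"
    using fin S(5) C3 by (subst card_Un_disjoint) auto
  moreover have "cross E S I \<union> cross E S C \<subseteq> cross E S (I \<union> C)" by (auto simp: cross_def)
  then have "card (cross E S I \<union> cross E S C) \<le> card (cross E S (I \<union> C))" by (rule card_mono[rotated]) simp
  moreover have "cross E S I \<inter> cross E S C = {}"
  proof (rule ccontr)
    assume "\<not> ?thesis"
    then obtain e where e: "e \<in> cross E S I" "e \<in> cross E S C" by blast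
    have "e \<subseteq> S \<union> I" using e(1) by (auto simp: cross_def)
    moreover obtain b where "b \<in> C" "b \<in> e" using e(2) by (auto simp: cross_def)
    ultimately show False using S(5) by blast
  qed
  then have "card (cross E S I \<union> cross E S C) = card (cross E S I) + card (cross E S C)"
    by (simp add: card_Un_disjoint)
  ultimately have "card (cross E S I) + card (cross E S C) + 4 \<le> 2 * (card S + card I + 3)" by simp
  then have cSC7: "card (cross E S C) \<le> 7" using c by simp
  have eqs: "card (induced E C) = 3" "card (cross E S C) = 7"
    using cSC7 iSC iC i contra by auto
  obtain c1 c2 c3 where C: "C = {c1, c2, c3}" "c1 \<noteq> c2" "c1 \<noteq> c3" "c2 \<noteq> c3"
    using C3 by (auto simp: card_3_iff)
  define P2 where "P2 = {e. e \<subseteq> C \<and> card e = 2}"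
  have "finite P2" unfolding P2_def using fin(3) by simp
  moreover have "induced E C \<subseteq> P2" using edge_card by (auto simp: induced_def P2_def)
  moreover have "card P2 = 3"
    unfolding P2_def using n_subsets[OF fin(3), of 2] C3 by (simp add: numeral_eq_Suc)
  ultimately have P2: "induced E C = P2"
    using eqs(1) card_subset_eq by metis
  have CE: "{a, b} \<in> E" if "a \<in> C" "b \<in> C" "a \<noteq> b" for a b
  proof -
    have "{a, b} \<in> P2" using that by (simp add: P2_def)
    then show ?thesis unfolding P2[symmetric] by (simp add: induced_def)
  qed
  have sum7: "card (nbrs E {c1} S) + card (nbrs E {c2} S) + card (nbrs E {c3} S) = 7"
    using cross_sum[OF S(1,3) SC] eqs(2) C by simp
  \<comment> \<open>Contracting the edge \<open>{a, b}\<close> leaves two vertices for the triangle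
    instead of three, and the same count permits only five edges from them to
    \<open>S\<close>.\<close>
  have pair: "card (nbrs E {a} S \<union> nbrs E {b} S) + card (nbrs E {d} S) \<le> 5"
    if abd: "a \<in> C" "b \<in> C" "d \<in> C" "a \<noteq> b" "a \<noteq> d" "b \<noteq> d" for a b d
  proof -
    define P where "P = (\<lambda>i. if i = a then {a, b} else {d})"
    have "(\<Sum>r\<in>{a, d}. card (nbrs E (P r) S)) + card (cross E S I) + 4 \<le> 2 * (card S + card I + card {a, d})"
    proof (rule contracted_bipartite_bound[OF S(1,2) _ S(4)])
      show "{a, d} \<subseteq> V" using abd S(3) by blast
      show "{a, d} \<inter> (S \<union> I) = {}" using abd S(5) by blast
      show "P r \<subseteq> V - (S \<union> I)" for r using abd S(3,5) by (auto simp: P_def)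
      have "connected_in E {b, a}"
        using connected_in_insert[of E "{a}" a b] CE[OF abd(1,2,4)] by simp
      then show "connected_in E (P r)" for r by (simp add: P_def insert_commute)
      show "P r \<inter> P r' = {}" if "r \<in> {a, d}" "r' \<in> {a, d}" "r \<noteq> r'" for r r'
        using that abd by (auto simp: P_def)
      show "3 \<le> card S + card I + card {a, d}" using n by simp
    qed
    moreover have "nbrs E (P a) S = nbrs E {a} S \<union> nbrs E {b} S" "nbrs E (P d) S = nbrs E {d} S"
      using abd by (auto simp: P_def nbrs_def)
    ultimately show ?thesis using abd(5) c by simp
  qed
  have finN: "finite (nbrs E {a} S)" for a using fin(1) by (simp add: nbrs_def)
  obtain y z where yz: "y \<noteq> z" "{y, z} \<subseteq> nbrs E {c1} S \<inter> nbrs E {c2} S \<inter> nbrs E {c3} S"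
    using common_pair_of_three_sets[OF finN finN finN sum7 pair pair pair] C by auto
  have yzS: "y \<in> S" "z \<in> S" using yz(2) by (auto simp: nbrs_def)
  have yzE: "{a, y} \<in> E" "{a, z} \<in> E" if "a \<in> C" for a
    using yz(2) that C(1) by (auto simp: nbrs_def)
  define R where "R = C \<union> {y, z}"
  have finR: "finite R" using fin by (simp add: R_def)
  have cR: "card R = 5"
    using C3 fin(3) yz(1) yzS SC by (auto simp: R_def card_Un_disjoint card_insert_if)
  \<comment> \<open>Five pairwise adjacent vertices, with \<open>{y, z}\<close> realised outside,
    would need ten edges, while the bound is \<open>3 * card C = 9\<close>.\<close>
  have "{e. e \<subseteq> R \<and> card e = 2} \<subseteq> insert {y, z} (induced E R)"
  proof
    fix e assume "e \<in> {e. e \<subseteq> R \<and> card e = 2}"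
    then obtain a b where ab: "e = {a, b}" "a \<noteq> b" "a \<in> R" "b \<in> R" by (auto simp: card_2_iff)
    then have "e = {y, z} \<or> e \<in> E"
      using CE[of a b] yzE[of a] yzE[of b] unfolding R_def by (auto simp: insert_commute)
    then show "e \<in> insert {y, z} (induced E R)" using ab by (auto simp: induced_def)
  qed
  then have "card {e. e \<subseteq> R \<and> card e = 2} \<le> card (insert {y, z} (induced E R))"
    by (rule card_mono[rotated]) simp
  moreover have "card {e. e \<subseteq> R \<and> card e = 2} = 10"
    using n_subsets[OF finR, of 2] cR by (simp add: numeral_eq_Suc)
  moreover have "card (insert {y, z} (induced E R)) \<le> 3 * card C"
    unfolding R_def by (rule no_outside_path[OF S _ _ yzS yz(1)]) (use C3 n c in auto)
  ultimately show False using C3 by simp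
qed

end

section \<open>The extremal structure of planar graphs without \<open>t\<close> disjoint
  edges\<close>

context planar_edges
begin

text \<open>Let \<open>W\<close> be the union of the parts with at least two vertices,
  \<open>I\<close> the single vertices and \<open>K\<close> the sum of \<open>card C div 2\<close>.
  The planar bounds for \<open>S \<union> W\<close> and for \<open>S\<close> against
  \<open>I\<close> give at most \<open>2 n + 3 * card S + card W - 10\<close> edges. With
  \<open>card W \<le> 3 * K\<close> and \<open>card S + K \<le> t - 1\<close> this is at most
  \<open>2 n + 3 t - 13\<close>, while \<open>2 n + 3 t - 14\<close> are present. So all these
  inequalities together have slack at most one.\<close>

theorem matching_structure:
  assumes t: "7 \<le> t" and n: "3 * t \<le> card V + 6" and many: "2 * card V + 3 * t \<le> card E + 14"
    and nomatch: "\<And>M. M \<subseteq> E \<Longrightarrow> disjoint M \<Longrightarrow> card M < t"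
  shows "(\<exists>S. S \<subseteq> V \<and> card S + 1 = t \<and> card E \<le> card (induced E S) + card (cross E S (V - S))) \<or>
    (\<exists>S C. S \<subseteq> V \<and> C \<subseteq> V \<and> S \<inter> C = {} \<and> card C = 3 \<and> connected_in E C \<and> card S + 2 = t \<and>
       3 * card S \<le> card (induced E S) + 6 \<and>
       2 * (card V - 3) \<le> card (cross E S (V - S - C)) + 5 \<and> card E + 14 \<le> 2 * card V + 3 * t)"
proof -
  have "\<exists>S \<C>. S \<subseteq> V \<and> finite \<C> \<and> disjoint \<C> \<and> \<Union>\<C> = V - S \<and> (\<forall>C\<in>\<C>. connected_in E C) \<and>
    (\<forall>e\<in>E. e \<inter> S \<noteq> {} \<or> (\<exists>C\<in>\<C>. e \<subseteq> C)) \<and> card S + (\<Sum>C\<in>\<C>. card C div 2) < t"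
    by (rule tutte_berge[OF finite_V]) (fact edge_sub edge_card nomatch | rule edge_sub edge_card nomatch; assumption)+
  then obtain S \<C> where SC: "S \<subseteq> V" "finite \<C>" "disjoint \<C>" "\<Union>\<C> = V - S" "\<forall>C\<in>\<C>. connected_in E C"
    "\<forall>e\<in>E. e \<inter> S \<noteq> {} \<or> (\<exists>C\<in>\<C>. e \<subseteq> C)" "card S + (\<Sum>C\<in>\<C>. card C div 2) < t"
    by (elim exE conjE) (rule that; assumption)
  define \<W> where "\<W> = {C \<in> \<C>. 2 \<le> card C}"
  define W where "W = \<Union>\<W>"
  define I where "I = V - S - W"
  define K where "K = (\<Sum>C\<in>\<W>. card C div 2)"
  define q where "q = card \<W>"
  have finW: "finite \<W>" using SC(2) by (simp add: \<W>_def)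
  have part: "C \<subseteq> V - S" "finite C" "C \<noteq> {}" "connected_in E C" if "C \<in> \<C>" for C
  proof -
    show "C \<subseteq> V - S" using that SC(4) by blast
    then show "finite C" using finite_V finite_subset by blast
    show "connected_in E C" using that SC(5) by blast
    then show "C \<noteq> {}" by (simp add: connected_in_def)
  qed
  have WC: "C \<in> \<C>" "2 \<le> card C" if "C \<in> \<W>" for C using that by (simp_all add: \<W>_def)
  have disj: "C \<inter> C' = {}" if "C \<in> \<C>" "C' \<in> \<C>" "C \<noteq> C'" for C C'
    using SC(3) that by (simp add: disjoint_def)
  have WV: "W \<subseteq> V - S" using part(1) WC(1) by (auto simp: W_def)
  have I: "I \<subseteq> V" "S \<inter> I = {}" "S \<inter> W = {}" "I \<inter> W = {}" "V = S \<union> I \<union> W"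
    using WV SC(1) by (auto simp: I_def)
  have fin: "finite S" "finite I" "finite W" using SC(1) I(1) WV finite_V finite_subset by blast+
  have cV: "card V = card S + card I + card W"
  proof -
    have "card (S \<union> I) = card S + card I" using fin I(2) by (simp add: card_Un_disjoint)
    moreover have "card (S \<union> I \<union> W) = card (S \<union> I) + card W"
      using fin I(3,4) by (intro card_Un_disjoint) auto
    ultimately show ?thesis using I(5) by simp
  qed
  have cW: "card W = (\<Sum>C\<in>\<W>. card C)"
    unfolding W_def
    by (rule card_Union_disjoint)
       (use disj WC part(2) in \<open>auto simp: pairwise_def disjnt_def\<close>)
  have K3: "card W \<le> 3 * K"
  proof -
    have "card C \<le> 3 * (card C div 2)" if "C \<in> \<W>" for C using WC(2)[OF that] by presburger
    then have "(\<Sum>C\<in>\<W>. card C) \<le> (\<Sum>C\<in>\<W>. 3 * (card C div 2))" by (rule sum_mono)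
    then show ?thesis by (simp add: cW K_def sum_distrib_left)
  qed
  have K2: "card W \<le> 2 * K + q"
  proof -
    have "card C \<le> 2 * (card C div 2) + 1" for C :: "'a set" by presburger
    then have "(\<Sum>C\<in>\<W>. card C) \<le> (\<Sum>C\<in>\<W>. 2 * (card C div 2) + 1)" by (rule sum_mono)
    also have "\<dots> = 2 * K + q" unfolding K_def q_def sum.distrib sum_distrib_left by simp
    finally show ?thesis by (simp add: cW)
  qed
  have KC: "(\<Sum>C\<in>\<C>. card C div 2) \<ge> K"
    unfolding K_def by (rule sum_mono2) (use SC(2) in \<open>auto simp: \<W>_def\<close>)
  have sK: "card S + K + 1 \<le> t" using SC(7) KC by linarith
  have edge_in: "\<exists>C\<in>\<W>. e \<subseteq> C" if e: "e \<in> E" "e \<inter> S = {}" for e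
  proof -
    obtain C where C: "C \<in> \<C>" "e \<subseteq> C" using SC(6) e by blast
    then have "card e \<le> card C" using part(2) by (intro card_mono)
    then have "C \<in> \<W>" using C(1) edge_card[OF e(1)] by (simp add: \<W>_def)
    then show ?thesis using C(2) by blast
  qed
  have split: "E \<subseteq> induced E (S \<union> W) \<union> cross E S I"
  proof
    fix e assume e: "e \<in> E"
    show "e \<in> induced E (S \<union> W) \<union> cross E S I"
    proof (cases "e \<inter> S = {}")
      case True
      then show ?thesis using edge_in[OF e] e by (auto simp: W_def induced_def)
    next
      case False
      then obtain a where a: "a \<in> e" "a \<in> S" by blast
      obtain b where b: "e = {a, b}" using edge_doubleton[OF e a(1)] by metis
      have "b \<in> V" using edge_sub[OF e] b by simp
      then consider "b \<in> S \<union> W" | "b \<in> I" using I(5) by blast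
      then show ?thesis
      proof cases
        case 1
        then show ?thesis using a b e by (simp add: induced_def)
      next
        case 2
        then have "e \<in> cross E S I" using a b e unfolding cross_def by blast
        then show ?thesis by blast
      qed
    qed
  qed
  have cE: "card E \<le> card (induced E (S \<union> W)) + card (cross E S I)"
  proof -
    have "card E \<le> card (induced E (S \<union> W) \<union> cross E S I)"
      by (rule card_mono[OF _ split]) simp
    also have "\<dots> \<le> card (induced E (S \<union> W)) + card (cross E S I)" by (rule card_Un_le)
    finally show ?thesis .
  qed
  have WVS: "S \<union> W \<subseteq> V" using WV SC(1) by blast
  have cSW: "card (S \<union> W) = card S + card W" using fin I(3) by (simp add: card_Un_disjoint)
  have q0: "card W = 0" if "q = 0" using that finW by (simp add: q_def W_def)
  \<comment> \<open>For at most one vertex in \<open>S\<close> the parts share no edges, and each of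
    them pays the additive constant of the planar bound separately. This leaves too few
    edges.\<close>
  have s2: "2 \<le> card S"
  proof (rule ccontr)
    assume "\<not> 2 \<le> card S"
    then consider "card S = 0" | "card S = 1" by linarith
    then show False
    proof cases
      case 1
      then have S0: "S = {}" using fin(1) by simp
      have "E \<subseteq> (\<Union>C\<in>\<W>. induced E C)"
        using edge_in S0 by (fastforce simp: induced_def)
      then have "card E \<le> card (\<Union>C\<in>\<W>. induced E C)"
        by (rule card_mono[rotated]) (use finW in simp)
      also have "\<dots> \<le> (\<Sum>C\<in>\<W>. card (induced E C))" by (rule card_UN_le[OF finW])
      finally have "card E + 5 * q \<le> (\<Sum>C\<in>\<W>. card (induced E C) + 5)"
        by (simp add: q_def sum.distrib)
      also have "\<dots> \<le> (\<Sum>C\<in>\<W>. 3 * card C)"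
      proof (rule sum_mono)
        fix C assume C: "C \<in> \<W>"
        show "card (induced E C) + 5 \<le> 3 * card C"
        proof (cases "3 \<le> card C")
          case True
          have "C \<subseteq> V" using part(1) WC(1)[OF C] by blast
          then show ?thesis using induced_bound[OF _ True] by simp
        next
          case False
          then have c2: "card C = 2" using WC(2)[OF C] by simp
          have "induced E C \<subseteq> {C}"
          proof
            fix e assume "e \<in> induced E C"
            then have "e \<subseteq> C" "card e = 2" using edge_card by (auto simp: induced_def)
            then have "e = C" using card_subset_eq[OF part(2)[OF WC(1)[OF C]]] c2 by simp
            then show "e \<in> {C}" by simp
          qed
          then have "card (induced E C) \<le> card {C}" by (rule card_mono[rotated]) simp
          then show ?thesis using c2 by simp
        qed
      qed
      also have "\<dots> = 3 * card W" by (simp add: cW sum_distrib_left)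
      finally have e5: "card E + 5 * q \<le> 3 * card W" .
      consider "q = 0" | "q = 1" | "2 \<le> q" by linarith
      then show False
      proof cases
        case 1
        then show False using e5 q0 many t by simp
      next
        case 2
        \<comment> \<open>Here \<open>card W \<le> 2 t - 1\<close>, hence
          \<open>card E \<le> 6 t - 8\<close>, whereas \<open>many\<close> and \<open>n\<close> give
          \<open>card E \<ge> 9 t - 26\<close>. These are incompatible exactly for
          \<open>t \<ge> 7\<close>.\<close>
        then show False using e5 many t n cV sK K2 \<open>card S = 0\<close> by simp
      next
        case 3
        then show False using e5 many t cV sK K2 \<open>card S = 0\<close> by simp
      qed
    next
      case 2
      then obtain x where x: "S = {x}" by (meson card_1_singletonE)
      have "E \<subseteq> cross E S I \<union> (\<Union>C\<in>\<W>. induced E (insert x C))"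
      proof
        fix e assume e: "e \<in> E"
        show "e \<in> cross E S I \<union> (\<Union>C\<in>\<W>. induced E (insert x C))"
        proof (cases "e \<inter> S = {}")
          case True
          then show ?thesis using edge_in[OF e] e by (auto simp: induced_def)
        next
          case False
          then have "x \<in> e" using x by simp
          then obtain b where b: "e = {x, b}" "x \<noteq> b" using edge_doubleton[OF e] by metis
          have "b \<in> I \<or> b \<in> W" using edge_sub[OF e] b I(5) x by auto
          then show ?thesis
          proof
            assume "b \<in> I"
            then show ?thesis using b e x unfolding cross_def by blast
          next
            assume "b \<in> W"
            then obtain C where "C \<in> \<W>" "b \<in> C" by (auto simp: W_def)
            then show ?thesis using b e by (auto simp: induced_def)
          qed
        qed
      qed
      then have "card E \<le> card (cross E S I \<union> (\<Union>C\<in>\<W>. induced E (insert x C)))"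
        by (rule card_mono[rotated]) (use finW in simp)
      also have "\<dots> \<le> card (cross E S I) + card (\<Union>C\<in>\<W>. induced E (insert x C))" by (rule card_Un_le)
      also have "card (\<Union>C\<in>\<W>. induced E (insert x C)) \<le> (\<Sum>C\<in>\<W>. card (induced E (insert x C)))"
        by (rule card_UN_le[OF finW])
      finally have "card E + 3 * q \<le> card (cross E S I) + (\<Sum>C\<in>\<W>. card (induced E (insert x C)) + 3)"
        by (simp add: q_def sum.distrib)
      also have "(\<Sum>C\<in>\<W>. card (induced E (insert x C)) + 3) \<le> (\<Sum>C\<in>\<W>. 3 * card C)"
      proof (rule sum_mono)
        fix C assume C: "C \<in> \<W>"
        have CV: "C \<subseteq> V - S" "finite C" using part(1,2) WC(1)[OF C] by auto
        then have "card (insert x C) = card C + 1" using x by (subst card_insert_disjoint) auto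
        moreover have "insert x C \<subseteq> V" using CV x SC(1) by blast
        ultimately show "card (induced E (insert x C)) + 3 \<le> 3 * card C"
          using induced_bound[of "insert x C"] WC(2)[OF C] by simp
      qed
      also have "\<dots> = 3 * card W" by (simp add: cW sum_distrib_left)
      finally have e3: "card E + 3 * q \<le> card (cross E S I) + 3 * card W" by simp
      have "cross E S I \<subseteq> (\<lambda>i. {x, i}) ` I" by (auto simp: cross_def x)
      then have "card (cross E S I) \<le> card ((\<lambda>i. {x, i}) ` I)"
        by (rule card_mono[rotated]) (use fin in simp)
      also have "\<dots> \<le> card I" by (rule card_image_le[OF fin(2)])
      finally have cI: "card (cross E S I) \<le> card I" .
      show False
      proof (cases "q = 0")
        case True
        then show False using e3 q0 cI many t cV by simp
      next
        case False
        then show False using e3 cI many t cV sK K2 \<open>card S = 1\<close> by linarith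
      qed
    qed
  qed
  have cb: "card (cross E S I) + 4 \<le> 2 * (card S + card I)"
  proof (cases "3 \<le> card S + card I")
    case True
    then show ?thesis using cross_bound[OF SC(1) I(1,2)] by simp
  next
    case False
    then have "card I = 0" using s2 by linarith
    then have "I = {}" using fin(2) by simp
    then show ?thesis using s2 by (simp add: cross_def)
  qed
  show ?thesis
  proof (cases "\<W> = {}")
    case True
    then have W0: "W = {}" by (simp add: W_def)
    have "3 \<le> card S"
    proof (rule ccontr)
      assume "\<not> 3 \<le> card S"
      then have S2: "card S = 2" using s2 by simp
      have "induced E S \<subseteq> {S}"
      proof
        fix e assume "e \<in> induced E S"
        then have "e \<subseteq> S" "card e = 2" using edge_card by (auto simp: induced_def)
        then have "e = S" using card_subset_eq[OF fin(1)] S2 by simp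
        then show "e \<in> {S}" by simp
      qed
      then have "card (induced E S) \<le> card {S}" by (rule card_mono[rotated]) simp
      then show False using cE cb W0 many t cV S2 by simp
    qed
    then have "card (induced E S) + 6 \<le> 3 * card S" by (rule induced_bound[OF SC(1)])
    then have "card S + 1 = t" using cE cb W0 many cV sK by simp
    moreover have "V - S = I" using I(5,2) W0 by blast
    ultimately show ?thesis using cE W0 SC(1) by (intro disjI1 exI[of _ S]) simp
  next
    case False
    then have K1: "2 \<le> card W"
    proof -
      obtain C where C: "C \<in> \<W>" using False by blast
      then have "C \<subseteq> W" by (auto simp: W_def)
      then show ?thesis using WC(2)[OF C] card_mono[OF fin(3)] order_trans by blast
    qed
    have ib: "card (induced E (S \<union> W)) + 6 \<le> 3 * (card S + card W)"
      using induced_bound[OF WVS] cSW s2 K1 by simp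
    \<comment> \<open>A loss of one in \<open>card S + K + 1 \<le> t\<close> would cost three
      edges.\<close>
    have tight: "card S + K + 1 = t" using cE cb ib many cV sK K3 unfolding distrib_left by linarith
    have tightW: "3 * K \<le> card W + 1" using cE cb ib many cV sK K3 unfolding distrib_left by linarith
    have slack1: "card (induced E (S \<union> W)) + 6 = 3 * (card S + card W) \<or>
        card (induced E (S \<union> W)) + 7 = 3 * (card S + card W) \<and> card W = 3 * K \<and>
          card (cross E S I) + 4 = 2 * (card S + card I)"
    proof (cases "card (induced E (S \<union> W)) + 6 = 3 * (card S + card W)")
      case False
      then have l: "card (induced E (S \<union> W)) + 7 \<le> 3 * (card S + card W)" using ib unfolding distrib_left by linarith
      have "card (induced E (S \<union> W)) + 7 = 3 * (card S + card W)"
        using l cE cb many cV sK K3 unfolding distrib_left by linarith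
      moreover have "card W = 3 * K" using l cE cb many cV sK K3 unfolding distrib_left by linarith
      moreover have "card (cross E S I) + 4 = 2 * (card S + card I)"
        using l cE cb many cV sK K3 unfolding distrib_left by linarith
      ultimately show ?thesis by blast
    qed blast
    have slack2: "2 * (card S + card I) \<le> card (cross E S I) + 5"
      using cE ib many cV sK K3 unfolding distrib_left by linarith
    have slack3: "card W = 3 * K" if "card (cross E S I) + 5 = 2 * (card S + card I)"
      using that cE ib many cV sK K3 unfolding distrib_left by linarith
    have upper: "card E + 14 \<le> 2 * card V + 3 * t" if K1: "K = 1" and W3: "card W = 3"
      and up: "card (induced E (S \<union> W)) + 6 = 3 * (card S + card W) \<Longrightarrow> card (cross E S I) + 5 \<le> 2 * (card S + card I)"
    proof (cases "card (induced E (S \<union> W)) + 6 = 3 * (card S + card W)")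
      case True
      show ?thesis using True up[OF True] cE cV tight K1 W3 unfolding distrib_left by linarith
    next
      case False
      then show ?thesis using ib cb cE cV tight K1 W3 unfolding distrib_left by linarith
    qed
    have remain: "3 \<le> card S + card W - card C" if C: "C \<in> \<W>" for C
    proof -
      have CW: "C \<subseteq> W" using C by (auto simp: W_def)
      have le: "card C \<le> card W" by (rule card_mono[OF fin(3) CW])
      show ?thesis
      proof (cases "card S = 2")
        case False
        then show ?thesis using s2 le unfolding distrib_left by linarith
      next
        case True
        have "card C div 2 \<le> K"
          unfolding K_def by (rule member_le_sum[OF C]) (use finW in auto)
        \<comment> \<open>For \<open>card S = 2\<close> one has \<open>K = t - 3 \<ge> 4\<close> and
          \<open>card W \<ge> 3 * K - 1\<close>, while a single part has at most
          \<open>2 * K + 1\<close> vertices.\<close>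
        then have "card C \<noteq> card W" using tight tightW True t by presburger
        then show ?thesis using True le unfolding distrib_left by linarith
      qed
    qed
    have nbr_out: "nbrs E C (S \<union> W' - C) = nbrs E C S" if C: "C \<in> \<W>" and W': "W' \<subseteq> W" for C W'
    proof -
      have "b \<in> S" if b: "b \<in> S \<union> W' - C" "a \<in> C" "{a, b} \<in> E" for a b
      proof (rule ccontr)
        assume "b \<notin> S"
        moreover have "a \<notin> S" using b(2) part(1)[OF WC(1)[OF C]] by blast
        ultimately obtain C' where C': "C' \<in> \<W>" "{a, b} \<subseteq> C'" using edge_in[OF b(3)] by blast
        then have "C' = C" using disj[OF WC(1)[OF C] WC(1)[OF C'(1)]] b(2) by blast
        then show False using C'(2) b(1) by blast
      qed
      moreover have "S \<inter> C = {}" using part(1)[OF WC(1)[OF C]] by blast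
      ultimately show ?thesis unfolding nbrs_def by blast
    qed
    have contract: "(\<Sum>C\<in>\<D>. card (nbrs E C S)) + card (cross E S I) + 4 \<le> 2 * (card S + card I + card \<D>)"
      if \<D>: "\<D> \<subseteq> \<W>" "\<D> \<noteq> {}" for \<D>
    proof -
      define r where "r = (\<lambda>C :: 'a set. SOME c. c \<in> C)"
      have r: "r C \<in> C" if "C \<in> \<D>" for C
        unfolding r_def by (rule someI_ex) (use part(3) WC(1) \<D>(1) that in blast)
      have inj: "inj_on r \<D>"
      proof (rule inj_onI)
        fix C C' assume CC: "C \<in> \<D>" "C' \<in> \<D>" "r C = r C'"
        then have "C \<inter> C' \<noteq> {}" using r[OF CC(1)] r[OF CC(2)] by auto
        then show "C = C'" using disj WC(1) \<D>(1) CC(1,2) by blast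
      qed
      define P where "P = inv_into \<D> r"
      have Pr: "P (r C) = C" if "C \<in> \<D>" for C unfolding P_def using inj that by simp
      have finD: "finite \<D>" using \<D>(1) finW finite_subset by blast
      have cD: "card (r ` \<D>) = card \<D>" by (rule card_image[OF inj])
      have CV: "C \<subseteq> V - (S \<union> I)" if "C \<in> \<D>" for C
      proof -
        have "C \<subseteq> W" using that \<D>(1) by (auto simp: W_def)
        then show ?thesis using WV I by blast
      qed
      have "(\<Sum>c\<in>r ` \<D>. card (nbrs E (P c) S)) + card (cross E S I) + 4 \<le> 2 * (card S + card I + card (r ` \<D>))"
      proof (rule contracted_bipartite_bound[OF SC(1) I(1) _ I(2)])
        show "r ` \<D> \<subseteq> V" using r CV by blast
        show "r ` \<D> \<inter> (S \<union> I) = {}" using r CV by blast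
        show "P c \<subseteq> V - (S \<union> I)" if "c \<in> r ` \<D>" for c using that Pr CV by auto
        show "connected_in E (P c)" if c: "c \<in> r ` \<D>" for c
        proof -
          obtain C where "C \<in> \<D>" "c = r C" using c by blast
          then show ?thesis using Pr part(4) WC(1) \<D>(1) by auto
        qed
        show "P c \<inter> P c' = {}" if c: "c \<in> r ` \<D>" "c' \<in> r ` \<D>" "c \<noteq> c'" for c c'
        proof -
          obtain C C' where C: "C \<in> \<D>" "c = r C" "C' \<in> \<D>" "c' = r C'" using c(1,2) by blast
          then have "C \<noteq> C'" using c(3) by auto
          then have "C \<inter> C' = {}" using disj WC(1) \<D>(1) C(1,3) by blast
          then show ?thesis using Pr[OF C(1)] Pr[OF C(3)] C(2,4) by simp
        qed
        have "card \<D> \<noteq> 0" using \<D>(2) finD by simp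
        then show "3 \<le> card S + card I + card (r ` \<D>)" using s2 cD unfolding distrib_left by linarith
      qed
      moreover have "(\<Sum>c\<in>r ` \<D>. card (nbrs E (P c) S)) = (\<Sum>C\<in>\<D>. card (nbrs E C S))"
        by (simp add: sum.reindex[OF inj] Pr)
      ultimately show ?thesis using cD by simp
    qed
    have single: "card (nbrs E C S) + card (cross E S I) + 4 \<le> 2 * (card S + card I + 1)" if "C \<in> \<W>" for C
      using contract[of "{C}"] that by simp
    have cutU: "card (induced E (S \<union> W')) + 7 \<le> 3 * (card S + card W')"
      and cut_eq: "card (induced E (S \<union> W')) + 7 = 3 * (card S + card W') \<Longrightarrow> \<exists>y z. nbrs E C S = {y, z} \<and> y \<noteq> z \<and>
      ({y, z} \<in> E \<and> card (induced E (S \<union> (W' - C))) + 6 = 3 * (card S + card W' - card C) \<or>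
       {y, z} \<notin> E \<and> card (induced E (C \<union> {y, z})) = 3 * card C)"
      if C: "C \<in> \<W>" "C \<subseteq> W'" "W' \<subseteq> W" "card (nbrs E C S) \<le> 2" "3 \<le> card S + card W' - card C" for C W'
    proof -
      have finW': "finite W'" using C(3) fin(3) finite_subset by blast
      have SW': "S \<inter> W' = {}" using I(3) C(3) by blast
      have c: "card (S \<union> W') = card S + card W'" using fin(1) finW' SW' by (simp add: card_Un_disjoint)
      have SCd: "S \<inter> C = {}" using SW' C(2) by blast
      have c2: "card (S \<union> W' - C) = card S + card W' - card C"
        using card_Diff_subset[of C "S \<union> W'"] C(2) part(2)[OF WC(1)[OF C(1)]] c by auto
      have eq: "S \<union> W' - C = S \<union> (W' - C)" using SCd by blast
      have U: "S \<union> W' \<subseteq> V" using C(3) WVS by blast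
      have X: "nbrs E C S = nbrs E C (S \<union> W' - C)" using nbr_out[OF C(1,3)] by simp
      have CU: "C \<subseteq> S \<union> W'" using C(2) by blast
      have r3: "3 \<le> card (S \<union> W' - C)" using c2 C(5) by simp
      note cc = cut_cases[OF U CU part(4)[OF WC(1)[OF C(1)]] WC(2)[OF C(1)] r3 X C(4)]
      show "card (induced E (S \<union> W')) + 7 \<le> 3 * (card S + card W')"
        using cc(1) c by simp
      assume "card (induced E (S \<union> W')) + 7 = 3 * (card S + card W')"
      then have "card (induced E (S \<union> W')) + 7 = 3 * card (S \<union> W')" using c by simp
      from cc(2)[OF this] show "\<exists>y z. nbrs E C S = {y, z} \<and> y \<noteq> z \<and>
        ({y, z} \<in> E \<and> card (induced E (S \<union> (W' - C))) + 6 = 3 * (card S + card W' - card C) \<or>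
         {y, z} \<notin> E \<and> card (induced E (C \<union> {y, z})) = 3 * card C)"
        unfolding eq c2[unfolded eq] .
    qed
    have finish: ?thesis if C: "\<W> = {C}" "card W = 3 * K" and tightS: "card C = 3 \<Longrightarrow> 3 * card S \<le> card (induced E S) + 6"
      and up: "card (induced E (S \<union> W)) + 6 = 3 * (card S + card W) \<Longrightarrow> card (cross E S I) + 5 \<le> 2 * (card S + card I)"
      for C
    proof -
      have WC': "W = C" "K = card C div 2" using C(1) by (simp_all add: W_def K_def)
      \<comment> \<open>\<open>card C = 3 * (card C div 2)\<close> with at least two vertices has
        the only solution 3.\<close>
      have c3: "card C = 3" using C(2) WC' WC(2)[of C] C(1) by simp presburger
      then have K1: "K = 1" using WC'(2) by simp
      have "card S + 2 = t" using tight K1 by simp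
      moreover have "V - S - C = I" using WC'(1) by (simp add: I_def)
      moreover have "2 * (card V - 3) \<le> card (cross E S I) + 5" using slack2 cV WC'(1) c3 by simp
      moreover have "card E + 14 \<le> 2 * card V + 3 * t" by (rule upper[OF K1 _ up]) (use WC'(1) c3 in simp)
      moreover have "C \<subseteq> V" "S \<inter> C = {}" using WV WC'(1) by auto
      moreover have "connected_in E C" using part(4) WC(1) C(1) by blast
      ultimately show ?thesis using SC(1) c3 tightS[OF c3] by (intro disjI2 exI[of _ S] exI[of _ C]) simp
    qed
    from slack1 show ?thesis
    proof
      \<comment> \<open>\<open>S \<union> W\<close> is triangulated, so no part has only two
        neighbours. Contracting one part with three neighbours costs the graph between
        \<open>S\<close> and \<open>I\<close> one edge; a second part would cost another
        one.\<close>
      assume full: "card (induced E (S \<union> W)) + 6 = 3 * (card S + card W)"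
      have three: "3 \<le> card (nbrs E C S)" if C: "C \<in> \<W>" for C
      proof (rule ccontr)
        assume "\<not> ?thesis"
        then have "card (induced E (S \<union> W)) + 7 \<le> 3 * (card S + card W)"
          by (intro cutU[OF C]) (use C remain[OF C] in \<open>auto simp: W_def\<close>)
        then show False using full by simp
      qed
      obtain C where C: "C \<in> \<W>" using False by blast
      have c5: "card (cross E S I) + 5 = 2 * (card S + card I)"
        using single[OF C] three[OF C] slack2 cb unfolding distrib_left by linarith
      have one: "\<W> = {C}"
      proof (rule ccontr)
        assume "\<W> \<noteq> {C}"
        then obtain C' where C': "C' \<in> \<W>" "C' \<noteq> C" using C by blast
        then have "card (nbrs E C S) + card (nbrs E C' S) + card (cross E S I) + 4 \<le> 2 * (card S + card I + 2)"
          using contract[of "{C, C'}"] C by simp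
        then show False using three[OF C] three[OF C'(1)] c5 unfolding distrib_left by linarith
      qed
      show ?thesis
      proof (rule finish[OF one slack3[OF c5]])
        assume c3: "card C = 3"
        have WC': "W = C" "K = card C div 2" using one by (simp_all add: W_def K_def)
        show "3 * card S \<le> card (induced E S) + 6"
        proof (rule triangle_forces_tight_core[OF SC(1) I(1) _ I(2) _ c3])
          show "C \<subseteq> V" "C \<inter> (S \<union> I) = {}" using WC'(1) WV I(3,4) by auto
          show "3 * (card S + 3) \<le> card (induced E (S \<union> C)) + 6" using full WC'(1) c3 by simp
          show "5 \<le> card S + card I" using tight t WC'(2) c3 by simp
          show "2 * (card S + card I) \<le> card (cross E S I) + 5" using c5 by simp
        qed
      qed (use c5 in simp)
    next
      \<comment> \<open>Now the graph between \<open>S\<close> and \<open>I\<close> attains its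
        bound, so contracting a part shows that it has at most two neighbours. The nonadjacent
        alternative of \<open>cut_cases\<close> is excluded by a link outside, so removing the part
        leaves a triangulated graph, which has no room for a second part with two
        neighbours.\<close>
      assume less: "card (induced E (S \<union> W)) + 7 = 3 * (card S + card W) \<and> card W = 3 * K \<and>
          card (cross E S I) + 4 = 2 * (card S + card I)"
      then have l1: "card (induced E (S \<union> W)) + 7 = 3 * (card S + card W)" and l2: "card W = 3 * K"
        and l3: "card (cross E S I) + 4 = 2 * (card S + card I)" by blast+
      have two: "card (nbrs E C S) \<le> 2" if "C \<in> \<W>" for C using single[OF that] l3 unfolding distrib_left by linarith
      obtain C where C: "C \<in> \<W>" using False by blast
      have CW: "C \<subseteq> W" using C by (auto simp: W_def)
      obtain y z where yz: "nbrs E C S = {y, z}" "y \<noteq> z"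
        and alt: "{y, z} \<in> E \<and> card (induced E (S \<union> (W - C))) + 6 = 3 * (card S + card W - card C) \<or>
          {y, z} \<notin> E \<and> card (induced E (C \<union> {y, z})) = 3 * card C"
        using cut_eq[OF C CW order_refl two[OF C] remain[OF C] l1] by blast
      have yzS: "y \<in> S" "z \<in> S" using yz(1) by (auto simp: nbrs_def)
      have n3: "3 \<le> card S + card I" using n cV l2 tight s2 unfolding distrib_left by linarith
      have C_disj: "C \<subseteq> V" "C \<inter> (S \<union> I) = {}" using CW WV I(3,4) by auto
      have "card (insert {y, z} (induced E (C \<union> {y, z}))) \<le> 3 * card C"
        by (rule no_outside_path[OF SC(1) I(1) C_disj(1) I(2) C_disj(2) WC(2)[OF C] _ yzS yz(2)])
           (use n3 l3 in simp)
      moreover have "card (insert {y, z} (induced E (C \<union> {y, z}))) = card (induced E (C \<union> {y, z})) + 1"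
        if "{y, z} \<notin> E"
      proof -
        have "{y, z} \<notin> induced E (C \<union> {y, z})" using that by (simp add: induced_def)
        then show ?thesis by simp
      qed
      ultimately have "\<not> ({y, z} \<notin> E \<and> card (induced E (C \<union> {y, z})) = 3 * card C)"
        by linarith
      then have rest: "card (induced E (S \<union> (W - C))) + 6 = 3 * (card S + card W - card C)"
        using alt by blast
      have cWC: "card (W - C) = card W - card C"
        using card_Diff_subset[OF part(2)[OF WC(1)[OF C]] CW] .
      have one: "\<W> = {C}"
      proof (rule ccontr)
        assume "\<W> \<noteq> {C}"
        then obtain C' where C': "C' \<in> \<W>" "C' \<noteq> C" using C by blast
        have "C' \<inter> C = {}" using disj[OF WC(1)[OF C'(1)] WC(1)[OF C] C'(2)] .
        then have C'W: "C' \<subseteq> W - C" using C'(1) by (auto simp: W_def)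
        have "card C div 2 + card C' div 2 \<le> K"
        proof -
          have "(\<Sum>D\<in>{C, C'}. card D div 2) \<le> K"
            unfolding K_def by (rule sum_mono2[OF finW]) (use C C'(1) in auto)
          then show ?thesis using C'(2) by simp
        qed
        moreover have "card C' \<le> card (W - C)" by (rule card_mono) (use C'W fin in auto)
        moreover have "card C \<le> card W" by (rule card_mono[OF fin(3) CW])
        ultimately have r3: "3 \<le> card S + card (W - C) - card C'"
          using cWC l2 tight t s2 by (cases "card S = 2") linarith+
        have "card (induced E (S \<union> (W - C))) + 7 \<le> 3 * (card S + card (W - C))"
          by (rule cutU[OF C'(1) C'W _ two[OF C'(1)] r3]) blast
        then show False using rest cWC \<open>card C \<le> card W\<close> by simp
      qed
      have WC': "W = C" using one by (simp add: W_def)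
      show ?thesis
        by (rule finish[OF one l2]) (use rest WC' l1 in auto)
    qed
  qed
qed

end

section \<open>Hall's theorem\<close>

text \<open>The induction of Halmos and Vaughan: if a proper nonempty subset has no surplus of
  neighbours, it and its complement are matched separately, the latter outside the neighbourhood of
  the former. If every such subset has a surplus, one element is matched arbitrarily.\<close>

theorem hall_marriage:
  assumes "finite S" "\<And>x. x \<in> S \<Longrightarrow> finite (N x)" "\<And>A. A \<subseteq> S \<Longrightarrow> card A \<le> card (\<Union>(N ` A))"
  shows "\<exists>f. inj_on f S \<and> (\<forall>x\<in>S. f x \<in> N x)"
  using assms
proof (induction "card S" arbitrary: S N rule: less_induct)
  case less
  note finS = less.prems(1) and finN = less.prems(2) and hall = less.prems(3)
  show ?case
  proof (cases "S = {}")
    case True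
    then show ?thesis by simp
  next
    case False
    show ?thesis
    proof (cases "\<exists>A. A \<subset> S \<and> A \<noteq> {} \<and> card (\<Union>(N ` A)) \<le> card A")
      case True
      then obtain A where A: "A \<subset> S" "A \<noteq> {}" "card (\<Union>(N ` A)) \<le> card A" by blast
      have AS: "A \<subseteq> S" using A(1) by blast
      have finA: "finite A" using AS finS finite_subset by blast
      have finNA: "finite (\<Union>(N ` B))" if "B \<subseteq> S" for B
        using that finS finN finite_subset[OF that finS] by (intro finite_UN_I) blast+
      have "card A < card S" using A(1) finS by (rule psubset_card_mono[rotated])
      then have "\<exists>f. inj_on f A \<and> (\<forall>x\<in>A. f x \<in> N x)"
      proof (rule less.hyps)
        show "finite A" by (rule finA)
        show "finite (N x)" if "x \<in> A" for x using finN AS that by blast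
        show "card B \<le> card (\<Union>(N ` B))" if "B \<subseteq> A" for B using hall AS that by blast
      qed
      then obtain f where f: "inj_on f A" "\<forall>x\<in>A. f x \<in> N x" by blast
      define N' where "N' = (\<lambda>x. N x - \<Union>(N ` A))"
      have "card (S - A) < card S" using A(1,2) finS by (intro psubset_card_mono) auto
      then have "\<exists>g. inj_on g (S - A) \<and> (\<forall>x\<in>S - A. g x \<in> N' x)"
      proof (rule less.hyps)
        show "finite (S - A)" using finS by simp
        show "finite (N' x)" if "x \<in> S - A" for x using finN that by (simp add: N'_def)
        show "card B \<le> card (\<Union>(N' ` B))" if B: "B \<subseteq> S - A" for B
        proof -
          have AB: "A \<union> B \<subseteq> S" using B AS by blast
          have finB: "finite B" using B finS finite_subset by blast
          have "A \<inter> B = {}" using B by blast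
          then have "card A + card B = card (A \<union> B)" using finA finB by (simp add: card_Un_disjoint)
          also have "\<dots> \<le> card (\<Union>(N ` (A \<union> B)))" using AB by (rule hall)
          also have "\<Union>(N ` (A \<union> B)) = \<Union>(N ` A) \<union> \<Union>(N' ` B)" by (auto simp: N'_def)
          also have "card \<dots> \<le> card (\<Union>(N ` A)) + card (\<Union>(N' ` B))" by (rule card_Un_le)
          finally show ?thesis using A(3) by linarith
        qed
      qed
      then obtain g where g: "inj_on g (S - A)" "\<forall>x\<in>S - A. g x \<in> N' x" by blast
      have "inj_on (\<lambda>x. if x \<in> A then f x else g x) S"
      proof (rule inj_onI)
        fix x y assume xy: "x \<in> S" "y \<in> S" "(if x \<in> A then f x else g x) = (if y \<in> A then f y else g y)"
        have *: "f a \<noteq> g b" if "a \<in> A" "b \<in> S - A" for a b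
          using that f(2) g(2) by (auto simp: N'_def)
        consider "x \<in> A" "y \<in> A" | "x \<in> A" "y \<notin> A" | "x \<notin> A" "y \<in> A" | "x \<notin> A" "y \<notin> A" by blast
        then show "x = y"
        proof cases
          case 1
          then show ?thesis using xy(3) f(1) by (simp add: inj_on_eq_iff)
        next
          case 2
          then show ?thesis using xy *[of x y] by simp
        next
          case 3
          then show ?thesis using xy *[of y x] by simp
        next
          case 4
          then show ?thesis using xy g(1) by (simp add: inj_on_eq_iff)
        qed
      qed
      moreover have "\<forall>x\<in>S. (if x \<in> A then f x else g x) \<in> N x"
        using f(2) g(2) by (auto simp: N'_def)
      ultimately show ?thesis by blast
    next
      case strict: False
      obtain x where x: "x \<in> S" using False by blast
      have "card {x} \<le> card (N x)" using hall[of "{x}"] x by simp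
      then obtain y where y: "y \<in> N x" by (cases "N x = {}") auto
      define N' where "N' = (\<lambda>z. N z - {y})"
      have "card (S - {x}) < card S" using x finS by (intro psubset_card_mono) auto
      then have "\<exists>f. inj_on f (S - {x}) \<and> (\<forall>z\<in>S - {x}. f z \<in> N' z)"
      proof (rule less.hyps)
        show "finite (S - {x})" using finS by simp
        show "finite (N' z)" if "z \<in> S - {x}" for z using finN that by (simp add: N'_def)
        show "card B \<le> card (\<Union>(N' ` B))" if B: "B \<subseteq> S - {x}" for B
        proof (cases "B = {}")
          case False
          have "B \<subset> S" using B x by blast
          then have lt: "card B < card (\<Union>(N ` B))" using strict False by (meson not_le)
          have "\<Union>(N ` B) \<subseteq> insert y (\<Union>(N' ` B))" by (auto simp: N'_def)
          moreover have "finite (\<Union>(N' ` B))"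
            using B finS finN finite_subset[OF B] by (intro finite_UN_I) (auto simp: N'_def)
          ultimately have "card (\<Union>(N ` B)) \<le> card (insert y (\<Union>(N' ` B)))" by (intro card_mono) auto
          also have "\<dots> \<le> Suc (card (\<Union>(N' ` B)))" by (rule card_insert_le_m1[THEN order_trans]) auto
          finally show ?thesis using lt by linarith
        qed simp
      qed
      then obtain f where f: "inj_on f (S - {x})" "\<forall>z\<in>S - {x}. f z \<in> N' z" by blast
      have ne: "f z \<noteq> y" if "z \<in> S" "z \<noteq> x" for z using f(2) that by (auto simp: N'_def)
      have "inj_on (f(x := y)) S"
      proof (rule inj_onI)
        fix a b assume ab: "a \<in> S" "b \<in> S" "(f(x := y)) a = (f(x := y)) b"
        consider "a = x" "b = x" | "a = x" "b \<noteq> x" | "a \<noteq> x" "b = x" | "a \<noteq> x" "b \<noteq> x" by blast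
        then show "a = b"
        proof cases
          case 2
          then show ?thesis using ab ne[of b] by simp
        next
          case 3
          then show ?thesis using ab ne[of a] by simp
        next
          case 4
          then show ?thesis using ab f(1) by (simp add: inj_on_eq_iff)
        qed simp
      qed
      moreover have "\<forall>z\<in>S. (f(x := y)) z \<in> N z" using f(2) y by (auto simp: N'_def)
      ultimately show ?thesis by blast
    qed
  qed
qed

section \<open>Matching the core into the remaining vertices\<close>

text \<open>\<open>dS\<close> and \<open>dH\<close> bound the number of edges by which
  \<open>G\<close> misses the planar bound on \<open>S\<close> and the bipartite bound between
  \<open>S\<close> and \<open>I\<close>. Degrees and neighbourhoods refer to \<open>G\<close>, but
  planarity is that of the triangulation \<open>E\<close>, so the edges of \<open>E\<close> inside
  \<open>I\<close> can be included in a count.\<close>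

locale tight_core = planar_edges V E for V :: "'a set" and E +
  fixes G S I and dS dH :: nat
  assumes GE: "G \<subseteq> E" and SV: "S \<subseteq> V" and IV: "I \<subseteq> V" and SI: "S \<inter> I = {}"
    and coreS: "3 * card S \<le> card (induced G S) + 6 + dS"
    and coreH: "2 * (card S + card I) \<le> card (cross G S I) + 4 + dH"
    and large: "5 + dS \<le> card S"
begin

abbreviation N where "N X \<equiv> nbrs G X I"

definition touch where "touch X = {e \<in> induced G S. e \<inter> X \<noteq> {}}"

lemma finS: "finite S" and finI: "finite I" and finG: "finite G"
  using SV IV finite_sub finite_E GE finite_subset by blast+

lemma finN [simp]: "finite (N X)" using finI by (simp add: nbrs_def)

lemma fin_touch [simp]: "finite (touch X)" and fin_indG [simp]: "finite (induced G X)"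
    and fin_crossG [simp]: "finite (cross G X Y)"
  using finG by (simp_all add: touch_def induced_def cross_def)

lemma N_sub: "N X \<subseteq> I" by (auto simp: nbrs_def)

lemma N_Un: "N (X \<union> Y) = N X \<union> N Y" by (auto simp: nbrs_def)

lemma N_mono: "X \<subseteq> Y \<Longrightarrow> N X \<subseteq> N Y" by (auto simp: nbrs_def)

lemma card_S_diff: "X \<subseteq> S \<Longrightarrow> card (S - X) + card X = card S"
  using card_Diff_subset[OF finite_subset[OF _ finS], of X S] card_mono[OF finS, of X] finS by simp

lemma card_I_diff: "card (I - N X) + card (N X) = card I"
  using card_Diff_subset[OF finN N_sub, of X] card_mono[OF finI N_sub, of X] by simp

text \<open>Removing \<open>X\<close> leaves a planar graph on \<open>S - X\<close>, so almost all
  of the \<open>3 * card X\<close> edges lost from the bound were really present at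
  \<open>X\<close>.\<close>

lemma touch_lower:
  assumes X: "X \<subseteq> S" and r: "3 \<le> card (S - X)"
  shows "3 * card X \<le> card (touch X) + dS"
proof -
  have "induced G S \<subseteq> touch X \<union> induced G (S - X)" by (auto simp: touch_def induced_def)
  then have "card (induced G S) \<le> card (touch X \<union> induced G (S - X))" by (intro card_mono) auto
  also have "\<dots> \<le> card (touch X) + card (induced G (S - X))" by (rule card_Un_le)
  finally have a: "card (induced G S) \<le> card (touch X) + card (induced G (S - X))" .
  have "card (induced G (S - X)) + 6 \<le> 3 * card (S - X)"
    by (rule edge_bound[OF _ _ _ r]) (use GE SV in \<open>auto simp: induced_def\<close>)
  then show ?thesis using a coreS card_S_diff[OF X] by linarith
qed

lemma touch_split:
  assumes X: "X \<subseteq> S"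
  shows "card (touch X) \<le> card (induced G X) + card (cross G X (S - X))"
proof -
  have "touch X \<subseteq> induced G X \<union> cross G X (S - X)"
  proof
    fix e assume e: "e \<in> touch X"
    then obtain a where a: "a \<in> e" "a \<in> X" by (auto simp: touch_def)
    have eG: "e \<in> G" "e \<subseteq> S" using e by (auto simp: touch_def induced_def)
    have "e \<in> E" using eG(1) GE by blast
    from edge_doubleton[OF this a(1)] obtain b where b: "e = {a, b}" by metis
    show "e \<in> induced G X \<union> cross G X (S - X)"
    proof (cases "b \<in> X")
      case True
      then show ?thesis using a b eG by (simp add: induced_def)
    next
      case False
      then have "b \<in> S - X" using b eG by simp
      then have "e \<in> cross G X (S - X)" unfolding cross_def using a b eG by blast
      then show ?thesis by blast
    qed
  qed
  then have "card (touch X) \<le> card (induced G X \<union> cross G X (S - X))" by (intro card_mono) auto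
  also have "\<dots> \<le> card (induced G X) + card (cross G X (S - X))" by (rule card_Un_le)
  finally show ?thesis .
qed

text \<open>Planarity of \<open>S \<union> N X\<close>, with the edges of \<open>E\<close> inside
  \<open>N X\<close> included, bounds the edges ending in \<open>N X\<close>; the other edges
  between \<open>S\<close> and \<open>I\<close> avoid \<open>X\<close>. Against the lower bounds for
  the core this leaves \<open>cross G (S - X) (I - N X)\<close> as the unknown, which the next
  lemmas estimate in two ways.\<close>

lemma core_N_bound:
  assumes X: "X \<subseteq> S"
  shows "2 * (card S + card I) + card (induced E (N X)) \<le>
    3 * card (N X) + card (cross G (S - X) (I - N X)) + 4 + dS + dH"
proof -
  have "cross G S I \<subseteq> cross G S (N X) \<union> cross G (S - X) (I - N X)"
  proof
    fix e assume "e \<in> cross G S I"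
    then obtain a b where e: "e \<in> G" "a \<in> S" "b \<in> I" "e = {a, b}" by (auto simp: cross_def)
    show "e \<in> cross G S (N X) \<union> cross G (S - X) (I - N X)"
    proof (cases "b \<in> N X")
      case True
      then have "e \<in> cross G S (N X)" unfolding cross_def using e by blast
      then show ?thesis by blast
    next
      case False
      then have "a \<notin> X" using e by (auto simp: nbrs_def)
      then have "e \<in> cross G (S - X) (I - N X)" unfolding cross_def using e False by blast
      then show ?thesis by blast
    qed
  qed
  then have "card (cross G S I) \<le> card (cross G S (N X) \<union> cross G (S - X) (I - N X))"
    by (intro card_mono) auto
  also have "\<dots> \<le> card (cross G S (N X)) + card (cross G (S - X) (I - N X))" by (rule card_Un_le)
  finally have a: "card (cross G S I) \<le> card (cross G S (N X)) + card (cross G (S - X) (I - N X))" .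
  have SN: "S \<inter> N X = {}" using SI N_sub by blast
  have "card (induced G S \<union> cross G S (N X) \<union> induced E (N X)) + 6 \<le> 3 * card (S \<union> N X)"
  proof (rule edge_bound)
    show "S \<union> N X \<subseteq> V" using SV IV N_sub by blast
    show "induced G S \<union> cross G S (N X) \<union> induced E (N X) \<subseteq> E"
      using GE by (auto simp: induced_def cross_def)
    show "\<Union>(induced G S \<union> cross G S (N X) \<union> induced E (N X)) \<subseteq> S \<union> N X"
      by (auto simp: induced_def cross_def)
    have "card S \<le> card (S \<union> N X)" using finS by (intro card_mono) auto
    then show "3 \<le> card (S \<union> N X)" using large by linarith
  qed
  moreover have "card (S \<union> N X) = card S + card (N X)" using finS SN by (simp add: card_Un_disjoint)
  moreover have "card (induced G S \<union> cross G S (N X) \<union> induced E (N X)) =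
    card (induced G S) + card (cross G S (N X)) + card (induced E (N X))"
  proof -
    have "induced G S \<inter> cross G S (N X) = {}" using SN by (auto simp: induced_def cross_def)
    moreover have "(induced G S \<union> cross G S (N X)) \<inter> induced E (N X) = {}"
    proof (rule ccontr)
      assume "\<not> ?thesis"
      then obtain e where e: "e \<in> E" "e \<subseteq> N X" "e \<in> induced G S \<union> cross G S (N X)" by (auto simp: induced_def)
      have "e \<noteq> {}" using edge_card[OF e(1)] by auto
      then have "e \<inter> S \<noteq> {}" using e(3) by (auto simp: induced_def cross_def)
      then show False using e(2) SN by blast
    qed
    ultimately show ?thesis by (simp add: card_Un_disjoint)
  qed
  ultimately have b: "card (induced G S) + card (cross G S (N X)) + card (induced E (N X)) + 6 \<le> 3 * (card S + card (N X))"
    by simp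
  show ?thesis using a b coreS coreH unfolding distrib_left by linarith
qed

text \<open>Moving \<open>X\<close> to the side of \<open>I - N X\<close>, the edges from
  \<open>S - X\<close> to both sets form one bipartite planar graph. Its bound trades
  \<open>cross G (S - X) (I - N X)\<close> for the edges from \<open>X\<close> into the rest of the
  core, and the unknown of \<open>core_N_bound\<close> cancels.\<close>

lemma touch_upper:
  assumes X: "X \<subseteq> S"
  shows "card (touch X) + card (induced E (N X)) \<le> card (N X) + card (induced G X) + dS + dH"
proof -
  let ?R = "S - X" and ?J = "I - N X"
  have "card (cross G X ?R \<union> cross G ?R ?J) + 4 \<le> 2 * (card ?R + card (X \<union> ?J))"
  proof (rule bipartite_bound)
    show "cross G X ?R \<union> cross G ?R ?J \<subseteq> E" using GE by (auto simp: cross_def)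
    show "\<exists>a\<in>?R. \<exists>b\<in>X \<union> ?J. q = {a, b}" if "q \<in> cross G X ?R \<union> cross G ?R ?J" for q
      using that by (fastforce simp: cross_def)
    show "?R \<subseteq> V" "X \<union> ?J \<subseteq> V" "?R \<inter> (X \<union> ?J) = {}" using SV IV SI X by auto
    have "card X \<le> card (X \<union> ?J)" using finS finI X finite_subset by (intro card_mono) auto
    then show "3 \<le> card ?R + card (X \<union> ?J)" using card_S_diff[OF X] large by linarith
  qed
  moreover have "card (X \<union> ?J) = card X + card ?J"
    using X SI finI finite_subset[OF X finS] by (intro card_Un_disjoint) auto
  moreover have "card (cross G X ?R \<union> cross G ?R ?J) = card (cross G X ?R) + card (cross G ?R ?J)"
  proof (rule card_Un_disjoint)
    show "cross G X ?R \<inter> cross G ?R ?J = {}"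
    proof (rule ccontr)
      assume "\<not> ?thesis"
      then obtain e where e: "e \<in> cross G X ?R" "e \<in> cross G ?R ?J" by blast
      have "e \<subseteq> S" using e(1) X by (auto simp: cross_def)
      moreover have "e \<inter> I \<noteq> {}" using e(2) by (auto simp: cross_def)
      ultimately show False using SI by blast
    qed
  qed simp_all
  ultimately have "card (cross G X ?R) + card (cross G ?R ?J) + 4 \<le> 2 * (card S + card ?J)"
    using card_S_diff[OF X] by simp
  then show ?thesis using core_N_bound[OF X] touch_split[OF X] card_I_diff[of X] unfolding distrib_left by linarith
qed

text \<open>Here the unknown of \<open>core_N_bound\<close> is estimated by the bipartite bound on
  \<open>S - X\<close> and \<open>I - N X\<close> alone: up to the slack, \<open>X\<close> has twice
  as many neighbours as elements, and edges of \<open>E\<close> among the neighbours demand even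
  more.\<close>

lemma expansion_lower:
  assumes X: "X \<subseteq> S" and three: "3 \<le> card (S - X) + card (I - N X)"
  shows "2 * card X + card (induced E (N X)) \<le> card (N X) + dS + dH"
proof -
  have "card (cross G (S - X) (I - N X)) + 4 \<le> 2 * (card (S - X) + card (I - N X))"
  proof (rule bipartite_bound[OF _ _ _ _ _ three])
    show "cross G (S - X) (I - N X) \<subseteq> E" using GE by (auto simp: cross_def)
    show "\<exists>a\<in>S - X. \<exists>b\<in>I - N X. q = {a, b}" if "q \<in> cross G (S - X) (I - N X)" for q
      using that by (auto simp: cross_def)
  qed (use SV IV SI in auto)
  then show ?thesis
    using core_N_bound[OF X] card_I_diff[of X] card_S_diff[OF X] unfolding distrib_left by linarith
qed

lemma touch_pair:
  assumes "x \<in> S" "y \<in> S" "x \<noteq> y"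
  shows "card (touch {x, y}) + card (induced G {x, y}) = card (touch {x}) + card (touch {y})"
proof -
  have "touch {x} \<inter> touch {y} = induced G {x, y}"
  proof
    show "touch {x} \<inter> touch {y} \<subseteq> induced G {x, y}"
    proof
      fix e assume e: "e \<in> touch {x} \<inter> touch {y}"
      then have xy: "x \<in> e" "y \<in> e" "e \<in> G" by (auto simp: touch_def induced_def)
      have "e \<in> E" using xy GE by blast
      from edge_doubleton[OF this xy(1)] obtain b where "e = {x, b}" by metis
      then show "e \<in> induced G {x, y}" using xy assms(3) by (auto simp: induced_def)
    qed
    show "induced G {x, y} \<subseteq> touch {x} \<inter> touch {y}"
    proof
      fix e assume e: "e \<in> induced G {x, y}"
      then have eE: "e \<in> G" "e \<subseteq> {x, y}" "card e = 2" using GE edge_card by (auto simp: induced_def)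
      then have "e = {x, y}" using assms(3) by (intro card_subset_eq) auto
      then show "e \<in> touch {x} \<inter> touch {y}" using assms eE by (simp add: touch_def induced_def)
    qed
  qed
  moreover have "touch {x} \<union> touch {y} = touch {x, y}" by (auto simp: touch_def)
  ultimately show ?thesis using card_Un_Int[of "touch {x}" "touch {y}"] by simp
qed

lemma touch_triple:
  assumes "x \<in> S" "y \<in> S" "z \<in> S" "x \<noteq> y" "x \<noteq> z" "y \<noteq> z"
  shows "card (touch {x, y, z}) + card (induced G {x, z}) + card (induced G {y, z}) = card (touch {x, y}) + card (touch {z})"
proof -
  have pair: "e = {a, b}" if "e \<in> induced G {a, b}" "a \<noteq> b" for e a b
  proof -
    have "e \<subseteq> {a, b}" "card e = 2" using that GE edge_card by (auto simp: induced_def)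
    then show ?thesis using that(2) by (intro card_subset_eq) auto
  qed
  have "touch {x, y} \<inter> touch {z} = induced G {x, z} \<union> induced G {y, z}"
  proof
    show "touch {x, y} \<inter> touch {z} \<subseteq> induced G {x, z} \<union> induced G {y, z}"
    proof
      fix e assume e: "e \<in> touch {x, y} \<inter> touch {z}"
      then have xy: "x \<in> e \<or> y \<in> e" "z \<in> e" "e \<in> G" by (auto simp: touch_def induced_def)
      have "e \<in> E" using xy GE by blast
      from edge_doubleton[OF this xy(2)] obtain b where b: "e = {z, b}" by metis
      then have "b = x \<or> b = y" using xy(1) assms by blast
      then show "e \<in> induced G {x, z} \<union> induced G {y, z}" using xy(3) b by (auto simp: induced_def)
    qed
    show "induced G {x, z} \<union> induced G {y, z} \<subseteq> touch {x, y} \<inter> touch {z}"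
    proof
      fix e assume e: "e \<in> induced G {x, z} \<union> induced G {y, z}"
      then have "e \<in> G" by (auto simp: induced_def)
      moreover have "e = {x, z} \<or> e = {y, z}" using e pair assms(5,6) by blast
      ultimately show "e \<in> touch {x, y} \<inter> touch {z}" using assms by (auto simp: touch_def induced_def)
    qed
  qed
  moreover have "touch {x, y} \<union> touch {z} = touch {x, y, z}" by (auto simp: touch_def)
  moreover have "card (induced G {x, z} \<union> induced G {y, z}) = card (induced G {x, z}) + card (induced G {y, z})"
  proof (rule card_Un_disjoint)
    show "induced G {x, z} \<inter> induced G {y, z} = {}"
    proof (rule ccontr)
      assume "\<not> ?thesis"
      then obtain e where "e \<in> induced G {x, z}" "e \<in> induced G {y, z}" by blast
      then have "{x, z} = {y, z}" using pair assms(5,6) by metis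
      then show False using assms by (auto simp: doubleton_eq_iff)
    qed
  qed simp_all
  ultimately show ?thesis using card_Un_Int[of "touch {x, y}" "touch {z}"] by simp
qed

lemma induced_pair: "card (induced G {x, y}) \<le> 1"
proof -
  have "induced G {x, y} \<subseteq> {{x, y}}"
  proof
    fix e assume e: "e \<in> induced G {x, y}"
    then have *: "e \<subseteq> {x, y}" "card e = 2" using GE edge_card by (auto simp: induced_def)
    moreover have "card {x, y} \<le> 2" by (simp add: card_insert_if)
    ultimately have "e = {x, y}" by (intro card_seteq) auto
    then show "e \<in> {{x, y}}" by simp
  qed
  then have "card (induced G {x, y}) \<le> card {{x, y}}" by (intro card_mono) auto
  then show ?thesis by simp
qed

lemma induced_single: "card (induced G {x}) = 0"
proof -
  have "induced G {x} = {}"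
  proof (rule ccontr)
    assume "\<not> ?thesis"
    then obtain e where "e \<in> induced G {x}" by blast
    then have "e \<subseteq> {x}" "card e = 2" using GE edge_card by (auto simp: induced_def)
    then show False using card_mono[of "{x}" e] by simp
  qed
  then show ?thesis by simp
qed

lemma induced_triple:
  "card (induced G {x, y, z}) \<le> card (induced G {x, y}) + card (induced G {x, z}) + card (induced G {y, z})"
proof -
  have "induced G {x, y, z} \<subseteq> induced G {x, y} \<union> induced G {x, z} \<union> induced G {y, z}"
  proof
    fix e assume "e \<in> induced G {x, y, z}"
    then have e: "e \<in> G" "e \<subseteq> {x, y, z}" "card e = 2" using GE edge_card by (auto simp: induced_def)
    then obtain a b where "e = {a, b}" by (meson card_2_iff)
    then show "e \<in> induced G {x, y} \<union> induced G {x, z} \<union> induced G {y, z}"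
      using e(1,2) by (auto simp: induced_def)
  qed
  then have "card (induced G {x, y, z}) \<le> card (induced G {x, y} \<union> induced G {x, z} \<union> induced G {y, z})"
    by (intro card_mono) auto
  also have "\<dots> \<le> card (induced G {x, y} \<union> induced G {x, z}) + card (induced G {y, z})" by (rule card_Un_le)
  also have "\<dots> \<le> card (induced G {x, y}) + card (induced G {x, z}) + card (induced G {y, z})"
    using card_Un_le by simp
  finally show ?thesis .
qed

text \<open>A set endangering Hall's condition once \<open>u\<close> and \<open>v\<close> are taken
  away. The inequality is not strict because the forbidden edge \<open>g\<close> may cost
  \<open>A\<close> one more neighbour.\<close>

definition tight_set where
  "tight_set u v A \<longleftrightarrow> A \<subseteq> S \<and> A \<noteq> {} \<and> card (N A - {u, v}) \<le> card A"

text \<open>If both ends of \<^term>\<open>{u, v}\<close> are new neighbours, then the edge itself is new in the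
  neighbourhood, so in either case \<open>card (N X) - card (induced E (N X))\<close> grows by at most
  \<open>card A + 1\<close>.\<close>

lemma tight_step:
  assumes uv: "{u, v} \<in> E" and A: "tight_set u v A" and new: "u \<notin> N X" "v \<notin> N X"
  shows "card (N (X \<union> A)) + card (induced E (N X)) + card (N X \<inter> N A) \<le>
    card (N X) + card A + 1 + card (induced E (N (X \<union> A)))"
proof -
  define K where "K = N A - N X"
  have finK: "finite K" by (simp add: K_def)
  have NU: "card (N (X \<union> A)) = card (N X) + card K"
  proof -
    have "N (X \<union> A) = N X \<union> K" by (auto simp: N_Un K_def)
    moreover have "N X \<inter> K = {}" by (auto simp: K_def)
    ultimately show ?thesis using finK by (simp add: card_Un_disjoint)
  qed
  have "card (K - {u, v}) + card (N X \<inter> N A) = card ((K - {u, v}) \<union> (N X \<inter> N A))"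
    by (rule card_Un_disjoint[symmetric]) (auto simp: K_def)
  also have "(K - {u, v}) \<union> (N X \<inter> N A) = N A - {u, v}" using new by (auto simp: K_def)
  finally have "card (K - {u, v}) + card (N X \<inter> N A) \<le> card A" using A by (simp add: tight_set_def)
  moreover have "card K + card (induced E (N X)) \<le> card (K - {u, v}) + 1 + card (induced E (N (X \<union> A)))"
  proof (cases "u \<in> K \<and> v \<in> K")
    case True
    have "insert {u, v} (induced E (N X)) \<subseteq> induced E (N (X \<union> A))"
      using True uv by (auto simp: induced_def N_Un K_def)
    then have "card (insert {u, v} (induced E (N X))) \<le> card (induced E (N (X \<union> A)))"
      by (intro card_mono) auto
    moreover have "{u, v} \<notin> induced E (N X)" using new by (simp add: induced_def)
    ultimately have 1: "card (induced E (N X)) + 1 \<le> card (induced E (N (X \<union> A)))" by simp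
    have "K = (K - {u, v}) \<union> {u, v}" using True by blast
    then have "card K \<le> card (K - {u, v}) + card {u, v}" using card_Un_le by metis
    moreover have "card {u, v} \<le> 2" by (simp add: card_insert_if)
    ultimately show ?thesis using 1 by linarith
  next
    case False
    have "induced E (N X) \<subseteq> induced E (N (X \<union> A))" by (auto simp: induced_def N_Un)
    then have 1: "card (induced E (N X)) \<le> card (induced E (N (X \<union> A)))" by (intro card_mono) auto
    obtain w where "K \<subseteq> (K - {u, v}) \<union> {w}" using False by blast
    then have "card K \<le> card ((K - {u, v}) \<union> {w})" using finK by (intro card_mono) auto
    also have "\<dots> \<le> card (K - {u, v}) + card {w}" by (rule card_Un_le)
    finally show ?thesis using 1 by simp
  qed
  ultimately show ?thesis using NU by linarith
qed

lemma tight_first: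
  assumes uv: "{u, v} \<in> E" and A: "tight_set u v A"
  shows "card (N A) \<le> card A + 1 + card (induced E (N A))" "card (N A) \<le> card A + 2"
proof -
  have "N {} = {}" by (simp add: nbrs_def)
  then show "card (N A) \<le> card A + 1 + card (induced E (N A))"
    using tight_step[OF uv A, of "{}"] by simp
  have "N A \<subseteq> (N A - {u, v}) \<union> {u, v}" by blast
  then have "card (N A) \<le> card ((N A - {u, v}) \<union> {u, v})" by (intro card_mono) auto
  also have "\<dots> \<le> card (N A - {u, v}) + card {u, v}" by (rule card_Un_le)
  also have "\<dots> \<le> card A + 2"
    using A card_insert_le_m1[of 2 "{v}" u] by (simp add: tight_set_def card_insert_if)
  finally show "card (N A) \<le> card A + 2" .
qed

lemma N_single_degree:
  assumes x: "x \<in> S"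
  shows "2 \<le> card (N {x}) + dH"
proof -
  have "cross G S I \<subseteq> cross G (S - {x}) I \<union> (\<lambda>y. {x, y}) ` N {x}"
    by (auto simp: cross_def nbrs_def)
  then have "card (cross G S I) \<le> card (cross G (S - {x}) I \<union> (\<lambda>y. {x, y}) ` N {x})"
    by (intro card_mono) auto
  also have "\<dots> \<le> card (cross G (S - {x}) I) + card ((\<lambda>y. {x, y}) ` N {x})" by (rule card_Un_le)
  also have "card ((\<lambda>y. {x, y}) ` N {x}) \<le> card (N {x})" by (rule card_image_le) simp
  finally have a: "card (cross G S I) \<le> card (cross G (S - {x}) I) + card (N {x})" by simp
  have cS: "card (S - {x}) + 1 = card S" using card_S_diff[of "{x}"] x by simp
  have "card (cross G (S - {x}) I) + 4 \<le> 2 * (card (S - {x}) + card I)"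
  proof (rule bipartite_bound)
    show "cross G (S - {x}) I \<subseteq> E" using GE by (auto simp: cross_def)
    show "\<exists>a\<in>S - {x}. \<exists>b\<in>I. q = {a, b}" if "q \<in> cross G (S - {x}) I" for q
      using that by (auto simp: cross_def)
    show "3 \<le> card (S - {x}) + card I" using cS large by linarith
  qed (use SV IV SI in auto)
  then show ?thesis using a coreH cS unfolding distrib_left by linarith
qed

text \<open>Without slack, \<open>expansion_lower\<close> and \<open>tight_first\<close> leave only
  \<open>A = {x}\<close>. Then \<open>x\<close> has at least three edges inside the core by
  \<open>touch_lower\<close>, but at most \<open>card (N A) - card (induced E (N A)) \<le> 2\<close>
  by \<open>touch_upper\<close>.\<close>

lemma no_tight_set:
  assumes d: "dS = 0" "dH = 0" and s6: "6 \<le> card S" and wide: "2 * card S \<le> card I + 3"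
    and uv: "{u, v} \<in> E"
  shows "\<not> tight_set u v A"
proof
  assume A: "tight_set u v A"
  note AS = A[unfolded tight_set_def]
  have AS': "A \<subseteq> S" using AS by blast
  have aS: "card A \<le> card S" using AS finS by (intro card_mono) auto
  have J: "2 * card S \<le> card (I - N A) + card A + 5" using card_I_diff[of A] tight_first(2)[OF uv A] wide by linarith
  \<comment> \<open>If \<open>A\<close> omits at most one vertex of \<open>S\<close>, some
    \<open>w\<close> in \<open>I\<close> outside \<open>N A\<close> sends at most one edge to
    \<open>S\<close>. Deleting \<open>w\<close> would then leave more edges than the bipartite bound
    permits.\<close>
  have "2 \<le> card (S - A)"
  proof (rule ccontr)
    assume less: "\<not> ?thesis"
    have "card (I - N A) \<noteq> 0" using J aS s6 by linarith
    then have "I - N A \<noteq> {}" by (metis card.empty)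
    then obtain w where w: "w \<in> I" "w \<notin> N A" by blast
    have cI: "card (I - {w}) + 1 = card I" using w finI card_Suc_Diff1 by fastforce
    have "cross G S I \<subseteq> cross G S (I - {w}) \<union> (\<lambda>y. {y, w}) ` (S - A)"
    proof
      fix e assume "e \<in> cross G S I"
      then obtain a b where e: "e \<in> G" "a \<in> S" "b \<in> I" "e = {a, b}" by (auto simp: cross_def)
      show "e \<in> cross G S (I - {w}) \<union> (\<lambda>y. {y, w}) ` (S - A)"
      proof (cases "b = w")
        case True
        then have "a \<notin> A" using e w by (auto simp: nbrs_def)
        then show ?thesis using e True by blast
      next
        case False
        then have "e \<in> cross G S (I - {w})" unfolding cross_def using e by blast
        then show ?thesis by blast
      qed
    qed
    then have "card (cross G S I) \<le> card (cross G S (I - {w}) \<union> (\<lambda>y. {y, w}) ` (S - A))"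
      using finS by (intro card_mono) auto
    also have "\<dots> \<le> card (cross G S (I - {w})) + card ((\<lambda>y. {y, w}) ` (S - A))" by (rule card_Un_le)
    also have "card ((\<lambda>y. {y, w}) ` (S - A)) \<le> card (S - A)" by (rule card_image_le) (use finS in simp)
    finally have a: "card (cross G S I) \<le> card (cross G S (I - {w})) + card (S - A)" by simp
    have "card (cross G S (I - {w})) + 4 \<le> 2 * (card S + card (I - {w}))"
    proof (rule bipartite_bound)
      show "cross G S (I - {w}) \<subseteq> E" using GE by (auto simp: cross_def)
      show "\<exists>a\<in>S. \<exists>b\<in>I - {w}. q = {a, b}" if "q \<in> cross G S (I - {w})" for q
        using that by (auto simp: cross_def)
      show "3 \<le> card S + card (I - {w})" using s6 by linarith
    qed (use SV IV SI in auto)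
    then show False using a coreH d cI less unfolding distrib_left by linarith
  qed
  then have "3 \<le> card (S - A) + card (I - N A)" using J card_S_diff[OF AS'] s6 by linarith
  then have "2 * card A + card (induced E (N A)) \<le> card (N A)"
    using expansion_lower[OF AS'] d by simp
  then have "card A \<le> 1" using tight_first(1)[OF uv A] by linarith
  moreover have "card A \<noteq> 0" using AS finS finite_subset[OF AS' finS] by simp
  ultimately have "card A = 1" by linarith
  then obtain x where x: "A = {x}" by (rule card_1_singletonE)
  have "3 * card A \<le> card (touch A)"
    using touch_lower[OF AS'] card_S_diff[OF AS'] \<open>card A = 1\<close> s6 d by simp
  moreover have "card (touch A) + card (induced E (N A)) \<le> card (N A)"
    using touch_upper[OF AS'] d x induced_single[of x] by simp
  ultimately show False using tight_first(1)[OF uv A] \<open>card A = 1\<close> by linarith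
qed

end

section \<open>Tight sets when one edge is missing\<close>

locale slack_one_core = tight_core +
  assumes slack: "dS + dH \<le> 1" and wide: "card S + 12 \<le> card I"
begin

text \<open>By \<open>expansion_lower\<close> only a single vertex with at most one neighbour could
  fail. Its missing second neighbour uses up the slack, so \<open>dH = 1\<close> and
  \<open>dS = 0\<close>; then \<open>touch_lower\<close> demands three edges in the core and
  \<open>touch_upper\<close> permits two.\<close>

lemma N_expands:
  assumes B: "B \<subseteq> S" "B \<noteq> {}"
  shows "card B + 1 \<le> card (N B)"
proof (rule ccontr)
  assume "\<not> ?thesis"
  then have less: "card (N B) \<le> card B" by linarith
  have bS: "card B \<le> card S" using B finS by (intro card_mono) auto
  have "3 \<le> card (S - B) + card (I - N B)" using card_I_diff[of B] less wide bS by linarith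
  from expansion_lower[OF B(1) this] have "card B \<le> 1" using less slack by linarith
  moreover have "card B \<noteq> 0" using B finite_subset[OF B(1) finS] by simp
  ultimately have "card B = 1" by linarith
  then obtain x where x: "B = {x}" by (rule card_1_singletonE)
  have "3 \<le> card (touch B) + dS"
    using touch_lower[OF B(1)] card_S_diff[OF B(1)] \<open>card B = 1\<close> large by simp
  moreover have "card (touch B) \<le> 1 + dS + dH"
    using touch_upper[OF B(1)] x induced_single[of x] less by simp
  moreover have "2 \<le> card (N B) + dH" using N_single_degree[of x] B x by simp
  ultimately show False using less slack \<open>card B = 1\<close> by linarith
qed

lemma tight_card:
  assumes uv: "{u, v} \<in> E" and A: "tight_set u v A"
  shows "card A \<le> 2"
proof -
  have AS: "A \<subseteq> S" using A by (simp add: tight_set_def)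
  have "card A \<le> card S" using AS finS by (intro card_mono) auto
  then have "3 \<le> card (S - A) + card (I - N A)" using card_I_diff[of A] tight_first(2)[OF uv A] wide by linarith
  from expansion_lower[OF AS this] show ?thesis using tight_first(1)[OF uv A] slack by linarith
qed

lemma tight_single:
  assumes uv: "{u, v} \<in> E" and A: "tight_set u v {x}"
  shows "card (touch {x}) \<le> 3"
proof -
  have "{x} \<subseteq> S" using A by (simp add: tight_set_def)
  from touch_upper[OF this] show ?thesis
    using tight_first(1)[OF uv A] slack induced_single[of x] by simp
qed

text \<open>At least \<open>6 - dS\<close> edges of the core meet the pair and at most
  \<open>4 + card (induced G {x, y})\<close> can. So the pair is adjacent and the missing edge of
  \<open>G\<close> lies inside the core.\<close>

lemma tight_pair:
  assumes uv: "{u, v} \<in> E" and A: "tight_set u v {x, y}" and "x \<noteq> y"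
  shows "card (induced G {x, y}) = 1" "card (touch {x, y}) = 5" "dS = 1"
proof -
  have AS: "{x, y} \<subseteq> S" using A by (simp add: tight_set_def)
  have c: "card {x, y} = 2" using assms(3) by simp
  have "3 \<le> card (S - {x, y})" using card_S_diff[OF AS] c large by linarith
  from touch_lower[OF AS this] have 1: "6 \<le> card (touch {x, y}) + dS" using c by linarith
  have 2: "card (touch {x, y}) \<le> 4 + card (induced G {x, y})"
    using touch_upper[OF AS] tight_first(1)[OF uv A] c slack by linarith
  show "card (induced G {x, y}) = 1" "card (touch {x, y}) = 5" "dS = 1"
    using 1 2 induced_pair[of x y] slack by linarith+
qed

text \<open>The pair forces \<open>dS = 1\<close>, so at least 8 core edges meet the triple.
  Inclusion and exclusion gives at most \<open>5 + 3\<close>, with equality only if \<open>z\<close>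
  is adjacent to neither \<open>x\<close> nor \<open>y\<close>; then \<open>up\<close> permits only
  7.\<close>

lemma no_pair_and_single:
  assumes P: "{u, v} \<in> E" "tight_set u v {x, y}" "x \<noteq> y"
    and z: "{u', v'} \<in> E" "tight_set u' v' {z}" "z \<noteq> x" "z \<noteq> y"
    and up: "card (touch {x, y, z}) \<le> 6 + card (induced G {x, y, z})"
  shows False
proof -
  have S: "x \<in> S" "y \<in> S" "z \<in> S" using P(2) z(2) by (simp_all add: tight_set_def)
  have U: "{x, y, z} \<subseteq> S" using S by simp
  have c: "card {x, y, z} = 3" using P(3) z(3,4) by simp
  note p = tight_pair[OF P]
  have "3 \<le> card (S - {x, y, z})" using card_S_diff[OF U] c large p(3) by linarith
  from touch_lower[OF U this] have "8 \<le> card (touch {x, y, z})" using c p(3) by linarith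
  moreover have "card (touch {x, y, z}) + card (induced G {x, z}) + card (induced G {y, z}) = 5 + card (touch {z})"
    using touch_triple[OF S P(3)] z(3,4) p(2) by simp
  moreover have "card (touch {z}) \<le> 3" by (rule tight_single[OF z(1,2)])
  ultimately show False using up induced_triple[of x y z] p(1) by linarith
qed

text \<open>Adding the growth estimates for \<open>A\<close> and \<open>B\<close> and comparing with
  \<open>expansion_lower\<close> gives \<open>card (A \<union> B) \<le> 3 + card (A \<inter> B) -
  card (N A \<inter> N B)\<close>. A nonempty intersection has more neighbours than elements, which
  leaves two. A union of size three is a tight pair with a disjoint tight single vertex, which
  cannot occur. \<open>B\<close> is not inside \<open>A\<close>, since then \<open>u'\<close> and
  \<open>v'\<close> would not be neighbours of \<open>B\<close> at all.\<close>

lemma two_tight_sets: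
  assumes A: "{u, v} \<in> E" "tight_set u v A" and B: "{u', v'} \<in> E" "tight_set u' v' B"
    and new: "u' \<notin> N A" "v' \<notin> N A"
  shows "\<not> B \<subseteq> A" "card (A \<union> B) = 2" "card (touch (A \<union> B)) \<le> 5 + card (induced G (A \<union> B))"
proof -
  have AS: "A \<subseteq> S" "A \<noteq> {}" and BS: "B \<subseteq> S" "B \<noteq> {}" "card (N B - {u', v'}) \<le> card B"
    using A(2) B(2) by (auto simp: tight_set_def)
  have fin: "finite A" "finite B" using AS BS finS finite_subset by blast+
  show BA: "\<not> B \<subseteq> A"
  proof
    assume "B \<subseteq> A"
    then have "N B - {u', v'} = N B" using N_mono[of B A] new by blast
    then show False using BS(3) N_expands[OF BS(1,2)] by simp
  qed
  let ?U = "A \<union> B"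
  have U: "?U \<subseteq> S" using AS BS by blast
  have cU: "card ?U + card (A \<inter> B) = card A + card B" using card_Un_Int[OF fin] by simp
  have ab: "card A \<le> 2" "card B \<le> 2" using tight_card A B by blast+
  have ab0: "card A \<noteq> 0" "card B \<noteq> 0" using AS BS fin by simp_all
  have bU: "card (N ?U) + card (N A \<inter> N B) \<le> card A + card B + 2 + card (induced E (N ?U))"
    using tight_step[OF B new] tight_first(1)[OF A] by linarith
  have "card (N ?U) \<le> card (N A) + card (N B)" unfolding N_Un by (rule card_Un_le)
  then have "card (N ?U) \<le> 8" using tight_first(2)[OF A] tight_first(2)[OF B] ab by linarith
  then have "3 \<le> card (S - ?U) + card (I - N ?U)" using card_I_diff[of ?U] wide large by linarith
  from expansion_lower[OF U this] have lower: "2 * card ?U + card (induced E (N ?U)) \<le> card (N ?U) + 1"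
    using slack by linarith
  have upper: "card (touch ?U) + card (induced E (N ?U)) \<le> card (N ?U) + card (induced G ?U) + 1"
    using touch_upper[OF U] slack by linarith
  have meet: "card (A \<inter> B) + 1 \<le> card (N A \<inter> N B)" if "A \<inter> B \<noteq> {}"
  proof -
    have "card (A \<inter> B) + 1 \<le> card (N (A \<inter> B))" using that AS by (intro N_expands) auto
    also have "\<dots> \<le> card (N A \<inter> N B)" 
      using N_mono[of "A \<inter> B" A] N_mono[of "A \<inter> B" B] by (intro card_mono) auto
    finally show ?thesis .
  qed
  have two: "2 \<le> card ?U"
  proof -
    have "A \<subset> ?U" using BA by blast
    then have "card A < card ?U" using fin by (intro psubset_card_mono) auto
    then show ?thesis using ab0 by linarith
  qed
  have le3: "card ?U \<le> 2 \<or> A \<inter> B = {} \<and> card ?U = 3"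
  proof (cases "A \<inter> B = {}")
    case True
    then have "card (A \<inter> B) = 0" by simp
    then show ?thesis using True cU lower bU by linarith
  next
    case False
    then show ?thesis using meet lower bU cU by linarith
  qed
  have "card ?U \<noteq> 3"
  proof
    assume c3: "card ?U = 3"
    then have dis: "A \<inter> B = {}" using le3 by linarith
    then have s: "card A + card B = 3" using cU c3 by simp
    have f: "card (touch ?U) \<le> 6 + card (induced G ?U)" using upper bU s by linarith
    consider "card A = 2 \<and> card B = 1" | "card A = 1 \<and> card B = 2" using s ab ab0 by linarith
    then show False
    proof cases
      case 1
      then obtain x y z where e: "A = {x, y}" "x \<noteq> y" "B = {z}" by (meson card_1_singletonE card_2_iff)
      then have "A \<union> B = {x, y, z}" by blast
      then show False
        using no_pair_and_single[of u v x y u' v' z] A B e dis f by auto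
    next
      case 2
      then obtain x y z where e: "B = {x, y}" "x \<noteq> y" "A = {z}" by (meson card_1_singletonE card_2_iff)
      then have "A \<union> B = {x, y, z}" by blast
      then show False
        using no_pair_and_single[of u' v' x y u v z] A B e dis f by auto
    qed
  qed
  then show c2: "card ?U = 2" using two le3 by linarith
  show "card (touch ?U) \<le> 5 + card (induced G ?U)"
  proof (cases "A \<inter> B = {}")
    case True
    then have "card (A \<inter> B) = 0" by simp
    then show ?thesis using upper bU cU c2 by linarith
  next
    case False
    then show ?thesis using upper bU cU c2 meet by linarith
  qed
qed

text \<open>All unions of two of the sets have two elements and \<open>A3\<close> is not inside
  \<open>A1 \<union> A2\<close>, so the sets are three different singletons, each meeting at most
  three core edges, and each pair satisfies the bound of \<open>two_tight_sets\<close>.\<close>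

lemma no_three_tight_sets:
  assumes A: "{u1, v1} \<in> E" "tight_set u1 v1 A1" and B: "{u2, v2} \<in> E" "tight_set u2 v2 A2"
    and C: "{u3, v3} \<in> E" "tight_set u3 v3 A3"
    and newB: "u2 \<notin> N A1" "v2 \<notin> N A1" and newC: "u3 \<notin> N A1 \<union> N A2" "v3 \<notin> N A1 \<union> N A2"
  shows False
proof -
  have AS: "A1 \<subseteq> S" "A1 \<noteq> {}" "A2 \<subseteq> S" and CS: "A3 \<subseteq> S" "A3 \<noteq> {}" "card (N A3 - {u3, v3}) \<le> card A3"
    using A(2) B(2) C(2) by (auto simp: tight_set_def)
  note t12 = two_tight_sets[OF A B newB]
  have "u3 \<notin> N A1" "v3 \<notin> N A1" "u3 \<notin> N A2" "v3 \<notin> N A2" using newC by blast+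
  note t13 = two_tight_sets[OF A C this(1,2)] and t23 = two_tight_sets[OF B C this(3,4)]
  have "\<not> A3 \<subseteq> A1 \<union> A2"
  proof
    assume "A3 \<subseteq> A1 \<union> A2"
    then have "N A3 \<subseteq> N A1 \<union> N A2" using N_mono N_Un by metis
    then have "N A3 - {u3, v3} = N A3" using newC by blast
    then show False using CS(3) N_expands[OF CS(1,2)] by simp
  qed
  then obtain z where z: "z \<in> A3" "z \<notin> A1" "z \<notin> A2" by blast
  obtain y where y: "y \<in> A2" "y \<notin> A1" using t12(1) by blast
  obtain x where x: "x \<in> A1" using AS(2) by blast
  have ne: "x \<noteq> y" "x \<noteq> z" "y \<noteq> z" using x y z by auto
  have fin: "finite (A1 \<union> A2)" "finite (A1 \<union> A3)" "finite (A2 \<union> A3)"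
    using AS CS finite_subset[OF _ finS] by auto
  have eq: "A1 \<union> A2 = {x, y}" "A1 \<union> A3 = {x, z}" "A2 \<union> A3 = {y, z}"
    using card_subset_eq[OF fin(1), of "{x, y}"] card_subset_eq[OF fin(2), of "{x, z}"]
      card_subset_eq[OF fin(3), of "{y, z}"] x y z ne t12(2) t13(2) t23(2) by auto
  have "A1 = {x}" using eq(1,2) x ne by blast
  have "A2 = {y}" using eq(1,3) y ne by blast
  have "A3 \<subseteq> {x, z}" "A3 \<subseteq> {y, z}" using eq(2,3) by blast+
  then have "A3 = {z}" using z(1) ne by auto
  have S: "x \<in> S" "y \<in> S" "z \<in> S" using x y z AS CS by blast+
  have f3: "card (touch {x}) \<le> 3" "card (touch {y}) \<le> 3" "card (touch {z}) \<le> 3"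
    using tight_single A B C \<open>A1 = {x}\<close> \<open>A2 = {y}\<close> \<open>A3 = {z}\<close> by blast+
  note pxy = touch_pair[OF S(1,2) ne(1)] and pxz = touch_pair[OF S(1,3) ne(2)] and pyz = touch_pair[OF S(2,3) ne(3)]
  note u = t12(3)[unfolded eq(1)] t13(3)[unfolded eq(2)] t23(3)[unfolded eq(3)]
  show False
  proof (cases "dS = 0")
    case True
    have xyS: "{x, y} \<subseteq> S" using S by simp
    have c: "card {x, y} = 2" using ne by simp
    have "3 \<le> card (S - {x, y})" using card_S_diff[OF xyS] c large by linarith
    from touch_lower[OF xyS this] show False using c True pxy f3 u(1) by linarith
  next
    case False
    have xyzS: "{x, y, z} \<subseteq> S" using S by simp
    have c: "card {x, y, z} = 3" using ne by simp
    have "3 \<le> card (S - {x, y, z})" using card_S_diff[OF xyzS] c large False by linarith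
    from touch_lower[OF xyzS this] have "8 \<le> card (touch {x, y, z})" using c slack by linarith
    moreover have "card (touch {x, y, z}) + card (induced G {x, z}) + card (induced G {y, z}) = card (touch {x, y}) + card (touch {z})"
      by (rule touch_triple[OF S ne])
    \<comment> \<open>Adding the three bounds for pairs gives
      \<open>2 * card (touch {x, y, z}) \<le> 15\<close>, while at least 8 core edges meet the
      triple.\<close>
    ultimately show False
      using pxy pxz pyz u by linarith
  qed
qed

text \<open>A tight set has at most two elements and hence at most four neighbours in
  \<open>I\<close>. Two of them block at most eight vertices, which is the 8 in
  \<open>avail\<close>, so a third edge can be found outside both neighbourhoods.\<close>

lemma loose_edge:
  assumes avail: "\<And>W. W \<subseteq> I \<Longrightarrow> card I \<le> card W + 8 \<Longrightarrow> \<exists>u\<in>W. \<exists>v\<in>W. {u, v} \<in> E"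
  shows "\<exists>u\<in>I. \<exists>v\<in>I. {u, v} \<in> E \<and> (\<forall>A. \<not> tight_set u v A)"
proof (rule ccontr)
  assume none: "\<not> ?thesis"
  have bad: "\<exists>A. tight_set u v A" if "u \<in> I" "v \<in> I" "{u, v} \<in> E" for u v
    using none that by blast
  have small: "card (N A) \<le> 4" if "{u, v} \<in> E" "tight_set u v A" for u v A
    using tight_first(2)[OF that] tight_card[OF that] by linarith
  obtain u1 v1 where 1: "u1 \<in> I" "v1 \<in> I" "{u1, v1} \<in> E" using avail[of I] by auto
  obtain A1 where A1: "tight_set u1 v1 A1" using bad[OF 1] by blast
  have "card I \<le> card (I - N A1) + 8" using card_I_diff[of A1] small[OF 1(3) A1] by linarith
  then obtain u2 v2 where 2: "u2 \<in> I - N A1" "v2 \<in> I - N A1" "{u2, v2} \<in> E"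
    using avail[of "I - N A1"] by blast
  obtain A2 where A2: "tight_set u2 v2 A2" using bad 2 by blast
  have "card (N (A1 \<union> A2)) \<le> card (N A1) + card (N A2)" unfolding N_Un by (rule card_Un_le)
  then have "card I \<le> card (I - N (A1 \<union> A2)) + 8"
    using card_I_diff[of "A1 \<union> A2"] small[OF 1(3) A1] small[OF 2(3) A2] by linarith
  then obtain u3 v3 where 3: "u3 \<in> I - N (A1 \<union> A2)" "v3 \<in> I - N (A1 \<union> A2)" "{u3, v3} \<in> E"
    using avail[of "I - N (A1 \<union> A2)"] by blast
  obtain A3 where A3: "tight_set u3 v3 A3" using bad 3 by blast
  show False
    by (rule no_three_tight_sets[OF 1(3) A1 2(3) A2 3(3) A3]) (use 2 3 N_Un[of A1 A2] in auto)
qed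

end

context tight_core
begin

text \<open>Forbidding \<open>g\<close> removes at most one vertex of \<open>I\<close> from a
  neighbourhood, so a set violating Hall's condition in \<open>F\<close> would be tight.\<close>

lemma matching_into_I:
  assumes loose: "\<And>A. \<not> tight_set u v A"
  shows "\<exists>f. inj_on f S \<and> (\<forall>x\<in>S. f x \<in> I - {u, v} \<and> {x, f x} \<in> G - {g})"
proof -
  define F where "F = (\<lambda>x. {y \<in> I - {u, v}. {x, y} \<in> G - {g}})"
  have "\<exists>f. inj_on f S \<and> (\<forall>x\<in>S. f x \<in> F x)"
  proof (rule hall_marriage[OF finS])
    show "finite (F x)" if "x \<in> S" for x using finI by (simp add: F_def)
    show "card A \<le> card (\<Union>(F ` A))" if A: "A \<subseteq> S" for A
    proof (rule ccontr)
      assume less: "\<not> ?thesis"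
      define W where "W = {y \<in> I. \<exists>x\<in>S. g = {x, y}}"
      have W1: "card W \<le> 1"
      proof (cases "W = {}")
        case False
        then obtain y where y: "y \<in> W" by blast
        then have "W \<subseteq> {y}" using SI by (auto simp: W_def doubleton_eq_iff)
        then have "card W \<le> card {y}" by (intro card_mono) auto
        then show ?thesis by simp
      qed simp
      have finF: "finite (\<Union>(F ` A))" using finite_subset[of "\<Union>(F ` A)" I] finI by (auto simp: F_def)
      have "N A - {u, v} \<subseteq> \<Union>(F ` A) \<union> W"
      proof
        fix y assume y: "y \<in> N A - {u, v}"
        then obtain x where x: "x \<in> A" "{x, y} \<in> G" "y \<in> I" by (auto simp: nbrs_def)
        show "y \<in> \<Union>(F ` A) \<union> W"
        proof (cases "{x, y} = g")
          case True
          then show ?thesis using x A by (auto simp: W_def)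
        next
          case False
          then have "y \<in> F x" using x y by (simp add: F_def)
          then show ?thesis using x(1) by blast
        qed
      qed
      then have "card (N A - {u, v}) \<le> card (\<Union>(F ` A) \<union> W)"
        using finF finI by (intro card_mono) (auto simp: W_def)
      also have "\<dots> \<le> card (\<Union>(F ` A)) + card W" by (rule card_Un_le)
      finally have "card (N A - {u, v}) \<le> card A" using W1 less by linarith
      moreover have "A \<noteq> {}" using less by auto
      ultimately show False using loose[of A] A by (simp add: tight_set_def)
    qed
  qed
  then show ?thesis by (auto simp: F_def)
qed

end

section \<open>Rainbow matchings\<close>

lemma matching_copyD:
  assumes copy: "copy_of (matching_graph t) (V, E) f"
    and M: "M = (\<lambda>e. f ` e) ` edges (matching_graph t)"
  shows "M \<subseteq> E" "finite M" "disjoint M" "card M = t"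
proof -
  have inj: "inj_on f {..<2 * t}" and E: "f ` {2 * i, 2 * i + 1} \<in> E" if "i < t" for i
    using copy that by (auto simp: copy_of_def matching_graph_def)
  have M': "M = (\<lambda>i. f ` {2 * i, 2 * i + 1}) ` {..<t}" by (simp add: M matching_graph_def image_image)
  show "M \<subseteq> E" using E by (auto simp: M')
  show "finite M" by (simp add: M')
  have dis: "f ` {2 * i, 2 * i + 1} \<inter> f ` {2 * j, 2 * j + 1} = {}" if ij: "i < t" "j < t" "i \<noteq> j" for i j
  proof (rule ccontr)
    assume "\<not> ?thesis"
    then obtain a b where ab: "a \<in> {2 * i, 2 * i + 1}" "b \<in> {2 * j, 2 * j + 1}" "f a = f b" by blast
    have "a < 2 * t" "b < 2 * t" using ab ij by auto
    then have "a = b" using inj[OF ij(1)] ab(3) by (simp add: inj_on_eq_iff)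
    moreover have "a div 2 = i" "b div 2 = j" using ab(1,2) by auto
    ultimately show False using ij(3) by simp
  qed
  show "disjoint M"
  proof (rule disjointI)
    fix a b assume ab: "a \<in> M" "b \<in> M" "a \<noteq> b"
    then obtain i j where "i < t" "j < t" "a = f ` {2 * i, 2 * i + 1}" "b = f ` {2 * j, 2 * j + 1}"
      by (auto simp: M')
    then show "a \<inter> b = {}" using dis[of i j] ab(3) by auto
  qed
  have "inj_on (\<lambda>i. f ` {2 * i, 2 * i + 1}) {..<t}"
  proof (rule inj_onI)
    fix i j assume ij: "i \<in> {..<t}" "j \<in> {..<t}" "f ` {2 * i, 2 * i + 1} = f ` {2 * j, 2 * j + 1}"
    show "i = j"
    proof (rule ccontr)
      assume "i \<noteq> j"
      have "f ` {2 * i, 2 * i + 1} \<inter> f ` {2 * j, 2 * j + 1} = {}"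
        by (rule dis) (use ij(1,2) \<open>i \<noteq> j\<close> in auto)
      then show False unfolding ij(3) by auto
    qed
  qed
  then show "card M = t" by (simp add: M' card_image)
qed

lemma rainbow_copyI:
  assumes M: "M \<subseteq> E" "finite M" "disjoint M" "card M = t" "inj_on c M"
    and E: "\<And>e. e \<in> E \<Longrightarrow> e \<subseteq> V" "\<And>e. e \<in> E \<Longrightarrow> card e = 2"
  shows "contains_rainbow c (V, E) (matching_graph t)"
proof -
  obtain h where "bij_betw h {0..<card M} M" using ex_bij_betw_nat_finite[OF M(2)] by blast
  then have h: "inj_on h {..<t}" "h ` {..<t} = M" using M(4) by (simp_all add: bij_betw_def atLeast0LessThan)
  have "\<forall>e\<in>M. \<exists>a b. e = {a, b} \<and> a \<noteq> b" using M(1) E(2) by (meson card_2_iff subsetD)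
  then obtain a b where ab: "\<forall>e\<in>M. e = {a e, b e} \<and> a e \<noteq> b e" by metis
  define f where "f = (\<lambda>j. if even j then a (h (j div 2)) else b (h (j div 2)))"
  have hM: "h i \<in> M" if "i < t" for i using h(2) that by blast
  have fe: "f ` {2 * i, 2 * i + 1} = h i" if "i < t" for i
    using ab hM[OF that] by (auto simp: f_def)
  have fin: "f j \<in> h (j div 2)" if "j < 2 * t" for j
  proof -
    have "j div 2 < t" using that by presburger
    then have "h (j div 2) = {a (h (j div 2)), b (h (j div 2))}" using ab hM by blast
    then show ?thesis by (auto simp: f_def)
  qed
  have inj: "inj_on f {..<2 * t}"
  proof (rule inj_onI)
    fix j k assume jk: "j \<in> {..<2 * t}" "k \<in> {..<2 * t}" "f j = f k"
    have lt: "j div 2 < t" "k div 2 < t" using jk by auto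
    have "h (j div 2) \<inter> h (k div 2) \<noteq> {}" using fin[of j] fin[of k] jk by auto
    then have "h (j div 2) = h (k div 2)"
      using disjointD[OF M(3)] hM lt by blast
    then have eq: "j div 2 = k div 2" using h(1) lt by (simp add: inj_on_eq_iff)
    have ne: "a (h (k div 2)) \<noteq> b (h (k div 2))" using ab hM[OF lt(2)] by blast
    have "even j \<longleftrightarrow> even k"
    proof (rule ccontr)
      assume "(even j) \<noteq> (even k)"
      then show False using jk(3) eq ne by (cases "even j") (simp_all add: f_def)
    qed
    then show "j = k" using eq by presburger
  qed
  have im: "(\<lambda>e. f ` e) ` edges (matching_graph t) = M"
  proof -
    have "(\<lambda>e. f ` e) ` edges (matching_graph t) = (\<lambda>i. f ` {2 * i, 2 * i + 1}) ` {..<t}"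
      by (simp add: matching_graph_def image_image)
    also have "\<dots> = h ` {..<t}" using fe by (intro image_cong) auto
    finally show ?thesis using h(2) by simp
  qed
  have "f ` {..<2 * t} \<subseteq> V"
  proof
    fix y assume "y \<in> f ` {..<2 * t}"
    then obtain j where j: "j < 2 * t" "y = f j" by blast
    have "h (j div 2) \<in> M" by (rule hM) (use j in presburger)
    then have "h (j div 2) \<subseteq> V" using M(1) E(1) by blast
    then show "y \<in> V" using fin[OF j(1)] j(2) by blast
  qed
  moreover have "\<forall>e\<in>edges (matching_graph t). f ` e \<in> E" using im M(1) by blast
  ultimately have "copy_of (matching_graph t) (V, E) f"
    using inj by (simp add: copy_of_def matching_graph_def)
  moreover have "inj_on c ((\<lambda>e. f ` e) ` edges (matching_graph t))" unfolding im by (rule M(5))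
  ultimately show ?thesis unfolding contains_rainbow_def by blast
qed

lemma matching_le_cover:
  assumes "finite S" "disjoint M" "\<And>e. e \<in> M \<Longrightarrow> e \<inter> S \<noteq> {}"
  shows "card M \<le> card S"
proof -
  have "\<forall>e\<in>M. \<exists>x. x \<in> e \<inter> S" using assms(3) by blast
  then obtain h where h: "\<forall>e\<in>M. h e \<in> e \<inter> S" by metis
  have "inj_on h M"
  proof (rule inj_onI)
    fix a b assume ab: "a \<in> M" "b \<in> M" "h a = h b"
    then have "a \<inter> b \<noteq> {}" using h by (metis IntD1 disjoint_iff)
    then show "a = b" using disjointD[OF assms(2)] ab by blast
  qed
  then show ?thesis using h by (intro card_inj_on_le[OF _ _ assms(1)]) auto
qed

text \<open>A connected triple contains two edges, so one of them differs from the edge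
  \<open>g\<close> whose colour is already taken.\<close>

lemma edge_in_connected_triple:
  assumes con: "connected_in G C" and C: "card C = 3"
  shows "\<exists>e\<in>G - {g}. e \<subseteq> C"
proof -
  have step: "\<exists>y\<in>C - {x}. {x, y} \<in> G" if x: "x \<in> C" for x
  proof -
    have "C \<noteq> {x}" using C by auto
    then have "{x} \<subset> C" using x by blast
    then have "\<exists>a\<in>{x}. \<exists>y\<in>C - {x}. {a, y} \<in> G" using con unfolding connected_in_def by blast
    then show ?thesis by simp
  qed
  have "C \<noteq> {}" using C by auto
  then obtain x where x: "x \<in> C" by blast
  obtain y where y: "y \<in> C - {x}" "{x, y} \<in> G" using step[OF x] by blast
  have "\<not> C \<subseteq> {x, y}"
  proof
    assume "C \<subseteq> {x, y}"
    then have "card C \<le> card {x, y}" by (intro card_mono) auto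
    then show False using C by (simp add: card_insert_if split: if_splits)
  qed
  then obtain z where z: "z \<in> C" "z \<noteq> x" "z \<noteq> y" by blast
  obtain w where w: "w \<in> C - {z}" "{z, w} \<in> G" using step[OF z(1)] by blast
  have "{z, w} \<noteq> {x, y}" using z by (auto simp: doubleton_eq_iff)
  then have "{x, y} \<in> G - {g} \<or> {z, w} \<in> G - {g}" using y(2) w(2) by blast
  moreover have "{x, y} \<subseteq> C" "{z, w} \<subseteq> C" using x y(1) z(1) w(1) by blast+
  ultimately show ?thesis by blast
qed

text \<open>The edge \<open>{u, v}\<close> takes over the colour of \<open>g\<close>; all other
  edges come from \<open>G - {g}\<close> and have other, distinct colours. \<open>P\<close> holds
  the additional edge inside the triangle, if there is a triangle, and is empty otherwise.\<close>

lemma (in tight_core) rainbow_matching: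
  assumes uv: "{u, v} \<in> E" "u \<in> I" "v \<in> I" and loose: "\<And>A. \<not> tight_set u v A"
    and c: "inj_on c G" "g \<in> G" "c g = c {u, v}"
    and P: "P \<subseteq> G - {g}" "disjoint P" "\<Union>P \<inter> (S \<union> I) = {}" "card S + 1 + card P = t"
  shows "\<exists>M. M \<subseteq> E \<and> finite M \<and> disjoint M \<and> card M = t \<and> inj_on c M"
proof -
  obtain f where f: "inj_on f S" "\<forall>x\<in>S. f x \<in> I - {u, v} \<and> {x, f x} \<in> G - {g}"
    using matching_into_I[OF loose, of g] by (elim exE conjE) (rule that; assumption)
  define M where "M = (\<lambda>x. {x, f x}) ` S"
  have MG: "M \<subseteq> G - {g}" using f(2) by (auto simp: M_def)
  have cM: "card M = card S"
  proof -
    have "inj_on (\<lambda>x. {x, f x}) S"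
    proof (rule inj_onI)
      fix x y assume xy: "x \<in> S" "y \<in> S" "{x, f x} = {y, f y}"
      then show "x = y" using f(2) SI by (auto simp: doubleton_eq_iff)
    qed
    then show ?thesis by (simp add: M_def card_image)
  qed
  have dM: "disjoint M"
  proof (rule disjointI)
    fix a b assume "a \<in> M" "b \<in> M" "a \<noteq> b"
    then obtain x y where xy: "x \<in> S" "y \<in> S" "a = {x, f x}" "b = {y, f y}" "x \<noteq> y"
      by (auto simp: M_def)
    have "f x \<noteq> f y" using f(1) xy by (simp add: inj_on_eq_iff)
    moreover have "f x \<in> I" "f y \<in> I" using f(2) xy by auto
    ultimately show "a \<inter> b = {}" using xy SI by auto
  qed
  have MU: "\<Union>M \<subseteq> S \<union> (I - {u, v})" using f(2) by (auto simp: M_def)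
  have finM: "finite M" using finS by (simp add: M_def)
  have finP: "finite P" using P(1) finG finite_subset[of P G] by blast
  have edge2: "e \<noteq> {}" if "e \<in> G" for e using edge_card[of e] GE that by auto
  have MP: "M \<inter> P = {}"
  proof (rule ccontr)
    assume "\<not> ?thesis"
    then obtain e where e: "e \<in> M" "e \<in> P" by blast
    then have "e \<subseteq> S \<union> I" "e \<noteq> {}" using MU MG edge2 by blast+
    then show False using e(2) P(3) by blast
  qed
  have uvMP: "{u, v} \<notin> M \<union> P"
  proof
    assume "{u, v} \<in> M \<union> P"
    then have "{u, v} \<subseteq> S \<union> (I - {u, v}) \<or> {u, v} \<inter> (S \<union> I) = {}" using MU P(3) by blast
    then show False using uv SI by auto
  qed
  have "disjoint (M \<union> P)"
    by (rule disjoint_union[OF dM P(2)]) (use MU P(3) in blast)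
  then have "disjoint ({{u, v}} \<union> (M \<union> P))"
  proof (rule disjoint_union[rotated])
    have "{u, v} \<inter> \<Union>M = {}" using MU uv SI by blast
    moreover have "{u, v} \<inter> \<Union>P = {}" using P(3) uv by blast
    ultimately show "\<Union>{{u, v}} \<inter> \<Union>(M \<union> P) = {}" by blast
  qed simp
  moreover have "card ({{u, v}} \<union> (M \<union> P)) = t"
    using P(4) uvMP finM finP cM card_Un_disjoint[OF finM finP MP] by simp
  moreover have "inj_on c ({{u, v}} \<union> (M \<union> P))"
  proof -
    have sub: "M \<union> P \<subseteq> G - {g}" using MG P(1) by blast
    have "inj_on c (M \<union> P)" using c(1) sub by (meson inj_on_subset Diff_subset subset_trans)
    moreover have "c {u, v} \<notin> c ` (M \<union> P)"
    proof
      assume "c {u, v} \<in> c ` (M \<union> P)"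
      then obtain e where "e \<in> M \<union> P" "c e = c {u, v}" by (metis imageE)
      then have e: "e \<in> M \<union> P" "c e = c g" using c(3) by simp_all
      then have "e = g" using c(1,2) sub by (auto simp: inj_on_def)
      then show False using e(1) sub by blast
    qed
    ultimately show ?thesis using uvMP by simp
  qed
  moreover have "{{u, v}} \<union> (M \<union> P) \<subseteq> E" using uv(1) MG P(1) GE by blast
  ultimately show ?thesis using finM finP by (intro exI[of _ "{{u, v}} \<union> (M \<union> P)"]) simp
qed

text \<open>An independent \<open>W\<close> would receive at least \<open>3 * card W\<close> edges
  from outside by the minimum degree, but the bipartite bound permits only
  \<open>2 * card V - 4\<close>.\<close>

lemma (in planar_edges) edge_in_large_set:
  assumes mp: "maximal_planar (V, E)" and W: "W \<subseteq> V" "2 * card V < 3 * card W + 4" and V4: "4 \<le> card V"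
  shows "\<exists>u\<in>W. \<exists>v\<in>W. {u, v} \<in> E"
proof (rule ccontr)
  assume none: "\<not> ?thesis"
  have "3 \<le> card (nbrs E {w} (V - W))" if w: "w \<in> W" for w
  proof -
    have "{u \<in> V. {w, u} \<in> E} = nbrs E {w} (V - W)" using none w by (auto simp: nbrs_def)
    then show ?thesis using maximal_planar_min_degree[OF mp V4, of w] w W(1) by auto
  qed
  then have "(\<Sum>w\<in>W. 3) \<le> (\<Sum>w\<in>W. card (nbrs E {w} (V - W)))" by (intro sum_mono)
  moreover have "card (cross E (V - W) W) = (\<Sum>w\<in>W. card (nbrs E {w} (V - W)))"
    by (rule cross_sum) (use W(1) in auto)
  ultimately have "3 * card W \<le> card (cross E (V - W) W)" by simp
  moreover have c: "card (V - W) + card W = card V"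
    using card_Diff_subset[OF finite_sub[OF W(1)] W(1)] card_mono[OF finite_V W(1)] by simp
  moreover have "card (cross E (V - W) W) + 4 \<le> 2 * (card (V - W) + card W)"
    by (rule cross_bound) (use W(1) c V4 in auto)
  ultimately show False using W(2) by simp
qed

text \<open>\<open>M0\<close> expresses that the triangulation contains the matching. It provides
  the edge \<open>{u, v}\<close> when there is no slack and \<open>card V\<close> need not be large;
  for \<open>card V \<ge> 9 t + 3\<close> suitable edges come from the minimum degree.\<close>

theorem rainbow_matching_exists:
  assumes mp: "maximal_planar (V, E)" and t: "7 \<le> t"
    and M0: "M0 \<subseteq> E" "disjoint M0" "card M0 = t"
    and many: "3 * t \<le> card V + 6 \<and> 2 * card V + 3 * t \<le> card (c ` E) + 13 \<or>
      9 * t + 3 \<le> card V \<and> 2 * card V + 3 * t \<le> card (c ` E) + 14"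
  shows "\<exists>M. M \<subseteq> E \<and> finite M \<and> disjoint M \<and> card M = t \<and> inj_on c M"
proof (rule ccontr)
  assume none: "\<not> ?thesis"
  interpret planar_edges V E using mp by unfold_locales (simp add: maximal_planar_def)
  obtain G where G: "G \<subseteq> E" "inj_on c G" "c ` E = c ` G"
    using subset_image_inj[of "c ` E" c E] by auto
  have cG: "card (c ` E) = card G" using G(2,3) by (simp add: card_image)
  have repr: "\<exists>g\<in>G. c g = c e" if "e \<in> E" for e
  proof -
    have "c e \<in> c ` G" using that G(3) by blast
    then show ?thesis by (metis imageE)
  qed
  have "planar (V, G)"
    by (rule planar_subgraph[OF planar order_refl G(1)]) (use G(1) edge_sub in blast)
  then interpret GG: planar_edges V G by unfold_locales
  have nomatch: "card M < t" if M: "M \<subseteq> G" "disjoint M" for M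
  proof (rule ccontr)
    assume "\<not> ?thesis"
    then obtain M' where M': "M' \<subseteq> M" "card M' = t" using obtain_subset_with_card_n[of t M] by auto
    have "finite M'" using M' M G(1) finite_E by (meson finite_subset)
    moreover have "disjoint M'" using M' M(2) by (auto simp: disjoint_def)
    moreover have "inj_on c M'" using G(2) M' M by (meson inj_on_subset)
    ultimately show False using none M' M G(1) by blast
  qed
  have n: "3 * t \<le> card V + 6" "2 * card V + 3 * t \<le> card G + 14" using many t cG by linarith+
  from GG.matching_structure[OF t n nomatch] show False
  proof
    assume "\<exists>S. S \<subseteq> V \<and> card S + 1 = t \<and> card G \<le> card (induced G S) + card (cross G S (V - S))"
    then obtain S where S: "S \<subseteq> V" "card S + 1 = t" "card G \<le> card (induced G S) + card (cross G S (V - S))" by blast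
    define I where "I = V - S"
    have I: "I \<subseteq> V" "S \<inter> I = {}" by (auto simp: I_def)
    have cI: "card S + card I = card V"
      unfolding I_def using card_Diff_subset[OF finite_sub[OF S(1)] S(1)] card_mono[OF finite_V S(1)] by simp
    have b: "card (induced G S) + 6 \<le> 3 * card S" by (rule GG.induced_bound[OF S(1)]) (use S(2) t in linarith)
    have b': "card (cross G S I) + 4 \<le> 2 * (card S + card I)"
      by (rule GG.cross_bound[OF S(1) I]) (use S(2) t in linarith)
    from many show False
    proof
      assume many1: "3 * t \<le> card V + 6 \<and> 2 * card V + 3 * t \<le> card (c ` E) + 13"
      interpret tight_core V E G S I 0 0
      proof unfold_locales
        show "3 * card S \<le> card (induced G S) + 6 + 0"
          using b' S(2,3) many1 cG cI I_def by simp
        show "2 * (card S + card I) \<le> card (cross G S I) + 4 + 0"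
          using b S(2,3) many1 cG cI I_def by simp
        show "5 + 0 \<le> card S" using S(2) t by simp
      qed (use S I G in auto)
      \<comment> \<open>\<open>S\<close> has only \<open>t - 1\<close> vertices and cannot meet all
        \<open>t\<close> disjoint edges of \<open>M0\<close>.\<close>
      have "\<exists>e\<in>M0. e \<inter> S = {}"
      proof (rule ccontr)
        assume "\<not> ?thesis"
        then have "card M0 \<le> card S" by (intro matching_le_cover[OF finite_sub[OF S(1)] M0(2)]) blast
        then show False using M0(3) S(2) by simp
      qed
      then obtain e where e: "e \<in> M0" "e \<inter> S = {}" by blast
      then have eE: "e \<in> E" using M0(1) by blast
      then have "e \<subseteq> I" using e(2) edge_sub by (auto simp: I_def)
      moreover obtain u v where "e = {u, v}" using edge_card[OF eE] by (meson card_2_iff)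
      ultimately have uv: "{u, v} \<in> E" "u \<in> I" "v \<in> I" using eE by auto
      obtain g where g: "g \<in> G" "c g = c {u, v}" using repr[OF uv(1)] by blast
      have "\<not> tight_set u v A" for A
        by (rule no_tight_set[OF refl refl _ _ uv(1)]) (use S(2) t cI many1 in linarith)+
      then have "\<exists>M. M \<subseteq> E \<and> finite M \<and> disjoint M \<and> card M = t \<and> inj_on c M"
        by (rule rainbow_matching[OF uv _ G(2) g, of "{}"]) (use S(2) in auto)
      then show False using none by blast
    next
      assume many2: "9 * t + 3 \<le> card V \<and> 2 * card V + 3 * t \<le> card (c ` E) + 14"
      define dS where "dS = 3 * card S - 6 - card (induced G S)"
      define dH where "dH = 2 * (card S + card I) - 4 - card (cross G S I)"
      have d: "3 * card S = card (induced G S) + 6 + dS" "2 * (card S + card I) = card (cross G S I) + 4 + dH"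
        using b b' by (simp_all add: dS_def dH_def)
      have d1: "dS + dH \<le> 1"
      proof -
        have "card G \<le> card (induced G S) + card (cross G S I)" using S(3) by (simp add: I_def)
        then show ?thesis using d S(2) many2 cG cI unfolding distrib_left by linarith
      qed
      interpret slack_one_core V E G S I dS dH
      proof unfold_locales
        show "5 + dS \<le> card S" using S(2) t d1 by linarith
        show "card S + 12 \<le> card I" using S(2) cI many2 t by linarith
      qed (use S I G d d1 in auto)
      have "\<exists>u\<in>W. \<exists>v\<in>W. {u, v} \<in> E" if W: "W \<subseteq> I" "card I \<le> card W + 8" for W
        by (rule edge_in_large_set[OF mp]) (use W I(1) S(2) cI many2 t in \<open>blast | linarith\<close>)+
      from loose_edge[OF this] obtain u v where uv: "{u, v} \<in> E" "u \<in> I" "v \<in> I"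
        and loose: "\<forall>A. \<not> tight_set u v A" by blast
      obtain g where g: "g \<in> G" "c g = c {u, v}" using repr[OF uv(1)] by blast
      have "\<exists>M. M \<subseteq> E \<and> finite M \<and> disjoint M \<and> card M = t \<and> inj_on c M"
        by (rule rainbow_matching[OF uv loose[rule_format] G(2) g, of "{}"]) (use S(2) in auto)
      then show False using none by blast
    qed
  next
    assume "\<exists>S C. S \<subseteq> V \<and> C \<subseteq> V \<and> S \<inter> C = {} \<and> card C = 3 \<and> connected_in G C \<and> card S + 2 = t \<and>
       3 * card S \<le> card (induced G S) + 6 \<and>
       2 * (card V - 3) \<le> card (cross G S (V - S - C)) + 5 \<and> card G + 14 \<le> 2 * card V + 3 * t"
    then obtain S C where SC: "S \<subseteq> V" "C \<subseteq> V" "S \<inter> C = {}" "card C = 3" "connected_in G C" "card S + 2 = t"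
      "3 * card S \<le> card (induced G S) + 6" "2 * (card V - 3) \<le> card (cross G S (V - S - C)) + 5"
      "card G + 14 \<le> 2 * card V + 3 * t"
      by (elim exE conjE) (rule that; assumption)
    \<comment> \<open>With a triangle as further part there are at most
      \<open>2 * card V + 3 * t - 14\<close> colours, which excludes the first alternative of
      \<open>many\<close>.\<close>
    have many2: "9 * t + 3 \<le> card V" using many SC(9) cG by linarith
    define I where "I = V - S - C"
    have I: "I \<subseteq> V" "S \<inter> I = {}" "C \<inter> (S \<union> I) = {}" using SC(3) by (auto simp: I_def)
    have cI: "card S + card I + 3 = card V"
    proof -
      have "card (V - (S \<union> C)) = card V - card (S \<union> C)" "card (S \<union> C) \<le> card V"
        using SC(1,2) finite_V finite_sub by (auto intro!: card_Diff_subset card_mono)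
      moreover have "card (S \<union> C) = card S + 3"
        using card_Un_disjoint[OF finite_sub[OF SC(1)] finite_sub[OF SC(2)] SC(3)] SC(4) by simp
      moreover have "V - (S \<union> C) = I" by (auto simp: I_def)
      ultimately show ?thesis by simp
    qed
    \<comment> \<open>The core is triangulated in this case, so the one missing edge is charged to
      the graph between \<open>S\<close> and \<open>I\<close>.\<close>
    interpret slack_one_core V E G S I 0 1
    proof unfold_locales
      show "2 * (card S + card I) \<le> card (cross G S I) + 4 + 1" using SC(8) cI by (simp add: I_def)
      show "5 + 0 \<le> card S" using SC(6) t by linarith
      show "card S + 12 \<le> card I" using SC(6) cI many2 t by linarith
    qed (use SC I G in auto)
    have "\<exists>u\<in>W. \<exists>v\<in>W. {u, v} \<in> E" if W: "W \<subseteq> I" "card I \<le> card W + 8" for W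
      by (rule edge_in_large_set[OF mp]) (use W I(1) SC(6) cI many2 t in \<open>blast | linarith\<close>)+
    from loose_edge[OF this] obtain u v where uv: "{u, v} \<in> E" "u \<in> I" "v \<in> I"
      and loose: "\<forall>A. \<not> tight_set u v A" by blast
    obtain g where g: "g \<in> G" "c g = c {u, v}" using repr[OF uv(1)] by blast
    obtain e where e: "e \<in> G - {g}" "e \<subseteq> C" using edge_in_connected_triple[OF SC(5,4)] by blast
    have "\<exists>M. M \<subseteq> E \<and> finite M \<and> disjoint M \<and> card M = t \<and> inj_on c M"
      by (rule rainbow_matching[OF uv loose[rule_format] G(2) g, of "{e}"]) (use e I(3) SC(6) in auto)
    then show False using none by blast
  qed
qed

section \<open>A triangulation with few vertices covering many edges\<close>

text \<open>Assigning to each point the only edge that may contain it turns disjointness of all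
  pairs of segments into one check per segment.\<close>

lemma straight_line_planar:
  fixes V :: "complex set" and owner :: "complex \<Rightarrow> complex set"
  assumes V: "finite V" "\<And>e. e \<in> E \<Longrightarrow> e \<subseteq> V"
    and seg: "\<And>e. e \<in> E \<Longrightarrow> \<exists>a b. e = {a, b} \<and> a \<noteq> b \<and> (\<forall>z\<in>open_segment a b. z \<notin> V \<and> owner z = e)"
  shows "planar (V, E)"
proof -
  obtain a b where ab: "\<forall>e\<in>E. e = {a e, b e} \<and> a e \<noteq> b e \<and> (\<forall>z\<in>open_segment (a e) (b e). z \<notin> V \<and> owner z = e)"
    using seg by metis
  have eq: "e = {a e, b e}" and ne: "a e \<noteq> b e" if "e \<in> E" for e
    using ab that by blast+
  have inner: "z \<in> e \<or> z \<notin> V \<and> owner z = e" if "e \<in> E" "z \<in> closed_segment (a e) (b e)" for e z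
  proof (cases "z \<in> open_segment (a e) (b e)")
    case True
    then show ?thesis using ab that(1) by blast
  next
    case False
    then have "z = a e \<or> z = b e" using that(2) by (auto simp: open_segment_def)
    then show ?thesis using eq[OF that(1)] by blast
  qed
  define \<gamma> where "\<gamma> = (\<lambda>e. linepath (a e) (b e))"
  have im: "path_image (\<gamma> e) = closed_segment (a e) (b e)" for e by (simp add: \<gamma>_def)
  have "plane_embedding (V, E) id \<gamma>"
    unfolding plane_embedding_def
  proof (intro conjI ballI impI)
    fix e assume e: "e \<in> edges (V, E)"
    then show "arc (\<gamma> e)" using ne by (simp add: \<gamma>_def arc_linepath)
    show "{pathstart (\<gamma> e), pathfinish (\<gamma> e)} = id ` e" using eq[of e] e by (simp add: \<gamma>_def)
    show "path_image (\<gamma> e) \<inter> id ` verts (V, E) \<subseteq> id ` e" using inner[of e] e by (auto simp: im)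
    fix e' assume e': "e' \<in> edges (V, E)" "e \<noteq> e'"
    show "path_image (\<gamma> e) \<inter> path_image (\<gamma> e') \<subseteq> id ` (e \<inter> e')"
    proof
      fix z assume "z \<in> path_image (\<gamma> e) \<inter> path_image (\<gamma> e')"
      then have z: "z \<in> e \<or> z \<notin> V \<and> owner z = e" "z \<in> e' \<or> z \<notin> V \<and> owner z = e'"
        using inner e e' by (auto simp: im)
      have "e \<subseteq> V" "e' \<subseteq> V" using V(2) e e' by auto
      then show "z \<in> id ` (e \<inter> e')" using z e'(2) by auto
    qed
  qed simp
  moreover have "card e = 2" if "e \<in> E" for e
    using eq[OF that] ne[OF that] by (metis card_2_iff)
  ultimately show ?thesis using V by (auto simp: planar_def simple_graph_def)
qed

section \<open>An explicit straight line drawing\<close>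

definition axis_point :: "nat \<Rightarrow> complex" where "axis_point j = Complex (real j) 0"

definition pole :: "real \<Rightarrow> complex" where "pole \<sigma> = Complex 0 \<sigma>"

text \<open>The centroid of the triangle with corners \<^term>\<open>pole \<sigma>\<close>, \<^term>\<open>axis_point j\<close> and
  \<^term>\<open>axis_point (j + 1)\<close>.\<close>

definition tip :: "real \<Rightarrow> nat \<Rightarrow> complex" where "tip \<sigma> j = Complex ((2 * real j + 1) / 3) (\<sigma> / 3)"

text \<open>Projecting from the pole of its half plane, a point \<open>z\<close> lands at \<open>Re z / (1 - \<bar>Im z\<bar>)\<close> on the
  real axis_point; the position of this projection relative to the integers tells which segment contains \<open>z\<close>.\<close>

definition owner :: "complex \<Rightarrow> complex set" where
  "owner z = (let \<sigma> = sgn (Im z); q = Re z / (1 - \<bar>Im z\<bar>); j = nat \<lfloor>q\<rfloor> in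
    if Re z = 0 then {pole 1, pole (- 1)}
    else if Im z = 0 then {axis_point j, axis_point (j + 1)}
    else if frac q = 0 then {pole \<sigma>, axis_point j}
    else if frac q = 1 / 2 then {pole \<sigma>, tip \<sigma> j}
    else if frac q < 1 / 2 then {axis_point j, tip \<sigma> j}
    else {axis_point (j + 1), tip \<sigma> j})"

text \<open>The poles and the axis points from 2 to \<open>m + 1\<close>, with the edge between the
  poles, form a triangulation with \<open>2 * m\<close> faces. A tip lies in each of the
  \<open>2 * (m - 1)\<close> faces over the steps of the axis. The axis points 1 and
  \<open>m + 2\<close> lie in the two faces at the edge between the poles, and the axis points after
  \<open>m + 2\<close> share the latter face.\<close>

definition hub_verts :: "nat \<Rightarrow> nat \<Rightarrow> complex set" where
  "hub_verts m L = pole ` {1, - 1} \<union> axis_point ` {1..L} \<union> (\<lambda>(\<sigma>, j). tip \<sigma> j) ` ({1, - 1} \<times> {2..m})"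

definition spokes where "spokes L = (\<lambda>(\<sigma>, j). {pole \<sigma>, axis_point j}) ` ({1, - 1} \<times> {1..L :: nat})"
definition steps where "steps L = (\<lambda>j. {axis_point j, axis_point (j + 1)}) ` {1..<L :: nat}"
definition tip_pole where "tip_pole m = (\<lambda>(\<sigma>, j). {pole \<sigma>, tip \<sigma> j}) ` ({1, - 1} \<times> {2..m :: nat})"
definition tip_left where "tip_left m = (\<lambda>(\<sigma>, j). {axis_point j, tip \<sigma> j}) ` ({1, - 1} \<times> {2..m :: nat})"
definition tip_right where "tip_right m = (\<lambda>(\<sigma>, j). {axis_point (j + 1), tip \<sigma> j}) ` ({1, - 1} \<times> {2..m :: nat})"

definition hub_edges :: "nat \<Rightarrow> nat \<Rightarrow> complex set set" where
  "hub_edges m L = {{pole 1, pole (- 1)}} \<union> spokes L \<union> steps L \<union> tip_pole m \<union> tip_left m \<union> tip_right m"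

lemmas family_defs = spokes_def steps_def tip_pole_def tip_left_def tip_right_def
lemmas point_defs = axis_point_def pole_def tip_def

lemma floor_frac_add:
  assumes "0 \<le> r" "r < 1"
  shows "\<lfloor>real j + r\<rfloor> = int j" "frac (real j + r) = r"
proof -
  show "\<lfloor>real j + r\<rfloor> = int j" using assms by linarith
  then show "frac (real j + r) = r" by (simp add: frac_def)
qed

text \<open>The values that \<open>owner\<close> looks at, evaluated at the vertices. An inner point
  of a segment with other values is therefore no vertex.\<close>

lemma hub_vertsD:
  assumes "z \<in> hub_verts m L"
  shows "Re z = 0 \<Longrightarrow> \<bar>Im z\<bar> = 1" and "Re z \<noteq> 0 \<Longrightarrow> Im z = 0 \<Longrightarrow> frac (Re z) = 0"
    and "Re z \<noteq> 0 \<Longrightarrow> Im z \<noteq> 0 \<Longrightarrow> \<bar>Im z\<bar> = 1 / 3 \<and> frac (Re z / (1 - \<bar>Im z\<bar>)) = 1 / 2"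
proof -
  consider "z = pole 1 \<or> z = pole (- 1)" | j where "z = axis_point j" "1 \<le> j"
    | \<sigma> j where "z = tip \<sigma> j" "\<sigma> = 1 \<or> \<sigma> = - 1" "2 \<le> j"
    using assms by (auto simp: hub_verts_def)
  then have "(Re z = 0 \<longrightarrow> \<bar>Im z\<bar> = 1) \<and> (Re z \<noteq> 0 \<longrightarrow> Im z = 0 \<longrightarrow> frac (Re z) = 0) \<and>
    (Re z \<noteq> 0 \<longrightarrow> Im z \<noteq> 0 \<longrightarrow> \<bar>Im z\<bar> = 1 / 3 \<and> frac (Re z / (1 - \<bar>Im z\<bar>)) = 1 / 2)"
  proof cases
    case 1
    then show ?thesis by (auto simp: pole_def)
  next
    case 2
    then show ?thesis by (simp add: axis_point_def)
  next
    case 3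
    then have 1: "\<bar>Im z\<bar> = 1 / 3" by (auto simp: tip_def)
    have "Re z / (1 - \<bar>Im z\<bar>) = real j + 1 / 2" unfolding 1 using 3(1) by (simp add: tip_def field_simps)
    then have "frac (Re z / (1 - \<bar>Im z\<bar>)) = 1 / 2" using floor_frac_add(2)[of "1 / 2" j] by simp
    moreover have "Re z \<noteq> 0" using 3(1) by (simp add: tip_def)
    moreover have "Im z \<noteq> 0" using 1 by auto
    ultimately show ?thesis using 1 by blast
  qed
  then show "Re z = 0 \<Longrightarrow> \<bar>Im z\<bar> = 1" and "Re z \<noteq> 0 \<Longrightarrow> Im z = 0 \<Longrightarrow> frac (Re z) = 0"
    and "Re z \<noteq> 0 \<Longrightarrow> Im z \<noteq> 0 \<Longrightarrow> \<bar>Im z\<bar> = 1 / 3 \<and> frac (Re z / (1 - \<bar>Im z\<bar>)) = 1 / 2"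
    by blast+
qed

lemma projection:
  assumes \<sigma>: "\<sigma> = 1 \<or> \<sigma> = - 1" and Im: "Im z = \<sigma> * y" "0 < y" "y < 1"
    and Re: "Re z = (1 - y) * (real j + r)" "0 \<le> r" "r < 1" and j: "1 \<le> j"
  shows "Re z \<noteq> 0" "Im z \<noteq> 0" "sgn (Im z) = \<sigma>" "\<bar>Im z\<bar> = y"
    "nat \<lfloor>Re z / (1 - \<bar>Im z\<bar>)\<rfloor> = j" "frac (Re z / (1 - \<bar>Im z\<bar>)) = r"
proof -
  show a: "\<bar>Im z\<bar> = y" using \<sigma> Im by (auto simp: abs_mult)
  have "0 < (1 - y) * (real j + r)" using assms by (intro mult_pos_pos) auto
  then show "Re z \<noteq> 0" unfolding Re(1) by (rule less_imp_neq[THEN not_sym])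
  show "Im z \<noteq> 0" using \<sigma> Im by auto
  show "sgn (Im z) = \<sigma>" using \<sigma> Im by (auto simp: sgn_if)
  have "Re z / (1 - \<bar>Im z\<bar>) = real j + r" unfolding a Re(1) using Im(3) by simp
  then show "nat \<lfloor>Re z / (1 - \<bar>Im z\<bar>)\<rfloor> = j" "frac (Re z / (1 - \<bar>Im z\<bar>)) = r"
    using floor_frac_add[OF Re(2,3), of j] by simp_all
qed

lemma owner_eq:
  assumes "Re z \<noteq> 0" "Im z \<noteq> 0" "sgn (Im z) = \<sigma>" "nat \<lfloor>Re z / (1 - \<bar>Im z\<bar>)\<rfloor> = j" "frac (Re z / (1 - \<bar>Im z\<bar>)) = r"
  shows "owner z = (if r = 0 then {pole \<sigma>, axis_point j} else if r = 1 / 2 then {pole \<sigma>, tip \<sigma> j}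
    else if r < 1 / 2 then {axis_point j, tip \<sigma> j} else {axis_point (j + 1), tip \<sigma> j})"
  unfolding owner_def Let_def assms(3-5) using assms(1,2) by simp

lemma not_hub_vert:
  assumes "Re z \<noteq> 0" "Im z \<noteq> 0" "frac (Re z / (1 - \<bar>Im z\<bar>)) = r" "r \<noteq> 1 / 2"
  shows "z \<notin> hub_verts m L"
proof
  assume "z \<in> hub_verts m L"
  from hub_vertsD(3)[OF this assms(1,2), THEN conjunct2] show False unfolding assms(3) using assms(4) by simp
qed

text \<open>A segment ending in a pole has constant projection, \<open>j\<close> or
  \<open>j + 1 / 2\<close>. On the segments between tip and axis the fractional part stays strictly
  between 0 and \<open>1 / 2\<close>, or strictly between \<open>1 / 2\<close> and 1, which decides
  between the left and the right one.\<close>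

lemma hub_planar: "planar (hub_verts m L, hub_edges m L)" if mL: "m < L"
proof (rule straight_line_planar[where owner = owner])
  show "finite (hub_verts m L)" by (simp add: hub_verts_def)
  show "e \<subseteq> hub_verts m L" if "e \<in> hub_edges m L" for e
    using that mL by (auto simp: hub_edges_def family_defs hub_verts_def)
  show "\<exists>a b. e = {a, b} \<and> a \<noteq> b \<and> (\<forall>z\<in>open_segment a b. z \<notin> hub_verts m L \<and> owner z = e)"
    if e: "e \<in> hub_edges m L" for e
  proof -
    have "e = {pole 1, pole (- 1)} \<or> e \<in> spokes L \<or> e \<in> steps L \<or> e \<in> tip_pole m \<or>
        e \<in> tip_left m \<or> e \<in> tip_right m"
      using e unfolding hub_edges_def Un_iff by blast
    then consider "e = {pole 1, pole (- 1)}" | "e \<in> spokes L" | "e \<in> steps L" | "e \<in> tip_pole m"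
      | "e \<in> tip_left m" | "e \<in> tip_right m"
      by blast
    then show ?thesis
    proof cases
      case 1
      have "z \<notin> hub_verts m L \<and> owner z = e" if z: "z \<in> open_segment (pole 1) (pole (- 1))" for z
      proof -
        obtain u where u: "0 < u" "u < 1" "z = (1 - u) *\<^sub>R pole 1 + u *\<^sub>R pole (- 1)"
          using z by (auto simp: in_segment)
        have "Re z = 0" "Im z = 1 - 2 * u" unfolding u(3) by (simp_all add: pole_def)
        moreover from this have "\<bar>Im z\<bar> \<noteq> 1" using u by auto
        ultimately show ?thesis using hub_vertsD(1)[of z m L] 1 by (auto simp: owner_def)
      qed
      moreover have "pole 1 \<noteq> pole (- 1)" by (simp add: pole_def)
      ultimately show ?thesis using 1 by blast
    next
      case 2
      then obtain \<sigma> j where 2: "e = {pole \<sigma>, axis_point j}" "\<sigma> = 1 \<or> \<sigma> = - 1" "1 \<le> j"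
        unfolding spokes_def by auto
      have "z \<notin> hub_verts m L \<and> owner z = e" if z: "z \<in> open_segment (pole \<sigma>) (axis_point j)" for z
      proof -
        obtain u where u: "0 < u" "u < 1" "z = (1 - u) *\<^sub>R pole \<sigma> + u *\<^sub>R axis_point j"
          using z by (auto simp: in_segment)
        have "Im z = \<sigma> * (1 - u)" unfolding u(3) by (simp add: point_defs)
        moreover have "Re z = (1 - (1 - u)) * (real j + 0)" unfolding u(3) by (simp add: point_defs)
        ultimately have p: "Re z \<noteq> 0" "Im z \<noteq> 0" "sgn (Im z) = \<sigma>"
          "nat \<lfloor>Re z / (1 - \<bar>Im z\<bar>)\<rfloor> = j" "frac (Re z / (1 - \<bar>Im z\<bar>)) = 0"
          using projection[OF 2(2), of z "1 - u" j 0] u 2(3) by simp_all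
        then show ?thesis using not_hub_vert[OF p(1,2,5)] owner_eq[OF p] 2(1) by auto
      qed
      moreover have "pole \<sigma> \<noteq> axis_point j" using 2 by (auto simp: point_defs)
      ultimately show ?thesis using 2(1) by blast
    next
      case 3
      then obtain j where 3: "e = {axis_point j, axis_point (j + 1)}" "1 \<le> j"
        unfolding steps_def by auto
      have "z \<notin> hub_verts m L \<and> owner z = e" if z: "z \<in> open_segment (axis_point j) (axis_point (j + 1))" for z
      proof -
        obtain u where u: "0 < u" "u < 1" "z = (1 - u) *\<^sub>R axis_point j + u *\<^sub>R axis_point (j + 1)"
          using z by (auto simp: in_segment)
        have z: "Im z = 0" "Re z = real j + u" unfolding u(3) by (simp_all add: point_defs algebra_simps)
        have "\<lfloor>Re z\<rfloor> = int j" "frac (Re z) = u" using floor_frac_add[of u j] u z by simp_all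
        moreover have "Re z \<noteq> 0" using z 3(2) u by simp
        ultimately show ?thesis using hub_vertsD(2)[of z m L] 3(1) z(1) u by (auto simp: owner_def Let_def)
      qed
      moreover have "axis_point j \<noteq> axis_point (j + 1)" by (simp add: axis_point_def)
      ultimately show ?thesis using 3(1) by blast
    next
      case 4
      then obtain \<sigma> j where 4: "e = {pole \<sigma>, tip \<sigma> j}" "\<sigma> = 1 \<or> \<sigma> = - 1" "1 \<le> j"
        unfolding tip_pole_def by auto
      have "z \<notin> hub_verts m L \<and> owner z = e" if z: "z \<in> open_segment (pole \<sigma>) (tip \<sigma> j)" for z
      proof -
        obtain u where u: "0 < u" "u < 1" "z = (1 - u) *\<^sub>R pole \<sigma> + u *\<^sub>R tip \<sigma> j"
          using z by (auto simp: in_segment)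
        have "Im z = \<sigma> * (1 - 2 * u / 3)" unfolding u(3) by (simp add: point_defs algebra_simps)
        moreover have "Re z = (1 - (1 - 2 * u / 3)) * (real j + 1 / 2)"
          unfolding u(3) by (simp add: point_defs field_simps)
        ultimately have p: "Re z \<noteq> 0" "Im z \<noteq> 0" "sgn (Im z) = \<sigma>" "\<bar>Im z\<bar> = 1 - 2 * u / 3"
          "nat \<lfloor>Re z / (1 - \<bar>Im z\<bar>)\<rfloor> = j" "frac (Re z / (1 - \<bar>Im z\<bar>)) = 1 / 2"
          using projection[OF 4(2), of z "1 - 2 * u / 3" j "1 / 2"] u 4(3) by simp_all
        have "\<bar>Im z\<bar> \<noteq> 1 / 3" using p(4) u by simp
        then have "z \<notin> hub_verts m L" using hub_vertsD(3)[of z m L] p(1,2) by blast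
        then show ?thesis using owner_eq[OF p(1,2,3,5,6)] 4(1) by simp
      qed
      moreover have "pole \<sigma> \<noteq> tip \<sigma> j" by (simp add: point_defs)
      ultimately show ?thesis using 4(1) by blast
    next
      case 5
      then obtain \<sigma> j where 5: "e = {axis_point j, tip \<sigma> j}" "\<sigma> = 1 \<or> \<sigma> = - 1" "1 \<le> j"
        unfolding tip_left_def by auto
      have "z \<notin> hub_verts m L \<and> owner z = e" if z: "z \<in> open_segment (axis_point j) (tip \<sigma> j)" for z
      proof -
        obtain u where u: "0 < u" "u < 1" "z = (1 - u) *\<^sub>R axis_point j + u *\<^sub>R tip \<sigma> j"
          using z by (auto simp: in_segment)
        have r: "0 < u / (3 - u)" "u / (3 - u) < 1 / 2" using u by (simp_all add: field_simps)
        have im: "Im z = \<sigma> * (u / 3)" unfolding u(3) by (simp add: point_defs)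
        \<comment> \<open>The point has height \<open>u / 3\<close> and real part
          \<open>(1 - u / 3) * j + u / 3\<close>; division by \<open>1 - u / 3\<close> gives the
          fractional part \<open>u / (3 - u)\<close>, which grows from 0 to
          \<open>1 / 2\<close>.\<close>
        have re: "Re z = (1 - u / 3) * (real j + u / (3 - u))"
        proof -
          have "(1 - u / 3) * (real j + u / (3 - u)) = (1 - u / 3) * real j + u / 3"
            using u by (simp add: field_simps)
          then show ?thesis unfolding u(3) by (simp add: point_defs field_simps)
        qed
        have y: "0 < u / 3" "u / 3 < 1" and r': "0 \<le> u / (3 - u)" "u / (3 - u) < 1" using u r by auto
        note p = projection[OF 5(2) im y re r' 5(3)]
        have f: "u / (3 - u) \<noteq> 0" "u / (3 - u) \<noteq> 1 / 2" "u / (3 - u) < 1 / 2" using r by linarith+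
        have "owner z = e" by (simp only: owner_eq[OF p(1,2,3,5,6)] 5(1) f if_True if_False simp_thms)
        then show ?thesis using not_hub_vert[OF p(1,2,6) f(2)] by blast
      qed
      moreover have "axis_point j \<noteq> tip \<sigma> j" using 5(2) by (auto simp: point_defs)
      ultimately show ?thesis using 5(1) by blast
    next
      case 6
      then obtain \<sigma> j where 6: "e = {axis_point (j + 1), tip \<sigma> j}" "\<sigma> = 1 \<or> \<sigma> = - 1" "1 \<le> j"
        unfolding tip_right_def by auto
      have "z \<notin> hub_verts m L \<and> owner z = e" if z: "z \<in> open_segment (axis_point (j + 1)) (tip \<sigma> j)" for z
      proof -
        obtain u where u: "0 < u" "u < 1" "z = (1 - u) *\<^sub>R axis_point (j + 1) + u *\<^sub>R tip \<sigma> j"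
          using z by (auto simp: in_segment)
        have r: "0 < u / (3 - u)" "u / (3 - u) < 1 / 2" using u by (simp_all add: field_simps)
        have im: "Im z = \<sigma> * (u / 3)" unfolding u(3) by (simp add: point_defs)
        have re: "Re z = (1 - u / 3) * (real j + (1 - u / (3 - u)))"
        proof -
          have "Re z = (1 - u / 3) * (real j + 1) - u / 3"
            unfolding u(3) by (simp add: point_defs field_simps)
          also have "\<dots> = (1 - u / 3) * (real j + (1 - u / (3 - u)))"
            using u by (simp add: field_simps)
          finally show ?thesis .
        qed
        have y: "0 < u / 3" "u / 3 < 1" and r': "0 \<le> 1 - u / (3 - u)" "1 - u / (3 - u) < 1" using u r by auto
        note p = projection[OF 6(2) im y re r' 6(3)]
        have f: "1 - u / (3 - u) \<noteq> 0" "1 - u / (3 - u) \<noteq> 1 / 2" "\<not> 1 - u / (3 - u) < 1 / 2" using r by linarith+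
        have "owner z = e" by (simp only: owner_eq[OF p(1,2,3,5,6)] 6(1) f if_True if_False simp_thms)
        then show ?thesis using not_hub_vert[OF p(1,2,6) f(2)] by blast
      qed
      moreover have "axis_point (j + 1) \<noteq> tip \<sigma> j" using 6(2) by (auto simp: point_defs)
      ultimately show ?thesis using 6(1) by blast
    qed
  qed
qed

lemma card_poles: "card (pole ` {1, - 1}) = 2"
proof -
  have "card (pole ` {1, - 1}) = card {1, - 1 :: real}"
    by (rule card_image) (simp add: inj_on_def point_defs)
  then show ?thesis by simp
qed

lemma card_hub_verts:
  assumes "1 \<le> m"
  shows "card (hub_verts m L) = L + 2 * m"
proof -
  define A where "A = pole ` {1, - 1}"
  define B where "B = axis_point ` {1..L}"
  define C where "C = (\<lambda>(\<sigma>, j). tip \<sigma> j) ` ({1, - 1} \<times> {2..m})"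
  have tip: "inj_on (\<lambda>(\<sigma>, j). tip \<sigma> j) ({1, - 1} \<times> {2..m})" by (auto simp: inj_on_def tip_def)
  have m2: "card {2..m} = m - 1" by (cases m) auto
  have "card A = 2" unfolding A_def by (rule card_poles)
  moreover have "card B = L" by (simp add: B_def card_image inj_on_def axis_point_def)
  moreover have "card C = 2 * (m - 1)"
    unfolding C_def card_image[OF tip] card_cartesian_product m2 by simp
  moreover have "A \<inter> B = {}" "(A \<union> B) \<inter> C = {}" by (auto simp: A_def B_def C_def point_defs)
  moreover have "finite A" "finite B" "finite C" by (simp_all add: A_def B_def C_def)
  moreover have "hub_verts m L = A \<union> B \<union> C" by (simp only: hub_verts_def A_def B_def C_def)
  ultimately show ?thesis using assms by (simp add: card_Un_disjoint)
qed

text \<open>This is the set of \<open>t - 2\<close> vertices for \<open>m = t - 4\<close>.\<close>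

definition hub_core :: "nat \<Rightarrow> complex set" where
  "hub_core m = pole ` {1, - 1} \<union> axis_point ` {2..m + 1}"

lemma card_hub_core: "card (hub_core m) = m + 2"
proof -
  have c: "card (axis_point ` {2..m + 1}) = m" by (simp add: card_image inj_on_def axis_point_def)
  have dis: "pole ` {1, - 1} \<inter> axis_point ` {2..m + 1} = {}" by (auto simp: point_defs)
  have fin: "finite (pole ` {1, - 1})" "finite (axis_point ` {2..m + 1})" by simp_all
  show ?thesis unfolding hub_core_def card_Un_disjoint[OF fin dis] card_poles c by simp
qed

text \<open>The core spans \<open>3 * m\<close> edges; each tip and each of the axis points 1 and
  \<open>m + 2\<close> has three neighbours in it, and every later axis point has the two poles. For
  \<open>m = t - 4\<close> and \<open>L = n - 2 * m\<close> the total
  \<open>2 * L + 7 * m - 4\<close> equals \<open>2 n + 3 t - 16\<close>.\<close>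

lemma card_core_edges:
  assumes m: "1 \<le> m" and L: "m + 2 \<le> L"
  shows "2 * L + 7 * m \<le> card {e \<in> hub_edges m L. e \<inter> hub_core m \<noteq> {}} + 4"
proof -
  \<comment> \<open>Only the steps starting at 1 up to \<open>m + 1\<close> have an end in the
    core.\<close>
  let ?A = "{{pole 1, pole (- 1)}}" and ?B = "steps (m + 2)"
  have inj: "inj_on (\<lambda>(\<sigma>, j). {pole \<sigma>, axis_point j}) ({1, - 1} \<times> {1..L})"
    "inj_on (\<lambda>j. {axis_point j, axis_point (j + 1)}) {1..<m + 2}"
    "inj_on (\<lambda>(\<sigma>, j). {pole \<sigma>, tip \<sigma> j}) ({1, - 1} \<times> {2..m})"
    "inj_on (\<lambda>(\<sigma>, j). {axis_point j, tip \<sigma> j}) ({1, - 1} \<times> {2..m})"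
    "inj_on (\<lambda>(\<sigma>, j). {axis_point (j + 1), tip \<sigma> j}) ({1, - 1} \<times> {2..m})"
    by (auto simp: inj_on_def point_defs doubleton_eq_iff)
  have m2: "card {2..m} = m - 1" by (cases m) auto
  have c: "card (spokes L) = 2 * L" "card ?B = m + 1" "card (tip_pole m) = 2 * (m - 1)"
    "card (tip_left m) = 2 * (m - 1)" "card (tip_right m) = 2 * (m - 1)"
    unfolding family_defs card_image[OF inj(1)] card_image[OF inj(2)] card_image[OF inj(3)]
      card_image[OF inj(4)] card_image[OF inj(5)] card_cartesian_product m2 by simp_all
  have fin: "finite (spokes L)" "finite ?B" "finite (tip_pole m)" "finite (tip_left m)" "finite (tip_right m)"
    by (simp_all add: family_defs)
  \<comment> \<open>The total height of the ends tells the families of edges apart, except the left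
    and right tip edges.\<close>
  define ht where "ht = (\<lambda>e. \<Sum>z\<in>e. \<bar>Im z\<bar>)"
  have ht: "\<forall>e\<in>?A. ht e = 2" "\<forall>e\<in>spokes L. ht e = 1" "\<forall>e\<in>?B. ht e = 0" "\<forall>e\<in>tip_pole m. ht e = 4 / 3"
    "\<forall>e\<in>tip_left m. ht e = 1 / 3" "\<forall>e\<in>tip_right m. ht e = 1 / 3"
    by (auto simp: ht_def family_defs point_defs)
  have sep: "X \<inter> Y = {}" if "\<forall>e\<in>X. ht e \<in> U" "\<forall>e\<in>Y. ht e \<notin> U" for X Y U
    using that by blast
  have d1: "?A \<inter> spokes L = {}" by (rule sep[of _ "{2}"]) (use ht in auto)
  have d2: "(?A \<union> spokes L) \<inter> ?B = {}" by (rule sep[of _ "{2, 1}"]) (use ht in auto)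
  have d3: "(?A \<union> spokes L \<union> ?B) \<inter> tip_pole m = {}" by (rule sep[of _ "{2, 1, 0}"]) (use ht in auto)
  have d4: "(?A \<union> spokes L \<union> ?B \<union> tip_pole m) \<inter> tip_left m = {}"
    by (rule sep[of _ "{2, 1, 0, 4 / 3}"]) (use ht in auto)
  have "(?A \<union> spokes L \<union> ?B \<union> tip_pole m) \<inter> tip_right m = {}"
    by (rule sep[of _ "{2, 1, 0, 4 / 3}"]) (use ht in auto)
  moreover have "tip_left m \<inter> tip_right m = {}" by (auto simp: family_defs point_defs doubleton_eq_iff)
  ultimately have d5: "(?A \<union> spokes L \<union> ?B \<union> tip_pole m \<union> tip_left m) \<inter> tip_right m = {}" by blast
  have "card (?A \<union> spokes L \<union> ?B \<union> tip_pole m \<union> tip_left m \<union> tip_right m) =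
    1 + 2 * L + (m + 1) + 6 * (m - 1)"
    using fin d1 d2 d3 d4 d5 c by (simp add: card_Un_disjoint)
  moreover have "?A \<union> spokes L \<union> ?B \<union> tip_pole m \<union> tip_left m \<union> tip_right m \<subseteq>
    {e \<in> hub_edges m L. e \<inter> hub_core m \<noteq> {}}"
  proof -
    have "?B \<subseteq> steps L" using L by (auto simp: steps_def)
    then have "?A \<union> spokes L \<union> ?B \<union> tip_pole m \<union> tip_left m \<union> tip_right m \<subseteq> hub_edges m L"
      unfolding hub_edges_def by blast
    moreover have "e \<inter> hub_core m \<noteq> {}"
      if e: "e \<in> ?A \<union> spokes L \<union> ?B \<union> tip_pole m \<union> tip_left m \<union> tip_right m" for e
    proof -
      have P: "pole 1 \<in> hub_core m" "pole (- 1) \<in> hub_core m" by (simp_all add: hub_core_def)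
      have X: "axis_point j \<in> hub_core m" if "2 \<le> j" "j \<le> m + 1" for j
        using that by (simp add: hub_core_def)
      have S: "axis_point j \<in> hub_core m \<or> axis_point (Suc j) \<in> hub_core m" if "1 \<le> j" "j < m + 2" for j
        using X[of j] X[of "Suc j"] that m by linarith
      consider "e \<in> ?A" | "e \<in> spokes L" | "e \<in> ?B" | "e \<in> tip_pole m" | "e \<in> tip_left m" | "e \<in> tip_right m"
        using e unfolding Un_iff by blast
      then show ?thesis
      proof cases
        case 1
        then show ?thesis using P by auto
      next
        case 2
        then obtain \<sigma> j where "e = {pole \<sigma>, axis_point j}" "\<sigma> = 1 \<or> \<sigma> = - 1" unfolding spokes_def by auto
        then show ?thesis using P by auto
      next
        case 3
        then obtain j where "e = {axis_point j, axis_point (Suc j)}" "1 \<le> j" "j < m + 2" unfolding steps_def by auto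
        then show ?thesis using S[of j] by auto
      next
        case 4
        then obtain \<sigma> j where "e = {pole \<sigma>, tip \<sigma> j}" "\<sigma> = 1 \<or> \<sigma> = - 1" unfolding tip_pole_def by auto
        then show ?thesis using P by auto
      next
        case 5
        then obtain \<sigma> j where "e = {axis_point j, tip \<sigma> j}" "2 \<le> j" "j \<le> m" unfolding tip_left_def by auto
        then show ?thesis using X[of j] by auto
      next
        case 6
        then obtain \<sigma> j where "e = {axis_point (j + 1), tip \<sigma> j}" "2 \<le> j" "j \<le> m" unfolding tip_right_def by auto
        then show ?thesis using X[of "j + 1"] by auto
      qed
    qed
    ultimately show ?thesis by blast
  qed
  moreover have "finite {e \<in> hub_edges m L. e \<inter> hub_core m \<noteq> {}}"
    by (simp add: hub_edges_def family_defs)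
  ultimately have "1 + 2 * L + (m + 1) + 6 * (m - 1) \<le> card {e \<in> hub_edges m L. e \<inter> hub_core m \<noteq> {}}"
    by (metis (no_types, lifting) card_mono)
  then show ?thesis using m by simp
qed

text \<open>Every second step of the axis is used. The triangulation has to contain the matching,
  since otherwise it says nothing about \<open>rb\<close>.\<close>

lemma hub_matching:
  assumes "2 * t \<le> L"
  shows "\<exists>M. M \<subseteq> hub_edges m L \<and> disjoint M \<and> card M = t"
proof -
  define M where "M = (\<lambda>i. {axis_point (2 * i + 1), axis_point (2 * i + 2)}) ` {..<t}"
  have "M \<subseteq> steps L"
    unfolding M_def steps_def
  proof
    fix e assume "e \<in> (\<lambda>i. {axis_point (2 * i + 1), axis_point (2 * i + 2)}) ` {..<t}"
    then obtain i where "i < t" "e = {axis_point (2 * i + 1), axis_point (2 * i + 2)}" by blast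
    then show "e \<in> (\<lambda>j. {axis_point j, axis_point (j + 1)}) ` {1..<L}"
      using assms by (intro image_eqI[of _ _ "2 * i + 1"]) auto
  qed
  moreover have "disjoint M"
  proof (rule disjointI)
    fix a b assume "a \<in> M" "b \<in> M" "a \<noteq> b"
    then obtain i j where ij: "a = {axis_point (2 * i + 1), axis_point (2 * i + 2)}" "b = {axis_point (2 * j + 1), axis_point (2 * j + 2)}" "i \<noteq> j"
      by (auto simp: M_def)
    have "axis_point x \<noteq> axis_point y" if "x \<noteq> y" for x y using that by (simp add: axis_point_def)
    moreover have "2 * i + 1 \<noteq> 2 * j + 1" "2 * i + 1 \<noteq> 2 * j + 2" "2 * i + 2 \<noteq> 2 * j + 1" "2 * i + 2 \<noteq> 2 * j + 2"
      using ij(3) by presburger+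
    ultimately show "a \<inter> b = {}" unfolding ij(1,2) by blast
  qed
  moreover have "card M = t"
  proof -
    have "inj_on (\<lambda>i. {axis_point (2 * i + 1), axis_point (2 * i + 2)}) {..<t}"
    proof (rule inj_onI)
      fix i j assume "{axis_point (2 * i + 1), axis_point (2 * i + 2)} = {axis_point (2 * j + 1), axis_point (2 * j + 2)}"
      then have "2 * i + 1 = 2 * j + 1 \<or> 2 * i + 1 = 2 * j + 2"
        by (auto simp: doubleton_eq_iff axis_point_def)
      then show "i = j" by presburger
    qed
    then show ?thesis by (simp add: M_def card_image)
  qed
  ultimately show ?thesis unfolding hub_edges_def by blast
qed

section \<open>Transfer to natural numbers and completion to a triangulation\<close>

lemma planar_image:
  assumes "planar (V, E)" and f: "inj_on f V"
  shows "planar (f ` V, (\<lambda>e. f ` e) ` E)"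
proof -
  obtain p \<gamma> where E: "simple_graph (V, E)" and emb: "plane_embedding (V, E) p \<gamma>"
    using assms(1) unfolding planar_def by blast
  define h where "h = inv_into V f"
  have h: "h (f x) = x" if "x \<in> V" for x using f that by (simp add: h_def)
  have eV: "e \<subseteq> V" "card e = 2" if "e \<in> E" for e using E that by (auto simp: simple_graph_def)
  have hV: "h ` f ` A = A" if "A \<subseteq> V" for A
  proof -
    have "h ` f ` A = (\<lambda>x. h (f x)) ` A" by (rule image_image)
    also have "\<dots> = A" using that h by (auto simp: subset_iff image_iff)
    finally show ?thesis .
  qed
  have "plane_embedding (f ` V, (\<lambda>e. f ` e) ` E) (p \<circ> h) (\<lambda>e. \<gamma> (h ` e))"
    unfolding plane_embedding_def
  proof (intro conjI ballI impI)
    show "inj_on (p \<circ> h) (verts (f ` V, (\<lambda>e. f ` e) ` E))"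
    proof (rule comp_inj_on)
      show "inj_on h (verts (f ` V, (\<lambda>e. f ` e) ` E))" using h by (auto simp: inj_on_def)
      show "inj_on p (h ` verts (f ` V, (\<lambda>e. f ` e) ` E))"
        using emb hV[of V] by (simp add: plane_embedding_def)
    qed
  next
    fix e assume "e \<in> edges (f ` V, (\<lambda>e. f ` e) ` E)"
    then obtain d where d: "d \<in> E" "e = f ` d" by auto
    have hd: "h ` e = d" using hV[OF eV(1)[OF d(1)]] d(2) by simp
    have dE: "d \<in> edges (V, E)" using d(1) by simp
    note D = emb[unfolded plane_embedding_def, THEN conjunct2, THEN conjunct1, rule_format, OF dE]
    have hv: "h ` verts (f ` V, (\<lambda>e. f ` e) ` E) = V" using hV[of V] by simp
    show "arc (\<gamma> (h ` e))" unfolding hd using D by blast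
    show "{pathstart (\<gamma> (h ` e)), pathfinish (\<gamma> (h ` e))} = (p \<circ> h) ` e"
      unfolding image_comp[symmetric] hd using D by blast
    show "path_image (\<gamma> (h ` e)) \<inter> (p \<circ> h) ` verts (f ` V, (\<lambda>e. f ` e) ` E) \<subseteq> (p \<circ> h) ` e"
      unfolding image_comp[symmetric] hd hv using D by simp
    fix e' assume e': "e' \<in> edges (f ` V, (\<lambda>e. f ` e) ` E)" "e \<noteq> e'"
    then obtain d' where d': "d' \<in> E" "e' = f ` d'" by auto
    have hd': "h ` e' = d'" using hV[OF eV(1)[OF d'(1)]] d'(2) by simp
    have ne: "d \<noteq> d'" using e'(2) d d' by blast
    have "e \<inter> e' = f ` (d \<inter> d')"
      unfolding d(2) d'(2) by (rule inj_on_image_Int[symmetric, OF f]) (use eV d d' in auto)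
    then have hee: "h ` (e \<inter> e') = d \<inter> d'" using hV[of "d \<inter> d'"] eV[OF d(1)] by auto
    have d'E: "d' \<in> edges (V, E)" using d'(1) by simp
    show "path_image (\<gamma> (h ` e)) \<inter> path_image (\<gamma> (h ` e')) \<subseteq> (p \<circ> h) ` (e \<inter> e')"
      unfolding image_comp[symmetric] hd hd' hee
      using emb[unfolded plane_embedding_def, THEN conjunct2, THEN conjunct2, rule_format, OF dE d'E ne] .
  qed
  moreover have "simple_graph (f ` V, (\<lambda>e. f ` e) ` E)"
  proof -
    have "card (f ` e) = 2" if "e \<in> E" for e
      using card_image[OF inj_on_subset[OF f eV(1)[OF that]]] eV(2)[OF that] by simp
    then show ?thesis using E eV(1) unfolding simple_graph_def by auto
  qed
  ultimately show ?thesis unfolding planar_def by blast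
qed

lemma maximal_planar_extension:
  assumes "planar (V, E)"
  shows "\<exists>E'. E \<subseteq> E' \<and> maximal_planar (V, E')"
proof -
  define A where "A = {E'. E \<subseteq> E' \<and> planar (V, E')}"
  have "finite V" using planarD(1)[OF assms] .
  moreover have "A \<subseteq> Pow (Pow V)" using planarD(3) by (fastforce simp: A_def)
  ultimately have "finite A" by (meson finite_Pow_iff finite_subset)
  moreover have "E \<in> A" using assms by (simp add: A_def)
  ultimately obtain E' where E': "E' \<in> A" and best: "\<forall>F\<in>A. card F \<le> card E'"
    using finite_has_max[of A card] by blast
  have "\<not> planar (V, insert {u, v} E')" if "{u, v} \<notin> E'" for u v
  proof
    assume "planar (V, insert {u, v} E')"
    then have "insert {u, v} E' \<in> A" using E' by (auto simp: A_def)
    then have "card (insert {u, v} E') \<le> card E'" using best by blast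
    moreover have "finite E'" using E' planarD(2)[of V E'] by (simp add: A_def)
    ultimately show False using that by simp
  qed
  then have "maximal_planar (V, E')" using E' by (simp add: A_def maximal_planar_def)
  then show ?thesis using E' by (auto simp: A_def)
qed

text \<open>The drawing is completed to a maximal planar graph on the same vertices. Additional
  edges preserve the matching and can only increase the number of edges meeting \<open>S\<close>, so
  a lower bound for the drawing suffices.\<close>

theorem dense_cover_triangulation:
  assumes t: "5 \<le> t" and n: "4 * t \<le> n + 8" 
  shows "\<exists>(V :: nat set) E S M. maximal_planar (V, E) \<and> card V = n \<and> S \<subseteq> V \<and> card S + 2 = t \<and>
    2 * n + 3 * t \<le> card {e \<in> E. e \<inter> S \<noteq> {}} + 16 \<and> M \<subseteq> E \<and> disjoint M \<and> card M = t"
proof -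
  \<comment> \<open>The core has \<open>m + 2 = t - 2\<close> vertices, and \<open>L\<close> makes
    the total \<open>n\<close>. The condition \<open>4 * t \<le> n + 8\<close> is
    \<open>2 * t \<le> L\<close>, which leaves room for the matching on the axis.\<close>
  define m where "m = t - 4"
  define L where "L = n - 2 * m"
  have mL: "1 \<le> m" "t = m + 4" "m + 2 \<le> L" "2 * t \<le> L" "n = L + 2 * m"
    using t n by (auto simp: m_def L_def)
  define V0 where "V0 = hub_verts m L"
  define E0 where "E0 = hub_edges m L"
  define S0 where "S0 = hub_core m"
  have pl: "planar (V0, E0)" unfolding V0_def E0_def by (rule hub_planar) (use mL in simp)
  have cV: "card V0 = n" using card_hub_verts[OF mL(1), of L] mL by (simp add: V0_def)
  have finV: "finite V0" using planarD(1)[OF pl] .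
  have SV: "S0 \<subseteq> V0" using mL by (auto simp: S0_def V0_def hub_core_def hub_verts_def)
  obtain M0 where M0: "M0 \<subseteq> E0" "disjoint M0" "card M0 = t"
    using hub_matching[OF mL(4), of m] by (auto simp: E0_def)
  have many: "2 * n + 3 * t \<le> card {e \<in> E0. e \<inter> S0 \<noteq> {}} + 16"
    using card_core_edges[OF mL(1,3)] mL by (simp add: E0_def S0_def)
  obtain f where f: "bij_betw f V0 {0..<n}" using ex_bij_betw_finite_nat[OF finV] cV by blast
  then have inj: "inj_on f V0" by (simp add: bij_betw_def)
  have E0V: "E0 \<subseteq> Pow V0" using planarD(3)[OF pl] by blast
  have injE: "inj_on (\<lambda>e. f ` e) E0"
    by (rule inj_on_subset[OF _ E0V]) (rule inj_on_image_Pow[OF inj])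
  obtain E where E: "(\<lambda>e. f ` e) ` E0 \<subseteq> E" "maximal_planar (f ` V0, E)"
    using maximal_planar_extension[OF planar_image[OF pl inj]] by blast
  have "finite E" using planarD(2)[of "f ` V0" E] E(2) by (simp add: maximal_planar_def)
  have "card {e \<in> E0. e \<inter> S0 \<noteq> {}} \<le> card {e \<in> E. e \<inter> f ` S0 \<noteq> {}}"
  proof (rule card_inj_on_le)
    show "inj_on (\<lambda>e. f ` e) {e \<in> E0. e \<inter> S0 \<noteq> {}}" by (rule inj_on_subset[OF injE]) blast
    show "(\<lambda>e. f ` e) ` {e \<in> E0. e \<inter> S0 \<noteq> {}} \<subseteq> {e \<in> E. e \<inter> f ` S0 \<noteq> {}}" using E(1) by blast
    show "finite {e \<in> E. e \<inter> f ` S0 \<noteq> {}}" using \<open>finite E\<close> by simp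
  qed
  then have "2 * n + 3 * t \<le> card {e \<in> E. e \<inter> f ` S0 \<noteq> {}} + 16" using many by linarith
  moreover have "card (f ` V0) = n" using card_image[OF inj] cV by simp
  moreover have "card (f ` S0) + 2 = t"
    using card_image[OF inj_on_subset[OF inj SV]] card_hub_core[of m] mL(2) by (simp add: S0_def)
  moreover have "card ((\<lambda>e. f ` e) ` M0) = t"
    using card_image[OF inj_on_subset[OF injE M0(1)]] M0(3) by simp
  moreover have "disjoint ((\<lambda>e. f ` e) ` M0)"
  proof (rule disjointI)
    fix a b assume "a \<in> (\<lambda>e. f ` e) ` M0" "b \<in> (\<lambda>e. f ` e) ` M0" "a \<noteq> b"
    then obtain d d' where d: "d \<in> M0" "d' \<in> M0" "a = f ` d" "b = f ` d'" "d \<noteq> d'" by blast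
    have "f ` d \<inter> f ` d' = f ` (d \<inter> d')"
      by (rule inj_on_image_Int[symmetric, OF inj]) (use d M0(1) E0V in auto)
    then show "a \<inter> b = {}" using disjointD[OF M0(2) d(1,2,5)] d(3,4) by simp
  qed
  moreover have "(\<lambda>e. f ` e) ` M0 \<subseteq> E" using M0(1) E(1) by blast
  moreover have "f ` S0 \<subseteq> f ` V0" using SV by blast
  ultimately show ?thesis using E(2) by blast
qed

section \<open>The rainbow number\<close>

definition forces_rainbow :: "nat \<Rightarrow> nat \<Rightarrow> nat \<Rightarrow> bool" where
  "forces_rainbow n t k \<longleftrightarrow> (\<forall>G\<in>plane_triangulations n. contains_subgraph G (matching_graph t) \<longrightarrow>
     (\<forall>c :: nat set \<Rightarrow> nat. k \<le> card (c ` edges G) \<longrightarrow> contains_rainbow c G (matching_graph t)))"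

lemma rb_Least: "rb (plane_triangulations n) (matching_graph t) = (LEAST k. forces_rainbow n t k)"
  by (simp add: rb_def forces_rainbow_def)

lemma forces_rainbowI:
  assumes t: "7 \<le> t"
    and k: "3 * t \<le> n + 6 \<and> 2 * n + 3 * t \<le> k + 13 \<or> 9 * t + 3 \<le> n \<and> 2 * n + 3 * t \<le> k + 14"
  shows "forces_rainbow n t k"
  unfolding forces_rainbow_def
proof (intro ballI impI allI)
  fix G :: "nat graph" and c :: "nat set \<Rightarrow> nat"
  assume G: "G \<in> plane_triangulations n" "contains_subgraph G (matching_graph t)" and c: "k \<le> card (c ` edges G)"
  obtain V E where VE: "G = (V, E)" by (cases G)
  have mp: "maximal_planar (V, E)" "card V = n" using G(1) VE by (simp_all add: plane_triangulations_def)
  have pl: "planar (V, E)" using mp(1) by (simp add: maximal_planar_def)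
  obtain f where f: "copy_of (matching_graph t) (V, E) f" using G(2) VE by (auto simp: contains_subgraph_def)
  note M0 = matching_copyD[OF f refl]
  have "3 * t \<le> card V + 6 \<and> 2 * card V + 3 * t \<le> card (c ` E) + 13 \<or>
      9 * t + 3 \<le> card V \<and> 2 * card V + 3 * t \<le> card (c ` E) + 14"
    using k c mp(2) VE by auto
  from rainbow_matching_exists[OF mp(1) t M0(1,3,4) this]
  obtain M where M: "M \<subseteq> E" "finite M" "disjoint M" "card M = t" "inj_on c M" by blast
  show "contains_rainbow c G (matching_graph t)"
    unfolding VE by (rule rainbow_copyI[OF M planarD(3)[OF pl] planarD(4)[OF pl]])
qed

text \<open>Edges meeting \<open>S\<close> get distinct colours and all others the colour 0. A
  rainbow matching has at most \<open>card S = t - 2\<close> edges of the first kind and one of the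
  second, so fewer than \<open>t\<close>.\<close>

lemma not_forces_rainbow:
  assumes t: "5 \<le> t" and n: "4 * t \<le> n + 8"
  shows "\<not> forces_rainbow n t (2 * n + 3 * t - 15)"
proof
  assume forced: "forces_rainbow n t (2 * n + 3 * t - 15)"
  obtain V :: "nat set" and E S M where VE: "maximal_planar (V, E)" "card V = n" and S: "S \<subseteq> V" "card S + 2 = t"
    and many: "2 * n + 3 * t \<le> card {e \<in> E. e \<inter> S \<noteq> {}} + 16" and M: "M \<subseteq> E" "disjoint M" "card M = t"
    using dense_cover_triangulation[OF t n] by (elim exE conjE) (rule that; assumption)
  have pl: "planar (V, E)" using VE(1) by (simp add: maximal_planar_def)
  have fin: "finite E" "finite S" "finite M"
    using planarD(1,2)[OF pl] S(1) M(1) finite_subset by blast+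
  obtain h :: "nat set \<Rightarrow> nat" where h: "inj_on h E" using finite_imp_inj_to_nat_seg[OF fin(1)] by blast
  define c where "c = (\<lambda>e. if e \<inter> S = {} then 0 else Suc (h e))"
  define F where "F = {e \<in> E. e \<inter> S \<noteq> {}}"
  have finF: "finite F" using fin(1) by (simp add: F_def)
  have "card F + 1 \<le> card (c ` E)"
  proof -
    \<comment> \<open>The colour 0 must really occur to reach \<open>2 n + 3 t - 15\<close> colours;
      the \<open>t\<close> disjoint edges of \<open>M\<close> cannot all meet the
      \<open>t - 2\<close> vertices of \<open>S\<close>.\<close>
    have "\<exists>e\<in>M. e \<inter> S = {}"
    proof (rule ccontr)
      assume "\<not> ?thesis"
      then have "card M \<le> card S" by (intro matching_le_cover[OF fin(2) M(2)]) blast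
      then show False using M(3) S(2) by simp
    qed
    then obtain e where "e \<in> E" "c e = 0" using M(1) by (auto simp: c_def)
    then have "0 \<in> c ` E" by (metis imageI)
    moreover have "(\<lambda>e. Suc (h e)) ` F \<subseteq> c ` E"
    proof
      fix y assume "y \<in> (\<lambda>e. Suc (h e)) ` F"
      then obtain e where "e \<in> E" "e \<inter> S \<noteq> {}" "y = Suc (h e)" by (auto simp: F_def)
      then have "y = c e" "e \<in> E" by (simp_all add: c_def)
      then show "y \<in> c ` E" by simp
    qed
    ultimately have "insert 0 ((\<lambda>e. Suc (h e)) ` F) \<subseteq> c ` E" by blast
    then have "card (insert 0 ((\<lambda>e. Suc (h e)) ` F)) \<le> card (c ` E)" by (intro card_mono) (use fin in simp)
    moreover have "card ((\<lambda>e. Suc (h e)) ` F) = card F"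
      by (rule card_image) (use h in \<open>auto simp: inj_on_def F_def\<close>)
    moreover have "0 \<notin> (\<lambda>e. Suc (h e)) ` F" by auto
    ultimately show ?thesis using finF by simp
  qed
  then have k: "2 * n + 3 * t - 15 \<le> card (c ` edges (V, E))" using many by (simp add: F_def)
  have "inj_on h M" using h M(1) by (rule inj_on_subset)
  then have "contains_rainbow h (V, E) (matching_graph t)"
    by (rule rainbow_copyI[OF M(1) fin(3) M(2,3) _ planarD(3)[OF pl] planarD(4)[OF pl]])
  then have "contains_subgraph (V, E) (matching_graph t)"
    unfolding contains_rainbow_def contains_subgraph_def by blast
  moreover have "(V, E) \<in> plane_triangulations n" using VE by (simp add: plane_triangulations_def)
  ultimately have "contains_rainbow c (V, E) (matching_graph t)"
    using forced k unfolding forces_rainbow_def by blast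
  then obtain f where f: "copy_of (matching_graph t) (V, E) f" "inj_on c ((\<lambda>e. f ` e) ` edges (matching_graph t))"
    unfolding contains_rainbow_def by blast
  define N where "N = (\<lambda>e. f ` e) ` edges (matching_graph t)"
  note N = matching_copyD[OF f(1) N_def]
  define N0 where "N0 = {e \<in> N. e \<inter> S = {}}"
  have "card (N - N0) \<le> card S"
  proof (rule matching_le_cover[OF fin(2)])
    show "disjoint (N - N0)" using N(3) by (auto simp: disjoint_def)
  qed (auto simp: N0_def)
  moreover have "card N0 \<le> 1"
  proof -
    have "inj_on c N0" by (rule inj_on_subset[OF f(2)[folded N_def]]) (auto simp: N0_def)
    then have "card N0 = card (c ` N0)" by (simp add: card_image)
    also have "\<dots> \<le> card {0 :: nat}" by (rule card_mono) (auto simp: N0_def c_def)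
    finally show ?thesis by simp
  qed
  moreover have "card N \<le> card N0 + card (N - N0)"
  proof -
    have "N = N0 \<union> (N - N0)" by (auto simp: N0_def)
    then show ?thesis using card_Un_le by metis
  qed
  ultimately show False using N(4) S(2) by linarith
qed

theorem theorem1p4:
  "(\<forall>t n :: nat. t \<ge> 7 \<longrightarrow> n \<ge> 3 * t - 6 \<longrightarrow>
      rb (plane_triangulations n) (matching_graph t) \<le> 2 * n + 3 * t - 13) \<and>
   (\<forall>t n :: nat. t \<ge> 7 \<longrightarrow> n \<ge> 9 * t + 3 \<longrightarrow>
      rb (plane_triangulations n) (matching_graph t) = 2 * n + 3 * t - 14)"
proof (intro conjI allI impI)
  fix t n :: nat
  assume t: "7 \<le> t" and n: "3 * t - 6 \<le> n"
  have "forces_rainbow n t (2 * n + 3 * t - 13)" by (rule forces_rainbowI) (use t n in auto)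
  then show "rb (plane_triangulations n) (matching_graph t) \<le> 2 * n + 3 * t - 13"
    unfolding rb_Least by (rule Least_le)
next
  fix t n :: nat
  assume t: "7 \<le> t" and n: "9 * t + 3 \<le> n"
  show "rb (plane_triangulations n) (matching_graph t) = 2 * n + 3 * t - 14"
    unfolding rb_Least
  proof (rule Least_equality)
    show "forces_rainbow n t (2 * n + 3 * t - 14)" by (rule forces_rainbowI) (use t n in auto)
    fix k assume k: "forces_rainbow n t k"
    show "2 * n + 3 * t - 14 \<le> k"
    proof (rule ccontr)
      assume "\<not> ?thesis"
      then have "k \<le> 2 * n + 3 * t - 15" by linarith
      \<comment> \<open>The condition is upward closed in the number of colours, so refuting it one
        below the claimed value is enough.\<close>
      then have "forces_rainbow n t (2 * n + 3 * t - 15)"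
        using k unfolding forces_rainbow_def by (meson order_trans)
      moreover have "\<not> forces_rainbow n t (2 * n + 3 * t - 15)"
        by (rule not_forces_rainbow) (use t n in auto)
      ultimately show False by blast
    qed
  qed
qed

end
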